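(* Let $F$ be a Euclidean Coxeter simplex and let $W\subset G_F$ be a maximal reflection subgroup which has infinite index in $G_F$. Let $\Sigma$ be the Coxeter diagram of a fundamental chamber of $W$. Then $(\Sigma(F),\Sigma)$ coincides with one of the following pairs: $(\widetilde A_n,\ \widetilde A_k+\widetilde A_{n-1-k})$ with $k=0,1,2,\dots,n-1$; $(\widetilde D_n,\widetilde D_{n-1})$; $(\widetilde D_n,\widetilde A_{n-1})$; $(\widetilde E_6,\widetilde D_5)$; $(\widetilde E_7,\widetilde E_6)$.
   Context: A Euclidean Coxeter simplex is a simplex $F$ in $\mathbb{E}^n$ all of whose dihedral angles are integer submultiples of $\pi$; $G_F$ is the discrete group generated by the reflections in its facets and $\Sigma(F)$ is its Coxeter diagram (a connected parabolic diagram in the standard notation $\widetilde A_n,\widetilde B_n,\widetilde C_n,\widetilde D_n,\widetilde E_6,\widetilde E_7,\widetilde E_8,\widetilde F_4,\widetilde G_2$). A reflection subgroup of $G_F$ is a subgroup generated by reflections. It is maximal if it is proper and there is no reflection subgroup strictly between it and $G_F$. The fundamental chamber of an arbitrary discrete reflection group $W$ in $\mathbb{E}^n$ (a connected component of the complement of its mirrors) is a direct product of simplices, simplicial cones and possibly a Euclidean space; its Coxeter diagram (nodes = facets; $(m-2)$-fold edges for angles $\pi/m$, bold edges for parallel facets) is a disjoint union of connected parabolic and elliptic diagrams. The symbol $+$ denotes disjoint union of diagrams, $\widetilde A_0$ is the empty diagram, and $\widetilde D_3=\widetilde A_3$. *)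

theory Defs
  imports
    "HOL-Analysis.Analysis"
    "HOL-Algebra.Bij"
    "HOL-Algebra.Coset"
    "HOL-Algebra.Generated_Groups"
    "HOL-Library.Extended_Nat"
begin

section \<open>Reflections and reflection subgroups\<close>

definition hyperplane_reflection :: "'a::euclidean_space \<Rightarrow> real \<Rightarrow> 'a \<Rightarrow> 'a" where
  "hyperplane_reflection a b x = x - (2 * (a \<bullet> x - b) / (a \<bullet> a)) *\<^sub>R a"

definition reflections :: "('a::euclidean_space \<Rightarrow> 'a) set" where
  "reflections = {hyperplane_reflection a b | a b. a \<noteq> 0}"

text \<open>All groups below are generated by reflections, hence consist of isometries; they are
  formed inside the group of all bijections of the space, with composition.\<close>

abbreviation transformation_group :: "('a::euclidean_space \<Rightarrow> 'a) monoid" where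
  "transformation_group \<equiv> BijGroup UNIV"

definition facet_reflection_group :: "'a::euclidean_space set \<Rightarrow> ('a \<Rightarrow> 'a) set" where
  "facet_reflection_group F = generate transformation_group
     {hyperplane_reflection a b | a b.
        a \<noteq> 0 \<and> (\<exists>f. f facet_of F \<and> affine hull f = {x. a \<bullet> x = b})}"

definition reflection_subgroup ::
  "('a::euclidean_space \<Rightarrow> 'a) set \<Rightarrow> ('a \<Rightarrow> 'a) set \<Rightarrow> bool" where
  "reflection_subgroup W G \<longleftrightarrow>
     W \<subseteq> G \<and> (\<exists>R \<subseteq> reflections. W = generate transformation_group R)"

definition maximal_reflection_subgroup ::
  "('a::euclidean_space \<Rightarrow> 'a) set \<Rightarrow> ('a \<Rightarrow> 'a) set \<Rightarrow> bool" where
  "maximal_reflection_subgroup W G \<longleftrightarrow>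
     reflection_subgroup W G \<and> W \<noteq> G \<and>
     (\<nexists>W'. reflection_subgroup W' G \<and> W \<subset> W' \<and> W' \<subset> G)"

definition infinite_index ::
  "('a::euclidean_space \<Rightarrow> 'a) set \<Rightarrow> ('a \<Rightarrow> 'a) set \<Rightarrow> bool" where
  "infinite_index W G \<longleftrightarrow> infinite (rcosets\<^bsub>transformation_group\<lparr>carrier := G\<rparr>\<^esub> W)"

definition mirrors :: "('a::euclidean_space \<Rightarrow> 'a) set \<Rightarrow> 'a set set" where
  "mirrors W = {{x. a \<bullet> x = b} | a b. a \<noteq> 0 \<and> hyperplane_reflection a b \<in> W}"

text \<open>Chambers are open; their facets are the facets of the closure.\<close>

definition fundamental_chamber ::
  "('a::euclidean_space \<Rightarrow> 'a) set \<Rightarrow> 'a set \<Rightarrow> bool" where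
  "fundamental_chamber W C \<longleftrightarrow> C \<in> components (UNIV - \<Union>(mirrors W))"


section \<open>Dihedral angles and Coxeter simplices\<close>

text \<open>Unique if \<open>P\<close> is convex and full-dimensional and \<open>f\<close> is a facet of it.\<close>

definition outer_normal :: "'a::euclidean_space set \<Rightarrow> 'a set \<Rightarrow> 'a" where
  "outer_normal P f =
     (THE u. norm u = 1 \<and> (\<exists>b. P \<subseteq> {x. u \<bullet> x \<le> b} \<and> f \<subseteq> {x. u \<bullet> x = b}))"

definition dihedral_angle :: "'a::euclidean_space set \<Rightarrow> 'a set \<Rightarrow> 'a set \<Rightarrow> real" where
  "dihedral_angle P f g = pi - arccos (outer_normal P f \<bullet> outer_normal P g)"

text \<open>Any two facets of a simplex of dimension at least 2 meet in a codimension 2 face.  The two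
  facets (endpoints) of a segment do not meet, and form no dihedral angle.\<close>

definition euclidean_coxeter_simplex :: "'a::euclidean_space set \<Rightarrow> bool" where
  "euclidean_coxeter_simplex F \<longleftrightarrow>
     int DIM('a) simplex F \<and>
     (\<forall>f g. f facet_of F \<and> g facet_of F \<and> f \<noteq> g \<and> f \<inter> g \<noteq> {} \<longrightarrow>
        (\<exists>m\<ge>2. dihedral_angle F f g = pi / real m))"


section \<open>Coxeter diagrams\<close>

text \<open>\<open>edge_mult D v w\<close>, for distinct nodes, is the multiplicity of the edge joining them:
  \<open>0\<close> if they are not joined, \<open>\<infinity>\<close> for a bold edge.  Its values elsewhere are irrelevant.\<close>

datatype 'v diagram = Diagram (nodes: "'v set") (edge_mult: "'v \<Rightarrow> 'v \<Rightarrow> enat")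

definition diagram_iso :: "'v diagram \<Rightarrow> 'w diagram \<Rightarrow> bool" (infix \<open>\<simeq>\<^sub>D\<close> 50) where
  "D \<simeq>\<^sub>D E \<longleftrightarrow>
     (\<exists>\<phi>. bij_betw \<phi> (nodes D) (nodes E) \<and>
        (\<forall>v\<in>nodes D. \<forall>w\<in>nodes D. v \<noteq> w \<longrightarrow> edge_mult E (\<phi> v) (\<phi> w) = edge_mult D v w))"

definition diagram_sum :: "'v diagram \<Rightarrow> 'w diagram \<Rightarrow> ('v + 'w) diagram" (infixl \<open>+\<^sub>D\<close> 65) where
  "D +\<^sub>D E = Diagram (nodes D <+> nodes E)
     (\<lambda>x y. case (x, y) of
         (Inl v, Inl w) \<Rightarrow> edge_mult D v w
       | (Inr v, Inr w) \<Rightarrow> edge_mult E v w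
       | _ \<Rightarrow> 0)"

text \<open>An edge of multiplicity \<open>k\<close> stands for the angle \<open>\<pi> / (k + 2)\<close>.\<close>

definition coxeter_diagram :: "'a::euclidean_space set \<Rightarrow> 'a set diagram" where
  "coxeter_diagram P = Diagram {f. f facet_of P}
     (\<lambda>f g. if affine_parallel (affine hull f) (affine hull g) then \<infinity>
            else enat (THE k. dihedral_angle P f g = pi / real (k + 2)))"

definition simple_diagram :: "nat set \<Rightarrow> nat set set \<Rightarrow> nat diagram" where
  "simple_diagram V E = Diagram V (\<lambda>i j. if {i, j} \<in> E then 1 else 0)"

definition affine_A :: "nat \<Rightarrow> nat diagram" where
  "affine_A n =
     (if n = 0 then Diagram {} (\<lambda>_ _. 0)
      else if n = 1 then Diagram {0, 1} (\<lambda>_ _. \<infinity>)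
      else simple_diagram {0..n} ({{i, Suc i} | i. i < n} \<union> {{0, n}}))"

text \<open>For \<open>n \<ge> 4\<close>: the path \<open>1, \<dots>, n - 1\<close>, with \<open>0\<close> joined to \<open>2\<close> and \<open>n\<close> joined to \<open>n - 2\<close>.\<close>

definition affine_D :: "nat \<Rightarrow> nat diagram" where
  "affine_D n =
     (if n = 3 then affine_A 3
      else simple_diagram {0..n}
             ({{i, Suc i} | i. 1 \<le> i \<and> Suc i \<le> n - 1} \<union> {{0, 2}, {n - 2, n}}))"

definition affine_E6 :: "nat diagram" where
  "affine_E6 = simple_diagram {0..6} {{0, 1}, {1, 2}, {0, 3}, {3, 4}, {0, 5}, {5, 6}}"

definition affine_E7 :: "nat diagram" where
  "affine_E7 = simple_diagram {0..7}
     {{0, 1}, {1, 2}, {2, 3}, {0, 4}, {4, 5}, {5, 6}, {0, 7}}"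

end

theory Submission
  imports Defs
begin

text \<open>A maximal subgroup \<open>W\<close> of infinite index has no mirror that is the only one of its direction: adding
  suitable translates of such mirrors would give a larger proper subgroup.  Hence every mirror of \<open>W\<close>
  yields a translation in \<open>W\<close>; these translations cannot span, as the index is infinite, so all mirrors
  of \<open>W\<close> are parallel to a common direction \<open>\<nu>\<close>.  By maximality, \<open>W\<close> contains every reflection of
  \<open>G\<^sub>F\<close> whose mirror is parallel to \<open>\<nu>\<close>, and a monoid of linear maps that contains the linear parts
  of these reflections contains either no other reflection of the linear part of \<open>G\<^sub>F\<close> or all
  of them; this is impossible if \<open>\<Sigma>(F)\<close> has a multiple edge.  In the simply laced case, \<open>\<nu>\<close> is up to the
  linear action a fundamental coweight \<open>\<omega>\<^sub>q\<close> of a node \<open>q\<close> of mark 1, and a chamber of \<open>W\<close> is bounded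
  by the walls of the simple roots other than \<open>p\<close> (the affine node) and \<open>q\<close> and by the affine lowest roots of the
  components left after deleting \<open>p\<close> and \<open>q\<close>.  The simply laced diagrams themselves are found from
  the barycentric weights, which are harmonic on the diagram.\<close>

section \<open>Groups generated by reflections\<close>

text \<open>Once the direction \<nu> is found, maximality enters through absorption: if a monoid of
  maps contains the reflections of \<open>W\<close> but not all of \<open>G\<close>, then every
  reflection of \<open>G\<close> in that monoid already lies in \<open>W\<close>. Each structural
  step therefore amounts to choosing an invariant (a stabiliser, a lattice congruence, a family of
  point sets, a parity of signs) that \<open>W\<close> respects and some generator violates. The
  obstacle is that discreteness, on which the passage from infinite index to \<nu> rests, is derived
  from an integral Cartan matrix. The Coxeter condition alone does not provide one, so the weights
  must first exclude the angle \<pi>/5 and bring diagrams with multiple edges close enough to their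
  final shape for suitably rescaled normals to be integral. The marks come late for the same reason:
  the weights are real numbers divided by their minimum, and turn out to be integers only when the
  diagram has been labelled completely; a node of minimal weight serves as the affine node. Type E_8
  contributes no pair because no second node of mark 1 exists.\<close>

abbreviation (input) \<rho> :: "'a::euclidean_space \<Rightarrow> real \<Rightarrow> 'a \<Rightarrow> 'a" where
  "\<rho> \<equiv> hyperplane_reflection"

abbreviation (input) gen :: "('a::euclidean_space \<Rightarrow> 'a) set \<Rightarrow> ('a \<Rightarrow> 'a) set" where
  "gen \<equiv> generate transformation_group"

lemma hyperplane_reflection_involution:
  assumes "a \<noteq> 0"
  shows "\<rho> a b (\<rho> a b x) = x"
proof -
  define t where "t = 2 * (a \<bullet> x - b) / (a \<bullet> a)"
  have "a \<bullet> a \<noteq> 0" using assms by simp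
  then have "a \<bullet> (x - t *\<^sub>R a) - b = - (a \<bullet> x - b)"
    by (simp add: inner_diff_right t_def)
  then have "2 * (a \<bullet> (x - t *\<^sub>R a) - b) / (a \<bullet> a) = - t"
    by (simp only: t_def minus_divide_left mult_minus_right)
  then show ?thesis unfolding hyperplane_reflection_def t_def[symmetric] by simp
qed

lemma hyperplane_reflection_comp_self:
  "a \<noteq> 0 \<Longrightarrow> \<rho> a b \<circ> \<rho> a b = id"
  by (auto simp: hyperplane_reflection_involution)

lemma reflections_involution: "s \<in> reflections \<Longrightarrow> s \<circ> s = id"
  by (auto simp: reflections_def hyperplane_reflection_comp_self)

lemma hyperplane_reflection_mem_reflections [intro]:
  "a \<noteq> 0 \<Longrightarrow> \<rho> a b \<in> reflections"
  by (auto simp: reflections_def)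

lemma reflections_bij: "s \<in> reflections \<Longrightarrow> bij s"
  using reflections_involution by (metis o_bij)

lemma reflections_inv: "s \<in> reflections \<Longrightarrow> inv_into UNIV s = s"
  using reflections_involution by (metis inv_unique_comp)

lemma hyperplane_reflection_cong:
  assumes "a \<noteq> 0" "k \<noteq> 0" shows "\<rho> (k *\<^sub>R a) (k * b) = \<rho> a b"
proof
  fix x
  have "a \<bullet> a \<noteq> 0" using assms by simp
  then show "\<rho> (k *\<^sub>R a) (k * b) x = \<rho> a b x"
    using assms unfolding hyperplane_reflection_def by (simp add: field_simps)
qed

lemma transformation_group_simps:
  "carrier transformation_group = {f. bij f}"
  "bij f \<Longrightarrow> bij g \<Longrightarrow> f \<otimes>\<^bsub>transformation_group\<^esub> g = f \<circ> g"
  "\<one>\<^bsub>transformation_group\<^esub> = id"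
  "bij f \<Longrightarrow> inv\<^bsub>transformation_group\<^esub> f = inv_into UNIV f"
proof -
  have B: "Bij UNIV = {f::'b \<Rightarrow> 'b. bij f}" for x :: 'b
    by (auto simp: Bij_def extensional_def)
  show "carrier transformation_group = {f. bij f}"
    by (simp add: BijGroup_def Bij_def extensional_def)
  show "bij f \<Longrightarrow> bij g \<Longrightarrow> f \<otimes>\<^bsub>transformation_group\<^esub> g = f \<circ> g"
    by (simp add: BijGroup_def Bij_def extensional_def compose_def fun_eq_iff)
  show "\<one>\<^bsub>transformation_group\<^esub> = id"
    by (simp add: BijGroup_def fun_eq_iff)
  show "bij f \<Longrightarrow> inv\<^bsub>transformation_group\<^esub> f = inv_into UNIV f"
    by (subst inv_BijGroup) (auto simp: Bij_def extensional_def)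
qed

section \<open>Affine isometries and their linear parts\<close>

definition affine_isometry :: "('a::euclidean_space \<Rightarrow> 'a) \<Rightarrow> bool" where
  "affine_isometry g \<longleftrightarrow> orthogonal_transformation (\<lambda>v. g v - g 0)"

definition linear_part :: "('a::euclidean_space \<Rightarrow> 'a) \<Rightarrow> 'a \<Rightarrow> 'a" where
  "linear_part g v = g v - g 0"

lemma linear_part_orthogonal: "affine_isometry g \<Longrightarrow> orthogonal_transformation (linear_part g)"
  by (simp add: affine_isometry_def linear_part_def[abs_def])

lemma affine_isometry_add:
  assumes "affine_isometry g" shows "g (x + v) = g x + linear_part g v"
proof -
  have "linear_part g (x + v) = linear_part g x + linear_part g v"
    by (meson assms linear_part_orthogonal linear_add orthogonal_transformation_linear)
  then show ?thesis by (simp add: linear_part_def algebra_simps)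
qed

lemma affine_isometry_diff:
  assumes "affine_isometry g" shows "linear_part g (x - y) = g x - g y"
  using affine_isometry_add[OF assms, of y "x - y"] by simp

lemma affine_isometry_id: "affine_isometry id"
  by (simp add: affine_isometry_def orthogonal_transformation_def linear_def module_hom_def
      module_hom_axioms_def module_axioms id_def linear_id)

lemma linear_part_id [simp]: "linear_part id = id"
  by (simp add: linear_part_def[abs_def] id_def)

lemma linear_part_comp:
  assumes "affine_isometry f"
  shows "linear_part (f \<circ> g) = linear_part f \<circ> linear_part g"
proof
  fix v
  show "linear_part (f \<circ> g) v = (linear_part f \<circ> linear_part g) v"
    using affine_isometry_diff[OF assms, of "g v" "g 0"] by (simp add: linear_part_def)
qed

lemma affine_isometry_comp:
  assumes "affine_isometry f" "affine_isometry g" shows "affine_isometry (f \<circ> g)"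
proof -
  have "orthogonal_transformation (linear_part (f \<circ> g))"
    using assms linear_part_comp linear_part_orthogonal orthogonal_transformation_compose by metis
  then show ?thesis by (simp add: affine_isometry_def linear_part_def[abs_def])
qed

lemma linear_part_hyperplane_reflection:
  "linear_part (\<rho> a b) v = v - (2 * (a \<bullet> v) / (a \<bullet> a)) *\<^sub>R a"
  by (simp add: linear_part_def hyperplane_reflection_def scaleR_diff_left diff_divide_distrib
      right_diff_distrib)

lemma linear_part_reflection_inner:
  fixes a v w :: "'a::euclidean_space"
  assumes "a \<noteq> 0"
  shows "linear_part (\<rho> a b) v \<bullet> linear_part (\<rho> a b) w = v \<bullet> w"
proof -
  have "a \<bullet> a \<noteq> 0" using assms by simp
  then show ?thesis
    by (simp add: linear_part_hyperplane_reflection inner_diff_left inner_diff_right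
        inner_commute field_simps)
qed

lemma affine_isometry_hyperplane_reflection:
  assumes "a \<noteq> 0" shows "affine_isometry (\<rho> a b)"
proof -
  have "linear (linear_part (\<rho> a b))"
    by (rule linearI) (simp_all add: linear_part_hyperplane_reflection inner_add_right algebra_simps
        add_divide_distrib)
  then have "orthogonal_transformation (linear_part (\<rho> a b))"
    unfolding orthogonal_transformation_def using linear_part_reflection_inner[OF assms] by blast
  then show ?thesis by (simp add: affine_isometry_def linear_part_def[abs_def])
qed

lemma reflections_affine_isometry: "s \<in> reflections \<Longrightarrow> affine_isometry s"
  by (auto simp: reflections_def affine_isometry_hyperplane_reflection)

lemma generate_reflections:
  assumes "R \<subseteq> reflections" "g \<in> gen R"
  shows generate_reflections_bij: "bij g"
    and generate_reflections_isometry: "affine_isometry g"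
proof -
  have "bij g \<and> affine_isometry g"
    using assms(2)
  proof (induction rule: generate.induct)
    case one
    show ?case unfolding transformation_group_simps(3) by (simp only: bij_id affine_isometry_id)
  next
    case (incl h)
    then show ?case using assms(1) reflections_bij reflections_affine_isometry by blast
  next
    case (inv h)
    then show ?case using assms(1) reflections_bij reflections_affine_isometry
      by (metis reflections_inv subsetD transformation_group_simps(4))
  next
    case (eng h1 h2)
    then have "h1 \<otimes>\<^bsub>transformation_group\<^esub> h2 = h1 \<circ> h2"
      by (intro transformation_group_simps(2)) auto
    then show ?case using eng.IH affine_isometry_comp bij_comp by metis
  qed
  then show "bij g" "affine_isometry g" by auto
qed

lemma generate_id: "id \<in> gen R"
  using generate.one[of transformation_group R] by (simp add: transformation_group_simps)

lemma generate_incl: "R \<subseteq> gen R"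
  by (auto intro: generate.incl)

lemma generate_comp:
  assumes "R \<subseteq> reflections" "f \<in> gen R" "g \<in> gen R"
  shows "f \<circ> g \<in> gen R"
  using generate.eng[OF assms(2,3)] generate_reflections_bij[OF assms(1)] assms(2,3)
  by (simp add: transformation_group_simps)

text \<open>Reflections are their own inverses, so the group they generate is already the monoid
  they generate; a set closed under composition that contains the generators contains the group, and
  inverses need not be checked.\<close>

lemma generate_reflections_subset:
  assumes "R \<subseteq> reflections" "R \<subseteq> H" "id \<in> H" "\<And>f g. f \<in> H \<Longrightarrow> g \<in> H \<Longrightarrow> f \<circ> g \<in> H"
  shows "gen R \<subseteq> H"
proof
  fix g assume "g \<in> gen R"
  then show "g \<in> H"
  proof (induction rule: generate.induct)
    case one
    show ?case unfolding transformation_group_simps(3) by (rule assms(3))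
  next
    case (incl h)
    then show ?case using assms by blast
  next
    case (inv h)
    then show ?case using assms reflections_bij
      by (metis reflections_inv subsetD transformation_group_simps(4))
  next
    case (eng h1 h2)
    then have "h1 \<otimes>\<^bsub>transformation_group\<^esub> h2 = h1 \<circ> h2"
      by (intro transformation_group_simps(2) generate_reflections_bij[OF assms(1)])
    then show ?case using eng.IH assms(4) by metis
  qed
qed

lemma generate_inv:
  assumes "R \<subseteq> reflections" "f \<in> gen R"
  shows "inv_into UNIV f \<in> gen R"
proof -
  let ?G = "gen R"
  have "?G \<subseteq> {g. bij g \<and> inv_into UNIV g \<in> ?G}"
  proof (rule generate_reflections_subset[OF assms(1)])
    show "R \<subseteq> {g. bij g \<and> inv_into UNIV g \<in> ?G}"
      using assms(1) reflections_bij reflections_inv generate_incl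
      by (smt (verit) mem_Collect_eq subset_eq)
    show "id \<in> {g. bij g \<and> inv_into UNIV g \<in> ?G}" by (simp add: generate_id)
    show "f \<circ> g \<in> {g. bij g \<and> inv_into UNIV g \<in> ?G}"
      if "f \<in> {g. bij g \<and> inv_into UNIV g \<in> ?G}" "g \<in> {g. bij g \<and> inv_into UNIV g \<in> ?G}" for f g
      using that by (auto simp: bij_comp o_inv_distrib intro!: generate_comp[OF assms(1)])
  qed
  then show ?thesis using assms(2) by blast
qed

lemma generate_subset_generate:
  assumes "R \<subseteq> reflections" "S \<subseteq> reflections" "R \<subseteq> gen S"
  shows "gen R \<subseteq> gen S"
  using generate_reflections_subset[OF assms(1,3) generate_id] generate_comp[OF assms(2)] by blast

text \<open>An isometry \<open>g\<close> carries the mirror of \<open>\<rho> a b\<close> to a mirror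
  with normal \<open>linear_part g a\<close>; the shift of the offset accounts for the translation
  part \<open>g 0\<close>. As an intertwining relation the statement avoids the inverse of
  \<open>g\<close>.\<close>

lemma conjugate_reflection:
  assumes "affine_isometry g" "a \<noteq> 0"
  shows "g \<circ> \<rho> a b
     = \<rho> (linear_part g a) (b + linear_part g a \<bullet> g 0) \<circ> g"
proof
  fix x
  have o: "orthogonal_transformation (linear_part g)" using assms(1) by (rule linear_part_orthogonal)
  then have lin: "linear (linear_part g)" by (rule orthogonal_transformation_linear)
  have ip: "linear_part g v \<bullet> linear_part g w = v \<bullet> w" for v w
    using o by (simp add: orthogonal_transformation_def)
  have gx: "g x = linear_part g x + g 0" by (simp add: linear_part_def)
  define k where "k = 2 * (a \<bullet> x - b) / (a \<bullet> a)"
  have "g (\<rho> a b x) = g (x + (- k) *\<^sub>R a)"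
    by (simp add: hyperplane_reflection_def k_def)
  also have "\<dots> = g x - k *\<^sub>R linear_part g a"
    by (subst affine_isometry_add[OF assms(1)]) (simp add: linear_cmul[OF lin] linear_neg[OF lin])
  also have "\<dots> = \<rho> (linear_part g a) (b + linear_part g a \<bullet> g 0) (g x)"
    unfolding hyperplane_reflection_def by (simp add: gx inner_add_right ip k_def)
  finally show "(g \<circ> \<rho> a b) x =
    (\<rho> (linear_part g a) (b + linear_part g a \<bullet> g 0) \<circ> g) x" by simp
qed

lemma linear_part_nonzero:
  assumes "affine_isometry g" "a \<noteq> 0" shows "linear_part g a \<noteq> 0"
proof
  assume "linear_part g a = 0"
  moreover have "norm (linear_part g a) = norm a"
    using assms(1) by (simp add: linear_part_orthogonal orthogonal_transformation_norm)
  ultimately show False using assms(2) by simp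
qed

lemma conjugate_reflection_mem:
  assumes R: "R \<subseteq> reflections" and g: "g \<in> gen R"
    and s: "\<rho> a b \<in> gen R" and "a \<noteq> 0"
  shows "\<rho> (linear_part g a) (b + linear_part g a \<bullet> g 0)
     \<in> gen R"
proof -
  have "g \<circ> \<rho> a b \<circ> inv_into UNIV g \<in> gen R"
    using generate_comp[OF R generate_comp[OF R g s] generate_inv[OF R g]] by simp
  moreover have "g \<circ> \<rho> a b \<circ> inv_into UNIV g =
     \<rho> (linear_part g a) (b + linear_part g a \<bullet> g 0)"
  proof -
    have "g \<circ> inv_into UNIV g = id" using generate_reflections_bij[OF R g] by (meson bij_is_surj surj_iff)
    then show ?thesis
      using conjugate_reflection[OF generate_reflections_isometry[OF R g] \<open>a \<noteq> 0\<close>, of b]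
      by (metis comp_assoc comp_id)
  qed
  ultimately show ?thesis by simp
qed

section \<open>Maximal reflection subgroups\<close>

lemma maximal_reflection_subgroupD:
  assumes "maximal_reflection_subgroup W G"
  shows "W \<subseteq> G" "W \<noteq> G" "W = gen (W \<inter> reflections)"
proof -
  obtain R where R: "R \<subseteq> reflections" "W = gen R"
    using assms unfolding maximal_reflection_subgroup_def reflection_subgroup_def by blast
  show "W \<subseteq> G" "W \<noteq> G"
    using assms unfolding maximal_reflection_subgroup_def reflection_subgroup_def by auto
  have W: "W \<inter> reflections \<subseteq> reflections" by blast
  have "R \<subseteq> W \<inter> reflections" using R(1) generate_incl[of R] unfolding R(2)[symmetric] by simp
  then have RW: "R \<subseteq> gen (W \<inter> reflections)"
    using generate_incl[of "W \<inter> reflections"] by (rule subset_trans)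
  have WR: "W \<inter> reflections \<subseteq> gen R"
    unfolding R(2)[symmetric] by simp
  show "W = gen (W \<inter> reflections)"
    using generate_subset_generate[OF R(1) W RW] generate_subset_generate[OF W R(1) WR]
    unfolding R(2)[symmetric] by (rule equalityI)
qed

lemma maximal_reflection_subgroup_overgroup:
  assumes max: "maximal_reflection_subgroup W G" and R: "R \<subseteq> reflections"
    and "gen R \<subseteq> G" "W \<subseteq> gen R"
  shows "gen R = W \<or> gen R = G"
  using assms unfolding maximal_reflection_subgroup_def reflection_subgroup_def by blast

text \<open>The reflections of \<open>G\<close> inside the monoid \<open>H\<close> generate a group
  that lies between \<open>W\<close> and \<open>G\<close> and stays in \<open>H\<close>. As
  \<open>g\<close> is outside \<open>H\<close>, this group is not \<open>G\<close>, so by maximality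
  it is \<open>W\<close>. Closure under composition is all that is asked of \<open>H\<close>, which
  may thus be the set of all maps that respect some structure.\<close>

lemma maximal_reflection_subgroup_absorbs:
  assumes max: "maximal_reflection_subgroup W G"
    and G: "G = gen R0" "R0 \<subseteq> reflections"
    and H: "id \<in> H" "\<And>f g. f \<in> H \<Longrightarrow> g \<in> H \<Longrightarrow> f \<circ> g \<in> H"
    and WH: "W \<inter> reflections \<subseteq> H" and g: "g \<in> G" "g \<notin> H"
    and s: "s \<in> G" "s \<in> reflections" "s \<in> H"
  shows "s \<in> W"
proof -
  let ?R = "G \<inter> reflections \<inter> H"
  have "gen ?R \<subseteq> G"
    unfolding G(1) by (rule generate_subset_generate) (use G in auto)
  moreover have "W \<subseteq> gen ?R"
  proof -
    have "W \<inter> reflections \<subseteq> ?R" using WH maximal_reflection_subgroupD(1)[OF max] by blast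
    then have "W \<inter> reflections \<subseteq> gen ?R"
      using generate_incl by (rule subset_trans)
    then have "gen (W \<inter> reflections) \<subseteq> gen ?R"
      by (intro generate_subset_generate) auto
    then show ?thesis using maximal_reflection_subgroupD(3)[OF max] by simp
  qed
  moreover have "gen ?R \<subseteq> H"
    using generate_reflections_subset[of ?R H, OF _ _ H] by blast
  ultimately have "gen ?R = W"
    using maximal_reflection_subgroup_overgroup[OF max, of ?R] g by blast
  then show ?thesis using s generate_incl[of ?R] by auto
qed

section \<open>Parallel mirrors and lonely mirrors\<close>

lemma hyperplane_reflection_comp_parallel:
  assumes "a \<noteq> 0"
  shows "\<rho> a b \<circ> \<rho> a b' = (+) ((2 * (b - b') / (a \<bullet> a)) *\<^sub>R a)"
proof
  fix x
  define t where "t = 2 * (a \<bullet> x - b') / (a \<bullet> a)"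
  have "a \<bullet> a \<noteq> 0" using assms by simp
  then have "a \<bullet> (x - t *\<^sub>R a) - b = 2 * b' - b - a \<bullet> x"
    by (simp add: inner_diff_right t_def)
  then have e: "2 * (a \<bullet> (x - t *\<^sub>R a) - b) / (a \<bullet> a) = - t - 2 * (b - b') / (a \<bullet> a)"
    unfolding t_def by (simp add: diff_divide_distrib[symmetric] minus_divide_left del: minus_divide_left[symmetric])
  have "\<rho> a b (\<rho> a b' x) = (x - t *\<^sub>R a) -
      (2 * (a \<bullet> (x - t *\<^sub>R a) - b) / (a \<bullet> a)) *\<^sub>R a"
    unfolding hyperplane_reflection_def t_def by simp
  then show "(\<rho> a b \<circ> \<rho> a b') x
      = (2 * (b - b') / (a \<bullet> a)) *\<^sub>R a + x"
    unfolding e by (simp add: scaleR_diff_left)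
qed

lemma linear_part_translation [simp]: "linear_part ((+) v) = id"
  by (auto simp: linear_part_def)

definition lonely_mirror :: "('a::euclidean_space \<Rightarrow> 'a) set \<Rightarrow> 'a \<Rightarrow> real \<Rightarrow> bool" where
  "lonely_mirror W a b \<longleftrightarrow>
     a \<noteq> 0 \<and> \<rho> a b \<in> W \<and> (\<forall>b'. \<rho> a b' \<in> W \<longrightarrow> b' = b)"

lemma not_lonely_translation:
  assumes R: "R \<subseteq> reflections" and W: "W = gen R"
    and "\<rho> a b \<in> W" "a \<noteq> 0" "\<not> lonely_mirror W a b"
  shows "\<exists>t. t \<noteq> 0 \<and> (+) (t *\<^sub>R a) \<in> W"
proof -
  obtain b' where b': "\<rho> a b' \<in> W" "b' \<noteq> b"
    using assms unfolding lonely_mirror_def by blast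
  have "\<rho> a b \<circ> \<rho> a b' \<in> W"
    unfolding W by (rule generate_comp[OF R]) (use assms b' in auto)
  moreover have "2 * (b - b') / (a \<bullet> a) \<noteq> 0" using b' assms by simp
  ultimately show ?thesis using hyperplane_reflection_comp_parallel[OF \<open>a \<noteq> 0\<close>] by metis
qed

text \<open>Conjugation by the translation along \<open>v\<close> turns the offset \<open>b\<close>
  into \<open>b + a \<bullet> v\<close>, and a lonely mirror has to stay where it is.\<close>

lemma lonely_orthogonal_translation:
  assumes R: "R \<subseteq> reflections" and W: "W = gen R"
    and l: "lonely_mirror W a b" and v: "(+) v \<in> W"
  shows "a \<bullet> v = 0"
proof -
  have a: "a \<noteq> 0" "\<rho> a b \<in> gen R"
    using l W by (auto simp: lonely_mirror_def)
  have "\<rho> a (b + a \<bullet> v) \<in> W"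
    using conjugate_reflection_mem[OF R _ a(2,1), of "(+) v"] v unfolding W by simp
  then have "b + a \<bullet> v = b" using l unfolding lonely_mirror_def by blast
  then show ?thesis by simp
qed

text \<open>What the index argument needs of the group of a simplex. Discreteness appears as
  finiteness of the set of linear parts and of the orbit of one base point \<open>p0\<close> inside
  each ball; \<open>irreducible\<close> is connectedness of the diagram, and
  \<open>no_fixpoint\<close> will force translations to exist.\<close>

locale discrete_reflection_group =
  fixes I :: "'i set" and \<alpha> :: "'i \<Rightarrow> 'a::euclidean_space" and b :: "'i \<Rightarrow> real"
    and G :: "('a \<Rightarrow> 'a) set" and p0 :: 'a
  assumes nonzero: "i \<in> I \<Longrightarrow> \<alpha> i \<noteq> 0"
    and G_def: "G = gen ((\<lambda>i. \<rho> (\<alpha> i) (b i)) ` I)"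
    and irreducible: "J \<subseteq> I \<Longrightarrow> (\<And>i j. i \<in> J \<Longrightarrow> j \<in> I - J \<Longrightarrow> \<alpha> i \<bullet> \<alpha> j = 0) \<Longrightarrow> J = {} \<or> J = I"
    and no_fixpoint: "\<not> (\<exists>x. \<forall>i\<in>I. \<alpha> i \<bullet> x = b i)"
    and spanning: "(\<And>i. i \<in> I \<Longrightarrow> \<alpha> i \<bullet> v = 0) \<Longrightarrow> v = 0"
    and finite_linear_part: "finite (linear_part ` G)"
    and finite_orbit: "finite {g p0 | g. g \<in> G \<and> norm (g p0 - p0) \<le> r}"
begin

lemma R0: "(\<lambda>i. \<rho> (\<alpha> i) (b i)) ` I \<subseteq> reflections"
  using nonzero by auto

lemma G_generator: "i \<in> I \<Longrightarrow> \<rho> (\<alpha> i) (b i) \<in> G"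
  unfolding G_def by (rule generate.incl) simp

lemma G_id: "id \<in> G" unfolding G_def by (rule generate_id)

lemma G_comp: "f \<in> G \<Longrightarrow> g \<in> G \<Longrightarrow> f \<circ> g \<in> G"
  unfolding G_def by (rule generate_comp[OF R0])

lemma G_inv: "f \<in> G \<Longrightarrow> inv_into UNIV f \<in> G"
  unfolding G_def by (rule generate_inv[OF R0])

lemma G_isometry: "g \<in> G \<Longrightarrow> affine_isometry g"
  unfolding G_def by (rule generate_reflections_isometry[OF R0])

lemma G_bij: "g \<in> G \<Longrightarrow> bij g"
  unfolding G_def by (rule generate_reflections_bij[OF R0])

lemma G_conjugate:
  "g \<in> G \<Longrightarrow> \<rho> a c \<in> G \<Longrightarrow> a \<noteq> 0 \<Longrightarrow>
     \<rho> (linear_part g a) (c + linear_part g a \<bullet> g 0) \<in> G"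
  unfolding G_def by (rule conjugate_reflection_mem[OF R0])

text \<open>An isometry is determined by its linear part and the image of \<open>p0\<close>, and
  both range over finite sets.\<close>

lemma finite_bounded: "finite {g \<in> G. norm (g p0 - p0) \<le> r}"
proof -
  let ?B = "{g \<in> G. norm (g p0 - p0) \<le> r}"
  have "inj_on (\<lambda>g. (linear_part g, g p0)) ?B"
  proof (rule inj_onI)
    fix g h assume g: "g \<in> ?B" "h \<in> ?B" and e: "(linear_part g, g p0) = (linear_part h, h p0)"
    show "g = h"
    proof
      fix x
      have "g x - g p0 = h x - h p0"
        using affine_isometry_diff[OF G_isometry, of g x p0] affine_isometry_diff[OF G_isometry, of h x p0]
          g e by auto
      then show "g x = h x" using e by simp
    qed
  qed
  moreover have "(\<lambda>g. (linear_part g, g p0)) ` ?B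
      \<subseteq> linear_part ` G \<times> {g p0 | g. g \<in> G \<and> norm (g p0 - p0) \<le> r}" by auto
  moreover have "finite (linear_part ` G \<times> {g p0 | g. g \<in> G \<and> norm (g p0 - p0) \<le> r})"
    using finite_linear_part finite_orbit by blast
  ultimately show ?thesis by (meson finite_imageD finite_subset)
qed

text \<open>The group \<open>W1\<close> generated by the lonely reflections moves every point along
  the span of the lonely normals. A translation in \<open>W1\<close> therefore lies in that span
  and, by \<open>lonely_orthogonal_translation\<close>, is orthogonal to it, hence zero. So
  \<open>W1\<close> embeds into the finite set of linear parts, and the centroid of a finite orbit
  is fixed by \<open>W1\<close>, that is, lies on all lonely mirrors.\<close>

lemma lonely_mirrors_meet:
  assumes R: "R \<subseteq> reflections" and W: "W = gen R" and WG: "W \<subseteq> G"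
  shows "\<exists>p. \<forall>a c. lonely_mirror W a c \<longrightarrow> a \<bullet> p = c"
proof -
  let ?L = "{\<rho> a c | a c. lonely_mirror W a c}"
  let ?V = "span {a. \<exists>c. lonely_mirror W a c}"
  define W1 where "W1 = gen ?L"
  have L: "?L \<subseteq> reflections" by (auto simp: lonely_mirror_def)
  have "?L \<subseteq> W" by (auto simp: lonely_mirror_def)
  then have W1W: "W1 \<subseteq> W" using generate_subset_generate[OF L R] unfolding W1_def W[symmetric] by simp
  have disp: "W1 \<subseteq> {g. \<forall>x. g x - x \<in> ?V}"
    unfolding W1_def
  proof (rule generate_reflections_subset[OF L])
    show "?L \<subseteq> {g. \<forall>x. g x - x \<in> ?V}"
    proof -
      have "\<rho> a c x - x \<in> ?V" if "lonely_mirror W a c" for a c x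
      proof -
        have "a \<in> ?V" using that by (intro span_base) blast
        then have "(- (2 * (a \<bullet> x - c) / (a \<bullet> a))) *\<^sub>R a \<in> ?V" by (rule span_scale)
        then show ?thesis by (simp add: hyperplane_reflection_def)
      qed
      then show ?thesis by blast
    qed
    show "f \<circ> g \<in> {g. \<forall>x. g x - x \<in> ?V}"
      if "f \<in> {g. \<forall>x. g x - x \<in> ?V}" "g \<in> {g. \<forall>x. g x - x \<in> ?V}" for f g
    proof -
      have "f (g x) - x \<in> ?V" for x
      proof -
        have "f (g x) - g x \<in> ?V" "g x - x \<in> ?V" using that by auto
        then show ?thesis using span_add by fastforce
      qed
      then show ?thesis by simp
    qed
  qed (auto simp: span_zero)
  have "inj_on linear_part W1"
  proof (rule inj_onI)
    fix g h assume g: "g \<in> W1" and h: "h \<in> W1" and e: "linear_part g = linear_part h"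
    define v where "v = g 0 - h 0"
    have gh: "g x = v + h x" for x
      using e unfolding v_def linear_part_def fun_eq_iff by (metis add_diff_eq diff_add_cancel add.commute diff_eq_eq)
    have "g \<circ> inv_into UNIV h \<in> W1" unfolding W1_def
      by (rule generate_comp[OF L _ generate_inv[OF L]]) (use g h in \<open>auto simp: W1_def\<close>)
    moreover have "g \<circ> inv_into UNIV h = (+) v"
    proof
      fix x
      have "bij h" using generate_reflections_bij[OF L] h by (simp add: W1_def)
      then have "h (inv_into UNIV h x) = x" by (simp add: bij_is_surj surj_f_inv_f)
      then show "(g \<circ> inv_into UNIV h) x = v + x" by (simp add: gh)
    qed
    ultimately have v: "(+) v \<in> W1" by simp
    then have "\<forall>x. v + x - x \<in> ?V" using disp by blast
    then have "v \<in> ?V" by simp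
    moreover have "a \<bullet> v = 0" if "a \<in> {a. \<exists>c. lonely_mirror W a c}" for a
      using that lonely_orthogonal_translation[OF R W] v W1W by blast
    ultimately have "orthogonal v v"
      using orthogonal_to_span[of v "{a. \<exists>c. lonely_mirror W a c}" v]
      by (auto simp: orthogonal_def inner_commute)
    then have "v = 0" by (simp add: orthogonal_def)
    then show "g = h" using gh by auto
  qed
  moreover have "finite (linear_part ` W1)"
    using finite_linear_part W1W WG by (meson finite_subset image_mono subset_trans)
  ultimately have fin: "finite W1" by (rule finite_imageD[rotated])
  define N where "N = real (card W1)"
  have "W1 \<noteq> {}" using generate_id unfolding W1_def by blast
  then have N: "N > 0" using fin by (simp add: N_def card_gt_0_iff)
  define p where "p = (1 / N) *\<^sub>R (\<Sum>g\<in>W1. g 0)"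
  have "a \<bullet> p = c" if l: "lonely_mirror W a c" for a c
  proof -
    let ?s = "\<rho> a c"
    have a: "a \<noteq> 0" using l by (simp add: lonely_mirror_def)
    have s: "?s \<in> W1" unfolding W1_def by (rule generate.incl) (use l in auto)
    have lin: "linear (linear_part ?s)"
      using affine_isometry_hyperplane_reflection[OF a] linear_part_orthogonal
        orthogonal_transformation_linear by blast
    have "(\<Sum>g\<in>W1. ?s (g 0)) = (\<Sum>g\<in>W1. g 0)"
    proof (rule sum.reindex_bij_witness[of _ "\<lambda>g. ?s \<circ> g" "\<lambda>g. ?s \<circ> g"])
      show "?s \<circ> g \<in> W1" if "g \<in> W1" for g
        using generate_comp[OF L] s that unfolding W1_def by blast
      then show "?s \<circ> g \<in> W1" if "g \<in> W1" for g using that .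
    qed (use a in \<open>auto simp: fun_eq_iff hyperplane_reflection_involution\<close>)
    also have "(\<Sum>g\<in>W1. ?s (g 0)) = linear_part ?s (\<Sum>g\<in>W1. g 0) + N *\<^sub>R ?s 0"
    proof -
      have "?s (g 0) = linear_part ?s (g 0) + ?s 0" for g :: "'a \<Rightarrow> 'a" by (simp add: linear_part_def)
      then show ?thesis
        by (simp add: sum.distrib linear_sum[OF lin] N_def sum_constant_scaleR)
    qed
    finally have "(1 / N) *\<^sub>R (linear_part ?s (\<Sum>g\<in>W1. g 0) + N *\<^sub>R ?s 0) = p"
      by (simp add: p_def)
    then have "linear_part ?s p + ?s 0 = p"
      using N by (simp add: p_def linear_cmul[OF lin] scaleR_add_right)
    then have "?s p = p" by (simp add: linear_part_def)
    then show "a \<bullet> p = c" using a by (simp add: hyperplane_reflection_def)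
  qed
  then show ?thesis by blast
qed

text \<open>Generators whose mirrors are not lonely supply translations along their normals, and
  every lonely normal is orthogonal to these. By irreducibility either all generators are lonely,
  and then they have a common fixed point, or none is, and then a lonely normal is orthogonal to a
  spanning set.\<close>

lemma parallel_translation:
  assumes "a \<noteq> 0" "\<rho> a c \<in> G"
  shows "\<exists>t. t \<noteq> 0 \<and> (+) (t *\<^sub>R a) \<in> G"
proof -
  define J where "J = {i \<in> I. lonely_mirror G (\<alpha> i) (b i)}"
  have trans: "\<exists>t. t \<noteq> 0 \<and> (+) (t *\<^sub>R \<alpha> i) \<in> G" if "i \<in> I - J" for i
    using not_lonely_translation[OF R0 G_def G_generator] that nonzero by (auto simp: J_def)
  have orth: "x \<bullet> \<alpha> j = 0" if "lonely_mirror G x c" "j \<in> I - J" for x c j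
  proof -
    obtain t where "t \<noteq> 0" "(+) (t *\<^sub>R \<alpha> j) \<in> G" using trans \<open>j \<in> I - J\<close> by blast
    then have "x \<bullet> (t *\<^sub>R \<alpha> j) = 0" using lonely_orthogonal_translation[OF R0 G_def] that by blast
    then show ?thesis using \<open>t \<noteq> 0\<close> by simp
  qed
  have "J = {} \<or> J = I"
    by (rule irreducible) (use orth in \<open>auto simp: J_def\<close>)
  moreover have "J \<noteq> I"
  proof
    assume "J = I"
    then have "\<And>i. i \<in> I \<Longrightarrow> lonely_mirror G (\<alpha> i) (b i)" by (auto simp: J_def)
    then show False using lonely_mirrors_meet[OF R0 G_def] no_fixpoint by (metis order_refl)
  qed
  ultimately have "J = {}" by blast
  have "\<not> lonely_mirror G a c"
  proof
    assume l: "lonely_mirror G a c"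
    have "a = 0"
      by (rule spanning) (use orth[OF l] \<open>J = {}\<close> in \<open>simp add: inner_commute\<close>)
    then show False using assms by simp
  qed
  then show ?thesis using not_lonely_translation[OF R0 G_def] assms by blast
qed

lemma translation_mult: "(+) v \<in> G \<Longrightarrow> (+) (real n *\<^sub>R v) \<in> G"
proof (induction n)
  case 0
  have "(+) (0::'a) = id" by auto
  then have e: "(+) (real 0 *\<^sub>R v) = id" by simp
  show ?case unfolding e by (rule G_id)
next
  case (Suc n)
  have "(+) v \<circ> (+) (real n *\<^sub>R v) \<in> G" using G_comp Suc by blast
  moreover have "(+) v \<circ> (+) (real n *\<^sub>R v) = (+) (real (Suc n) *\<^sub>R v)"
    by (auto simp: algebra_simps)
  ultimately show ?case by simp
qed

lemma translation_zero: "(+) 0 \<in> G"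
proof -
  have "(+) (0::'a) = id" by auto
  then show ?thesis using G_id by metis
qed

lemma finite_short_translations: "finite {v. (+) v \<in> G \<and> norm v \<le> r}"
proof -
  have "(\<lambda>v. (+) v) ` {v. (+) v \<in> G \<and> norm v \<le> r} \<subseteq> {g \<in> G. norm (g p0 - p0) \<le> r}" by auto
  moreover have "inj_on (\<lambda>v. (+) v) {v. (+) v \<in> G \<and> norm v \<le> r}"
    by (rule inj_onI) (metis add_0_right)
  ultimately show ?thesis using finite_bounded[of r] by (meson finite_imageD finite_subset)
qed

lemma translation_linear_part:
  assumes "(+) v \<in> G" "g \<in> G" shows "(+) (linear_part g v) \<in> G"
proof -
  have "g \<circ> (+) v \<circ> inv_into UNIV g \<in> G" using assms G_comp G_inv by blast
  moreover have "g \<circ> (+) v \<circ> inv_into UNIV g = (+) (linear_part g v)"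
  proof
    fix x
    have "g (inv_into UNIV g x) = x" using G_bij[OF assms(2)] by (simp add: bij_is_surj surj_f_inv_f)
    moreover have "g (v + inv_into UNIV g x) = g (inv_into UNIV g x) + linear_part g v"
      using affine_isometry_add[OF G_isometry[OF assms(2)], of "inv_into UNIV g x" v]
      by (simp add: add.commute)
    ultimately show "(g \<circ> (+) v \<circ> inv_into UNIV g) x = linear_part g v + x" by simp
  qed
  ultimately show ?thesis by simp
qed

lemma translation_diff:
  assumes "(+) v \<in> G" "(+) w \<in> G" shows "(+) (v - w) \<in> G"
proof -
  have "inv_into UNIV ((+) w) = (+) (- w)"
    by (rule inv_unique_comp) auto
  then have "(+) v \<circ> (+) (- w) \<in> G" using assms G_comp G_inv by metis
  moreover have "(+) v \<circ> (+) (- w) = (+) (v - w)" by auto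
  ultimately show ?thesis by simp
qed

lemma translation_add:
  assumes "(+) v \<in> G" "(+) w \<in> G" shows "(+) (v + w) \<in> G"
  using translation_diff[OF assms(1) translation_diff[OF translation_zero assms(2)]] by simp

text \<open>A maximal subgroup has no lonely mirror: otherwise translates of the lonely mirrors by
  multiples of \<open>N\<close> could be added without reaching all of \<open>G\<close>.\<close>

lemma maximal_no_lonely_mirror:
  assumes max: "maximal_reflection_subgroup W G"
  shows "\<not> lonely_mirror W a0 c0"
proof
  assume l0: "lonely_mirror W a0 c0"
  let ?R = "W \<inter> reflections"
  have R: "?R \<subseteq> reflections" by blast
  note WG = maximal_reflection_subgroupD(1)[OF max]
  note W = maximal_reflection_subgroupD(3)[OF max]
  obtain p where p: "\<And>a c. lonely_mirror W a c \<Longrightarrow> a \<bullet> p = c"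
    using lonely_mirrors_meet[OF R W WG] by blast
  define L where "L = {a. \<exists>c. lonely_mirror W a c}"
  define V where "V = span L"
  define T where "T = {v \<in> V. (+) v \<in> G}"
  have lonely_G: "\<rho> a c \<in> G" if "lonely_mirror W a c" for a c
    using that WG unfolding lonely_mirror_def by blast
  have a0: "a0 \<in> L" "a0 \<noteq> 0" using l0 unfolding L_def lonely_mirror_def by blast+
  obtain t where t: "t \<noteq> 0" "(+) (t *\<^sub>R a0) \<in> G"
    using parallel_translation[OF a0(2) lonely_G[OF l0]] by blast
  define \<tau> where "\<tau> = t *\<^sub>R a0"
  have \<tau>: "\<tau> \<in> T" "\<tau> \<noteq> 0" using t a0 by (auto simp: T_def \<tau>_def V_def intro: span_scale span_base)
  \<comment> \<open>Short translations are finite in number, so \<tau> cannot be divisible by every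
    \<open>N\<close> inside \<open>T\<close>; a failing \<open>N\<close> becomes the modulus of the
    congruence below.\<close>
  obtain N :: nat where N: "N \<ge> 1" "(1 / real N) *\<^sub>R \<tau> \<notin> T"
  proof (rule ccontr)
    assume "\<not> thesis"
    then have all: "\<And>N::nat. N \<ge> 1 \<Longrightarrow> (1 / real N) *\<^sub>R \<tau> \<in> T" using that by blast
    let ?f = "\<lambda>n::nat. (1 / real (Suc n)) *\<^sub>R \<tau>"
    have "range ?f \<subseteq> {v. (+) v \<in> G \<and> norm v \<le> norm \<tau>}"
    proof -
      have "norm (?f n) \<le> norm \<tau>" for n
        by (simp add: divide_le_eq mult_left_le_one_le mult_le_cancel_left1)
      moreover have "(+) (?f n) \<in> G" for n using all[of "Suc n"] by (simp add: T_def)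
      ultimately show ?thesis by blast
    qed
    then have "finite (range ?f)" using finite_short_translations finite_subset by blast
    moreover have "inj ?f" using \<tau>(2) by (intro injI) (simp add: field_simps)
    ultimately show False using finite_imageD by blast
  qed
  let ?E = "{\<rho> a (c + a \<bullet> (real N *\<^sub>R v)) | a c v. lonely_mirror W a c \<and> v \<in> T}"
  let ?R' = "?R \<union> ?E"
  have R': "?R' \<subseteq> reflections" by (auto simp: lonely_mirror_def)
  have EG: "?E \<subseteq> G"
  proof -
    have "\<rho> a (c + a \<bullet> (real N *\<^sub>R v)) \<in> G" if "lonely_mirror W a c" "v \<in> T" for a c v
    proof -
      have "(+) (real N *\<^sub>R v) \<in> G" using translation_mult that by (simp add: T_def)
      then show ?thesis
        using G_conjugate[OF _ lonely_G[OF that(1)], of "(+) (real N *\<^sub>R v)"] that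
        by (simp add: lonely_mirror_def)
    qed
    then show ?thesis by blast
  qed
  have "gen ?R' \<subseteq> G"
    unfolding G_def by (rule generate_subset_generate[OF R' R0]) (use EG WG G_def in auto)
  moreover have "W \<subseteq> gen ?R'"
  proof -
    have "?R \<subseteq> gen ?R'" using generate_incl[of ?R'] by blast
    then show ?thesis using generate_subset_generate[OF R R'] W by simp
  qed
  moreover have "gen ?R' \<noteq> W"
  proof
    assume e: "gen ?R' = W"
    have "\<rho> a0 (c0 + a0 \<bullet> (real N *\<^sub>R \<tau>)) \<in> ?R'" using l0 \<tau> by blast
    then have "\<rho> a0 (c0 + a0 \<bullet> (real N *\<^sub>R \<tau>)) \<in> W"
      using generate_incl[of ?R'] e by blast
    then have "c0 + a0 \<bullet> (real N *\<^sub>R \<tau>) = c0" using l0 unfolding lonely_mirror_def by blast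
    then show False using N t a0 by (simp add: \<tau>_def)
  qed
  ultimately have G': "gen ?R' = G"
    using maximal_reflection_subgroup_overgroup[OF max R'] by blast
  \<comment> \<open>The invariant: up to directions orthogonal to all lonely normals, the points
    congruent to the common point \<open>p\<close> modulo \<open>N\<close> times the lattice
    \<open>T\<close>. The generators in \<open>?R'\<close> preserve \<open>S\<close>; the
    translation \<tau> of \<open>G\<close> does not, since \<tau> is not divisible by
    \<open>N\<close> in \<open>T\<close>.\<close>
  define S where "S = {p + real N *\<^sub>R u + y | u y. u \<in> T \<and> (\<forall>a\<in>L. a \<bullet> y = 0)}"
  have "gen ?R' \<subseteq> {g. g ` S \<subseteq> S}"
  proof (rule generate_reflections_subset[OF R'])
    show "f \<circ> g \<in> {g. g ` S \<subseteq> S}" if "f \<in> {g. g ` S \<subseteq> S}" "g \<in> {g. g ` S \<subseteq> S}" for f g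
      using that by auto
    have lonely_step: "\<rho> a (c + a \<bullet> (real N *\<^sub>R v)) x \<in> S"
      if l: "lonely_mirror W a c" and v: "v \<in> T" and x: "x \<in> S" for a c v x
    proof -
      have a: "a \<noteq> 0" "a \<in> L" "a \<bullet> p = c" using l p[OF l] unfolding lonely_mirror_def L_def by auto
      obtain u y where u: "x = p + real N *\<^sub>R u + y" "u \<in> T" and y: "\<forall>a\<in>L. a \<bullet> y = 0"
        using x by (auto simp: S_def)
      let ?s = "linear_part (\<rho> a c)"
      have "(+) (?s (u - v)) \<in> G"
        using u v lonely_G[OF l] by (intro translation_linear_part translation_diff) (auto simp: T_def)
      then have "(+) (?s (u - v) + v) \<in> G" using v by (intro translation_add) (auto simp: T_def)
      moreover have "?s (u - v) \<in> V"
      proof -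
        have "u \<in> V" "v \<in> V" "a \<in> V" using u v a by (auto simp: T_def V_def span_base)
        then show ?thesis
          unfolding linear_part_hyperplane_reflection V_def by (intro span_diff span_scale)
      qed
      ultimately have "?s (u - v) + v \<in> T"
        using v unfolding T_def V_def by (auto intro!: span_add)
      moreover have "\<rho> a (c + a \<bullet> (real N *\<^sub>R v)) x
          = p + real N *\<^sub>R (?s (u - v) + v) + y"
      proof -
        have "a \<bullet> x - (c + a \<bullet> (real N *\<^sub>R v)) = real N * (a \<bullet> (u - v))"
          using u a y by (simp add: inner_add_right inner_diff_right algebra_simps)
        then show ?thesis
          unfolding hyperplane_reflection_def linear_part_hyperplane_reflection u(1)
          by (simp add: algebra_simps)
      qed
      ultimately show ?thesis using y unfolding S_def by blast
    qed
    show "?R' \<subseteq> {g. g ` S \<subseteq> S}"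
    proof
      fix s assume "s \<in> ?R'"
      then consider "s \<in> ?E" | "s \<in> W" "s \<in> reflections" by blast
      then show "s \<in> {g. g ` S \<subseteq> S}"
      proof cases
        case 1
        then show ?thesis using lonely_step by auto
      next
        case 2
        then obtain a c where s: "s = \<rho> a c" "a \<noteq> 0" by (auto simp: reflections_def)
        show ?thesis
        proof (cases "lonely_mirror W a c")
          case True
          have "(0::'a) \<in> T" using translation_zero unfolding T_def V_def by (simp add: span_zero)
          then show ?thesis using lonely_step[OF True, of 0] s by auto
        next
          case False
          \<comment> \<open>A mirror of \<open>W\<close> that is not lonely has a translation of
            \<open>W\<close> along its normal. The normal is thus orthogonal to \<open>L\<close>,
            and the reflection changes only the component \<open>y\<close> of a point of
            \<open>S\<close>.\<close>
          then obtain k where k: "k \<noteq> 0" "(+) (k *\<^sub>R a) \<in> W"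
            using not_lonely_translation[OF R W] 2 s by blast
          have "d \<bullet> a = 0" if "d \<in> L" for d
          proof -
            from that obtain c' where "lonely_mirror W d c'" unfolding L_def by blast
            then have "d \<bullet> (k *\<^sub>R a) = 0" using lonely_orthogonal_translation[OF R W] k by blast
            then show ?thesis using k by simp
          qed
          then have o: "\<forall>d\<in>L. d \<bullet> a = 0" by blast
          have "s x \<in> S" if x: "x \<in> S" for x
          proof -
            obtain u y where u: "x = p + real N *\<^sub>R u + y" "u \<in> T" and y: "\<forall>a\<in>L. a \<bullet> y = 0"
              using x by (auto simp: S_def)
            have "s x = p + real N *\<^sub>R u + (y - (2 * (a \<bullet> x - c) / (a \<bullet> a)) *\<^sub>R a)"
              unfolding s hyperplane_reflection_def by (simp add: u)
            moreover have "\<forall>d\<in>L. d \<bullet> (y - (2 * (a \<bullet> x - c) / (a \<bullet> a)) *\<^sub>R a) = 0"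
              using o y by (simp add: inner_diff_right)
            ultimately show ?thesis using u unfolding S_def by blast
          qed
          then show ?thesis by auto
        qed
      qed
    qed
  qed auto
  then have "(+) \<tau> ` S \<subseteq> S" using G' \<tau> by (auto simp: T_def)
  moreover have "p \<in> S"
  proof -
    have "(0::'a) \<in> T" using translation_zero unfolding T_def V_def by (simp add: span_zero)
    then show ?thesis unfolding S_def by (intro CollectI exI[of _ 0]) simp
  qed
  ultimately have "\<tau> + p \<in> S" by blast
  then obtain u y where u: "\<tau> = real N *\<^sub>R u + y" "u \<in> T" and y: "\<forall>a\<in>L. a \<bullet> y = 0"
    by (auto simp: S_def algebra_simps)
  have "y = \<tau> - real N *\<^sub>R u" using u by simp
  moreover have "\<tau> \<in> V" "u \<in> V" using \<tau> u by (auto simp: T_def)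
  ultimately have "y \<in> V" unfolding V_def by (simp only: span_diff span_scale)
  then have "orthogonal y y"
    using orthogonal_to_span[of y L y] y by (auto simp: orthogonal_def inner_commute V_def)
  then have "y = 0" by (simp add: orthogonal_def)
  then have "(1 / real N) *\<^sub>R \<tau> = u" using u N by simp
  then show False using N u by simp
qed

text \<open>Subtracting translations of \<open>W\<close>, every coset is represented by an element that moves
  \<open>p0\<close> by a bounded amount.\<close>

lemma spanning_translations_finite_index:
  assumes R: "R \<subseteq> reflections" and W: "W = gen R" and WG: "W \<subseteq> G"
    and span: "span {v. (+) v \<in> W} = UNIV"
  shows "finite (rcosets\<^bsub>transformation_group\<lparr>carrier := G\<rparr>\<^esub> W)"
proof -
  let ?T = "{v. (+) v \<in> W}"
  obtain B where B: "B \<subseteq> ?T" "independent B" "?T \<subseteq> span B"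
    using basis_exists[of ?T] by metis
  then have finB: "finite B" by (simp add: independent_bound)
  have spanB: "span B = UNIV" using span B by (metis UNIV_I span_span span_mono subset_antisym subset_UNIV)
  have W_id: "id \<in> W" unfolding W by (rule generate_id)
  have W_comp: "f \<circ> g \<in> W" if "f \<in> W" "g \<in> W" for f g
    using that unfolding W by (rule generate_comp[OF R])
  have W_inv: "inv_into UNIV f \<in> W" if "f \<in> W" for f
    using that unfolding W by (rule generate_inv[OF R])
  have zero: "(+) w \<in> W" if "w = 0" for w
  proof -
    have "(+) w = id" using that by auto
    then show ?thesis using W_id by metis
  qed
  have neg: "(+) (- v) \<in> W" if "(+) v \<in> W" for v
  proof -
    have "inv_into UNIV ((+) v) = (+) (- v)" by (rule inv_unique_comp) auto
    then show ?thesis using W_inv that by metis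
  qed
  have add: "(+) (v + w) \<in> W" if "(+) v \<in> W" "(+) w \<in> W" for v w
  proof -
    have "(+) v \<circ> (+) w = (+) (v + w)" by auto
    then show ?thesis using W_comp that by metis
  qed
  have nat_mult: "(+) (real n *\<^sub>R v) \<in> W" if "(+) v \<in> W" for v n
  proof (induction n)
    case 0
    show ?case by (rule zero) simp
  next
    case (Suc n)
    then show ?case using add[OF that Suc] by (simp add: scaleR_left_distrib)
  qed
  have int_mult: "(+) (real_of_int n *\<^sub>R v) \<in> W" if "(+) v \<in> W" for v n
  proof (cases "n \<ge> 0")
    case True
    then show ?thesis using nat_mult[OF that, of "nat n"] by simp
  next
    case False
    then show ?thesis using neg[OF nat_mult[OF that, of "nat (- n)"]] by simp
  qed
  have sum_mult: "(+) (\<Sum>v\<in>A. real_of_int (k v) *\<^sub>R v) \<in> W" if "A \<subseteq> B" for A k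
    using finite_subset[OF that finB] that
  proof (induction A rule: finite_induct)
    case empty
    show ?case by (rule zero) simp
  next
    case (insert x A)
    then have "(+) (real_of_int (k x) *\<^sub>R x) \<in> W" using B by (intro int_mult) auto
    then show ?case using insert add by simp
  qed
  define r where "r = (\<Sum>v\<in>B. norm v)"
  let ?K = "{g \<in> G. norm (g p0 - p0) \<le> r}"
  have rep: "\<exists>h\<in>?K. W #>\<^bsub>transformation_group\<lparr>carrier := G\<rparr>\<^esub> g
      = W #>\<^bsub>transformation_group\<lparr>carrier := G\<rparr>\<^esub> h" if g: "g \<in> G" for g
  proof -
    have "p0 - g p0 \<in> span B" using spanB by simp
    then obtain u where u: "p0 - g p0 = (\<Sum>v\<in>B. u v *\<^sub>R v)"
      using span_finite[OF finB] by auto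
    \<comment> \<open>Rounding down the coordinates of \<open>p0 - g p0\<close> in a basis of
      translations leaves a remainder bounded by the sum \<open>r\<close> of the basis
      norms.\<close>
    define t where "t = (\<Sum>v\<in>B. real_of_int \<lfloor>u v\<rfloor> *\<^sub>R v)"
    define h where "h = (+) t \<circ> g"
    have tW: "(+) t \<in> W" unfolding t_def by (rule sum_mult) simp
    then have hG: "h \<in> G" unfolding h_def using G_comp WG g by blast
    have "h p0 - p0 = t - (p0 - g p0)" by (simp add: h_def)
    also have "\<dots> = (\<Sum>v\<in>B. (real_of_int \<lfloor>u v\<rfloor> - u v) *\<^sub>R v)"
      unfolding u t_def by (simp add: sum_subtractf[symmetric] scaleR_diff_left)
    finally have "norm (h p0 - p0) \<le> (\<Sum>v\<in>B. norm ((real_of_int \<lfloor>u v\<rfloor> - u v) *\<^sub>R v))"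
      using norm_sum[of "\<lambda>v. (real_of_int \<lfloor>u v\<rfloor> - u v) *\<^sub>R v" B] by simp
    also have "\<dots> \<le> r" unfolding r_def
    proof (rule sum_mono)
      fix v
      have "\<bar>real_of_int \<lfloor>u v\<rfloor> - u v\<bar> \<le> 1" by linarith
      then show "norm ((real_of_int \<lfloor>u v\<rfloor> - u v) *\<^sub>R v) \<le> norm v"
        by (simp add: mult_left_le_one_le)
    qed
    finally have hK: "h \<in> ?K" using hG by simp
    have mult: "w \<otimes>\<^bsub>transformation_group\<lparr>carrier := G\<rparr>\<^esub> f = w \<circ> f" if "w \<in> W" "f \<in> G" for w f
    proof -
      have "bij w" "bij f" using that WG G_bij by auto
      then have "w \<otimes>\<^bsub>transformation_group\<^esub> f = w \<circ> f" by (rule transformation_group_simps(2))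
      then show ?thesis by simp
    qed
    have coset: "W #>\<^bsub>transformation_group\<lparr>carrier := G\<rparr>\<^esub> f = (\<lambda>w. w \<circ> f) ` W" if "f \<in> G" for f
      unfolding r_coset_def using mult[OF _ that] by auto
    have "(\<lambda>w. w \<circ> g) ` W = (\<lambda>w. w \<circ> h) ` W"
    proof
      show "(\<lambda>w. w \<circ> h) ` W \<subseteq> (\<lambda>w. w \<circ> g) ` W"
      proof
        fix f assume "f \<in> (\<lambda>w. w \<circ> h) ` W"
        then obtain w where w: "w \<in> W" "f = w \<circ> h" by blast
        have "f = (w \<circ> (+) t) \<circ> g" unfolding w h_def by (simp only: comp_assoc)
        then show "f \<in> (\<lambda>w. w \<circ> g) ` W" using W_comp[OF w(1) tW] by blast
      qed
      show "(\<lambda>w. w \<circ> g) ` W \<subseteq> (\<lambda>w. w \<circ> h) ` W"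
      proof
        fix f assume "f \<in> (\<lambda>w. w \<circ> g) ` W"
        then obtain w where w: "w \<in> W" "f = w \<circ> g" by blast
        have "f = (w \<circ> (+) (- t)) \<circ> h" unfolding w h_def by auto
        then show "f \<in> (\<lambda>w. w \<circ> h) ` W" using W_comp[OF w(1) neg[OF tW]] by blast
      qed
    qed
    then have "W #>\<^bsub>transformation_group\<lparr>carrier := G\<rparr>\<^esub> g = W #>\<^bsub>transformation_group\<lparr>carrier := G\<rparr>\<^esub> h"
      using coset g hG by metis
    then show ?thesis using hK by blast
  qed
  have "rcosets\<^bsub>transformation_group\<lparr>carrier := G\<rparr>\<^esub> W
      \<subseteq> (\<lambda>h. W #>\<^bsub>transformation_group\<lparr>carrier := G\<rparr>\<^esub> h) ` ?K"
    unfolding RCOSETS_def using rep by auto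
  then show ?thesis using finite_bounded finite_subset by blast
qed

theorem maximal_infinite_index_normal:
  assumes max: "maximal_reflection_subgroup W G" and inf: "infinite_index W G"
  shows "\<exists>\<nu>. \<nu> \<noteq> 0 \<and> (\<forall>a c. a \<noteq> 0 \<and> \<rho> a c \<in> W \<longrightarrow> a \<bullet> \<nu> = 0)"
proof -
  let ?T = "{v. (+) v \<in> W}"
  have R: "W \<inter> reflections \<subseteq> reflections" by blast
  note WG = maximal_reflection_subgroupD(1)[OF max]
  note W = maximal_reflection_subgroupD(3)[OF max]
  have "span ?T \<noteq> UNIV"
    using spanning_translations_finite_index[OF R W WG] inf by (auto simp: infinite_index_def)
  then have "dim ?T < DIM('a)"
    using dim_eq_full[of ?T] dim_subset_UNIV[of ?T] by linarith
  then obtain \<nu> where \<nu>: "\<nu> \<noteq> 0" "\<And>v. v \<in> span ?T \<Longrightarrow> \<nu> \<bullet> v = 0"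
    using orthogonal_to_subspace_exists[of ?T] by (auto simp: orthogonal_def)
  have "a \<bullet> \<nu> = 0" if a: "a \<noteq> 0" "\<rho> a c \<in> W" for a c
  proof -
    obtain t where "t \<noteq> 0" "(+) (t *\<^sub>R a) \<in> W"
      using not_lonely_translation[OF R W a(2,1)] maximal_no_lonely_mirror[OF max] by blast
    then have "\<nu> \<bullet> (t *\<^sub>R a) = 0" by (intro \<nu>(2) span_base) simp
    then show ?thesis using \<open>t \<noteq> 0\<close> by (simp add: inner_commute)
  qed
  then show ?thesis using \<nu>(1) by blast
qed

end

section \<open>Simplices with an integral Cartan matrix\<close>

lemma span_eq_UNIV_if_no_orthogonal:
  fixes S :: "'a::euclidean_space set"
  assumes "\<And>v. (\<And>s. s \<in> S \<Longrightarrow> s \<bullet> v = 0) \<Longrightarrow> v = 0"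
  shows "span S = UNIV"
proof (rule ccontr)
  assume "span S \<noteq> UNIV"
  then have "dim S < DIM('a)"
    using dim_eq_full[of S] dim_subset_UNIV[of S] by linarith
  then obtain v where v: "v \<noteq> 0" "\<And>s. s \<in> span S \<Longrightarrow> v \<bullet> s = 0"
    using orthogonal_to_subspace_exists[of S] by (auto simp: orthogonal_def)
  then have "v = 0" using assms span_base by (metis inner_commute)
  then show False using v by simp
qed

text \<open>A simplex given by its facets: \<open>\<alpha> i\<close> is an inward normal, and the
  numbers \<open>c i * (\<alpha> i \<bullet> x - b i)\<close> are the barycentric coordinates of
  \<open>x\<close>, extended to the whole space.\<close>

locale simplex_data =
  fixes I :: "'i set" and \<alpha> :: "'i \<Rightarrow> 'a::euclidean_space" and b c :: "'i \<Rightarrow> real"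
  assumes finite_I: "finite I"
    and nonzero: "i \<in> I \<Longrightarrow> \<alpha> i \<noteq> 0"
    and weight_pos: "i \<in> I \<Longrightarrow> c i > 0"
    and barycentric_sum: "(\<Sum>i\<in>I. c i * (\<alpha> i \<bullet> x - b i)) = 1"
    and barycentric_point: "(\<Sum>i\<in>I. c i * y i) = 1 \<Longrightarrow> \<exists>x. \<forall>i\<in>I. \<alpha> i \<bullet> x - b i = y i"
    and spanning: "(\<And>i. i \<in> I \<Longrightarrow> \<alpha> i \<bullet> v = 0) \<Longrightarrow> v = 0"
begin

lemma span_alpha: "span (\<alpha> ` I) = UNIV"
  by (rule span_eq_UNIV_if_no_orthogonal) (use spanning in blast)

text \<open>The sum in \<open>barycentric_sum\<close> is constant in \<open>x\<close>, so its
  gradient vanishes.\<close>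

lemma weighted_sum_zero: "(\<Sum>i\<in>I. c i *\<^sub>R \<alpha> i) = 0"
proof -
  have "(\<Sum>i\<in>I. c i *\<^sub>R \<alpha> i) \<bullet> x = 0" for x
  proof -
    have "(\<Sum>i\<in>I. c i *\<^sub>R \<alpha> i) \<bullet> x
        = (\<Sum>i\<in>I. c i * (\<alpha> i \<bullet> x - b i)) - (\<Sum>i\<in>I. c i * (\<alpha> i \<bullet> 0 - b i))"
      by (simp add: inner_sum_left sum_subtractf[symmetric] algebra_simps)
    then show ?thesis using barycentric_sum[of x] barycentric_sum[of 0] by simp
  qed
  then show ?thesis by (metis inner_eq_zero_iff)
qed

lemma no_common_zero: "\<not> (\<exists>x. \<forall>i\<in>I. \<alpha> i \<bullet> x = b i)"
proof
  assume "\<exists>x. \<forall>i\<in>I. \<alpha> i \<bullet> x = b i"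
  then obtain x where "\<forall>i\<in>I. \<alpha> i \<bullet> x = b i" by blast
  then have "(\<Sum>i\<in>I. c i * (\<alpha> i \<bullet> x - b i)) = 0" by (intro sum.neutral) simp
  then show False using barycentric_sum by simp
qed

lemma vertex:
  assumes "k \<in> I"
  shows "\<exists>x. \<alpha> k \<bullet> x - b k = 1 / c k \<and> (\<forall>i\<in>I - {k}. \<alpha> i \<bullet> x - b i = 0)"
proof -
  have "(\<Sum>i\<in>I. c i * (if i = k then 1 / c k else 0)) = 1"
    using assms finite_I weight_pos[OF assms] by (simp add: if_distrib[of "(*) _"] cong: if_cong)
  from barycentric_point[OF this] obtain x
    where "\<forall>i\<in>I. \<alpha> i \<bullet> x - b i = (if i = k then 1 / c k else 0)" by blast
  then show ?thesis using assms by (intro exI[of _ x]) auto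
qed

text \<open>A linear relation with coefficients \<open>t\<close> makes the sum of the functions
  \<open>t i * (\<alpha> i \<bullet> x - b i)\<close> constant; its value at the vertex opposite the
  facet \<open>j\<close> is \<open>t j / c j\<close>. Hence every relation is a multiple of the
  weights.\<close>

lemma affine_relation_trivial:
  assumes t: "(\<Sum>i\<in>I. t i *\<^sub>R \<alpha> i) = 0" and k: "k \<in> I" and "i \<in> I"
  shows "t i / c i = t k / c k"
proof -
  have const: "(\<Sum>i\<in>I. t i * (\<alpha> i \<bullet> x - b i)) = - (\<Sum>i\<in>I. t i * b i)" for x
  proof -
    have "(\<Sum>i\<in>I. t i * (\<alpha> i \<bullet> x - b i)) = (\<Sum>i\<in>I. t i *\<^sub>R \<alpha> i) \<bullet> x - (\<Sum>i\<in>I. t i * b i)"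
      by (simp add: inner_sum_left sum_subtractf[symmetric] algebra_simps)
    then show ?thesis using t by simp
  qed
  have eval: "t j / c j = - (\<Sum>i\<in>I. t i * b i)" if j: "j \<in> I" for j
  proof -
    obtain x where x: "\<alpha> j \<bullet> x - b j = 1 / c j" "\<forall>i\<in>I - {j}. \<alpha> i \<bullet> x - b i = 0"
      using vertex[OF j] by blast
    have "(\<Sum>i\<in>I. t i * (\<alpha> i \<bullet> x - b i)) = t j * (\<alpha> j \<bullet> x - b j) + (\<Sum>i\<in>I - {j}. t i * (\<alpha> i \<bullet> x - b i))"
      using finite_I j by (rule sum.remove)
    also have "(\<Sum>i\<in>I - {j}. t i * (\<alpha> i \<bullet> x - b i)) = 0" by (intro sum.neutral) (use x in simp)
    finally show ?thesis using const x by simp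
  qed
  show ?thesis using eval k \<open>i \<in> I\<close> by simp
qed

text \<open>If \<open>J\<close> were orthogonal to its complement, the two partial sums of the
  relation \<open>weighted_sum_zero\<close> would be both orthogonal and opposite, hence zero. This
  would be a relation supported on \<open>J\<close>, while all relations are multiples of the
  positive weights.\<close>

lemma irreducible:
  assumes J: "J \<subseteq> I" and o: "\<And>i j. i \<in> J \<Longrightarrow> j \<in> I - J \<Longrightarrow> \<alpha> i \<bullet> \<alpha> j = 0"
  shows "J = {} \<or> J = I"
proof (rule ccontr)
  assume "\<not> ?thesis"
  then obtain k i where k: "k \<in> J" "i \<in> I - J" using J by blast
  have finJ: "finite J" using J finite_I finite_subset by blast
  let ?v = "\<Sum>i\<in>J. c i *\<^sub>R \<alpha> i" and ?w = "\<Sum>i\<in>I - J. c i *\<^sub>R \<alpha> i"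
  have vw: "?v + ?w = 0" using weighted_sum_zero sum.subset_diff[OF J finite_I, of "\<lambda>i. c i *\<^sub>R \<alpha> i"]
    by (simp add: add.commute)
  have "?v \<bullet> ?w = 0"
    using o by (simp add: inner_sum_left inner_sum_right)
  then have "?v \<bullet> ?v = 0" using vw by (metis add_eq_0_iff inner_minus_right neg_equal_0_iff_equal)
  then have "?v = 0" by simp
  moreover have "(\<Sum>i\<in>I. (if i \<in> J then c i else 0) *\<^sub>R \<alpha> i) = ?v"
  proof -
    have "(\<Sum>i\<in>I. (if i \<in> J then c i else 0) *\<^sub>R \<alpha> i) = (\<Sum>i\<in>I. if i \<in> J then c i *\<^sub>R \<alpha> i else 0)"
      by (rule sum.cong) auto
    also have "\<dots> = (\<Sum>i\<in>I \<inter> J. c i *\<^sub>R \<alpha> i)" using finite_I by (simp add: sum.inter_restrict)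
    finally show ?thesis using J by (simp add: inf.absorb2)
  qed
  ultimately have "(\<Sum>i\<in>I. (if i \<in> J then c i else 0) *\<^sub>R \<alpha> i) = 0" by simp
  then have "(if i \<in> J then c i else 0) / c i = (if k \<in> J then c k else 0) / c k"
    by (rule affine_relation_trivial) (use k J in auto)
  then show False using k J weight_pos[of k] by auto
qed

end

section \<open>The coroot lattice and discreteness\<close>

locale cartan_simplex = simplex_data +
  assumes cartan_integer: "i \<in> I \<Longrightarrow> j \<in> I \<Longrightarrow> 2 * (\<alpha> i \<bullet> \<alpha> j) / (\<alpha> j \<bullet> \<alpha> j) \<in> \<int>"
begin

definition coroot :: "'a \<Rightarrow> 'b" where
  "coroot i = (2 / (\<alpha> i \<bullet> \<alpha> i)) *\<^sub>R \<alpha> i"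

definition coroot_lattice :: "'b set" where
  "coroot_lattice = {\<Sum>i\<in>I. real_of_int (z i) *\<^sub>R coroot i | z. True}"

definition G :: "('b \<Rightarrow> 'b) set" where
  "G = gen ((\<lambda>i. \<rho> (\<alpha> i) (b i)) ` I)"

lemma coroot_lattice_zero: "0 \<in> coroot_lattice"
  unfolding coroot_lattice_def by (intro CollectI exI[of _ "\<lambda>_. 0"]) simp

lemma coroot_lattice_add:
  assumes "v \<in> coroot_lattice" "w \<in> coroot_lattice" shows "v + w \<in> coroot_lattice"
proof -
  obtain y z where "v = (\<Sum>i\<in>I. real_of_int (y i) *\<^sub>R coroot i)" "w = (\<Sum>i\<in>I. real_of_int (z i) *\<^sub>R coroot i)"
    using assms by (auto simp: coroot_lattice_def)
  then have "v + w = (\<Sum>i\<in>I. real_of_int (y i + z i) *\<^sub>R coroot i)"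
    by (simp add: sum.distrib scaleR_add_left)
  then show ?thesis unfolding coroot_lattice_def by (intro CollectI exI[of _ "\<lambda>i. y i + z i"]) simp
qed

lemma coroot_lattice_mult:
  assumes "v \<in> coroot_lattice" "k \<in> \<int>" shows "k *\<^sub>R v \<in> coroot_lattice"
proof -
  obtain z l where "v = (\<Sum>i\<in>I. real_of_int (z i) *\<^sub>R coroot i)" "k = real_of_int l"
    using assms by (auto simp: coroot_lattice_def elim: Ints_cases)
  then have "k *\<^sub>R v = (\<Sum>i\<in>I. real_of_int (l * z i) *\<^sub>R coroot i)"
    by (simp add: scaleR_sum_right)
  then show ?thesis unfolding coroot_lattice_def by (intro CollectI exI[of _ "\<lambda>i. l * z i"]) simp
qed

lemma coroot_lattice_diff:
  "v \<in> coroot_lattice \<Longrightarrow> w \<in> coroot_lattice \<Longrightarrow> v - w \<in> coroot_lattice"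
  using coroot_lattice_add[of v "(- 1) *\<^sub>R w"] coroot_lattice_mult[of w "- 1"] by simp

lemma coroot_in_lattice:
  assumes "j \<in> I" shows "coroot j \<in> coroot_lattice"
proof -
  have "(\<Sum>i\<in>I. real_of_int (if i = j then 1 else 0) *\<^sub>R coroot i) = (\<Sum>i\<in>I. if i = j then coroot i else 0)"
    by (rule sum.cong) auto
  then have "coroot j = (\<Sum>i\<in>I. real_of_int (if i = j then 1 else 0) *\<^sub>R coroot i)"
    using finite_I assms by simp
  then show ?thesis unfolding coroot_lattice_def by (intro CollectI exI[of _ "\<lambda>i. if i = j then 1 else 0"]) simp
qed

lemma inner_coroot_lattice:
  assumes "i \<in> I" "q \<in> coroot_lattice" shows "\<alpha> i \<bullet> q \<in> \<int>"
proof -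
  obtain z where z: "q = (\<Sum>i\<in>I. real_of_int (z i) *\<^sub>R coroot i)"
    using assms by (auto simp: coroot_lattice_def)
  have "\<alpha> i \<bullet> coroot j \<in> \<int>" if "j \<in> I" for j
    using cartan_integer[OF assms(1) that] by (simp add: coroot_def)
  then show ?thesis unfolding z by (auto simp: inner_sum_right intro!: Ints_sum Ints_mult)
qed

text \<open>A lattice vector is determined by its products with the \<open>\<alpha> i\<close>; these
  are integers, bounded by Cauchy-Schwarz.\<close>

lemma finite_coroot_lattice_ball: "finite {q \<in> coroot_lattice. norm q \<le> r}"
proof -
  let ?Q = "{q \<in> coroot_lattice. norm q \<le> r}"
  let ?f = "\<lambda>q. restrict (\<lambda>i. \<alpha> i \<bullet> q) I"
  have "inj_on ?f ?Q"
  proof (rule inj_onI)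
    fix p q assume "?f p = ?f q"
    then have "\<alpha> i \<bullet> p = \<alpha> i \<bullet> q" if "i \<in> I" for i using that by (metis restrict_apply')
    then have "p - q = 0" by (intro spanning) (simp add: inner_diff_right)
    then show "p = q" by simp
  qed
  moreover have "?f ` ?Q \<subseteq> PiE I (\<lambda>i. {k \<in> \<int>. \<bar>k\<bar> \<le> norm (\<alpha> i) * r})"
  proof -
    have "\<alpha> i \<bullet> q \<in> {k \<in> \<int>. \<bar>k\<bar> \<le> norm (\<alpha> i) * r}" if "q \<in> ?Q" "i \<in> I" for i q
    proof -
      have "\<bar>\<alpha> i \<bullet> q\<bar> \<le> norm (\<alpha> i) * norm q" by (rule Cauchy_Schwarz_ineq2)
      also have "\<dots> \<le> norm (\<alpha> i) * r" using that by (intro mult_left_mono) auto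
      finally show ?thesis using inner_coroot_lattice that by auto
    qed
    then show ?thesis by auto
  qed
  moreover have "finite (PiE I (\<lambda>i. {k \<in> \<int>. \<bar>k\<bar> \<le> norm (\<alpha> i) * r}))"
    by (intro finite_PiE finite_I finite_abs_int_segment)
  ultimately show ?thesis by (meson finite_imageD finite_subset)
qed

lemma R0: "(\<lambda>i. \<rho> (\<alpha> i) (b i)) ` I \<subseteq> reflections"
  using nonzero by auto

lemma generator_eq: "\<rho> (\<alpha> i) (b i) x = x - (\<alpha> i \<bullet> x - b i) *\<^sub>R coroot i"
  by (simp add: hyperplane_reflection_def coroot_def)

lemma generator_linear_part:
  "linear_part (\<rho> (\<alpha> i) (b i)) v = v - (\<alpha> i \<bullet> v) *\<^sub>R coroot i"
  by (simp add: linear_part_hyperplane_reflection coroot_def)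

lemma G_isometry': "g \<in> G \<Longrightarrow> affine_isometry g"
  unfolding G_def by (rule generate_reflections_isometry[OF R0])

lemma linear_part_coroot_lattice:
  assumes "g \<in> G" "q \<in> coroot_lattice" shows "linear_part g q \<in> coroot_lattice"
proof -
  have "G \<subseteq> {g. affine_isometry g \<and> linear_part g ` coroot_lattice \<subseteq> coroot_lattice}"
    unfolding G_def
  proof (rule generate_reflections_subset[OF R0])
    show "(\<lambda>i. \<rho> (\<alpha> i) (b i)) ` I
        \<subseteq> {g. affine_isometry g \<and> linear_part g ` coroot_lattice \<subseteq> coroot_lattice}"
      by (auto simp: generator_linear_part affine_isometry_hyperplane_reflection nonzero
          intro!: coroot_lattice_diff coroot_lattice_mult coroot_in_lattice inner_coroot_lattice)
  qed (auto simp: affine_isometry_id affine_isometry_comp linear_part_comp simp flip: id_def)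
  then show ?thesis using assms by blast
qed

text \<open>A linear part is determined by the images of the coroots, which are lattice vectors no
  longer than the coroots themselves.\<close>

lemma finite_linear_parts: "finite (linear_part ` G)"
proof -
  let ?f = "\<lambda>l. restrict (\<lambda>i. l (coroot i)) I"
  have "inj_on ?f (linear_part ` G)"
  proof (rule inj_onI)
    fix l l' assume l: "l \<in> linear_part ` G" "l' \<in> linear_part ` G" and e: "?f l = ?f l'"
    have lin: "linear l" "linear l'"
      using l linear_part_orthogonal orthogonal_transformation_linear G_isometry' by blast+
    have ag: "l (\<alpha> i) = l' (\<alpha> i)" if "i \<in> I" for i
    proof -
      have "l (coroot i) = l' (coroot i)" using e that by (metis restrict_apply')
      then show ?thesis using nonzero[OF that] by (simp add: coroot_def linear_cmul[OF lin(1)] linear_cmul[OF lin(2)])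
    qed
    show "l = l'"
    proof
      fix v
      show "l v = l' v"
        by (rule linear_eq_on_span[OF lin, of "\<alpha> ` I"]) (use span_alpha ag in auto)
    qed
  qed
  moreover have "?f ` linear_part ` G
      \<subseteq> PiE I (\<lambda>i. {q \<in> coroot_lattice. norm q \<le> norm (coroot i)})"
  proof -
    have "linear_part g (coroot i) \<in> {q \<in> coroot_lattice. norm q \<le> norm (coroot i)}"
      if "g \<in> G" "i \<in> I" for g i
      using linear_part_coroot_lattice[OF that(1) coroot_in_lattice[OF that(2)]]
        linear_part_orthogonal[OF G_isometry'[OF that(1)]] by (simp add: orthogonal_transformation_norm)
    then show ?thesis by auto
  qed
  moreover have "finite (PiE I (\<lambda>i. {q \<in> coroot_lattice. norm q \<le> norm (coroot i)}))"
    by (intro finite_PiE finite_I finite_coroot_lattice_ball)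
  ultimately show ?thesis by (meson finite_imageD finite_subset)
qed

text \<open>The translates of \<open>p\<close> by \<open>d\<close> times the coroot lattice form a
  set preserved by each generator, because the values of \<open>p\<close> on all walls are integral
  multiples of \<open>d\<close>.\<close>

lemma orbit_in_lattice:
  assumes p: "\<And>i. i \<in> I \<Longrightarrow> (\<alpha> i \<bullet> p - b i) / d \<in> \<int>" "d \<noteq> 0" and g: "g \<in> G"
  shows "\<exists>q\<in>coroot_lattice. g p = p + d *\<^sub>R q"
proof -
  define S where "S = {p + d *\<^sub>R q | q. q \<in> coroot_lattice}"
  have "G \<subseteq> {g. g ` S \<subseteq> S}"
    unfolding G_def
  proof (rule generate_reflections_subset[OF R0])
    have "\<rho> (\<alpha> i) (b i) (p + d *\<^sub>R q) \<in> S" if "i \<in> I" "q \<in> coroot_lattice" for i q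
    proof -
      have "\<rho> (\<alpha> i) (b i) (p + d *\<^sub>R q)
          = p + d *\<^sub>R (q - ((\<alpha> i \<bullet> p - b i) / d + \<alpha> i \<bullet> q) *\<^sub>R coroot i)"
      proof -
        have "\<alpha> i \<bullet> (p + d *\<^sub>R q) - b i = d * ((\<alpha> i \<bullet> p - b i) / d + \<alpha> i \<bullet> q)"
          using \<open>d \<noteq> 0\<close> by (simp add: inner_add_right distrib_left)
        then show ?thesis unfolding generator_eq by (simp add: scaleR_diff_right)
      qed
      moreover have "q - ((\<alpha> i \<bullet> p - b i) / d + \<alpha> i \<bullet> q) *\<^sub>R coroot i \<in> coroot_lattice"
        using that p by (intro coroot_lattice_diff coroot_lattice_mult coroot_in_lattice Ints_add
            inner_coroot_lattice) auto
      ultimately show ?thesis unfolding S_def by blast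
    qed
    then show "(\<lambda>i. \<rho> (\<alpha> i) (b i)) ` I \<subseteq> {g. g ` S \<subseteq> S}"
      by (auto simp: S_def)
  qed auto
  moreover have "p \<in> S" using coroot_lattice_zero unfolding S_def by force
  ultimately show ?thesis using g unfolding S_def by blast
qed

text \<open>The base point is the vertex opposite the facet \<open>k\<close>. Its values on the
  walls are 0 and \<open>1 / c k\<close>, so its orbit lies in a translate of the coroot lattice
  scaled by \<open>1 / c k\<close>.\<close>

lemma discrete:
  assumes k: "k \<in> I" and p: "\<alpha> k \<bullet> p - b k = 1 / c k" "\<forall>i\<in>I - {k}. \<alpha> i \<bullet> p - b i = 0"
  shows "discrete_reflection_group I \<alpha> b G p"
proof
  show "finite {g p | g. g \<in> G \<and> norm (g p - p) \<le> r}" for r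
  proof -
    let ?d = "1 / c k"
    have d: "?d > 0" using weight_pos[OF k] by simp
    have "{g p | g. g \<in> G \<and> norm (g p - p) \<le> r}
        \<subseteq> (\<lambda>q. p + ?d *\<^sub>R q) ` {q \<in> coroot_lattice. norm q \<le> r / ?d}"
    proof
      fix x assume "x \<in> {g p | g. g \<in> G \<and> norm (g p - p) \<le> r}"
      then obtain g where g: "g \<in> G" "x = g p" "norm (g p - p) \<le> r" by blast
      have int: "(\<alpha> i \<bullet> p - b i) / ?d \<in> \<int>" if "i \<in> I" for i
        using p k that weight_pos[OF k] by (cases "i = k") auto
      have "?d \<noteq> 0" using d by simp
      then obtain q where q: "q \<in> coroot_lattice" "g p = p + ?d *\<^sub>R q"
        using orbit_in_lattice[OF int _ g(1)] by blast
      have "norm (g p - p) = norm q * ?d" using q weight_pos[OF k] by simp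
      then have "norm q \<le> r / ?d" using g(3) d by (simp only: pos_le_divide_eq)
      then show "x \<in> (\<lambda>q. p + ?d *\<^sub>R q) ` {q \<in> coroot_lattice. norm q \<le> r / ?d}" using q g by blast
    qed
    then show ?thesis using finite_coroot_lattice_ball finite_subset by blast
  qed
qed (use nonzero irreducible no_common_zero spanning finite_linear_parts in \<open>auto simp: G_def\<close>)

end

section \<open>Normals annihilating a maximal subgroup\<close>

definition reflect :: "'a::euclidean_space \<Rightarrow> 'a \<Rightarrow> 'a" where
  "reflect a v = v - (2 * (a \<bullet> v) / (a \<bullet> a)) *\<^sub>R a"

lemma linear_part_reflect: "linear_part (\<rho> a c) = reflect a"
  by (simp add: fun_eq_iff linear_part_hyperplane_reflection reflect_def)

lemma reflect_scale: "k \<noteq> 0 \<Longrightarrow> reflect (k *\<^sub>R a) = reflect a"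
  by (simp add: reflect_def fun_eq_iff)

lemma reflect_adjoint: "reflect a v \<bullet> w = v \<bullet> reflect a w"
  by (simp add: reflect_def inner_diff_left inner_diff_right inner_commute)

lemma reflect_involution:
  assumes "a \<noteq> 0" shows "reflect a (reflect a v) = v"
proof -
  have "a \<bullet> a \<noteq> 0" using assms by simp
  then have "a \<bullet> (v - (2 * (a \<bullet> v) / (a \<bullet> a)) *\<^sub>R a) = - (a \<bullet> v)" by (simp add: inner_diff_right)
  then show ?thesis unfolding reflect_def by simp
qed

lemma reflect_fixes: "a \<bullet> v = 0 \<Longrightarrow> reflect a v = v"
  by (simp add: reflect_def)

lemma reflect_minus: "reflect a (- v) = - reflect a v"
  by (simp add: reflect_def)

text \<open>The linear shadow of a maximal subgroup: \<open>D\<close> stands for the normals of all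
  mirrors of \<open>G\<close>, \<open>S\<close> for the multiples of the normals of the generators,
  and \<nu> for the direction to which all mirrors of \<open>W\<close> are parallel. Both
  \<open>generated\<close> and \<open>absorbs\<close> quantify over arbitrary monoids
  \<open>K\<close> of maps, so that an exclusion argument reduces to the choice of
  \<open>K\<close>.\<close>

locale absorbing_normal =
  fixes D S :: "'a::euclidean_space set" and \<nu> :: 'a
  assumes D_nonzero: "a \<in> D \<Longrightarrow> a \<noteq> 0"
    and S_subset: "S \<subseteq> D"
    and D_scale: "a \<in> D \<Longrightarrow> k \<noteq> 0 \<Longrightarrow> k *\<^sub>R a \<in> D"
    and D_reflect: "a \<in> D \<Longrightarrow> d \<in> D \<Longrightarrow> reflect d a \<in> D"
    and generated: "id \<in> K \<Longrightarrow> (\<And>f g. f \<in> K \<Longrightarrow> g \<in> K \<Longrightarrow> f \<circ> g \<in> K) \<Longrightarrow>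
      (\<And>s. s \<in> S \<Longrightarrow> reflect s \<in> K) \<Longrightarrow> a \<in> D \<Longrightarrow> reflect a \<in> K"
    and normal_nonzero: "\<nu> \<noteq> 0"
    and absorbs: "id \<in> K \<Longrightarrow> (\<And>f g. f \<in> K \<Longrightarrow> g \<in> K \<Longrightarrow> f \<circ> g \<in> K) \<Longrightarrow>
      (\<And>a. a \<in> D \<Longrightarrow> a \<bullet> \<nu> = 0 \<Longrightarrow> reflect a \<in> K) \<Longrightarrow>
      s \<in> S \<Longrightarrow> reflect s \<notin> K \<Longrightarrow> a \<in> D \<Longrightarrow> reflect a \<in> K \<Longrightarrow> a \<bullet> \<nu> = 0"

lemma (in cartan_simplex) maximal_normal_exists:
  assumes max: "maximal_reflection_subgroup W G" and inf: "infinite_index W G"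
  shows "\<exists>\<nu>. \<nu> \<noteq> 0 \<and> (\<forall>a c. a \<noteq> 0 \<and> \<rho> a c \<in> W \<longrightarrow> a \<bullet> \<nu> = 0)"
proof -
  have "I \<noteq> {}" using barycentric_sum by force
  then obtain k where k: "k \<in> I" by blast
  then obtain p where p: "\<alpha> k \<bullet> p - b k = 1 / c k" "\<forall>i\<in>I - {k}. \<alpha> i \<bullet> p - b i = 0"
    using vertex by blast
  interpret discrete_reflection_group I \<alpha> b G p by (rule discrete[OF k p])
  show ?thesis by (rule maximal_infinite_index_normal[OF max inf])
qed

text \<open>A monoid \<open>K\<close> of linear maps pulls back to the monoid of affine isometries
  with linear part in \<open>K\<close>, to which absorption applies. For the second claim
  \<open>K\<close> is the stabiliser of \<nu>: it contains every reflection whose mirror is parallel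
  to \<nu>, but not all generators, since the \<open>\<alpha> i\<close> span.\<close>

lemma (in cartan_simplex) maximal_absorbing_normal:
  assumes max: "maximal_reflection_subgroup W G"
    and \<nu>: "\<nu> \<noteq> 0" "\<And>a c. a \<noteq> 0 \<Longrightarrow> \<rho> a c \<in> W \<Longrightarrow> a \<bullet> \<nu> = 0"
  shows "absorbing_normal {a. a \<noteq> 0 \<and> (\<exists>c. \<rho> a c \<in> G)}
      {k *\<^sub>R \<alpha> i | k i. k \<noteq> 0 \<and> i \<in> I} \<nu>"
    and "\<And>a c. a \<noteq> 0 \<Longrightarrow> \<rho> a c \<in> W \<longleftrightarrow> \<rho> a c \<in> G \<and> a \<bullet> \<nu> = 0"
proof -
  have "I \<noteq> {}" using barycentric_sum by force
  then obtain k where k: "k \<in> I" by blast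
  then obtain p where p: "\<alpha> k \<bullet> p - b k = 1 / c k" "\<forall>i\<in>I - {k}. \<alpha> i \<bullet> p - b i = 0"
    using vertex by blast
  interpret discrete_reflection_group I \<alpha> b G p by (rule discrete[OF k p])
  note WG = maximal_reflection_subgroupD(1)[OF max]
  let ?D = "{a. a \<noteq> 0 \<and> (\<exists>c. \<rho> a c \<in> G)}"
  let ?S = "{k *\<^sub>R \<alpha> i | k i. k \<noteq> 0 \<and> i \<in> I}"
  have scale: "k *\<^sub>R a \<in> ?D" if "a \<in> ?D" "k \<noteq> 0" for a k
  proof -
    from that obtain c where c: "a \<noteq> 0" "\<rho> a c \<in> G" by blast
    then have "\<rho> (k *\<^sub>R a) (k * c) \<in> G"
      using hyperplane_reflection_cong[OF c(1) \<open>k \<noteq> 0\<close>] by simp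
    then show ?thesis using c that by auto
  qed
  have absorb: "a \<bullet> \<nu> = 0"
    if K: "id \<in> K" "\<And>f g. f \<in> K \<Longrightarrow> g \<in> K \<Longrightarrow> f \<circ> g \<in> K"
      and W: "\<And>a c. a \<noteq> 0 \<Longrightarrow> \<rho> a c \<in> W \<Longrightarrow> reflect a \<in> K"
      and i: "i \<in> I" "reflect (\<alpha> i) \<notin> K" and a: "a \<noteq> 0" "\<rho> a c \<in> G" "reflect a \<in> K"
    for K a c i
  proof -
    let ?H = "{g. affine_isometry g \<and> linear_part g \<in> K}"
    have "\<rho> a c \<in> W"
    proof (rule maximal_reflection_subgroup_absorbs[OF max G_def R0, of ?H])
      show "id \<in> ?H" using K(1) affine_isometry_id by simp
      show "f \<circ> g \<in> ?H" if "f \<in> ?H" "g \<in> ?H" for f g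
        using that K(2) by (simp add: affine_isometry_comp linear_part_comp)
      show "W \<inter> reflections \<subseteq> ?H"
        using W by (auto simp: reflections_def affine_isometry_hyperplane_reflection linear_part_reflect)
      show "\<rho> (\<alpha> i) (b i) \<in> G" using i G_generator by simp
      show "\<rho> (\<alpha> i) (b i) \<notin> ?H" using i by (simp add: linear_part_reflect)
      show "\<rho> a c \<in> ?H"
        using a by (simp add: linear_part_reflect affine_isometry_hyperplane_reflection)
    qed (use a in auto)
    then show ?thesis using \<nu>(2) a by blast
  qed
  show "absorbing_normal ?D ?S \<nu>"
  proof
    show "?S \<subseteq> ?D"
    proof
      fix x assume "x \<in> ?S"
      then obtain k i where k: "x = k *\<^sub>R \<alpha> i" "k \<noteq> 0" "i \<in> I" by blast
      have "\<rho> (\<alpha> i) (b i) \<in> G" "\<alpha> i \<noteq> 0" using k G_generator nonzero by blast+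
      then have "\<alpha> i \<in> ?D" by blast
      then show "x \<in> ?D" unfolding k(1) using k(2) by (rule scale)
    qed
    show "reflect d a \<in> ?D" if "a \<in> ?D" "d \<in> ?D" for a d
    proof -
      from that obtain c c' where "\<rho> a c \<in> G" "\<rho> d c' \<in> G" by blast
      then have "\<exists>c''. \<rho> (linear_part (\<rho> d c') a) c'' \<in> G"
        using G_conjugate that by blast
      moreover have "reflect d a \<noteq> 0"
        using that reflect_involution[of d a] by (auto simp: reflect_def[of d 0])
      ultimately show ?thesis by (simp add: linear_part_reflect)
    qed
    show "reflect a \<in> K"
      if K: "id \<in> K" "\<And>f g. f \<in> K \<Longrightarrow> g \<in> K \<Longrightarrow> f \<circ> g \<in> K"
        and S: "\<And>s. s \<in> ?S \<Longrightarrow> reflect s \<in> K" and a: "a \<in> ?D" for a K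
    proof -
      let ?H = "{g. affine_isometry g \<and> linear_part g \<in> K}"
      have "reflect (\<alpha> i) \<in> K" if "i \<in> I" for i
      proof -
        have "\<alpha> i = 1 *\<^sub>R \<alpha> i" by simp
        then have "\<alpha> i \<in> ?S" using that by (metis (mono_tags, lifting) mem_Collect_eq one_neq_zero)
        then show ?thesis by (rule S)
      qed
      then have "G \<subseteq> ?H"
        unfolding G_def
        by (intro generate_reflections_subset[OF R0])
          (use K in \<open>auto simp: affine_isometry_comp linear_part_comp affine_isometry_id linear_part_reflect
            affine_isometry_hyperplane_reflection nonzero simp flip: id_def\<close>)
      then show ?thesis using a by (auto simp: linear_part_reflect)
    qed
    show "a \<bullet> \<nu> = 0"
      if K: "id \<in> K" "\<And>f g. f \<in> K \<Longrightarrow> g \<in> K \<Longrightarrow> f \<circ> g \<in> K"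
        and D: "\<And>a. a \<in> ?D \<Longrightarrow> a \<bullet> \<nu> = 0 \<Longrightarrow> reflect a \<in> K"
        and s: "s \<in> ?S" "reflect s \<notin> K" and a: "a \<in> ?D" "reflect a \<in> K" for K s a
    proof -
      obtain k i where k: "s = k *\<^sub>R \<alpha> i" "k \<noteq> 0" "i \<in> I" using s by blast
      obtain c where c: "\<rho> a c \<in> G" using a by blast
      show ?thesis
      proof (rule absorb[OF K, of i])
        show "reflect a \<in> K" if "a \<noteq> 0" "\<rho> a c \<in> W" for a c
          using D \<nu>(2) that WG by blast
        show "reflect (\<alpha> i) \<notin> K" using s k reflect_scale by metis
      qed (use k a c in auto)
    qed
  qed (use scale \<nu> in auto)
  show "\<rho> a c \<in> W \<longleftrightarrow> \<rho> a c \<in> G \<and> a \<bullet> \<nu> = 0"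
    if a: "a \<noteq> 0" for a c
  proof
    assume "\<rho> a c \<in> G \<and> a \<bullet> \<nu> = 0"
    then have c: "\<rho> a c \<in> G" "a \<bullet> \<nu> = 0" by auto
    let ?H = "{g. affine_isometry g \<and> linear_part g \<nu> = \<nu>}"
    obtain i where i: "i \<in> I" "\<alpha> i \<bullet> \<nu> \<noteq> 0" using spanning \<nu>(1) by blast
    show "\<rho> a c \<in> W"
    proof (rule maximal_reflection_subgroup_absorbs[OF max G_def R0, of ?H])
      show "id \<in> ?H" using affine_isometry_id by simp
      show "f \<circ> g \<in> ?H" if "f \<in> ?H" "g \<in> ?H" for f g
        using that by (simp add: affine_isometry_comp linear_part_comp)
      show "W \<inter> reflections \<subseteq> ?H"
        using \<nu>(2) by (auto simp: reflections_def affine_isometry_hyperplane_reflection linear_part_reflect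
            intro!: reflect_fixes)
      show "\<rho> (\<alpha> i) (b i) \<in> G" using i G_generator by simp
      show "\<rho> (\<alpha> i) (b i) \<notin> ?H"
        using i nonzero by (auto simp: linear_part_reflect reflect_def)
      show "\<rho> a c \<in> ?H"
        using c a by (simp add: linear_part_reflect affine_isometry_hyperplane_reflection reflect_fixes)
    qed (use c a in auto)
  qed (use \<nu>(2) WG a in auto)
qed

text \<open>Used for type F_4, with the absolute values of four coordinates. By \<open>M\<close> one
  number is the sum of the other three; each maximum in \<open>N\<close> is then the sum that
  contains it, so the other three are equal, and if one of the four vanishes all do.\<close>

lemma max_sums_zero:
  fixes a b c d :: real
  assumes "a \<ge> 0" "b \<ge> 0" "c \<ge> 0" "d \<ge> 0" "a = 0 \<or> b = 0 \<or> c = 0 \<or> d = 0"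
    and M: "max (max a b) (max c d) = 1 / 2 * (a + b + c + d)"
    and N: "max (a + b) (c + d) = max (a + c) (b + d)" "max (a + b) (c + d) = max (a + d) (b + c)"
  shows "a + b + c + d = 0"
proof -
  have aux: "x + y + z + w = 0"
    if x: "x = y + z + w" and pos: "y \<ge> 0" "z \<ge> 0" "w \<ge> 0" and zero: "x = 0 \<or> y = 0 \<or> z = 0 \<or> w = 0"
      and N: "max (x + y) (z + w) = max (x + z) (y + w)" "max (x + y) (z + w) = max (x + w) (y + z)"
    for x y z w :: real
  proof -
    have "max (x + y) (z + w) = x + y" "max (x + z) (y + w) = x + z" "max (x + w) (y + z) = x + w"
      using x pos by (auto simp: max_def)
    then show ?thesis using N zero x pos by auto
  qed
  have "a = b + c + d \<or> b = a + d + c \<or> c = d + a + b \<or> d = c + b + a"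
    using M by (auto simp: max_def split: if_splits)
  then show ?thesis
  proof (elim disjE)
    assume "a = b + c + d" then show ?thesis using aux[of a b c d] assms by blast
  next
    assume "b = a + d + c"
    then have "b + a + d + c = 0" by (rule aux) (use assms in \<open>auto simp: add.commute\<close>)
    then show ?thesis by simp
  next
    assume "c = d + a + b"
    then have "c + d + a + b = 0" by (rule aux) (use assms in \<open>auto simp: add.commute max.commute\<close>)
    then show ?thesis by simp
  next
    assume "d = c + b + a"
    then have "d + c + b + a = 0" by (rule aux) (use assms in \<open>auto simp: add.commute max.commute\<close>)
    then show ?thesis by simp
  qed
qed

lemma abs_sum_eq_sum:
  fixes a b c d :: real
  assumes "\<bar>a\<bar> + \<bar>b\<bar> + \<bar>c\<bar> + \<bar>d\<bar> = a + b + c + d"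
  shows "0 \<le> a * b * (c * d)"
proof -
  have "0 \<le> a" "0 \<le> b" "0 \<le> c" "0 \<le> d"
    using assms abs_ge_self[of a] abs_ge_self[of b] abs_ge_self[of c] abs_ge_self[of d] by linarith+
  then show ?thesis by simp
qed

text \<open>The listed sums are those with an even number of minus signs, and an even number of sign
  changes leaves the product unchanged.\<close>

lemma abs_sum_eq_even_sum:
  fixes a b c d :: real
  assumes "\<bar>a\<bar> + \<bar>b\<bar> + \<bar>c\<bar> + \<bar>d\<bar> \<in> {a + b + c + d, a + b - c - d, a - b + c - d, a - b - c + d,
      - a - b - c - d, - a - b + c + d, - a + b - c + d, - a + b + c - d}"
  shows "0 \<le> a * b * (c * d)"
proof -
  note pp = abs_sum_eq_sum
  consider "\<bar>a\<bar> + \<bar>b\<bar> + \<bar>c\<bar> + \<bar>d\<bar> = a + b + c + d" | "\<bar>a\<bar> + \<bar>b\<bar> + \<bar>c\<bar> + \<bar>d\<bar> = a + b - c - d"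
    | "\<bar>a\<bar> + \<bar>b\<bar> + \<bar>c\<bar> + \<bar>d\<bar> = a - b + c - d" | "\<bar>a\<bar> + \<bar>b\<bar> + \<bar>c\<bar> + \<bar>d\<bar> = a - b - c + d"
    | "\<bar>a\<bar> + \<bar>b\<bar> + \<bar>c\<bar> + \<bar>d\<bar> = - a - b - c - d" | "\<bar>a\<bar> + \<bar>b\<bar> + \<bar>c\<bar> + \<bar>d\<bar> = - a - b + c + d"
    | "\<bar>a\<bar> + \<bar>b\<bar> + \<bar>c\<bar> + \<bar>d\<bar> = - a + b - c + d" | "\<bar>a\<bar> + \<bar>b\<bar> + \<bar>c\<bar> + \<bar>d\<bar> = - a + b + c - d"
    using assms unfolding insert_iff empty_iff by blast
  then show ?thesis
  proof cases
    case 1 then show ?thesis by (rule pp)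
  next
    case 2 then show ?thesis using pp[of a b "- c" "- d"] by simp
  next
    case 3 then show ?thesis using pp[of a "- b" c "- d"] by simp
  next
    case 4 then show ?thesis using pp[of a "- b" "- c" d] by simp
  next
    case 5 then show ?thesis using pp[of "- a" "- b" "- c" "- d"] by simp
  next
    case 6 then show ?thesis using pp[of "- a" "- b" c d] by simp
  next
    case 7 then show ?thesis using pp[of "- a" b "- c" d] by simp
  next
    case 8 then show ?thesis using pp[of "- a" b c "- d"] by simp
  qed
qed

section \<open>Exclusion of the linear types B, C, G_2 and F_4\<close>

context absorbing_normal
begin

lemma reflect_normal_fixed: "a \<in> D \<Longrightarrow> a \<bullet> \<nu> = 0 \<Longrightarrow> \<nu> \<bullet> reflect a x = \<nu> \<bullet> x"
  by (metis reflect_adjoint reflect_fixes)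

text \<open>If every set of a family is preserved by enough reflections, then by absorption the values of
  the normal on the sets are constant along orbits.\<close>

lemma values_constant:
  assumes perm: "\<And>s X. s \<in> S \<Longrightarrow> X \<in> \<F> \<Longrightarrow> reflect s ` X \<in> \<F>"
    and B: "B \<subseteq> D" "\<And>x X. x \<in> B \<Longrightarrow> X \<in> \<F> \<Longrightarrow> reflect x ` X = X" "\<And>v. (\<And>x. x \<in> B \<Longrightarrow> x \<bullet> v = 0) \<Longrightarrow> v = 0"
    and s: "s \<in> S" "X \<in> \<F>"
  shows "(\<lambda>x. \<nu> \<bullet> x) ` reflect s ` X = (\<lambda>x. \<nu> \<bullet> x) ` X"
proof (rule ccontr)
  \<comment> \<open>\<open>?K\<close> collects the maps that permute the family and keep the set of
    \<nu>-values of each member. Reflections along vectors orthogonal to \<nu> do so, and those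
    along \<open>B\<close> fix every member. Were the generator \<open>s\<close> outside
    \<open>?K\<close>, absorption would make all of \<open>B\<close> orthogonal to \<nu>, although
    \<open>B\<close> spans.\<close>
  let ?K = "{f. \<forall>X\<in>\<F>. f ` X \<in> \<F> \<and> (\<lambda>x. \<nu> \<bullet> x) ` f ` X = (\<lambda>x. \<nu> \<bullet> x) ` X}"
  assume ne: "(\<lambda>x. \<nu> \<bullet> x) ` reflect s ` X \<noteq> (\<lambda>x. \<nu> \<bullet> x) ` X"
  have comp: "f \<circ> g \<in> ?K" if "f \<in> ?K" "g \<in> ?K" for f g
    using that unfolding mem_Collect_eq image_comp[symmetric] by metis
  have permD: "reflect a ` X \<in> \<F>" if "a \<in> D" "X \<in> \<F>" for a X
  proof -
    have "reflect a \<in> {f. \<forall>X\<in>\<F>. f ` X \<in> \<F>}"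
      by (rule generated) (use perm that in \<open>auto simp flip: image_image\<close>)
    then show ?thesis using that by blast
  qed
  have "x \<bullet> \<nu> = 0" if x: "x \<in> B" for x
  proof (rule absorbs[of ?K s x])
    show "reflect a \<in> ?K" if "a \<in> D" "a \<bullet> \<nu> = 0" for a
      using permD reflect_normal_fixed that by (simp add: image_image)
    show "reflect x \<in> ?K" using B(2)[OF x] by simp
    show "reflect s \<notin> ?K" using ne s(2) by blast
  qed (use comp s B(1) x in auto)
  then have "\<nu> = 0" by (rule B(3))
  then show False using normal_nonzero by simp
qed

text \<open>The linear groups of type \<open>B\<close> and \<open>C\<close> act by signed permutations of an orthonormal basis.\<close>

lemma no_signed_permutations:
  fixes e :: "nat \<Rightarrow> 'a" and n :: nat
  assumes n: "n \<ge> 2"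
    and orth: "\<And>i j. i < n \<Longrightarrow> j < n \<Longrightarrow> e i \<bullet> e j = (if i = j then 1 else 0)"
    and span: "\<And>v. (\<And>i. i < n \<Longrightarrow> e i \<bullet> v = 0) \<Longrightarrow> v = 0"
    and S0: "e 0 \<in> S" and Sj: "\<And>j. 0 < j \<Longrightarrow> j < n \<Longrightarrow> e j - e (j - 1) \<in> S"
    and signed: "\<And>s i. s \<in> S \<Longrightarrow> i < n \<Longrightarrow> \<exists>j<n. reflect s (e i) = e j \<or> reflect s (e i) = - e j"
  shows False
proof -
  define E where "E = {e i | i. i < n} \<union> {- e i | i. i < n}"
  have signedD: "reflect a x \<in> E" if a: "a \<in> D" and x: "x \<in> E" for a x
  proof -
    have "reflect a \<in> {f. f ` E \<subseteq> E}"
    proof (rule generated)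
      show "reflect s \<in> {f. f ` E \<subseteq> E}" if "s \<in> S" for s
      proof -
        have "reflect s (e i) \<in> E" "reflect s (- e i) \<in> E" if "i < n" for i
          using signed[OF \<open>s \<in> S\<close> that] unfolding reflect_minus E_def by auto
        then show ?thesis by (auto simp: E_def)
      qed
    qed (use a in auto)
    then show ?thesis using x by blast
  qed
  have refl_e: "reflect (e k) (e i) = (if i = k then - e i else e i)" if "i < n" "k < n" for i k
    using orth[OF that(2,1)] orth[OF that(2,2)] by (auto simp: reflect_def scaleR_2)
  have refl_diff: "reflect (e j - e i) (e i) = e j" if "i < n" "j < n" "i \<noteq> j" for i j
    using that orth by (simp add: reflect_def inner_diff_left inner_diff_right)
  have eD: "e j \<in> D" if "j < n" for j
    using that
  proof (induction j)
    case 0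
    then show ?case using S0 S_subset by auto
  next
    case (Suc j)
    have "reflect (e (Suc j) - e j) (e j) \<in> D"
      using Suc Sj[of "Suc j"] S_subset by (intro D_reflect) auto
    then show ?case using refl_diff[of j "Suc j"] Suc by simp
  qed
  define t where "t = \<bar>\<nu> \<bullet> e 0\<bar>"
  have abs_eq: "\<bar>\<nu> \<bullet> e j\<bar> = t" if "j < n" for j
    using that
  proof (induction j)
    case (Suc j)
    have s: "e (Suc j) - e j \<in> S" using Sj[of "Suc j"] Suc.prems by simp
    \<comment> \<open>The family consists of the pairs \<open>{e i, - e i}\<close>, which all
      reflections along basis vectors preserve; constancy of values then equates the absolute values
      of the coordinates of \<nu>.\<close>
    have "(\<lambda>x. \<nu> \<bullet> x) ` reflect (e (Suc j) - e j) ` {e j, - e j} = (\<lambda>x. \<nu> \<bullet> x) ` {e j, - e j}"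
    proof (rule values_constant[of "{{e i, - e i} | i. i < n}" "{e i | i. i < n}"])
      show "reflect s ` X \<in> {{e i, - e i} | i. i < n}" if sX: "s \<in> S" "X \<in> {{e i, - e i} | i. i < n}" for s X
      proof -
        obtain i where i: "i < n" "X = {e i, - e i}" using sX(2) by blast
        obtain k where "k < n" "reflect s (e i) = e k \<or> reflect s (e i) = - e k" using signed[OF sX(1) i(1)] by blast
        then show ?thesis using i(2) by (intro CollectI exI[of _ k]) (auto simp: reflect_minus)
      qed
      show "reflect x ` X = X" if "x \<in> {e i | i. i < n}" "X \<in> {{e i, - e i} | i. i < n}" for x X
        using that refl_e by (auto simp: reflect_minus split: if_splits)
      show "v = 0" if "\<And>x. x \<in> {e i | i. i < n} \<Longrightarrow> x \<bullet> v = 0" for v by (rule span) (use that in blast)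
    qed (use s eD Suc.prems in auto)
    then have "{\<nu> \<bullet> e (Suc j), - (\<nu> \<bullet> e (Suc j))} = {\<nu> \<bullet> e j, - (\<nu> \<bullet> e j)}"
      using refl_diff[of j "Suc j"] Suc.prems by (simp add: reflect_minus)
    then show ?case using Suc by (auto simp: doubleton_eq_iff)
  qed (simp add: t_def)
  have t: "t > 0"
  proof (rule ccontr)
    assume "\<not> t > 0"
    then have "t = 0" by (simp add: t_def)
    then have "e j \<bullet> \<nu> = 0" if "j < n" for j using abs_eq[OF that] by (simp add: inner_commute)
    then have "\<nu> = 0" by (rule span)
    then show False using normal_nonzero by simp
  qed
  \<comment> \<open>The signs are chosen so that \<nu> has the same positive coordinate
    \<open>t\<close> along every \<open>f j\<close>. Reflections that fix \<nu> then permute the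
    \<open>f j\<close> without signs.\<close>
  define f where "f j = sgn (\<nu> \<bullet> e j) *\<^sub>R e j" for j
  have sgn: "sgn (\<nu> \<bullet> e j) = 1 \<or> sgn (\<nu> \<bullet> e j) = - 1" if "j < n" for j
    using abs_eq[OF that] t by (auto simp: sgn_real_def)
  have f\<nu>: "\<nu> \<bullet> f j = t" if "j < n" for j
    using abs_eq[OF that] by (simp add: f_def abs_sgn mult.commute)
  have f_orth: "f i \<bullet> f j = (if i = j then 1 else 0)" if "i < n" "j < n" for i j
    using orth[OF that] sgn[OF that(1)] sgn[OF that(2)] by (elim disjE) (auto simp: f_def)
  have Ef: "x \<in> E \<Longrightarrow> \<exists>j<n. x = f j \<or> x = - f j" for x
    using sgn unfolding E_def f_def by fastforce
  have fE: "f j \<in> E" if "j < n" for j using sgn[OF that] that by (auto simp: f_def E_def)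
  define F where "F = f ` {..<n}"
  \<comment> \<open>Vectors with coordinates 1 and -1 over \<open>F\<close> and an even number of
    minus signs: a half-spin orbit, up to a factor. Permutations of \<open>F\<close> preserve
    \<open>Y\<close>, the reflection along \<open>f 0\<close> does not, and the one along
    \<open>f 0 + f (Suc 0)\<close>, which swaps and negates two coordinates, does. Absorption would
    make \<open>f 0 + f (Suc 0)\<close> orthogonal to \<nu>, but the product is
    \<open>2 * t\<close>.\<close>
  define Y where "Y = {y. (\<forall>x\<in>F. y \<bullet> x = 1 \<or> y \<bullet> x = - 1) \<and> (\<Prod>x\<in>F. y \<bullet> x) = 1}"
  have inj_f: "inj_on f {..<n}"
    by (rule inj_onI) (metis f_orth lessThan_iff zero_neq_one)
  have refl_f: "reflect (f k) (f i) = (if i = k then - f i else f i)" if "i < n" "k < n" for i k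
    using f_orth[OF that(2,1)] f_orth[OF that(2,2)] by (auto simp: reflect_def scaleR_2)
  have "(f 0 + f (Suc 0)) \<bullet> \<nu> = 0"
  proof (rule absorbs[of "{g. g ` Y \<subseteq> Y}" "e 0"])
    show "reflect a \<in> {g. g ` Y \<subseteq> Y}" if a: "a \<in> D" "a \<bullet> \<nu> = 0" for a
    proof -
      have perm: "reflect a x \<in> F" if x: "x \<in> F" for x
      proof -
        obtain i where i: "i < n" "x = f i" using x by (auto simp: F_def)
        have "\<nu> \<bullet> reflect a x = t" using reflect_normal_fixed[OF a] f\<nu> i by simp
        moreover obtain j where j: "j < n" "reflect a x = f j \<or> reflect a x = - f j"
          using Ef[OF signedD[OF a(1) fE[OF i(1)]]] i(2) by metis
        ultimately have "reflect a x = f j" using f\<nu>[OF j(1)] t by auto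
        then show ?thesis using j(1) by (simp add: F_def)
      qed
      have "reflect a y \<in> Y" if y: "y \<in> Y" for y
      proof -
        have "(\<Prod>x\<in>F. reflect a y \<bullet> x) = (\<Prod>x\<in>F. y \<bullet> reflect a x)" by (simp add: reflect_adjoint)
        also have "\<dots> = (\<Prod>x\<in>F. y \<bullet> x)"
          by (rule prod.reindex_bij_witness[of _ "reflect a" "reflect a"])
            (use perm in \<open>auto simp: reflect_involution[OF D_nonzero[OF a(1)]]\<close>)
        finally show ?thesis using y perm unfolding Y_def by (auto simp: reflect_adjoint)
      qed
      then show ?thesis by auto
    qed
    have e0: "reflect (e 0) = reflect (f 0)"
      using sgn[of 0] n reflect_scale[of "sgn (\<nu> \<bullet> e 0)" "e 0"] by (auto simp: f_def)
    define y where "y = (\<Sum>x\<in>F. x)"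
    have yf: "y \<bullet> f j = 1" if "j < n" for j
    proof -
      have "y \<bullet> f j = (\<Sum>i<n. f i \<bullet> f j)"
        unfolding y_def F_def by (simp add: sum.reindex[OF inj_f] inner_sum_left)
      also have "\<dots> = (\<Sum>i<n. if i = j then 1 else 0)" by (rule sum.cong) (use f_orth that in auto)
      finally show ?thesis using that by simp
    qed
    then have "\<forall>x\<in>F. y \<bullet> x = 1" by (auto simp: F_def)
    then have "y \<in> Y" by (simp add: Y_def)
    moreover have "reflect (f 0) y \<notin> Y"
    proof -
      have "(\<Prod>x\<in>F. reflect (f 0) y \<bullet> x) = (\<Prod>i<n. reflect (f 0) y \<bullet> f i)"
        unfolding F_def by (simp add: prod.reindex[OF inj_f])
      also have "\<dots> = (\<Prod>i<n. if i = 0 then - 1 else 1)"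
        by (rule prod.cong) (use n in \<open>auto simp: reflect_adjoint refl_f yf\<close>)
      also have "\<dots> = - 1" using n by (simp add: prod.If_cases lessThan_def Collect_conv_if)
      finally show ?thesis by (simp add: Y_def)
    qed
    ultimately show "reflect (e 0) \<notin> {g. g ` Y \<subseteq> Y}" unfolding e0 by blast
    show "f 0 + f (Suc 0) \<in> D"
    proof -
      have d: "e (Suc 0) - e 0 \<in> D" using Sj[of "Suc 0"] n S_subset by auto
      have "reflect (e 0) (e (Suc 0) - e 0) \<in> D" using d eD n by (intro D_reflect) auto
      moreover have "reflect (e 0) (e (Suc 0) - e 0) = e (Suc 0) + e 0"
        using n orth by (simp add: reflect_def inner_diff_right scaleR_2)
      ultimately have p: "e (Suc 0) + e 0 \<in> D" by simp
      have "e 0 - e (Suc 0) \<in> D" "- e 0 - e (Suc 0) \<in> D"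
        using D_scale[OF d, of "- 1"] D_scale[OF p, of "- 1"] by (simp_all add: algebra_simps)
      then show ?thesis using sgn[of 0] sgn[of "Suc 0"] n d p
        by (auto simp: f_def add.commute)
    qed
    have n01: "(f 0 + f (Suc 0)) \<bullet> (f 0 + f (Suc 0)) = 2"
      using n f_orth by (simp add: inner_add_left inner_add_right)
    have r01: "reflect (f 0 + f (Suc 0)) (f i) = (if i = 0 then - f (Suc 0) else if i = Suc 0 then - f 0 else f i)"
      if "i < n" for i
      unfolding reflect_def n01 using that n f_orth by (auto simp: inner_add_left algebra_simps)
    have "reflect (f 0 + f (Suc 0)) y \<in> Y" if y: "y \<in> Y" for y
    proof -
      have pr: "(\<Prod>x\<in>F. z \<bullet> x) = (z \<bullet> f 0) * (z \<bullet> f (Suc 0)) * (\<Prod>i\<in>{..<n} - {0, Suc 0}. z \<bullet> f i)" for z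
      proof -
        have "(\<Prod>x\<in>F. z \<bullet> x) = (\<Prod>i<n. z \<bullet> f i)"
          unfolding F_def by (simp add: prod.reindex[OF inj_f])
        also have "\<dots> = (\<Prod>i\<in>{0, Suc 0}. z \<bullet> f i) * (\<Prod>i\<in>{..<n} - {0, Suc 0}. z \<bullet> f i)"
          using n by (subst prod.subset_diff[of "{0, Suc 0}"]) (auto simp: mult.commute)
        finally show ?thesis by simp
      qed
      have "(\<Prod>i\<in>{..<n} - {0, Suc 0}. reflect (f 0 + f (Suc 0)) y \<bullet> f i) = (\<Prod>i\<in>{..<n} - {0, Suc 0}. y \<bullet> f i)"
        by (rule prod.cong) (auto simp: reflect_adjoint r01)
      then have "(\<Prod>x\<in>F. reflect (f 0 + f (Suc 0)) y \<bullet> x) = (\<Prod>x\<in>F. y \<bullet> x)"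
        unfolding pr using n by (simp add: reflect_adjoint r01)
      moreover have "reflect (f 0 + f (Suc 0)) y \<bullet> x = 1 \<or> reflect (f 0 + f (Suc 0)) y \<bullet> x = - 1" if "x \<in> F" for x
      proof -
        from that obtain i where i: "i < n" "x = f i" by (auto simp: F_def)
        have "y \<bullet> f j = 1 \<or> y \<bullet> f j = - 1" if "j < n" for j
          using y that by (auto simp: Y_def F_def)
        from this[of 0] this[of "Suc 0"] this[of i] show ?thesis
          using i n by (auto simp: reflect_adjoint r01)
      qed
      ultimately show ?thesis using y unfolding Y_def by simp
    qed
    then show "reflect (f 0 + f (Suc 0)) \<in> {g. g ` Y \<subseteq> Y}" by auto
  qed (use S0 in auto)
  then show False using f\<nu>[of 0] f\<nu>[of "Suc 0"] n t by (simp add: inner_add_left inner_add_right inner_commute)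
qed

text \<open>Type G_2: up to scaling the normals form two hexagons, each the union of a triangle and
  its negative, \<open>X\<close> and \<open>X'\<close> with \<open>k\<close>, \<open>Y\<close> and
  \<open>Y'\<close> with \<open>g\<close>. Reflections along one hexagon fix the triangles of the
  other, so \<open>values_constant\<close> makes \<nu> take the same values on a triangle and its
  negative. With \<open>s\<close> and \<open>t\<close> the coordinates of \<nu>, this gives s = 0 or
  s = +-sqrt 3 t, and t = 0 or t = +-sqrt 3 s, which only s = t = 0 satisfies.\<close>

lemma no_hexagonal:
  fixes g k :: 'a
  defines "x \<equiv> (- 1 / 2) *\<^sub>R k - (sqrt 3 / 2) *\<^sub>R g"
  assumes orth: "g \<bullet> g = 1" "k \<bullet> k = 1" "g \<bullet> k = 0"
    and span: "\<And>v. g \<bullet> v = 0 \<Longrightarrow> k \<bullet> v = 0 \<Longrightarrow> v = 0"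
    and S: "g \<in> S" "k \<in> S" "x \<in> S" "\<And>s. s \<in> S \<Longrightarrow> \<exists>r y. r \<noteq> 0 \<and> s = r *\<^sub>R y \<and> y \<in> {g, k, x}"
  shows False
proof -
  define h where "h = sqrt 3 / 2"
  have hh: "h * h = 3 / 4" by (simp add: h_def)
  have hh': "h * (h * u) = 3 / 4 * u" for u using hh by (metis mult.assoc)
  define V where "V p q = p *\<^sub>R k + q *\<^sub>R g" for p q
  have x: "x = V (- 1 / 2) (- h)" by (simp add: x_def V_def h_def)
  have ip: "V p q \<bullet> V r s = p * r + q * s" for p q r s
    using orth by (simp add: V_def inner_add_left inner_add_right inner_commute algebra_simps)
  have refl: "reflect (V r s) (V p q) = V (p - 2 * (r * p + s * q) / (r * r + s * s) * r)
      (q - 2 * (r * p + s * q) / (r * r + s * s) * s)" for r s p q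
    unfolding reflect_def ip by (simp add: V_def algebra_simps)
  have k: "k = V 1 0" and g: "g = V 0 1" by (simp_all add: V_def)
  have rk: "reflect k (V p q) = V (- p) q" for p q unfolding k refl by simp
  have rg: "reflect g (V p q) = V p (- q)" for p q unfolding g refl by simp
  have rx: "reflect x (V p q) = V (p / 2 - h * q) (- (h * p) - q / 2)" for p q

    unfolding x refl by (rule arg_cong2[where f = V]) (simp_all add: hh field_simps hh')
  have ry: "reflect (V (- h) (- 1 / 2)) (V p q) = V (- (p / 2) - h * q) (q / 2 - h * p)" for p q
    unfolding refl by (rule arg_cong2[where f = V]) (simp_all add: hh field_simps hh')
  define X where "X = {V 1 0, V (- 1 / 2) h, V (- 1 / 2) (- h)}"
  define Y where "Y = {V 0 1, V h (- 1 / 2), V (- h) (- 1 / 2)}"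
  define X' where "X' = {V (- 1) 0, V (1 / 2) h, V (1 / 2) (- h)}"
  define Y' where "Y' = {V 0 (- 1), V h (1 / 2), V (- h) (1 / 2)}"
  have X: "reflect g ` X = X" "reflect k ` X = X'" "reflect x ` X = X'"
    "reflect g ` X' = X'" "reflect k ` X' = X" "reflect x ` X' = X"
    by (auto simp: X_def X'_def rg rk rx hh field_simps)
  have Y: "reflect g ` Y = Y'" "reflect k ` Y = Y" "reflect x ` Y = Y"
    "reflect g ` Y' = Y" "reflect k ` Y' = Y'" "reflect x ` Y' = Y'"
    by (auto simp: Y_def Y'_def rg rk rx hh field_simps)
  have SX: "reflect s ` Z \<in> {X, X'}" if "s \<in> S" "Z \<in> {X, X'}" for s Z
    using S(4)[OF that(1)] that(2) X by (auto simp: reflect_scale)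
  have SY: "reflect s ` Z \<in> {Y, Y'}" if "s \<in> S" "Z \<in> {Y, Y'}" for s Z
    using S(4)[OF that(1)] that(2) Y by (auto simp: reflect_scale)
  define s where "s = \<nu> \<bullet> k"
  define t where "t = \<nu> \<bullet> g"
  have \<nu>V: "\<nu> \<bullet> V p q = p * s + q * t" for p q by (simp add: V_def s_def t_def inner_add_right)
  have SD: "g \<in> D" "k \<in> D" "x \<in> D" using S S_subset by auto
  have yD: "V (- h) (- 1 / 2) \<in> D"
    using D_reflect[OF SD(1,3)] rx[of 0 1] g by simp
  have Xy: "reflect (V (- h) (- 1 / 2)) ` X = X" "reflect (V (- h) (- 1 / 2)) ` X' = X'"
    unfolding X_def X'_def image_insert image_empty ry by (auto simp: hh)
  have "(\<lambda>x. \<nu> \<bullet> x) ` reflect k ` X = (\<lambda>x. \<nu> \<bullet> x) ` X"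
  proof (rule values_constant[of "{X, X'}" "{g, V (- h) (- 1 / 2)}"])
    show "v = 0" if "\<And>y. y \<in> {g, V (- h) (- 1 / 2)} \<Longrightarrow> y \<bullet> v = 0" for v
    proof -
      have "g \<bullet> v = 0" "V (- h) (- 1 / 2) \<bullet> v = 0" using that by auto
      then have "g \<bullet> v = 0" "h * (k \<bullet> v) = 0" by (simp_all add: V_def inner_diff_left)
      then show ?thesis by (intro span) (auto simp: h_def)
    qed
    show "reflect y ` Z = Z" if "y \<in> {g, V (- h) (- 1 / 2)}" "Z \<in> {X, X'}" for y Z
      using that X Xy by blast
  qed (use S SX SD yD in auto)
  then have "- s \<in> {s, - s / 2 + h * t, - s / 2 - h * t}"
    unfolding X(2) unfolding X_def X'_def by (auto simp: \<nu>V)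
  then have s: "s = 0 \<or> s = 2 * h * t \<or> s = - 2 * h * t" by auto
  have "(\<lambda>x. \<nu> \<bullet> x) ` reflect g ` Y = (\<lambda>x. \<nu> \<bullet> x) ` Y"
  proof (rule values_constant[of "{Y, Y'}" "{k, x}"])
    show "v = 0" if "\<And>y. y \<in> {k, x} \<Longrightarrow> y \<bullet> v = 0" for v
    proof -
      have "k \<bullet> v = 0" "x \<bullet> v = 0" using that by auto
      then show ?thesis by (intro span) (auto simp: x_def inner_diff_left)
    qed
    show "reflect y ` Z = Z" if "y \<in> {k, x}" "Z \<in> {Y, Y'}" for y Z using that Y by blast
  qed (use S SY SD in auto)
  then have "- t \<in> {t, h * s - t / 2, - (h * s) - t / 2}"
    unfolding Y(1) unfolding Y_def Y'_def by (auto simp: \<nu>V)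
  then have t: "t = 0 \<or> t = 2 * h * s \<or> t = - 2 * h * s" by auto
  have "s = 0 \<and> t = 0"
    using s t hh by (elim disjE) (auto simp: hh algebra_simps hh')
  then have "\<nu> = 0" by (intro span) (auto simp: s_def t_def inner_commute)
  then show False using normal_nonzero by simp
qed

text \<open>The short roots form three orthonormal frames with signs, \<open>A\<close>,
  \<open>B\<close>, \<open>C\<close>, fixed by long reflections and permuted by short ones. The long
  roots form \<open>P\<close>, \<open>Q\<close>, \<open>R\<close>, one set for each splitting of the
  four coordinates into two pairs, and here short reflections fix and long ones permute. Hence \<nu>
  takes the same values on \<open>A\<close>, \<open>B\<close>, \<open>C\<close>, and likewise on
  \<open>P\<close>, \<open>Q\<close>, \<open>R\<close>; comparing maxima leaves \<nu> = 0.\<close>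

lemma no_type_F4:
  fixes e1 e2 e3 e4 :: 'a
  defines "x \<equiv> (1 / 2) *\<^sub>R (e1 - e2 - e3 - e4)"
  assumes orth: "e1 \<bullet> e1 = 1" "e2 \<bullet> e2 = 1" "e3 \<bullet> e3 = 1" "e4 \<bullet> e4 = 1"
      "e1 \<bullet> e2 = 0" "e1 \<bullet> e3 = 0" "e1 \<bullet> e4 = 0" "e2 \<bullet> e3 = 0" "e2 \<bullet> e4 = 0" "e3 \<bullet> e4 = 0"
    and span: "\<And>v. e1 \<bullet> v = 0 \<Longrightarrow> e2 \<bullet> v = 0 \<Longrightarrow> e3 \<bullet> v = 0 \<Longrightarrow> e4 \<bullet> v = 0 \<Longrightarrow> v = 0"
    and S: "e1 + e2 \<in> S" "e2 - e3 \<in> S" "e3 - e4 \<in> S" "e4 \<in> S" "x \<in> S"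
      "\<And>s. s \<in> S \<Longrightarrow> \<exists>r y. r \<noteq> 0 \<and> s = r *\<^sub>R y \<and> y \<in> {e1 + e2, e2 - e3, e3 - e4, e4, x}"
  shows False
proof -
  define V where "V p q r s = p *\<^sub>R e1 + q *\<^sub>R e2 + r *\<^sub>R e3 + s *\<^sub>R e4" for p q r s
  have ip: "V p q r s \<bullet> V p' q' r' s' = p * p' + q * q' + r * r' + s * s'" for p q r s p' q' r' s'
    using orth by (simp add: V_def inner_add_left inner_add_right inner_commute algebra_simps)
  have refl: "reflect (V a b c d) (V p q r s) =
      (let k = 2 * (a * p + b * q + c * r + d * s) / (a * a + b * b + c * c + d * d)
       in V (p - k * a) (q - k * b) (r - k * c) (s - k * d))" for a b c d p q r s
    unfolding reflect_def ip Let_def by (simp add: V_def algebra_simps)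
  have inj: "V p q r s = V p' q' r' s' \<longleftrightarrow> p = p' \<and> q = q' \<and> r = r' \<and> s = s'" for p q r s p' q' r' s'
  proof
    assume e: "V p q r s = V p' q' r' s'"
    have "V p q r s \<bullet> V 1 0 0 0 = V p' q' r' s' \<bullet> V 1 0 0 0" "V p q r s \<bullet> V 0 1 0 0 = V p' q' r' s' \<bullet> V 0 1 0 0"
      "V p q r s \<bullet> V 0 0 1 0 = V p' q' r' s' \<bullet> V 0 0 1 0" "V p q r s \<bullet> V 0 0 0 1 = V p' q' r' s' \<bullet> V 0 0 0 1"
      using e by simp_all
    then show "p = p' \<and> q = q' \<and> r = r' \<and> s = s'" by (simp add: ip)
  qed simp
  define h :: real where "h = 1 / 2"
  have hh: "h * h = 1 / 4" "h + h = 1" "2 * h = 1" "h * 2 = 1" "- h - h = - 1" "h - 1 = - h" "1 - h = h" "h - - h = 1"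
    by (simp_all add: h_def)
  have gens: "e1 + e2 = V 1 1 0 0" "e2 - e3 = V 0 1 (- 1) 0" "e3 - e4 = V 0 0 1 (- 1)" "e4 = V 0 0 0 1"
    "x = V h (- h) (- h) (- h)"
    by (simp_all add: V_def x_def h_def algebra_simps)
  have r1: "reflect (e1 + e2) (V p q r s) = V (- q) (- p) r s" for p q r s
    unfolding gens refl by (simp add: field_simps)
  have r2: "reflect (e2 - e3) (V p q r s) = V p r q s" for p q r s
    unfolding gens refl by (simp add: field_simps)
  have r3: "reflect (e3 - e4) (V p q r s) = V p q s r" for p q r s
    unfolding gens(3) refl by (simp add: field_simps)
  have r4: "reflect e4 (V p q r s) = V p q r (- s)" for p q r s
    unfolding gens refl by (simp add: field_simps)
  have r5: "reflect x (V p q r s) = V (p - h * (p - q - r - s)) (q + h * (p - q - r - s))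
      (r + h * (p - q - r - s)) (s + h * (p - q - r - s))" for p q r s
    unfolding gens refl Let_def inj by (simp add: h_def field_simps)
  define A where "A = {V 1 0 0 0, V (- 1) 0 0 0, V 0 1 0 0, V 0 (- 1) 0 0,
      V 0 0 1 0, V 0 0 (- 1) 0, V 0 0 0 1, V 0 0 0 (- 1)}"
  define B where "B = {V h h h h, V h h (- h) (- h), V h (- h) h (- h), V h (- h) (- h) h,
      V (- h) (- h) (- h) (- h), V (- h) (- h) h h, V (- h) h (- h) h, V (- h) h h (- h)}"
  define C where "C = {V h h h (- h), V h h (- h) h, V h (- h) h h, V (- h) h h h,
      V (- h) (- h) (- h) h, V (- h) (- h) h (- h), V (- h) h (- h) (- h), V h (- h) (- h) (- h)}"
  define P where "P = {V 1 1 0 0, V 1 (- 1) 0 0, V (- 1) 1 0 0, V (- 1) (- 1) 0 0,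
      V 0 0 1 1, V 0 0 1 (- 1), V 0 0 (- 1) 1, V 0 0 (- 1) (- 1)}"
  define Q where "Q = {V 1 0 1 0, V 1 0 (- 1) 0, V (- 1) 0 1 0, V (- 1) 0 (- 1) 0,
      V 0 1 0 1, V 0 1 0 (- 1), V 0 (- 1) 0 1, V 0 (- 1) 0 (- 1)}"
  define R where "R = {V 1 0 0 1, V 1 0 0 (- 1), V (- 1) 0 0 1, V (- 1) 0 0 (- 1),
      V 0 1 1 0, V 0 1 (- 1) 0, V 0 (- 1) 1 0, V 0 (- 1) (- 1) 0}"
  have long_short: "reflect (e1 + e2) ` A = A" "reflect (e2 - e3) ` A = A" "reflect (e3 - e4) ` A = A"
    "reflect (e1 + e2) ` B = B" "reflect (e2 - e3) ` B = B" "reflect (e3 - e4) ` B = B"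
    "reflect (e1 + e2) ` C = C" "reflect (e2 - e3) ` C = C" "reflect (e3 - e4) ` C = C"
    unfolding A_def B_def C_def image_insert image_empty r1 r2 r3 by auto
  have short_short: "reflect e4 ` A = A" "reflect e4 ` B = C" "reflect e4 ` C = B"
    "reflect x ` A = B" "reflect x ` B = A" "reflect x ` C = C"
    unfolding A_def B_def C_def image_insert image_empty r4 r5 by (auto simp: hh)
  have short_long: "reflect e4 ` P = P" "reflect e4 ` Q = Q" "reflect e4 ` R = R"
    "reflect x ` P = P" "reflect x ` Q = Q" "reflect x ` R = R"
    unfolding P_def Q_def R_def image_insert image_empty r4 r5 by (auto simp: hh)
  have long_long: "reflect (e1 + e2) ` P = P" "reflect (e1 + e2) ` Q = R" "reflect (e1 + e2) ` R = Q"
    "reflect (e2 - e3) ` P = Q" "reflect (e2 - e3) ` Q = P" "reflect (e2 - e3) ` R = R"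
    "reflect (e3 - e4) ` P = P" "reflect (e3 - e4) ` Q = R" "reflect (e3 - e4) ` R = Q"
    unfolding P_def Q_def R_def image_insert image_empty r1 r2 r3 by auto
  have SF: "reflect s ` X \<in> {A, B, C}" if "s \<in> S" "X \<in> {A, B, C}" for s X
  proof -
    from S(6)[OF that(1)] obtain r y
      where y: "r \<noteq> 0" "s = r *\<^sub>R y" "y \<in> {e1 + e2, e2 - e3, e3 - e4, e4, x}" by blast
    have "reflect y ` X \<in> {A, B, C}"
      using y(3) that(2) by (elim insertE emptyE) (simp_all only: long_short short_short insert_iff simp_thms)
    then show ?thesis unfolding y(2) reflect_scale[OF y(1)] .
  qed
  have LF: "reflect s ` X \<in> {P, Q, R}" if "s \<in> S" "X \<in> {P, Q, R}" for s X
  proof -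
    from S(6)[OF that(1)] obtain r y
      where y: "r \<noteq> 0" "s = r *\<^sub>R y" "y \<in> {e1 + e2, e2 - e3, e3 - e4, e4, x}" by blast
    have "reflect y ` X \<in> {P, Q, R}"
      using y(3) that(2) by (elim insertE emptyE) (simp_all only: long_long short_long insert_iff simp_thms)
    then show ?thesis unfolding y(2) reflect_scale[OF y(1)] .
  qed
  have SD: "e2 - e3 \<in> D" "e1 + e2 \<in> D" "e3 - e4 \<in> D" "V 0 0 0 1 \<in> D" "e4 \<in> D"
    using S S_subset gens by auto
  have D3: "V 0 0 1 0 \<in> D" using D_reflect[OF SD(4,3)] by (simp add: r3)
  have D2: "V 0 1 0 0 \<in> D" using D_reflect[OF D3 SD(1)] by (simp add: r2)
  have D1: "V (- 1) 0 0 0 \<in> D" using D_reflect[OF D2 SD(2)] by (simp add: r1)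
  have D34: "V 0 0 1 1 \<in> D" using D_reflect[OF SD(3,5)] by (simp add: gens(3) r4)
  have flip: "reflect (V (- 1) 0 0 0) (V p q r s) = V (- p) q r s" "reflect (V 0 1 0 0) (V p q r s) = V p (- q) r s"
    "reflect (V 0 0 1 0) (V p q r s) = V p q (- r) s" "reflect (V 0 0 0 1) (V p q r s) = V p q r (- s)"
    "reflect (V 0 0 1 1) (V p q r s) = V p q (- s) (- r)" for p q r s
    unfolding refl by (simp_all add: field_simps)
  have Vv: "V p q r s \<bullet> v = p * (e1 \<bullet> v) + q * (e2 \<bullet> v) + r * (e3 \<bullet> v) + s * (e4 \<bullet> v)" for p q r s v
    by (simp add: V_def inner_add_left)
  have h0: "h \<noteq> 0" by (simp add: h_def)
  define val where "val X = (\<lambda>x. \<nu> \<bullet> x) ` X" for X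
  have short_val: "val (reflect s ` X) = val X" if "s \<in> S" "X \<in> {A, B, C}" for s X
    unfolding val_def
  proof (rule values_constant[of "{A, B, C}" "{e1 + e2, e2 - e3, e3 - e4, V 0 0 1 1}", OF SF])
    have "reflect (V 0 0 1 1) ` A = A" "reflect (V 0 0 1 1) ` B = B" "reflect (V 0 0 1 1) ` C = C"
      unfolding A_def B_def C_def image_insert image_empty flip by auto
    then show "reflect y ` X = X" if "y \<in> {e1 + e2, e2 - e3, e3 - e4, V 0 0 1 1}" "X \<in> {A, B, C}" for y X
      using that by (elim insertE emptyE) (simp_all only: long_short)
    show "v = 0" if v: "\<And>y. y \<in> {e1 + e2, e2 - e3, e3 - e4, V 0 0 1 1} \<Longrightarrow> y \<bullet> v = 0" for v
      using v[of "e1 + e2"] v[of "e2 - e3"] v[of "e3 - e4"] v[of "V 0 0 1 1"]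
      by (intro span) (simp_all add: Vv inner_add_left inner_diff_left)
  qed (use that SD D34 in auto)
  have short: "val A = val B" "val A = val C"
    using short_val[OF S(5), of A] short_val[OF S(4), of B] short_short by auto
  have long_val: "val (reflect s ` X) = val X" if "s \<in> S" "X \<in> {P, Q, R}" for s X
    unfolding val_def
  proof (rule values_constant[of "{P, Q, R}" "{V (- 1) 0 0 0, V 0 1 0 0, V 0 0 1 0, V 0 0 0 1}", OF LF])
    show "reflect y ` X = X" if "y \<in> {V (- 1) 0 0 0, V 0 1 0 0, V 0 0 1 0, V 0 0 0 1}" "X \<in> {P, Q, R}" for y X
      using that by (elim insertE emptyE; simp only: P_def Q_def R_def image_insert image_empty flip; auto)
    show "v = 0" if v: "\<And>y. y \<in> {V (- 1) 0 0 0, V 0 1 0 0, V 0 0 1 0, V 0 0 0 1} \<Longrightarrow> y \<bullet> v = 0" for v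
      using v[of "V (- 1) 0 0 0"] v[of "V 0 1 0 0"] v[of "V 0 0 1 0"] v[of "V 0 0 0 1"]
      by (intro span) (simp_all add: Vv)
  qed (use that SD D1 D2 D3 in auto)
  have long: "val P = val Q" "val P = val R"
    using long_val[OF S(2), of P] long_val[OF S(1), of Q] long_long by auto
  define n1 where "n1 = \<nu> \<bullet> e1"
  define n2 where "n2 = \<nu> \<bullet> e2"
  define n3 where "n3 = \<nu> \<bullet> e3"
  define n4 where "n4 = \<nu> \<bullet> e4"
  have \<nu>V: "\<nu> \<bullet> V p q r s = p * n1 + q * n2 + r * n3 + s * n4" for p q r s
    by (simp add: V_def n1_def n2_def n3_def n4_def inner_add_right)
  have vA: "val A = {n1, - n1, n2, - n2, n3, - n3, n4, - n4}"
    unfolding val_def A_def image_insert image_empty \<nu>V by simp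
  have vB: "val B = {h * (n1 + n2 + n3 + n4), h * (n1 + n2 - n3 - n4), h * (n1 - n2 + n3 - n4),
      h * (n1 - n2 - n3 + n4), h * (- n1 - n2 - n3 - n4), h * (- n1 - n2 + n3 + n4),
      h * (- n1 + n2 - n3 + n4), h * (- n1 + n2 + n3 - n4)}"
    unfolding val_def B_def image_insert image_empty \<nu>V by (simp add: algebra_simps)
  have vC: "val C = {h * (n1 + n2 + n3 - n4), h * (n1 + n2 - n3 + n4), h * (n1 - n2 + n3 + n4),
      h * (n1 - n2 - n3 - n4), h * (- n1 - n2 - n3 + n4), h * (- n1 - n2 + n3 - n4),
      h * (- n1 + n2 - n3 - n4), h * (- n1 + n2 + n3 + n4)}"
    unfolding val_def C_def image_insert image_empty \<nu>V by (simp add: algebra_simps) blast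
  have vP: "val P = {n1 + n2, n1 - n2, - n1 + n2, - n1 - n2, n3 + n4, n3 - n4, - n3 + n4, - n3 - n4}"
    unfolding val_def P_def image_insert image_empty \<nu>V by simp
  have vQ: "val Q = {n1 + n3, n1 - n3, - n1 + n3, - n1 - n3, n2 + n4, n2 - n4, - n2 + n4, - n2 - n4}"
    unfolding val_def Q_def image_insert image_empty \<nu>V by simp
  have vR: "val R = {n1 + n4, n1 - n4, - n1 + n4, - n1 - n4, n2 + n3, n2 - n3, - n2 + n3, - n2 - n3}"
    unfolding val_def R_def image_insert image_empty \<nu>V by simp
  define M where "M = max (max \<bar>n1\<bar> \<bar>n2\<bar>) (max \<bar>n3\<bar> \<bar>n4\<bar>)"
  define T where "T = h * (\<bar>n1\<bar> + \<bar>n2\<bar> + \<bar>n3\<bar> + \<bar>n4\<bar>)"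
  have "M \<in> val A" unfolding vA M_def by (auto simp: max_def abs_if)
  have Mmax: "v \<le> M" if "v \<in> val A" for v
    using that unfolding vA M_def insert_iff empty_iff by (elim disjE) auto
  have "T \<in> val B \<union> val C"
    unfolding vB vC T_def Un_iff insert_iff mult_cancel_left
    by (cases "n1 \<ge> 0"; cases "n2 \<ge> 0"; cases "n3 \<ge> 0"; cases "n4 \<ge> 0") simp_all
  then have TA: "T \<in> val A" using short by blast
  have Tmax: "v \<le> T" if v: "v \<in> val B" for v
  proof -
    have "h * y \<le> T" if "y \<le> \<bar>n1\<bar> + \<bar>n2\<bar> + \<bar>n3\<bar> + \<bar>n4\<bar>" for y
      using that unfolding T_def h_def by simp
    then show ?thesis using v unfolding vB insert_iff empty_iff by (elim disjE) auto
  qed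
  have MT: "M = T" using Mmax[OF TA] Tmax[of M] \<open>M \<in> val A\<close> short by simp
  have "T \<in> val B" "T \<in> val C" using TA short by simp_all
  \<comment> \<open>The largest signed half-sum \<open>T\<close> is attained with an even number of
    minus signs (\<open>B\<close>) and with an odd one (\<open>C\<close>). Negating
    \<open>n4\<close> turns the odd case into the even one, so the product of the coordinates is
    both non-negative and non-positive.\<close>
  then have pos: "n1 * n2 * (n3 * n4) \<ge> 0" and neg: "n1 * n2 * (n3 * - n4) \<ge> 0"
    unfolding vB vC T_def insert_iff empty_iff mult_cancel_left using h0
    by (intro abs_sum_eq_even_sum; simp)+
  have zero: "n1 = 0 \<or> n2 = 0 \<or> n3 = 0 \<or> n4 = 0" using pos neg by (auto simp: order_antisym)
  have mP: "Max (val P) = max (\<bar>n1\<bar> + \<bar>n2\<bar>) (\<bar>n3\<bar> + \<bar>n4\<bar>)" unfolding vP by (simp add: abs_if max_def)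
  have mQ: "Max (val Q) = max (\<bar>n1\<bar> + \<bar>n3\<bar>) (\<bar>n2\<bar> + \<bar>n4\<bar>)" unfolding vQ by (simp add: abs_if max_def)
  have mR: "Max (val R) = max (\<bar>n1\<bar> + \<bar>n4\<bar>) (\<bar>n2\<bar> + \<bar>n3\<bar>)" unfolding vR by (simp add: abs_if max_def)
  have "\<bar>n1\<bar> + \<bar>n2\<bar> + \<bar>n3\<bar> + \<bar>n4\<bar> = 0"
  proof (rule max_sums_zero)
    show "max (max \<bar>n1\<bar> \<bar>n2\<bar>) (max \<bar>n3\<bar> \<bar>n4\<bar>) = 1 / 2 * (\<bar>n1\<bar> + \<bar>n2\<bar> + \<bar>n3\<bar> + \<bar>n4\<bar>)"
      using MT unfolding M_def T_def h_def .
    show "max (\<bar>n1\<bar> + \<bar>n2\<bar>) (\<bar>n3\<bar> + \<bar>n4\<bar>) = max (\<bar>n1\<bar> + \<bar>n3\<bar>) (\<bar>n2\<bar> + \<bar>n4\<bar>)"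
      using mP mQ long by metis
    show "max (\<bar>n1\<bar> + \<bar>n2\<bar>) (\<bar>n3\<bar> + \<bar>n4\<bar>) = max (\<bar>n1\<bar> + \<bar>n4\<bar>) (\<bar>n2\<bar> + \<bar>n3\<bar>)"
      using mP mR long by metis
  qed (use zero in auto)
  then have "\<nu> = 0" by (intro span) (auto simp: n1_def n2_def n3_def n4_def inner_commute)
  then show False using normal_nonzero by simp
qed

end

section \<open>Coxeter diagrams of simple polyhedra\<close>

text \<open>Normals have squared norm 2, so that in the simply laced case their products are the
  Cartan integers. Irredundancy is given by points that violate exactly one inequality.\<close>

locale irredundant_polyhedron =
  fixes J :: "'i set" and \<gamma> :: "'i \<Rightarrow> 'a::euclidean_space" and \<beta> :: "'i \<Rightarrow> real" and P :: "'a set"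
  assumes finite_J: "finite J"
    and P_def: "P = {x. \<forall>j\<in>J. \<gamma> j \<bullet> x \<ge> \<beta> j}"
    and norm2: "j \<in> J \<Longrightarrow> \<gamma> j \<bullet> \<gamma> j = 2"
    and interior_point: "\<exists>x. \<forall>j\<in>J. \<gamma> j \<bullet> x > \<beta> j"
    and irredundant: "j \<in> J \<Longrightarrow> \<exists>x. \<gamma> j \<bullet> x < \<beta> j \<and> (\<forall>i\<in>J - {j}. \<gamma> i \<bullet> x > \<beta> i)"
begin

lemma P_iff: "x \<in> P \<longleftrightarrow> (\<forall>j\<in>J. \<gamma> j \<bullet> x \<ge> \<beta> j)"
  by (simp add: P_def)

definition face :: "'i \<Rightarrow> 'a set" where
  "face j = P \<inter> {x. \<gamma> j \<bullet> x = \<beta> j}"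

text \<open>The segment from an interior point to a point that violates only the inequality
  \<open>j\<close> crosses the wall \<open>j\<close> strictly inside all other half-spaces.\<close>

lemma face_point:
  assumes j: "j \<in> J"
  shows "\<exists>x. \<gamma> j \<bullet> x = \<beta> j \<and> (\<forall>i\<in>J - {j}. \<gamma> i \<bullet> x > \<beta> i)"
proof -
  obtain y where y: "\<forall>j\<in>J. \<gamma> j \<bullet> y > \<beta> j" using interior_point by blast
  obtain z where z: "\<gamma> j \<bullet> z < \<beta> j" "\<forall>i\<in>J - {j}. \<gamma> i \<bullet> z > \<beta> i" using irredundant[OF j] by blast
  define p q where "p = \<gamma> j \<bullet> y - \<beta> j" and "q = \<beta> j - \<gamma> j \<bullet> z"
  have pq: "p > 0" "q > 0" using y z j by (auto simp: p_def q_def)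
  define x where "x = (q / (p + q)) *\<^sub>R y + (p / (p + q)) *\<^sub>R z"
  have val: "\<gamma> i \<bullet> x - \<beta> i = (q / (p + q)) * (\<gamma> i \<bullet> y - \<beta> i) + (p / (p + q)) * (\<gamma> i \<bullet> z - \<beta> i)" for i
  proof -
    have "q / (p + q) + p / (p + q) = 1" using pq by (simp add: add_divide_distrib[symmetric])
    then have "\<beta> i = (q / (p + q)) * \<beta> i + (p / (p + q)) * \<beta> i" by (metis distrib_right mult_1)
    then show ?thesis by (simp add: x_def inner_add_right right_diff_distrib)
  qed
  have "\<gamma> j \<bullet> x - \<beta> j = (q / (p + q)) * p - (p / (p + q)) * q"
    unfolding val by (simp add: p_def q_def right_diff_distrib)
  then have "\<gamma> j \<bullet> x = \<beta> j" by (simp add: mult.commute)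
  moreover have "\<gamma> i \<bullet> x > \<beta> i" if "i \<in> J - {j}" for i
  proof -
    have "(q / (p + q)) * (\<gamma> i \<bullet> y - \<beta> i) > 0" "(p / (p + q)) * (\<gamma> i \<bullet> z - \<beta> i) > 0"
      using pq y z that by auto
    then show ?thesis using val[of i] by linarith
  qed
  ultimately show ?thesis by blast
qed

lemma face_point_mem:
  assumes "\<gamma> j \<bullet> x = \<beta> j" "\<forall>i\<in>J - {j}. \<gamma> i \<bullet> x > \<beta> i"
  shows "x \<in> face j"
proof -
  have "\<gamma> i \<bullet> x \<ge> \<beta> i" if "i \<in> J" for i using assms that by (cases "i = j") (auto simp: less_imp_le)
  then show ?thesis using assms by (simp add: face_def P_iff)
qed

text \<open>From a point \<open>x\<close> in the relative interior of the face, a short step towards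
  any \<open>y\<close> of the hyperplane stays in the face, and \<open>y\<close> lies on the line
  through the two points.\<close>

lemma affine_hull_face:
  assumes j: "j \<in> J" shows "affine hull face j = {x. \<gamma> j \<bullet> x = \<beta> j}"
proof
  show "affine hull face j \<subseteq> {x. \<gamma> j \<bullet> x = \<beta> j}"
    by (rule hull_minimal) (auto simp: face_def affine_hyperplane)
  obtain x where x: "\<gamma> j \<bullet> x = \<beta> j" "\<forall>i\<in>J - {j}. \<gamma> i \<bullet> x > \<beta> i" using face_point[OF j] by blast
  show "{x. \<gamma> j \<bullet> x = \<beta> j} \<subseteq> affine hull face j"
  proof
    fix y assume "y \<in> {x. \<gamma> j \<bullet> x = \<beta> j}"
    then have y: "\<gamma> j \<bullet> y = \<beta> j" by simp
    have "\<forall>i\<in>J - {j}. eventually (\<lambda>t. \<gamma> i \<bullet> (x + t *\<^sub>R (y - x)) > \<beta> i) (at_right (0::real))"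
    proof
      fix i assume i: "i \<in> J - {j}"
      have "((\<lambda>t. \<gamma> i \<bullet> (x + t *\<^sub>R (y - x))) \<longlongrightarrow> \<gamma> i \<bullet> (x + 0 *\<^sub>R (y - x))) (at_right (0::real))"
        by (intro tendsto_intros)
      then show "eventually (\<lambda>t. \<gamma> i \<bullet> (x + t *\<^sub>R (y - x)) > \<beta> i) (at_right (0::real))"
        using x i by (intro order_tendstoD(1)) auto
    qed
    then have "eventually (\<lambda>t. \<forall>i\<in>J - {j}. \<gamma> i \<bullet> (x + t *\<^sub>R (y - x)) > \<beta> i) (at_right (0::real))"
      using finite_J by (simp add: eventually_ball_finite)
    then have "eventually (\<lambda>t. t > 0 \<and> (\<forall>i\<in>J - {j}. \<gamma> i \<bullet> (x + t *\<^sub>R (y - x)) > \<beta> i)) (at_right (0::real))"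
      using eventually_at_right_less[of "0::real"] by eventually_elim auto
    then obtain t where t: "t > 0" "\<forall>i\<in>J - {j}. \<gamma> i \<bullet> (x + t *\<^sub>R (y - x)) > \<beta> i"
      using eventually_happens[of _ "at_right (0::real)"] by (auto simp: trivial_limit_at_right_real)
    have "\<gamma> j \<bullet> (x + t *\<^sub>R (y - x)) = \<beta> j" using x y by (simp add: inner_add_right inner_diff_right)
    then have "x + t *\<^sub>R (y - x) \<in> face j" using t by (intro face_point_mem) auto
    moreover have "x \<in> face j" using x by (intro face_point_mem) auto
    ultimately have "(1 - 1 / t) *\<^sub>R x + (1 / t) *\<^sub>R (x + t *\<^sub>R (y - x)) \<in> affine hull face j"
      by (intro mem_affine[OF affine_affine_hull] hull_inc) auto
    moreover have "(1 - 1 / t) *\<^sub>R x + (1 / t) *\<^sub>R (x + t *\<^sub>R (y - x)) = y"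
      using t by (simp add: algebra_simps)
    ultimately show "y \<in> affine hull face j" by simp
  qed
qed

lemma affine_hull_P: "affine hull P = UNIV"
proof -
  obtain y where y: "\<forall>j\<in>J. \<gamma> j \<bullet> y > \<beta> j" using interior_point by blast
  have "open {x. \<forall>j\<in>J. \<gamma> j \<bullet> x > \<beta> j}"
  proof -
    have "{x. \<forall>j\<in>J. \<gamma> j \<bullet> x > \<beta> j} = (\<Inter>j\<in>J. {x. \<gamma> j \<bullet> x > \<beta> j})" by auto
    then show ?thesis using finite_J by (simp add: open_INT open_halfspace_gt)
  qed
  moreover have "{x. \<forall>j\<in>J. \<gamma> j \<bullet> x > \<beta> j} \<subseteq> P" by (auto simp: P_iff less_imp_le)
  ultimately have "y \<in> interior P" using y by (auto simp: interior_def)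
  then show ?thesis using affine_hull_nonempty_interior[of P] by blast
qed

lemma halfspace_inj: "inj_on (\<lambda>j. {x. (- \<gamma> j) \<bullet> x \<le> - \<beta> j}) J"
proof (rule inj_onI, rule ccontr)
  fix i j assume ij: "i \<in> J" "j \<in> J" "{x. (- \<gamma> i) \<bullet> x \<le> - \<beta> i} = {x. (- \<gamma> j) \<bullet> x \<le> - \<beta> j}" "i \<noteq> j"
  obtain z where z: "\<gamma> j \<bullet> z < \<beta> j" "\<forall>i\<in>J - {j}. \<gamma> i \<bullet> z > \<beta> i" using irredundant[OF ij(2)] by blast
  have "\<gamma> i \<bullet> z > \<beta> i" using z ij by blast
  then have "z \<in> {x. (- \<gamma> i) \<bullet> x \<le> - \<beta> i}" by simp
  then have "z \<in> {x. (- \<gamma> j) \<bullet> x \<le> - \<beta> j}" unfolding ij(3) .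
  then show False using z by simp
qed

lemma facets: "{f. f facet_of P} = face ` J"
proof -
  define H where "H j = {x. (- \<gamma> j) \<bullet> x \<le> - \<beta> j}" for j
  have inj: "inj_on H J" using halfspace_inj by (simp add: H_def[abs_def])
  let ?F = "H ` J"
  \<comment> \<open>The explicit description of facets is indexed by half-spaces; \<open>g\<close>
    leads back to the index set \<open>J\<close>.\<close>
  define g where "g h = inv_into J H h" for h
  have g: "g (H j) = j" if "j \<in> J" for j using inj that by (simp add: g_def)
  have "c facet_of P \<longleftrightarrow> (\<exists>h. h \<in> ?F \<and> c = P \<inter> {x. (- \<gamma> (g h)) \<bullet> x = - \<beta> (g h)})" for c
  proof (rule facet_of_polyhedron_explicit)
    show "finite ?F" using finite_J by simp
    show "P = affine hull P \<inter> \<Inter> ?F" unfolding affine_hull_P by (auto simp: P_iff H_def)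
    show "- \<gamma> (g h) \<noteq> 0 \<and> h = {x. (- \<gamma> (g h)) \<bullet> x \<le> - \<beta> (g h)}" if h: "h \<in> ?F" for h
    proof -
      obtain j where j: "j \<in> J" "h = H j" using h by blast
      have "\<gamma> j \<noteq> 0" using norm2[OF j(1)] by auto
      then show ?thesis unfolding j(2) g[OF j(1)] by (simp add: H_def)
    qed
    show "P \<subset> affine hull P \<inter> \<Inter> F'" if F': "F' \<subset> ?F" for F'
    proof -
      obtain j where j: "j \<in> J" "H j \<notin> F'" using F' by blast
      obtain z where z: "\<gamma> j \<bullet> z < \<beta> j" "\<forall>i\<in>J - {j}. \<gamma> i \<bullet> z > \<beta> i" using irredundant[OF j(1)] by blast
      have "z \<in> \<Inter> F'"
      proof
        fix h assume h: "h \<in> F'"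
        then obtain i where i: "i \<in> J" "h = H i" using F' by blast
        then have "i \<noteq> j" using j h by blast
        then show "z \<in> h" using z i by (auto simp: H_def less_imp_le)
      qed
      moreover have "z \<notin> P" using z(1) j(1) by (auto simp: P_iff not_le)
      moreover have "P \<subseteq> \<Inter> F'" using F' by (auto simp: P_iff H_def)
      ultimately show ?thesis unfolding affine_hull_P by blast
    qed
  qed
  then have "{f. f facet_of P} = (\<lambda>h. P \<inter> {x. (- \<gamma> (g h)) \<bullet> x = - \<beta> (g h)}) ` H ` J" by blast
  also have "\<dots> = face ` J" unfolding image_image by (rule image_cong) (auto simp: g face_def)
  finally show ?thesis .
qed

lemma face_inj: "inj_on face J"
proof (rule inj_onI, rule ccontr)
  fix i j assume ij: "i \<in> J" "j \<in> J" "face i = face j" "i \<noteq> j"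
  obtain x where x: "\<gamma> j \<bullet> x = \<beta> j" "\<forall>i\<in>J - {j}. \<gamma> i \<bullet> x > \<beta> i" using face_point[OF ij(2)] by blast
  then have "x \<in> face j" by (intro face_point_mem) auto
  then have "\<gamma> i \<bullet> x = \<beta> i" using ij(3) by (auto simp: face_def)
  then show False using x ij by force
qed

text \<open>A functional constant on the facet is constant on its affine hull, hence a multiple of
  the product with \<open>\<gamma> j\<close>; an interior point decides the sign.\<close>

lemma outer_normal_face:
  assumes j: "j \<in> J" shows "outer_normal P (face j) = - (1 / sqrt 2) *\<^sub>R \<gamma> j"
  unfolding outer_normal_def
proof (rule the_equality)
  have "norm (\<gamma> j) = sqrt 2" using norm2[OF j] by (simp add: norm_eq_sqrt_inner)
  then have "norm (- (1 / sqrt 2) *\<^sub>R \<gamma> j) = 1" by simp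
  moreover have "P \<subseteq> {x. (- (1 / sqrt 2) *\<^sub>R \<gamma> j) \<bullet> x \<le> - (1 / sqrt 2) * \<beta> j}"
    using j by (auto simp: P_iff divide_right_mono)
  moreover have "face j \<subseteq> {x. (- (1 / sqrt 2) *\<^sub>R \<gamma> j) \<bullet> x = - (1 / sqrt 2) * \<beta> j}"
    by (auto simp: face_def)
  ultimately show "norm (- (1 / sqrt 2) *\<^sub>R \<gamma> j) = 1 \<and>
    (\<exists>b. P \<subseteq> {x. (- (1 / sqrt 2) *\<^sub>R \<gamma> j) \<bullet> x \<le> b} \<and> face j \<subseteq> {x. (- (1 / sqrt 2) *\<^sub>R \<gamma> j) \<bullet> x = b})"
    by blast
next
  fix u assume "norm u = 1 \<and> (\<exists>b. P \<subseteq> {x. u \<bullet> x \<le> b} \<and> face j \<subseteq> {x. u \<bullet> x = b})"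
  then obtain b where u: "norm u = 1" "P \<subseteq> {x. u \<bullet> x \<le> b}" "face j \<subseteq> {x. u \<bullet> x = b}" by blast
  obtain x where x: "\<gamma> j \<bullet> x = \<beta> j" "\<forall>i\<in>J - {j}. \<gamma> i \<bullet> x > \<beta> i" using face_point[OF j] by blast
  obtain y where y: "\<forall>j\<in>J. \<gamma> j \<bullet> y > \<beta> j" using interior_point by blast
  have "affine hull face j \<subseteq> {x. u \<bullet> x = b}"
    using u(3) by (intro hull_minimal) (auto simp: affine_hyperplane)
  then have H: "u \<bullet> z = b" if "\<gamma> j \<bullet> z = \<beta> j" for z using that affine_hull_face[OF j] by auto
  define w where "w = u - ((u \<bullet> \<gamma> j) / 2) *\<^sub>R \<gamma> j"
  have w\<gamma>: "\<gamma> j \<bullet> w = 0" using norm2[OF j] by (simp add: w_def inner_diff_right inner_commute)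
  have "u \<bullet> (x + w) = b" by (rule H) (use w\<gamma> x in \<open>simp add: inner_add_right\<close>)
  moreover have "u \<bullet> x = b" by (rule H) (use x in simp)
  ultimately have "u \<bullet> w = 0" by (simp add: inner_add_right)
  moreover have "w \<bullet> w = u \<bullet> w - ((u \<bullet> \<gamma> j) / 2) * (\<gamma> j \<bullet> w)"
    unfolding inner_diff_left[symmetric] inner_scaleR_left[symmetric] w_def ..
  ultimately have "w \<bullet> w = 0" using w\<gamma> by simp
  then have uk: "u = ((u \<bullet> \<gamma> j) / 2) *\<^sub>R \<gamma> j" by (simp add: w_def)
  define k where "k = (u \<bullet> \<gamma> j) / 2"
  have u_eq: "u = k *\<^sub>R \<gamma> j" using uk by (simp only: k_def)
  have "u \<bullet> u = 1" using u(1) by (simp add: norm_eq_sqrt_inner)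
  then have kk: "k * k = 1 / 2" unfolding u_eq using norm2[OF j] by simp
  have "y \<in> P" using y by (simp add: P_iff less_imp_le)
  then have "u \<bullet> y \<le> u \<bullet> x" using u(2) H[OF x(1)] by auto
  then have "k * (\<gamma> j \<bullet> y - \<beta> j) \<le> 0" using x unfolding u_eq by (simp add: right_diff_distrib)
  moreover have "\<gamma> j \<bullet> y - \<beta> j > 0" using y j by simp
  ultimately have "k \<le> 0" by (simp add: mult_le_0_iff)
  have "(- k)\<^sup>2 = (1 / sqrt 2)\<^sup>2" using kk by (simp add: power2_eq_square)
  then have "- k = 1 / sqrt 2" by (rule power2_eq_imp_eq) (use \<open>k \<le> 0\<close> in auto)
  then have "k = - (1 / sqrt 2)" by (rule minus_equation_iff[THEN iffD1, symmetric])
  then show "u = - (1 / sqrt 2) *\<^sub>R \<gamma> j" unfolding u_eq by (rule arg_cong)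
qed

lemma dihedral_angle_face:
  assumes "i \<in> J" "j \<in> J"
  shows "dihedral_angle P (face i) (face j) = pi - arccos ((\<gamma> i \<bullet> \<gamma> j) / 2)"
  unfolding dihedral_angle_def outer_normal_face[OF assms(1)] outer_normal_face[OF assms(2)]
  by (simp add: field_simps)

end

locale simply_laced_polyhedron = irredundant_polyhedron +
  assumes gram: "i \<in> J \<Longrightarrow> j \<in> J \<Longrightarrow> i \<noteq> j \<Longrightarrow> \<gamma> i \<bullet> \<gamma> j \<in> {0, - 1, - 2}"
begin

text \<open>For vectors of squared norm 2 the product -2 means opposite normals, hence parallel
  facets and a bold edge; the products 0 and -1 belong to the angles \<open>pi / 2\<close> and
  \<open>pi / 3\<close>.\<close>

lemma edge_mult_face:
  assumes ij: "i \<in> J" "j \<in> J" "i \<noteq> j"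
  shows "edge_mult (coxeter_diagram P) (face i) (face j)
    = (if \<gamma> i \<bullet> \<gamma> j = 0 then 0 else if \<gamma> i \<bullet> \<gamma> j = - 1 then 1 else \<infinity>)"
proof -
  have par: "affine_parallel (affine hull face i) (affine hull face j) \<longleftrightarrow> \<gamma> i \<bullet> \<gamma> j = - 2"
  proof
    assume "\<gamma> i \<bullet> \<gamma> j = - 2"
    then have "(\<gamma> i + \<gamma> j) \<bullet> (\<gamma> i + \<gamma> j) = 0"
      using norm2 ij by (simp add: inner_add_left inner_add_right inner_commute)
    then have "\<gamma> i + \<gamma> j = 0" by simp
    then have e: "\<gamma> j = - \<gamma> i" by (simp add: eq_neg_iff_add_eq_0 add.commute)
    show "affine_parallel (affine hull face i) (affine hull face j)"
      unfolding affine_parallel_def affine_hull_face[OF ij(1)] affine_hull_face[OF ij(2)]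
    proof (intro exI, rule affine_parallel_expl_aux)
      fix x
      have "\<gamma> i \<bullet> ((- ((\<beta> i + \<beta> j) / 2)) *\<^sub>R \<gamma> i + x) = - (\<beta> i + \<beta> j) + \<gamma> i \<bullet> x"
        unfolding inner_add_right inner_scaleR_right norm2[OF ij(1)] by (simp add: field_simps)
      then show "x \<in> {x. \<gamma> i \<bullet> x = \<beta> i} \<longleftrightarrow> (- ((\<beta> i + \<beta> j) / 2)) *\<^sub>R \<gamma> i + x \<in> {x. \<gamma> j \<bullet> x = \<beta> j}"
        unfolding e mem_Collect_eq inner_minus_left by auto
    qed
  next
    assume "affine_parallel (affine hull face i) (affine hull face j)"
    then obtain a where a: "{x. \<gamma> j \<bullet> x = \<beta> j} = (\<lambda>x. a + x) ` {x. \<gamma> i \<bullet> x = \<beta> i}"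
      unfolding affine_parallel_def affine_hull_face[OF ij(1)] affine_hull_face[OF ij(2)] by blast
    define x where "x = (\<beta> i / 2) *\<^sub>R \<gamma> i"
    have x: "\<gamma> i \<bullet> x = \<beta> i" using norm2[OF ij(1)] by (simp add: x_def)
    define w where "w = \<gamma> j - ((\<gamma> i \<bullet> \<gamma> j) / 2) *\<^sub>R \<gamma> i"
    have w: "\<gamma> i \<bullet> w = 0" using norm2[OF ij(1)] by (simp add: w_def inner_diff_right)
    have "a + x \<in> {x. \<gamma> j \<bullet> x = \<beta> j}" "a + (x + w) \<in> {x. \<gamma> j \<bullet> x = \<beta> j}"
      unfolding a using x w by (auto simp: inner_add_right)
    then have "\<gamma> j \<bullet> w = 0" by (simp add: inner_add_right)
    moreover have "w \<bullet> w = \<gamma> j \<bullet> w - ((\<gamma> i \<bullet> \<gamma> j) / 2) * (\<gamma> i \<bullet> w)"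
    unfolding inner_diff_left[symmetric] inner_scaleR_left[symmetric] w_def ..
  ultimately have "w \<bullet> w = 0" using w by simp
    then have e: "\<gamma> j = ((\<gamma> i \<bullet> \<gamma> j) / 2) *\<^sub>R \<gamma> i" by (simp add: w_def)
    have "\<gamma> j \<bullet> \<gamma> j = ((\<gamma> i \<bullet> \<gamma> j) / 2) * (\<gamma> i \<bullet> \<gamma> j)" by (subst e) simp
    then have "(\<gamma> i \<bullet> \<gamma> j) * (\<gamma> i \<bullet> \<gamma> j) = 4" using norm2[OF ij(2)] by simp
    then show "\<gamma> i \<bullet> \<gamma> j = - 2" using gram[OF ij] by auto
  qed
  have th: "(THE k. pi / real (m + 2) = pi / real (k + 2)) = m" for m :: nat
    by (rule the_equality) (auto simp: field_simps)
  have em: "edge_mult (coxeter_diagram P) (face i) (face j) =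
      (if \<gamma> i \<bullet> \<gamma> j = - 2 then \<infinity> else enat (THE k. pi - arccos ((\<gamma> i \<bullet> \<gamma> j) / 2) = pi / real (k + 2)))"
    by (simp add: coxeter_diagram_def par dihedral_angle_face[OF ij(1,2)])
  have a1: "pi - arccos (- (1 / 2)) = pi / real (1 + 2)"
  proof -
    have "arccos (- (1 / 2)) = 2 * pi / 3"
      using arccos_cos[of "2 * pi / 3"] by (simp add: cos_120)
    then show ?thesis by simp
  qed
  have a0: "pi - arccos 0 = pi / real (0 + 2)" by simp
  from gram[OF ij] consider "\<gamma> i \<bullet> \<gamma> j = 0" | "\<gamma> i \<bullet> \<gamma> j = - 1" | "\<gamma> i \<bullet> \<gamma> j = - 2" by auto
  then show ?thesis
  proof cases
    case 1
    then show ?thesis unfolding em using th[of 0] a0 by (simp add: zero_enat_def)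
  next
    case 2
    then show ?thesis unfolding em using th[of 1] a1 by (simp add: one_enat_def)
  next
    case 3
    then show ?thesis unfolding em by simp
  qed
qed

lemma coxeter_diagram_iso:
  "coxeter_diagram P \<simeq>\<^sub>D
     Diagram J (\<lambda>i j. if \<gamma> i \<bullet> \<gamma> j = 0 then 0 else if \<gamma> i \<bullet> \<gamma> j = - 1 then 1 else \<infinity>)"
proof -
  have nodes: "nodes (coxeter_diagram P) = face ` J" by (simp add: coxeter_diagram_def facets)
  have inv: "inv_into J face (face j) = j" if "j \<in> J" for j using face_inj that by simp
  show ?thesis
    unfolding diagram_iso_def nodes
  proof (intro exI conjI ballI impI)
    show "bij_betw (inv_into J face) (face ` J) (nodes (Diagram J
       (\<lambda>i j. if \<gamma> i \<bullet> \<gamma> j = 0 then 0 else if \<gamma> i \<bullet> \<gamma> j = - 1 then 1 else \<infinity>)))"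
      using face_inj by (simp add: inj_on_imp_bij_betw bij_betw_inv_into)
    fix v w assume "v \<in> face ` J" "w \<in> face ` J" "v \<noteq> w"
    then obtain i j where "i \<in> J" "j \<in> J" "i \<noteq> j" "v = face i" "w = face j" by blast
    then show "edge_mult (Diagram J
         (\<lambda>i j. if \<gamma> i \<bullet> \<gamma> j = 0 then 0 else if \<gamma> i \<bullet> \<gamma> j = - 1 then 1 else \<infinity>))
        (inv_into J face v) (inv_into J face w) = edge_mult (coxeter_diagram P) v w"
      by (simp add: inv edge_mult_face)
  qed
qed

end

lemma diagram_iso_trans:
  assumes "D \<simeq>\<^sub>D E" "E \<simeq>\<^sub>D H" shows "D \<simeq>\<^sub>D H"
proof -
  obtain f where f: "bij_betw f (nodes D) (nodes E)"
    "\<forall>v\<in>nodes D. \<forall>w\<in>nodes D. v \<noteq> w \<longrightarrow> edge_mult E (f v) (f w) = edge_mult D v w"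
    using assms(1) unfolding diagram_iso_def by blast
  obtain g where g: "bij_betw g (nodes E) (nodes H)"
    "\<forall>v\<in>nodes E. \<forall>w\<in>nodes E. v \<noteq> w \<longrightarrow> edge_mult H (g v) (g w) = edge_mult E v w"
    using assms(2) unfolding diagram_iso_def by blast
  have fE: "f v \<in> nodes E" if "v \<in> nodes D" for v using f(1) that by (auto simp: bij_betw_def)
  have fne: "f v \<noteq> f w" if "v \<in> nodes D" "w \<in> nodes D" "v \<noteq> w" for v w
    using f(1) that by (auto simp: bij_betw_def inj_on_def)
  show ?thesis
    unfolding diagram_iso_def
  proof (intro exI[of _ "g \<circ> f"] conjI ballI impI)
    show "bij_betw (g \<circ> f) (nodes D) (nodes H)" using f(1) g(1) by (rule bij_betw_trans)
    show "edge_mult H ((g \<circ> f) v) ((g \<circ> f) w) = edge_mult D v w"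
      if "v \<in> nodes D" "w \<in> nodes D" "v \<noteq> w" for v w
      using f(2) g(2) fE[OF that(1)] fE[OF that(2)] fne[OF that] that by simp
  qed
qed

section \<open>The inward normals of a simplex\<close>

lemma equal_hyperplanes_reflection:
  fixes a a' :: "'a::euclidean_space"
  assumes eq: "{x. a \<bullet> x = b} = {x. a' \<bullet> x = b'}" and "a \<noteq> 0" "a' \<noteq> 0"
  shows "\<rho> a' b' = \<rho> a b"
proof -
  have aa: "a \<bullet> a \<noteq> 0" using assms by simp
  define x where "x = (b / (a \<bullet> a)) *\<^sub>R a"
  define k where "k = (a \<bullet> a') / (a \<bullet> a)"
  define w where "w = a' - k *\<^sub>R a"
  have x: "a \<bullet> x = b" using aa by (simp add: x_def)
  have w: "a \<bullet> w = 0" using aa by (simp add: w_def k_def inner_diff_right)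
  have "x \<in> {x. a \<bullet> x = b}" "x + w \<in> {x. a \<bullet> x = b}" using x w by (auto simp: inner_add_right)
  then have a'x: "a' \<bullet> x = b'" "a' \<bullet> (x + w) = b'" unfolding eq by auto
  then have "a' \<bullet> w = 0" by (simp add: inner_add_right)
  moreover have "w \<bullet> w = a' \<bullet> w - k * (a \<bullet> w)"
    unfolding inner_diff_left[symmetric] inner_scaleR_left[symmetric] w_def ..
  ultimately have "w \<bullet> w = 0" using w by simp
  then have a': "a' = k *\<^sub>R a" by (simp add: w_def)
  then have "k \<noteq> 0" using assms by auto
  moreover have "b' = k * b" using a'x(1) x unfolding a' by simp
  ultimately show ?thesis unfolding a' using hyperplane_reflection_cong[OF \<open>a \<noteq> 0\<close>] by simp
qed

text \<open>Facets are indexed by the opposite vertices. The normal of a facet has squared norm 2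
  and points to the opposite vertex \<open>v\<close>; the weight is
  \<open>1 / (\<alpha> v \<bullet> v - b v)\<close>, a multiple of the reciprocal height, which
  turns wall values into barycentric coordinates.\<close>

lemma simplex_inward_normals:
  fixes F :: "'a::euclidean_space set"
  assumes "int DIM('a) simplex F"
  obtains K :: "'a set" and \<alpha> b c where
    "simplex_data K \<alpha> b c" "\<And>v. v \<in> K \<Longrightarrow> \<alpha> v \<bullet> \<alpha> v = 2"
    "F = {x. \<forall>v\<in>K. \<alpha> v \<bullet> x \<ge> b v}" "card K = DIM('a) + 1"
proof -
  obtain K where K: "\<not> affine_dependent K" "int (card K) = int DIM('a) + 1" "F = convex hull K"
    using assms unfolding simplex_def by blast
  have finK: "finite K" using K(1) by (rule aff_independent_finite)
  have cardK: "card K = DIM('a) + 1" using K(2) by linarith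
  have full: "affine hull K = UNIV"
    using affine_independent_span_eq[OF K(1)] cardK by simp
  have "\<exists>a b. a \<bullet> a = 2 \<and> a \<bullet> v > b \<and> (\<forall>w\<in>K - {v}. a \<bullet> w = b)" if v: "v \<in> K" for v
  proof -
    have "\<not> affine_dependent (K - {v})" using K(1) affine_independent_Diff by blast
    then have "aff_dim (K - {v}) = int (card (K - {v})) - 1" using affine_independent_iff_card by blast
    then have "aff_dim (K - {v}) = DIM('a) - 1" using v finK cardK by simp
    then obtain a b where a: "a \<noteq> 0" "affine hull (K - {v}) = {x. a \<bullet> x = b}"
      using aff_dim_eq_hyperplane by blast
    have "v \<notin> affine hull (K - {v})" using K(1) v unfolding affine_dependent_def by blast
    then have av: "a \<bullet> v \<noteq> b" using a(2) by simp
    have aw: "\<forall>w\<in>K - {v}. a \<bullet> w = b" using a(2) hull_subset[of "K - {v}" affine] by blast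
    define k where "k = sgn (a \<bullet> v - b) * sqrt 2 / norm a"
    have k2: "k * k * (a \<bullet> a) = 2"
    proof -
      have "sgn (a \<bullet> v - b) * sgn (a \<bullet> v - b) = 1" using av by (simp add: sgn_real_def)
      then have "k * k = 2 / (norm a * norm a)" unfolding k_def by (simp add: field_simps)
      then show ?thesis using a(1) by (simp add: dot_square_norm power2_eq_square)
    qed
    have "k * (a \<bullet> v - b) > 0"
    proof -
      have "sgn y * sqrt 2 / norm a * y = \<bar>y\<bar> * (sqrt 2 / norm a)" for y
        by (simp add: abs_sgn mult.commute)
      then have "k * (a \<bullet> v - b) = \<bar>a \<bullet> v - b\<bar> * (sqrt 2 / norm a)" unfolding k_def .
      then show ?thesis using av a(1) by simp
    qed
    then show ?thesis using k2 aw
      by (intro exI[of _ "k *\<^sub>R a"] exI[of _ "k * b"]) (auto simp: right_diff_distrib mult.assoc)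
  qed
  then obtain \<alpha> b where \<alpha>: "\<And>v. v \<in> K \<Longrightarrow> \<alpha> v \<bullet> \<alpha> v = 2" "\<And>v. v \<in> K \<Longrightarrow> \<alpha> v \<bullet> v > b v"
    "\<And>v w. v \<in> K \<Longrightarrow> w \<in> K - {v} \<Longrightarrow> \<alpha> v \<bullet> w = b v"
    by metis
  define c where "c v = 1 / (\<alpha> v \<bullet> v - b v)" for v
  have cpos: "c v > 0" if "v \<in> K" for v using \<alpha>(2)[OF that] by (simp add: c_def)
  have coord: "\<alpha> v \<bullet> (\<Sum>w\<in>K. t w *\<^sub>R w) - b v = t v / c v" if v: "v \<in> K" and t: "sum t K = 1" for v t
  proof -
    have "\<alpha> v \<bullet> (\<Sum>w\<in>K. t w *\<^sub>R w) - b v = (\<Sum>w\<in>K. t w * (\<alpha> v \<bullet> w)) - sum t K * b v"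
      using t by (simp add: inner_sum_right)
    also have "\<dots> = (\<Sum>w\<in>K. t w * (\<alpha> v \<bullet> w - b v))"
      by (simp add: sum_distrib_right sum_subtractf right_diff_distrib)
    also have "\<dots> = (\<Sum>w\<in>K. if w = v then t v / c v else 0)"
      by (rule sum.cong) (use \<alpha>(3)[OF v] in \<open>auto simp: c_def\<close>)
    also have "\<dots> = t v / c v" using v finK by simp
    finally show ?thesis .
  qed
  have repr: "\<exists>t. sum t K = 1 \<and> x = (\<Sum>w\<in>K. t w *\<^sub>R w)" for x
  proof -
    have "x \<in> affine hull K" using full by simp
    then show ?thesis unfolding affine_hull_finite[OF finK] by auto
  qed
  have ct: "c v * (t / c v) = t" if "v \<in> K" for v t using cpos[OF that] by simp
  have data: "simplex_data K \<alpha> b c"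
  proof
    show "finite K" by (rule finK)
    show "\<alpha> v \<noteq> 0" if "v \<in> K" for v using \<alpha>(1)[OF that] by auto
    show "c v > 0" if "v \<in> K" for v using cpos[OF that] .
    show "(\<Sum>v\<in>K. c v * (\<alpha> v \<bullet> x - b v)) = 1" for x
    proof -
      obtain t where t: "sum t K = 1" "x = (\<Sum>w\<in>K. t w *\<^sub>R w)" using repr by blast
      have "(\<Sum>v\<in>K. c v * (\<alpha> v \<bullet> x - b v)) = sum t K"
        by (rule sum.cong) (use coord[OF _ t(1)] ct in \<open>simp_all add: t(2)\<close>)
      then show ?thesis using t(1) by simp
    qed
    show "\<exists>x. \<forall>v\<in>K. \<alpha> v \<bullet> x - b v = y v" if y: "(\<Sum>v\<in>K. c v * y v) = 1" for y
    proof (intro exI ballI)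
      fix v assume v: "v \<in> K"
      show "\<alpha> v \<bullet> (\<Sum>w\<in>K. (c w * y w) *\<^sub>R w) - b v = y v"
        using coord[OF v y] cpos[OF v] by simp
    qed
    show "x = 0" if "\<And>v. v \<in> K \<Longrightarrow> \<alpha> v \<bullet> x = 0" for x
    proof -
      obtain s where s: "sum s K = 1" "x = (\<Sum>w\<in>K. s w *\<^sub>R w)" using repr by blast
      obtain t where t: "sum t K = 1" "0 = (\<Sum>w\<in>K. t w *\<^sub>R w)" using repr by blast
      have "s v = t v" if v: "v \<in> K" for v
      proof -
        have "\<alpha> v \<bullet> x - b v = s v / c v" using coord[OF v s(1)] by (simp add: s(2))
        moreover have "\<alpha> v \<bullet> 0 - b v = t v / c v" using coord[OF v t(1)] by (simp only: t(2)[symmetric])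
        ultimately show ?thesis using \<open>\<And>v. v \<in> K \<Longrightarrow> \<alpha> v \<bullet> x = 0\<close>[OF v] cpos[OF v] by simp
      qed
      then have "(\<Sum>w\<in>K. s w *\<^sub>R w) = (\<Sum>w\<in>K. t w *\<^sub>R w)" by (intro sum.cong) auto
      then show ?thesis using s(2) t(2) by simp
    qed
  qed
  have "F = {x. \<forall>v\<in>K. \<alpha> v \<bullet> x \<ge> b v}"
  proof
    show "F \<subseteq> {x. \<forall>v\<in>K. \<alpha> v \<bullet> x \<ge> b v}"
    proof
      fix x assume "x \<in> F"
      then obtain t where t: "\<forall>w\<in>K. t w \<ge> 0" "sum t K = 1" "x = (\<Sum>w\<in>K. t w *\<^sub>R w)"
        unfolding K(3) convex_hull_finite[OF finK] by auto
      have "\<alpha> v \<bullet> x - b v \<ge> 0" if v: "v \<in> K" for v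
        using coord[OF v t(2)] t(1) v cpos[OF v] by (simp add: t(3))
      then show "x \<in> {x. \<forall>v\<in>K. \<alpha> v \<bullet> x \<ge> b v}" by simp
    qed
    show "{x. \<forall>v\<in>K. \<alpha> v \<bullet> x \<ge> b v} \<subseteq> F"
    proof
      fix x assume x: "x \<in> {x. \<forall>v\<in>K. \<alpha> v \<bullet> x \<ge> b v}"
      obtain t where t: "sum t K = 1" "x = (\<Sum>w\<in>K. t w *\<^sub>R w)" using repr by blast
      have "t v \<ge> 0" if v: "v \<in> K" for v
      proof -
        have "\<alpha> v \<bullet> x - b v \<ge> 0" using x v by simp
        then have "t v / c v \<ge> 0" using coord[OF v t(1)] by (simp add: t(2)[symmetric])
        then show ?thesis using cpos[OF v] by (simp add: zero_le_divide_iff)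
      qed
      then show "x \<in> F" unfolding K(3) convex_hull_finite[OF finK] using t by auto
    qed
  qed
  then show ?thesis using that data \<alpha>(1) cardK by blast
qed

lemma (in simplex_data) irredundant_polyhedron:
  assumes norm2: "\<And>i. i \<in> I \<Longrightarrow> \<alpha> i \<bullet> \<alpha> i = 2" and card: "card I \<ge> 2"
  shows "irredundant_polyhedron I \<alpha> b {x. \<forall>i\<in>I. \<alpha> i \<bullet> x \<ge> b i}"
proof
  show "finite I" by (rule finite_I)
  have ne: "I - {j} \<noteq> {}" for j
  proof
    assume "I - {j} = {}"
    then have "I \<subseteq> {j}" by blast
    then have "card I \<le> card {j}" by (intro card_mono) auto
    then show False using card by simp
  qed
  have sum_pos: "sum c (I - {j}) > 0" for j
    using finite_I ne weight_pos by (intro sum_pos) auto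
  show "\<exists>x. \<forall>j\<in>I. \<alpha> j \<bullet> x > b j"
  proof -
    have "I \<noteq> {}" using ne by blast
    then have s: "sum c I > 0" using finite_I weight_pos by (intro Groups_Big.sum_pos) auto
    have "(\<Sum>i\<in>I. c i * (1 / sum c I)) = 1" using s by (simp add: sum_divide_distrib[symmetric])
    then obtain x where x: "\<forall>i\<in>I. \<alpha> i \<bullet> x - b i = 1 / sum c I" using barycentric_point[of "\<lambda>_. 1 / sum c I"] by blast
    have "\<alpha> j \<bullet> x > b j" if "j \<in> I" for j
    proof -
      have "\<alpha> j \<bullet> x - b j > 0" using x s that by simp
      then show ?thesis by simp
    qed
    then show ?thesis by blast
  qed
  show "\<exists>x. \<alpha> j \<bullet> x < b j \<and> (\<forall>i\<in>I - {j}. \<alpha> i \<bullet> x > b i)" if j: "j \<in> I" for j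
  proof -
    \<comment> \<open>Value -1 on the wall \<open>j\<close> and one common value on all others,
      chosen to make the weighted sum 1.\<close>
    define y where "y i = (if i = j then - 1 else (1 + c j) / sum c (I - {j}))" for i
    have "(\<Sum>i\<in>I. c i * y i) = c j * y j + (\<Sum>i\<in>I - {j}. c i * y i)"
      using finite_I j by (rule sum.remove)
    also have "(\<Sum>i\<in>I - {j}. c i * y i) = (\<Sum>i\<in>I - {j}. c i * ((1 + c j) / sum c (I - {j})))"
      by (rule sum.cong) (auto simp: y_def)
    also have "\<dots> = sum c (I - {j}) * ((1 + c j) / sum c (I - {j}))" by (rule sum_distrib_right[symmetric])
    also have "\<dots> = 1 + c j" using sum_pos[of j] by simp
    finally have "(\<Sum>i\<in>I. c i * y i) = 1" by (simp add: y_def)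
    then obtain x where x: "\<forall>i\<in>I. \<alpha> i \<bullet> x - b i = y i" using barycentric_point by blast
    have "\<alpha> j \<bullet> x < b j" using bspec[OF x j] by (simp add: y_def)
    moreover have "\<alpha> i \<bullet> x > b i" if "i \<in> I - {j}" for i
    proof -
      have "y i > 0" using that sum_pos[of j] weight_pos[OF j] by (simp add: y_def)
      moreover have "\<alpha> i \<bullet> x - b i = y i" using x that by blast
      ultimately show ?thesis by linarith
    qed
    ultimately show ?thesis by blast
  qed
qed (use norm2 in auto)

lemma (in irredundant_polyhedron) facet_reflection_group_eq:
  "facet_reflection_group P = gen ((\<lambda>j. \<rho> (\<gamma> j) (\<beta> j)) ` J)"
proof -
  have nz: "\<gamma> j \<noteq> 0" if "j \<in> J" for j using norm2[OF that] by auto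
  have "{\<rho> a b | a b. a \<noteq> 0 \<and> (\<exists>f. f facet_of P \<and> affine hull f = {x. a \<bullet> x = b})}
      = (\<lambda>j. \<rho> (\<gamma> j) (\<beta> j)) ` J"
  proof
    show "(\<lambda>j. \<rho> (\<gamma> j) (\<beta> j)) ` J \<subseteq>
      {\<rho> a b | a b. a \<noteq> 0 \<and> (\<exists>f. f facet_of P \<and> affine hull f = {x. a \<bullet> x = b})}"
    proof
      fix s assume "s \<in> (\<lambda>j. \<rho> (\<gamma> j) (\<beta> j)) ` J"
      then obtain j where j: "j \<in> J" "s = \<rho> (\<gamma> j) (\<beta> j)" by blast
      have "face j facet_of P" using facets j(1) by blast
      then show "s \<in> {\<rho> a b | a b. a \<noteq> 0 \<and>
          (\<exists>f. f facet_of P \<and> affine hull f = {x. a \<bullet> x = b})}"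
        using nz[OF j(1)] affine_hull_face[OF j(1)] j(2) by blast
    qed
    show "{\<rho> a b | a b. a \<noteq> 0 \<and> (\<exists>f. f facet_of P \<and> affine hull f = {x. a \<bullet> x = b})}
      \<subseteq> (\<lambda>j. \<rho> (\<gamma> j) (\<beta> j)) ` J"
    proof clarify
      fix a b f assume a: "a \<noteq> 0" "f facet_of P" "affine hull f = {x. a \<bullet> x = b}"
      obtain j where j: "j \<in> J" "f = face j" using facets a(2) by blast
      have "\<rho> a b = \<rho> (\<gamma> j) (\<beta> j)"
        by (rule equal_hyperplanes_reflection) (use a affine_hull_face j nz in auto)
      then show "\<rho> a b \<in> (\<lambda>j. \<rho> (\<gamma> j) (\<beta> j)) ` J" using j(1) by blast
    qed
  qed
  then show ?thesis by (simp add: facet_reflection_group_def)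
qed

text \<open>The two facets of a segment do not meet; there the product comes from the weight
  relation, which makes the normals opposite. In higher dimension there is a third facet, and the
  vertex opposite to it lies on both \<open>face i\<close> and \<open>face j\<close>, so that the
  angle condition applies to them.\<close>

lemma (in simplex_data) coxeter_simplex_gram:
  assumes norm2: "\<And>i. i \<in> I \<Longrightarrow> \<alpha> i \<bullet> \<alpha> i = 2" and card: "card I = DIM('a) + 1"
    and cox: "euclidean_coxeter_simplex {x. \<forall>i\<in>I. \<alpha> i \<bullet> x \<ge> b i}"
    and ij: "i \<in> I" "j \<in> I" "i \<noteq> j"
  shows "if card I = 2 then \<alpha> i \<bullet> \<alpha> j = - 2 else (\<exists>m::nat\<ge>2. \<alpha> i \<bullet> \<alpha> j = - 2 * cos (pi / m))"
proof -
  have c2: "card I \<ge> 2" using card DIM_positive[where 'a = 'a] by linarith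
  interpret irredundant_polyhedron I \<alpha> b "{x. \<forall>i\<in>I. \<alpha> i \<bullet> x \<ge> b i}"
    by (rule irredundant_polyhedron[OF norm2 c2])
  show ?thesis
  proof (cases "card I = 2")
    case True
    have "{i, j} = I" using ij True finite_I by (intro card_subset_eq) auto
    then have "c i *\<^sub>R \<alpha> i + c j *\<^sub>R \<alpha> j = 0" using weighted_sum_zero ij by auto
    then have e: "c i *\<^sub>R \<alpha> i = - (c j *\<^sub>R \<alpha> j)" by (simp add: eq_neg_iff_add_eq_0)
    then have "(c i *\<^sub>R \<alpha> i) \<bullet> (c i *\<^sub>R \<alpha> i) = (c j *\<^sub>R \<alpha> j) \<bullet> (c j *\<^sub>R \<alpha> j)" by simp
    then have "(c i)\<^sup>2 = (c j)\<^sup>2" using norm2 ij by (simp add: power2_eq_square)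
    then have "c i = c j" using weight_pos ij by (simp add: less_imp_le)
    then have "c i *\<^sub>R \<alpha> i = c i *\<^sub>R (- \<alpha> j)" using e by simp
    then have "\<alpha> i = - \<alpha> j" using weight_pos[OF ij(1)] by (metis less_irrefl scaleR_left_imp_eq)
    then show ?thesis using True norm2[OF ij(2)] by simp
  next
    case False
    have "\<exists>k. k \<in> I \<and> k \<noteq> i \<and> k \<noteq> j"
    proof (rule ccontr)
      assume "\<not> ?thesis"
      then have "I \<subseteq> {i, j}" by blast
      then have "card I \<le> card {i, j}" by (intro card_mono) auto
      then show False using False c2 ij by simp
    qed
    then obtain k where k: "k \<in> I" "k \<noteq> i" "k \<noteq> j" by blast
    obtain x where x: "\<alpha> k \<bullet> x - b k = 1 / c k" "\<forall>i\<in>I - {k}. \<alpha> i \<bullet> x - b i = 0"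
      using vertex[OF k(1)] by blast
    have "\<alpha> l \<bullet> x \<ge> b l" if "l \<in> I" for l
    proof (cases "l = k")
      case True
      moreover have "1 / c k > 0" using weight_pos[OF k(1)] by simp
      ultimately show ?thesis using x(1) unfolding True by linarith
    qed (use x that in auto)
    then have "x \<in> face i \<inter> face j" using x k ij by (simp add: face_def)
    moreover have "face i facet_of {x. \<forall>i\<in>I. \<alpha> i \<bullet> x \<ge> b i}" "face j facet_of {x. \<forall>i\<in>I. \<alpha> i \<bullet> x \<ge> b i}"
      using facets ij by blast+
    moreover have "face i \<noteq> face j" using face_inj ij by (auto simp: inj_on_def)
    ultimately obtain m :: nat where m: "m \<ge> 2" "dihedral_angle {x. \<forall>i\<in>I. \<alpha> i \<bullet> x \<ge> b i} (face i) (face j) = pi / m"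
      using cox unfolding euclidean_coxeter_simplex_def by blast
    have bd: "\<bar>(\<alpha> i \<bullet> \<alpha> j) / 2\<bar> \<le> 1"
      using Cauchy_Schwarz_ineq2[of "\<alpha> i" "\<alpha> j"] norm2 ij by (simp add: norm_eq_sqrt_inner)
    have "arccos ((\<alpha> i \<bullet> \<alpha> j) / 2) = pi - pi / m"
      using m(2) unfolding dihedral_angle_face[OF ij(1,2)] by linarith
    then have "cos (arccos ((\<alpha> i \<bullet> \<alpha> j) / 2)) = - cos (pi / m)" by simp
    then have "\<alpha> i \<bullet> \<alpha> j = - 2 * cos (pi / m)" using bd by (simp add: cos_arccos_abs)
    then show ?thesis using m(1) False by auto
  qed
qed

section \<open>Simply laced affine root systems\<close>

text \<open>Split an integral combination into its positive and negative part: if both were non-zero,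
  evenness of the form would give them norm at least 2 each.\<close>

lemma sign_coherent:
  fixes \<gamma> :: "'i \<Rightarrow> 'a::euclidean_space" and z :: "'i \<Rightarrow> int"
  assumes fin: "finite J"
    and off: "\<And>i j. i \<in> J \<Longrightarrow> j \<in> J \<Longrightarrow> i \<noteq> j \<Longrightarrow> \<gamma> i \<bullet> \<gamma> j \<le> 0"
    and even: "\<And>y :: 'i \<Rightarrow> int. \<exists>n::int. (\<Sum>j\<in>J. of_int (y j) *\<^sub>R \<gamma> j) \<bullet> (\<Sum>j\<in>J. of_int (y j) *\<^sub>R \<gamma> j) = 2 * of_int n"
    and rad: "\<And>y :: 'i \<Rightarrow> int. (\<And>j. j \<in> J \<Longrightarrow> y j \<ge> 0) \<Longrightarrow> (\<Sum>j\<in>J. of_int (y j) *\<^sub>R \<gamma> j) = 0 \<Longrightarrow>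
       (\<forall>j\<in>J. y j = 0) \<or> (\<forall>j\<in>J. y j > 0)"
    and z: "(\<Sum>j\<in>J. of_int (z j) *\<^sub>R \<gamma> j) \<bullet> (\<Sum>j\<in>J. of_int (z j) *\<^sub>R \<gamma> j) = 2"
  shows "(\<forall>j\<in>J. z j \<ge> 0) \<or> (\<forall>j\<in>J. z j \<le> 0)"
proof -
  define vec where "vec y = (\<Sum>j\<in>J. real_of_int (y j) *\<^sub>R \<gamma> j)" for y :: "'i \<Rightarrow> int"
  define p n where "p j = max (z j) 0" and "n j = max (- z j) 0" for j
  have vz: "vec z = vec p - vec n"
  proof -
    have "vec z = (\<Sum>j\<in>J. real_of_int (p j - n j) *\<^sub>R \<gamma> j)"
      unfolding vec_def by (rule sum.cong) (auto simp: p_def n_def max_def)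
    then show ?thesis by (simp add: vec_def scaleR_diff_left sum_subtractf)
  qed
  have pn: "vec p \<bullet> vec n \<le> 0"
  proof -
    have "vec p \<bullet> vec n = (\<Sum>j\<in>J. \<Sum>i\<in>J. real_of_int (p i * n j) * (\<gamma> i \<bullet> \<gamma> j))"
      unfolding vec_def by (simp add: inner_sum_left inner_sum_right sum_distrib_left mult.assoc mult.left_commute)
    also have "\<dots> \<le> 0"
    proof (intro sum_nonpos)
      fix j i assume ij: "j \<in> J" "i \<in> J"
      show "real_of_int (p i * n j) * (\<gamma> i \<bullet> \<gamma> j) \<le> 0"
      proof (cases "i = j")
        case True
        then have "p i * n j = 0" by (simp add: p_def n_def max_def)
        then show ?thesis by (simp only: of_int_0 mult_zero_left order_refl)
      next
        case False
        have "p i * n j \<ge> 0" by (simp add: p_def n_def)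
        then show ?thesis using off[OF ij(2,1) False] by (simp add: mult_nonneg_nonpos del: of_int_mult)
      qed
    qed
    finally show ?thesis .
  qed
  have two: "vec p \<bullet> vec p + vec n \<bullet> vec n \<le> 2"
    using z pn unfolding vec_def[symmetric] vz by (simp add: inner_diff_left inner_diff_right inner_commute)
  obtain k l :: int where k: "vec p \<bullet> vec p = 2 * of_int k" and l: "vec n \<bullet> vec n = 2 * of_int l"
    using even[of p] even[of n] unfolding vec_def by blast
  have "k \<ge> 0" "l \<ge> 0" using k l inner_ge_zero[of "vec p"] inner_ge_zero[of "vec n"] by auto
  moreover have "k + l \<le> 1" using two k l by linarith
  ultimately have "k = 0 \<or> l = 0" by linarith
  then have "vec p = 0 \<or> vec n = 0" using k l by auto
  \<comment> \<open>By \<open>rad\<close> a part that vanishes has all coefficients zero or all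
    positive; in the latter case all \<open>z j\<close> have the same strict sign.\<close>
  then consider "\<forall>j\<in>J. p j = 0" | "\<forall>j\<in>J. p j > 0" | "\<forall>j\<in>J. n j = 0" | "\<forall>j\<in>J. n j > 0"
    using rad[of p] rad[of n] unfolding vec_def p_def n_def by fastforce
  then show ?thesis
    by cases (auto simp: p_def n_def max_def split: if_splits)
qed

lemma span_image_sum:
  assumes "finite A" "v \<in> span (f ` A)"
  shows "\<exists>t. v = (\<Sum>i\<in>A. t i *\<^sub>R f i)"
proof -
  let ?S = "{v. \<exists>t. v = (\<Sum>i\<in>A. t i *\<^sub>R f i)}"
  have "subspace ?S"
  proof (rule subspaceI)
    show "0 \<in> ?S" by (intro CollectI exI[of _ "\<lambda>_. 0"]) simp
    show "x + y \<in> ?S" if "x \<in> ?S" "y \<in> ?S" for x y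
    proof -
      from that obtain t u where "x = (\<Sum>i\<in>A. t i *\<^sub>R f i)" "y = (\<Sum>i\<in>A. u i *\<^sub>R f i)" by blast
      then have "x + y = (\<Sum>i\<in>A. (t i + u i) *\<^sub>R f i)" by (simp add: scaleR_add_left sum.distrib)
      then show ?thesis by (intro CollectI exI[of _ "\<lambda>i. t i + u i"])
    qed
    show "k *\<^sub>R x \<in> ?S" if "x \<in> ?S" for k x
    proof -
      from that obtain t where "x = (\<Sum>i\<in>A. t i *\<^sub>R f i)" by blast
      then have "k *\<^sub>R x = (\<Sum>i\<in>A. (k * t i) *\<^sub>R f i)" by (simp add: scaleR_sum_right)
      then show ?thesis by (intro CollectI exI[of _ "\<lambda>i. k * t i"])
    qed
  qed
  moreover have "f ` A \<subseteq> ?S"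
  proof
    fix x assume "x \<in> f ` A"
    then obtain j where j: "j \<in> A" "x = f j" by blast
    have "(\<Sum>i\<in>A. (if i = j then 1 else 0) *\<^sub>R f i) = (\<Sum>i\<in>A. if i = j then f j else 0)"
      by (rule sum.cong) auto
    then have "x = (\<Sum>i\<in>A. (if i = j then 1 else 0) *\<^sub>R f i)" using j assms(1) by simp
    then show "x \<in> ?S" by (intro CollectI exI[of _ "\<lambda>i. if i = j then 1 else 0"])
  qed
  ultimately have "span (f ` A) \<subseteq> ?S" by (simp add: span_minimal)
  then show ?thesis using assms(2) by blast
qed

lemma (in cartan_simplex) coroot_lattice_sum:
  "(\<And>x. x \<in> A \<Longrightarrow> f x \<in> coroot_lattice) \<Longrightarrow> (\<Sum>x\<in>A. f x) \<in> coroot_lattice"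
  by (induction A rule: infinite_finite_induct) (simp_all add: coroot_lattice_zero coroot_lattice_add)

locale affine_simply_laced = simplex_data I \<alpha> b c
  for I :: "'i set" and \<alpha> :: "'i \<Rightarrow> 'a::euclidean_space" and b c +
  fixes m :: "'i \<Rightarrow> nat" and d :: real and p :: 'i
  assumes norm2: "i \<in> I \<Longrightarrow> \<alpha> i \<bullet> \<alpha> i = 2"
    and gram: "i \<in> I \<Longrightarrow> j \<in> I \<Longrightarrow> i \<noteq> j \<Longrightarrow> \<alpha> i \<bullet> \<alpha> j \<in> {0, - 1, - 2}"
    and d_pos: "d > 0" and weight_eq: "i \<in> I \<Longrightarrow> c i = real (m i) / d"
    and p_in: "p \<in> I" and mark_p: "m p = 1"
    and neighbour: "i \<in> I \<Longrightarrow> m i \<ge> 2 \<Longrightarrow> \<exists>j\<in>I. \<alpha> j \<bullet> \<alpha> i = - 1"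

sublocale affine_simply_laced \<subseteq> cartan_simplex
proof
  show "2 * (\<alpha> i \<bullet> \<alpha> j) / (\<alpha> j \<bullet> \<alpha> j) \<in> \<int>" if "i \<in> I" "j \<in> I" for i j
    using gram[OF that] norm2[OF that(1)] norm2[OF that(2)] by (cases "i = j") auto
qed

context affine_simply_laced
begin

section \<open>Affine roots as integral coefficient vectors\<close>

lemma mark_pos: "i \<in> I \<Longrightarrow> m i \<ge> 1"
  using weight_pos weight_eq d_pos by (metis One_nat_def Suc_leI div_0 gr0I less_irrefl of_nat_0)

lemma coroot_eq: "i \<in> I \<Longrightarrow> coroot i = \<alpha> i"
  by (simp add: coroot_def norm2)

lemma inner_integer: "i \<in> I \<Longrightarrow> j \<in> I \<Longrightarrow> \<alpha> i \<bullet> \<alpha> j \<in> \<int>"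
  using gram[of i j] norm2[of i] by (cases "i = j") auto

text \<open>An affine root is encoded by its coefficients \<open>z\<close> over the simple ones:
  \<open>val z\<close> is the affine function, \<open>vec z\<close> its gradient and
  \<open>off z\<close> its offset. The coefficients \<open>m\<close> belong to the constant function
  \<open>d\<close>, so adding a multiple of \<open>m\<close> to \<open>z\<close> moves the wall
  parallel to itself.\<close>

definition vec :: "('i \<Rightarrow> int) \<Rightarrow> 'a" where
  "vec z = (\<Sum>i\<in>I. real_of_int (z i) *\<^sub>R \<alpha> i)"

definition off :: "('i \<Rightarrow> int) \<Rightarrow> real" where
  "off z = (\<Sum>i\<in>I. real_of_int (z i) * b i)"

definition val :: "('i \<Rightarrow> int) \<Rightarrow> 'a \<Rightarrow> real" where
  "val z x = (\<Sum>i\<in>I. real_of_int (z i) * (\<alpha> i \<bullet> x - b i))"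

lemma val_eq: "val z x = vec z \<bullet> x - off z"
  by (simp add: val_def vec_def off_def inner_sum_left right_diff_distrib sum_subtractf)

lemma lattice_eq: "coroot_lattice = range vec"
proof -
  have "(\<Sum>i\<in>I. real_of_int (z i) *\<^sub>R coroot i) = vec z" for z
    unfolding vec_def by (rule sum.cong) (auto simp: coroot_eq)
  then show ?thesis by (auto simp: coroot_lattice_def)
qed

lemma marks_sum: "(\<Sum>i\<in>I. real (m i) * (\<alpha> i \<bullet> x - b i)) = d"
proof -
  have "(\<Sum>i\<in>I. real (m i) * (\<alpha> i \<bullet> x - b i)) = d * (\<Sum>i\<in>I. c i * (\<alpha> i \<bullet> x - b i))"
    unfolding sum_distrib_left by (rule sum.cong) (use weight_eq d_pos in auto)
  then show ?thesis using barycentric_sum by simp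
qed

lemma marks_sum_vec: "(\<Sum>i\<in>I. real (m i) *\<^sub>R \<alpha> i) = 0"
proof -
  have "(\<Sum>i\<in>I. real (m i) *\<^sub>R \<alpha> i) = d *\<^sub>R (\<Sum>i\<in>I. c i *\<^sub>R \<alpha> i)"
    unfolding scaleR_sum_right by (rule sum.cong) (use weight_eq d_pos in auto)
  then show ?thesis using weighted_sum_zero by simp
qed

lemma relation_marks:
  assumes t: "(\<Sum>i\<in>I. t i *\<^sub>R \<alpha> i) = 0" and i: "i \<in> I"
  shows "t i = t p * real (m i)"
proof -
  have "t i / c i = t p / c p" by (rule affine_relation_trivial[OF t p_in i])
  then show ?thesis
    using weight_eq[OF i] weight_eq[OF p_in] mark_p d_pos mark_pos[OF i] by (simp add: field_simps)
qed

lemma values_exist: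
  assumes "(\<Sum>i\<in>I. real (m i) * y i) = d"
  shows "\<exists>x. \<forall>i\<in>I. \<alpha> i \<bullet> x - b i = y i"
proof -
  have "(\<Sum>i\<in>I. c i * y i) = (\<Sum>i\<in>I. real (m i) * y i) / d"
    unfolding sum_divide_distrib by (rule sum.cong) (use weight_eq in auto)
  then show ?thesis using assms d_pos by (intro barycentric_point) simp
qed

lemma values_exist_except:
  assumes "q \<in> I" "m q = 1"
  shows "\<exists>x. (\<forall>i\<in>I - {q}. \<alpha> i \<bullet> x - b i = y i) \<and>
     \<alpha> q \<bullet> x - b q = d - (\<Sum>i\<in>I - {q}. real (m i) * y i)"
proof -
  let ?y = "y(q := d - (\<Sum>i\<in>I - {q}. real (m i) * y i))"
  have "(\<Sum>i\<in>I. real (m i) * ?y i) = real (m q) * ?y q + (\<Sum>i\<in>I - {q}. real (m i) * ?y i)"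
    using finite_I assms(1) by (rule sum.remove)
  also have "(\<Sum>i\<in>I - {q}. real (m i) * ?y i) = (\<Sum>i\<in>I - {q}. real (m i) * y i)"
    by (rule sum.cong) auto
  finally have "(\<Sum>i\<in>I. real (m i) * ?y i) = d" using assms by simp
  from values_exist[OF this] obtain x where x: "\<forall>i\<in>I. \<alpha> i \<bullet> x - b i = ?y i" by blast
  then show ?thesis using assms(1) by (intro exI[of _ x]) auto
qed

definition origin :: 'a where
  "origin = (SOME x. \<alpha> p \<bullet> x - b p = d \<and> (\<forall>i\<in>I - {p}. \<alpha> i \<bullet> x - b i = 0))"

lemma origin: "\<alpha> p \<bullet> origin - b p = d" "i \<in> I - {p} \<Longrightarrow> \<alpha> i \<bullet> origin - b i = 0"
proof -
  have "\<exists>x. \<alpha> p \<bullet> x - b p = d \<and> (\<forall>i\<in>I - {p}. \<alpha> i \<bullet> x - b i = 0)"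
    using values_exist_except[OF p_in mark_p, of "\<lambda>_. 0"] by auto
  then have "\<alpha> p \<bullet> origin - b p = d \<and> (\<forall>i\<in>I - {p}. \<alpha> i \<bullet> origin - b i = 0)"
    unfolding origin_def by (rule someI_ex)
  then show "\<alpha> p \<bullet> origin - b p = d" "i \<in> I - {p} \<Longrightarrow> \<alpha> i \<bullet> origin - b i = 0" by auto
qed

sublocale discrete_reflection_group I \<alpha> b G origin
  using origin weight_eq[OF p_in] mark_p by (intro discrete[OF p_in]) auto

definition coweight :: "'i \<Rightarrow> 'a" where
  "coweight k = (SOME w. (\<forall>i\<in>I - {p}. \<alpha> i \<bullet> w = (if i = k then 1 else 0)))"

lemma coweight: "i \<in> I - {p} \<Longrightarrow> \<alpha> i \<bullet> coweight k = (if i = k then 1 else 0)"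
proof -
  obtain x where x: "\<forall>i\<in>I - {p}. \<alpha> i \<bullet> x - b i = (if i = k then 1 else 0)"
    using values_exist_except[OF p_in mark_p, of "\<lambda>i. if i = k then 1 else 0"] by blast
  have "\<forall>i\<in>I - {p}. \<alpha> i \<bullet> (x - origin) = (if i = k then 1 else 0)"
    using x origin(2) by (simp add: inner_diff_right)
  then have "\<forall>i\<in>I - {p}. \<alpha> i \<bullet> coweight k = (if i = k then 1 else 0)"
    unfolding coweight_def by (rule someI)
  then show "i \<in> I - {p} \<Longrightarrow> \<alpha> i \<bullet> coweight k = (if i = k then 1 else 0)" by blast
qed

lemma sum_split_p: "(\<Sum>i\<in>I. t i *\<^sub>R \<alpha> i) = t p *\<^sub>R \<alpha> p + (\<Sum>i\<in>I - {p}. t i *\<^sub>R \<alpha> i)"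
  using finite_I p_in by (rule sum.remove)

lemma alpha_p: "\<alpha> p = - (\<Sum>i\<in>I - {p}. real (m i) *\<^sub>R \<alpha> i)"
  using marks_sum_vec sum_split_p[of "\<lambda>i. real (m i)"] mark_p by (simp add: eq_neg_iff_add_eq_0)

lemma inner_alpha_p: "\<alpha> p \<bullet> v = - (\<Sum>i\<in>I - {p}. real (m i) * (\<alpha> i \<bullet> v))"
  by (subst alpha_p) (simp add: inner_sum_left)

lemma coweight_sum:
  assumes k: "k \<in> I - {p}"
  shows "(\<Sum>i\<in>I - {p}. t i *\<^sub>R \<alpha> i) \<bullet> coweight k = t k"
proof -
  have "(\<Sum>i\<in>I - {p}. t i *\<^sub>R \<alpha> i) \<bullet> coweight k = (\<Sum>i\<in>I - {p}. if i = k then t k else 0)"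
    unfolding inner_sum_left by (rule sum.cong) (auto simp: coweight)
  then show ?thesis using finite_I k by simp
qed

lemma real_combination: "\<exists>t. v = (\<Sum>i\<in>I - {p}. t i *\<^sub>R \<alpha> i)"
proof -
  have "\<alpha> ` I \<subseteq> span (\<alpha> ` (I - {p}))"
  proof
    fix x assume "x \<in> \<alpha> ` I"
    then obtain i where i: "i \<in> I" "x = \<alpha> i" by blast
    show "x \<in> span (\<alpha> ` (I - {p}))"
    proof (cases "i = p")
      case True
      have "- (\<Sum>i\<in>I - {p}. real (m i) *\<^sub>R \<alpha> i) \<in> span (\<alpha> ` (I - {p}))"
        by (intro span_neg span_sum span_scale span_base) auto
      then show ?thesis using i True alpha_p by simp
    qed (use i in \<open>auto intro: span_base\<close>)
  qed
  then have "span (\<alpha> ` I) \<subseteq> span (\<alpha> ` (I - {p}))" by (metis span_mono span_span)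
  then have "v \<in> span (\<alpha> ` (I - {p}))" using span_alpha by blast
  then show ?thesis using span_image_sum[of "I - {p}" v \<alpha>] finite_I by simp
qed

lemma combination_coweight: "v = (\<Sum>i\<in>I - {p}. (v \<bullet> coweight i) *\<^sub>R \<alpha> i)"
proof -
  obtain t where t: "v = (\<Sum>i\<in>I - {p}. t i *\<^sub>R \<alpha> i)" using real_combination by blast
  have "(\<Sum>i\<in>I - {p}. (v \<bullet> coweight i) *\<^sub>R \<alpha> i) = (\<Sum>i\<in>I - {p}. t i *\<^sub>R \<alpha> i)"
    by (rule sum.cong) (use coweight_sum[of _ t] t in auto)
  then show ?thesis using t by simp
qed

text \<open>Since \<open>p\<close> has mark 1, \<open>\<alpha> p\<close> is an integral combination
  of the other simple roots; these form a basis of the lattice, with the coweights as dual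
  basis.\<close>

lemma lattice_iff_coweight: "v \<in> coroot_lattice \<longleftrightarrow> (\<forall>k\<in>I - {p}. v \<bullet> coweight k \<in> \<int>)"
proof
  assume "v \<in> coroot_lattice"
  then obtain z where z: "v = vec z" using lattice_eq by auto
  have "v = (\<Sum>i\<in>I - {p}. real_of_int (z i - z p * int (m i)) *\<^sub>R \<alpha> i)"
    unfolding z vec_def sum_split_p by (subst alpha_p)
      (simp add: scaleR_diff_left sum_subtractf scaleR_sum_right)
  then have "v \<bullet> coweight k = real_of_int (z k - z p * int (m k))" if "k \<in> I - {p}" for k
    using coweight_sum[OF that, of "\<lambda>i. real_of_int (z i - z p * int (m i))"] by simp
  then show "\<forall>k\<in>I - {p}. v \<bullet> coweight k \<in> \<int>" using Ints_of_int by metis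
next
  assume "\<forall>k\<in>I - {p}. v \<bullet> coweight k \<in> \<int>"
  then have "(\<Sum>i\<in>I - {p}. (v \<bullet> coweight i) *\<^sub>R coroot i) \<in> coroot_lattice"
    by (intro coroot_lattice_sum coroot_lattice_mult coroot_in_lattice) auto
  moreover have "(\<Sum>i\<in>I - {p}. (v \<bullet> coweight i) *\<^sub>R coroot i) = v"
    by (subst combination_coweight[of v]) (rule sum.cong, auto simp: coroot_eq)
  ultimately show "v \<in> coroot_lattice" by simp
qed

lemma lattice_vec:
  assumes "v \<in> coroot_lattice"
  obtains z where "v = vec z" "z p = 0" "\<And>k. k \<in> I - {p} \<Longrightarrow> of_int (z k) = v \<bullet> coweight k"
proof -
  have "\<forall>k\<in>I - {p}. \<exists>n::int. v \<bullet> coweight k = of_int n"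
    using assms lattice_iff_coweight by (meson Ints_cases)
  then obtain y :: "'i \<Rightarrow> int" where y: "\<forall>k\<in>I - {p}. v \<bullet> coweight k = of_int (y k)" by metis
  define z where "z = y(p := 0)"
  have "vec z = (\<Sum>i\<in>I - {p}. real_of_int (z i) *\<^sub>R \<alpha> i)"
    unfolding vec_def sum_split_p by (simp add: z_def)
  also have "\<dots> = (\<Sum>i\<in>I - {p}. (v \<bullet> coweight i) *\<^sub>R \<alpha> i)"
    by (rule sum.cong) (use y in \<open>auto simp: z_def\<close>)
  finally have "v = vec z" using combination_coweight by simp
  then show ?thesis using that[of z] y by (simp add: z_def)
qed

text \<open>Generators of squared norm 2 with integral products: adding a multiple of one generator
  changes the squared norm by an even integer.\<close>

lemma even_norm: "\<exists>n::int. vec z \<bullet> vec z = 2 * of_int n"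
proof -
  have "\<exists>n::int. (\<Sum>i\<in>A. real_of_int (z i) *\<^sub>R \<alpha> i) \<bullet> (\<Sum>i\<in>A. real_of_int (z i) *\<^sub>R \<alpha> i) = 2 * of_int n"
    if "A \<subseteq> I" for A
    using finite_subset[OF that finite_I] that
  proof (induction A rule: finite_induct)
    case (insert i A)
    define v where "v = (\<Sum>i\<in>A. real_of_int (z i) *\<^sub>R \<alpha> i)"
    obtain n :: int where n: "v \<bullet> v = 2 * of_int n" using insert by (auto simp: v_def)
    have "v \<bullet> \<alpha> i \<in> \<int>"
      unfolding v_def inner_sum_left using insert.prems inner_integer by (auto intro!: Ints_sum Ints_mult)
    then obtain k :: int where k: "v \<bullet> \<alpha> i = of_int k" by (auto elim: Ints_cases)
    have "(real_of_int (z i) *\<^sub>R \<alpha> i + v) \<bullet> (real_of_int (z i) *\<^sub>R \<alpha> i + v)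
        = 2 * of_int (z i * z i + z i * k + n)"
      using n k norm2[of i] insert.prems
      by (simp add: inner_add_left inner_add_right inner_commute[of "\<alpha> i" v] algebra_simps)
    moreover have "(\<Sum>j\<in>insert i A. real_of_int (z j) *\<^sub>R \<alpha> j) = real_of_int (z i) *\<^sub>R \<alpha> i + v"
      using insert.hyps by (simp add: v_def)
    ultimately show ?case by metis
  qed (auto intro: exI[of _ 0])
  then show ?thesis by (simp add: vec_def)
qed

text \<open>The simple roots other than \<open>\<alpha> p\<close> have the coweights as dual basis,
  so they satisfy no relation; this gives the first alternative in the hypothesis \<open>rad\<close>
  of \<open>sign_coherent\<close>.\<close>

lemma sign_coherent_finite:
  assumes "vec z \<bullet> vec z = 2" "z p = 0"
  shows "(\<forall>i\<in>I. z i \<ge> 0) \<or> (\<forall>i\<in>I. z i \<le> 0)"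
proof -
  have drop: "(\<Sum>j\<in>I - {p}. of_int (y j) *\<^sub>R \<alpha> j) = vec (y(p := 0))" for y :: "'i \<Rightarrow> int"
    unfolding vec_def sum_split_p by (auto intro!: sum.cong)
  have "(\<forall>i\<in>I - {p}. z i \<ge> 0) \<or> (\<forall>i\<in>I - {p}. z i \<le> 0)"
  proof (rule sign_coherent[of _ \<alpha>])
    show "finite (I - {p})" using finite_I by simp
    show "\<alpha> i \<bullet> \<alpha> j \<le> 0" if "i \<in> I - {p}" "j \<in> I - {p}" "i \<noteq> j" for i j using gram[of i j] that by auto
    show "\<exists>n::int. (\<Sum>j\<in>I - {p}. of_int (y j) *\<^sub>R \<alpha> j) \<bullet> (\<Sum>j\<in>I - {p}. of_int (y j) *\<^sub>R \<alpha> j) = 2 * of_int n"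
      for y :: "'i \<Rightarrow> int" unfolding drop by (rule even_norm)
    show "(\<forall>j\<in>I - {p}. y j = 0) \<or> (\<forall>j\<in>I - {p}. y j > 0)"
      if "(\<Sum>j\<in>I - {p}. of_int (y j) *\<^sub>R \<alpha> j) = 0" for y :: "'i \<Rightarrow> int"
    proof -
      have "y k = 0" if k: "k \<in> I - {p}" for k
        using coweight_sum[OF k, of "\<lambda>j. of_int (y j)"] \<open>(\<Sum>j\<in>I - {p}. of_int (y j) *\<^sub>R \<alpha> j) = 0\<close> by simp
      then show ?thesis by blast
    qed
    have "z(p := 0) = z" using assms by auto
    then show "(\<Sum>j\<in>I - {p}. of_int (z j) *\<^sub>R \<alpha> j) \<bullet> (\<Sum>j\<in>I - {p}. of_int (z j) *\<^sub>R \<alpha> j) = 2"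
      unfolding drop using assms by simp
  qed
  then show ?thesis using assms(2) by (metis Diff_iff order_refl singletonD)
qed

text \<open>All relations among the simple roots are multiples of the marks, and the marks are
  positive everywhere; hence the two alternatives in \<open>rad\<close>.\<close>

lemma sign_coherent_affine:
  assumes "vec z \<bullet> vec z = 2"
  shows "(\<forall>i\<in>I. z i \<ge> 0) \<or> (\<forall>i\<in>I. z i \<le> 0)"
proof (rule sign_coherent[of _ \<alpha>])
  show "finite I" by (rule finite_I)
  show "\<alpha> i \<bullet> \<alpha> j \<le> 0" if "i \<in> I" "j \<in> I" "i \<noteq> j" for i j using gram[of i j] that by auto
  show "\<exists>n::int. (\<Sum>j\<in>I. of_int (y j) *\<^sub>R \<alpha> j) \<bullet> (\<Sum>j\<in>I. of_int (y j) *\<^sub>R \<alpha> j) = 2 * of_int n"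
    for y :: "'i \<Rightarrow> int" using even_norm[of y] by (simp add: vec_def)
  show "(\<forall>j\<in>I. y j = 0) \<or> (\<forall>j\<in>I. y j > 0)"
    if "\<And>j. j \<in> I \<Longrightarrow> y j \<ge> 0" "(\<Sum>j\<in>I. of_int (y j) *\<^sub>R \<alpha> j) = 0" for y :: "'i \<Rightarrow> int"
  proof -
    have e: "y j = y p * int (m j)" if j: "j \<in> I" for j
      using relation_marks[OF \<open>(\<Sum>j\<in>I. of_int (y j) *\<^sub>R \<alpha> j) = 0\<close> j]
      by (metis of_int_eq_iff of_int_mult of_int_of_nat_eq)
    show ?thesis
    proof (cases "y p = 0")
      case False
      then have "y p > 0" using that(1)[OF p_in] by simp
      then show ?thesis using e mark_pos by (metis One_nat_def Suc_le_lessD of_nat_0_less_iff zero_less_mult_iff)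
    qed (use e in auto)
  qed
  show "(\<Sum>j\<in>I. of_int (z j) *\<^sub>R \<alpha> j) \<bullet> (\<Sum>j\<in>I. of_int (z j) *\<^sub>R \<alpha> j) = 2"
    using assms by (simp add: vec_def)
qed

text \<open>An element of \<open>G\<close> acts trivially on coweights modulo the root lattice; since the weight
  pairing is perfect, the primitive normal of a reflection in \<open>G\<close> has norm 2.\<close>

lemma displacement_in_lattice:
  assumes g: "g \<in> G" and v: "\<And>i. i \<in> I \<Longrightarrow> \<alpha> i \<bullet> v \<in> \<int>"
  shows "linear_part g v - v \<in> coroot_lattice"
proof -
  let ?P = "{v. \<forall>i\<in>I. \<alpha> i \<bullet> v \<in> \<int>}"
  have "G \<subseteq> {g. affine_isometry g \<and> (\<forall>v\<in>?P. linear_part g v - v \<in> coroot_lattice)}"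
    unfolding G_def
  proof (rule generate_reflections_subset[OF R0])
    show "(\<lambda>i. \<rho> (\<alpha> i) (b i)) ` I
        \<subseteq> {g. affine_isometry g \<and> (\<forall>v\<in>?P. linear_part g v - v \<in> coroot_lattice)}"
    proof -
      have "- ((\<alpha> i \<bullet> v) *\<^sub>R coroot i) \<in> coroot_lattice" if "i \<in> I" "v \<in> ?P" for i v
        using coroot_lattice_diff[OF coroot_lattice_zero coroot_lattice_mult[OF coroot_in_lattice]] that by simp
      then show ?thesis
        by (auto simp: generator_linear_part affine_isometry_hyperplane_reflection nonzero)
    qed
    show "f \<circ> g \<in> {g. affine_isometry g \<and> (\<forall>v\<in>?P. linear_part g v - v \<in> coroot_lattice)}"
      if f: "f \<in> {g. affine_isometry g \<and> (\<forall>v\<in>?P. linear_part g v - v \<in> coroot_lattice)}"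
        and g: "g \<in> {g. affine_isometry g \<and> (\<forall>v\<in>?P. linear_part g v - v \<in> coroot_lattice)}" for f g
    proof -
      have "linear_part (f \<circ> g) v - v \<in> coroot_lattice" if v: "v \<in> ?P" for v
      proof -
        define w where "w = linear_part g v"
        have gv: "w - v \<in> coroot_lattice" using g v by (simp add: w_def)
        have "\<alpha> i \<bullet> w \<in> \<int>" if "i \<in> I" for i
        proof -
          have "\<alpha> i \<bullet> (w - v) \<in> \<int>" "\<alpha> i \<bullet> v \<in> \<int>" using inner_coroot_lattice[OF that gv] v that by auto
          then have "\<alpha> i \<bullet> (w - v) + \<alpha> i \<bullet> v \<in> \<int>" by (rule Ints_add)
          then show ?thesis by (simp add: inner_diff_right)
        qed
        then have "linear_part f w - w \<in> coroot_lattice" using f by simp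
        then have "(linear_part f w - w) + (w - v) \<in> coroot_lattice" using gv by (rule coroot_lattice_add)
        then show ?thesis using f by (simp add: linear_part_comp w_def)
      qed
      then show ?thesis using f g by (simp add: affine_isometry_comp)
    qed
  qed (auto simp: affine_isometry_id coroot_lattice_zero simp flip: id_def)
  then show ?thesis using g v by blast
qed

lemma reflection_root:
  assumes a: "a \<noteq> 0" and s: "\<rho> a \<beta> \<in> G"
  obtains z k where "k \<noteq> 0" "vec z \<bullet> vec z = 2" "a = k *\<^sub>R vec z" "\<beta> = k * off z"
proof -
  have reflP: "(2 * (a \<bullet> v) / (a \<bullet> a)) *\<^sub>R a \<in> coroot_lattice" if "\<And>i. i \<in> I \<Longrightarrow> \<alpha> i \<bullet> v \<in> \<int>" for v
  proof -
    have "0 - (linear_part (\<rho> a \<beta>) v - v) \<in> coroot_lattice"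
      by (intro coroot_lattice_diff coroot_lattice_zero displacement_in_lattice[OF s] that)
    then show ?thesis by (simp add: linear_part_hyperplane_reflection)
  qed
  have coweight_P: "\<alpha> i \<bullet> coweight k \<in> \<int>" if "i \<in> I" for i k
  proof (cases "i = p")
    case True
    then show ?thesis unfolding True inner_alpha_p
      by (auto simp: coweight intro!: Ints_sum Ints_mult Ints_minus)
  qed (use that in \<open>auto simp: coweight\<close>)
  obtain k0 where k0: "k0 \<in> I - {p}" "a \<bullet> coweight k0 \<noteq> 0"
  proof (rule ccontr)
    assume "\<not> thesis"
    then have "\<forall>k\<in>I - {p}. a \<bullet> coweight k = 0" using that by blast
    then have "a = 0" by (subst combination_coweight) simp
    then show False using a by simp
  qed
  define r0 where "r0 = (2 * (a \<bullet> coweight k0) / (a \<bullet> a)) *\<^sub>R a"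
  have r0: "r0 \<in> coroot_lattice" "r0 \<noteq> 0"
    using reflP[OF coweight_P] k0 a by (auto simp: r0_def)
  \<comment> \<open>Non-zero lattice vectors on the line of \<open>a\<close>. A shortest one,
    \<open>r\<close>, is primitive: only its integral multiples lie in the lattice.\<close>
  define M where "M = {q \<in> coroot_lattice. norm q \<le> norm r0} \<inter> {q. q \<noteq> 0 \<and> (\<exists>k. q = k *\<^sub>R a)}"
  have "finite M" unfolding M_def using finite_coroot_lattice_ball by blast
  moreover have "r0 \<in> M" using r0 unfolding M_def r0_def by blast
  ultimately obtain r where r: "r \<in> M" "\<And>q. q \<in> M \<Longrightarrow> norm r \<le> norm q"
    using ex_is_arg_min_if_finite[of M norm] by (auto simp: is_arg_min_linorder)
  obtain k' where k': "r = k' *\<^sub>R a" "r \<in> coroot_lattice" "r \<noteq> 0" "norm r \<le> norm r0"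
    using r(1) by (auto simp: M_def)
  then have k'0: "k' \<noteq> 0" by auto
  have mult: "x \<in> \<int>" if "x *\<^sub>R r \<in> coroot_lattice" for x
  proof (rule ccontr)
    assume x: "x \<notin> \<int>"
    define q where "q = (x - of_int \<lfloor>x\<rfloor>) *\<^sub>R r"
    have "q = x *\<^sub>R r - of_int \<lfloor>x\<rfloor> *\<^sub>R r" by (simp add: q_def scaleR_diff_left)
    then have qQ: "q \<in> coroot_lattice"
      using coroot_lattice_diff[OF that coroot_lattice_mult[OF k'(2), of "of_int \<lfloor>x\<rfloor>"]] by simp
    have fr: "0 < x - of_int \<lfloor>x\<rfloor>" "x - of_int \<lfloor>x\<rfloor> < 1"
      using x by (metis Ints_of_int diff_gt_0_iff_gt floor_correct less_eq_real_def, linarith)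
    have "norm q = (x - of_int \<lfloor>x\<rfloor>) * norm r" using fr by (simp add: q_def)
    also have "\<dots> < 1 * norm r" by (rule mult_strict_right_mono) (use fr k'(3) in auto)
    finally have nq: "norm q < norm r" by simp
    have "q \<noteq> 0" using fr k'(3) by (simp add: q_def)
    moreover have "q = ((x - of_int \<lfloor>x\<rfloor>) * k') *\<^sub>R a" by (simp add: q_def k'(1))
    moreover have "norm q \<le> norm r0" using nq k'(4) by linarith
    ultimately have "q \<in> M" using qQ unfolding M_def by blast
    then show False using r(2)[of q] nq by linarith
  qed
  have rr: "r \<bullet> r > 0" using k'(3) by simp
  \<comment> \<open>Primitivity is used twice. The displacement of each coweight is an integral
    multiple of \<open>r\<close>, so this vector pairs integrally with all coweights and lies in the
    lattice; therefore its factor \<open>2 / (r \<bullet> r)\<close> is an integer. As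
    \<open>r \<bullet> r\<close> is even, it equals 2.\<close>
  have "(2 / (r \<bullet> r)) *\<^sub>R r \<in> coroot_lattice"
    unfolding lattice_iff_coweight
  proof
    fix k assume k: "k \<in> I - {p}"
    have "(2 * (a \<bullet> coweight k) / (a \<bullet> a)) *\<^sub>R a = (2 * (r \<bullet> coweight k) / (r \<bullet> r)) *\<^sub>R r"
      using k'0 a by (simp add: k' field_simps)
    then have "(2 * (r \<bullet> coweight k) / (r \<bullet> r)) *\<^sub>R r \<in> coroot_lattice"
      using reflP[OF coweight_P, of k] by simp
    then have "2 * (r \<bullet> coweight k) / (r \<bullet> r) \<in> \<int>" by (rule mult)
    then show "((2 / (r \<bullet> r)) *\<^sub>R r) \<bullet> coweight k \<in> \<int>" by simp
  qed
  then have "2 / (r \<bullet> r) \<in> \<int>" by (rule mult)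
  then obtain n :: int where n: "2 / (r \<bullet> r) = of_int n" by (auto elim: Ints_cases)
  obtain z where z: "r = vec z" "z p = 0" using lattice_vec[OF k'(2)] by metis
  obtain l :: int where l: "r \<bullet> r = 2 * of_int l" using even_norm z by blast
  have "of_int n * (2 * of_int l) = (2::real)" using n l rr by (simp add: field_simps)
  then have "real_of_int (n * l) = 1" by simp
  then have "n * l = 1" by (simp only: of_int_eq_1_iff)
  moreover have "l > 0" using l rr by simp
  ultimately have "l = 1" by (simp add: zmult_eq_1_iff)
  then have r2: "r \<bullet> r = 2" using l by simp
  define \<beta>' where "\<beta>' = k' * \<beta>"
  have "\<rho> r \<beta>' = \<rho> a \<beta>"
    unfolding k'(1) \<beta>'_def using hyperplane_reflection_cong[OF a k'0] .
  then have sr: "\<rho> r \<beta>' \<in> G" using s by simp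
  have "\<exists>q\<in>coroot_lattice. \<rho> r \<beta>' origin = origin + d *\<^sub>R q"
  proof (rule orbit_in_lattice[OF _ _ sr])
    show "(\<alpha> i \<bullet> origin - b i) / d \<in> \<int>" if "i \<in> I" for i
      using origin that d_pos by (cases "i = p") auto
  qed (use d_pos in simp)
  then obtain q where q: "q \<in> coroot_lattice" "\<rho> r \<beta>' origin = origin + d *\<^sub>R q" by blast
  moreover have "\<rho> r \<beta>' origin = origin - (r \<bullet> origin - \<beta>') *\<^sub>R r"
    unfolding hyperplane_reflection_def r2 by (simp only: nonzero_mult_div_cancel_left zero_neq_numeral not_False_eq_True)
  ultimately have "d *\<^sub>R q = - ((r \<bullet> origin - \<beta>') *\<^sub>R r)" by (simp add: algebra_simps)
  then have "q = (- (r \<bullet> origin - \<beta>') / d) *\<^sub>R r"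
  proof -
    have "q = (1 / d) *\<^sub>R (d *\<^sub>R q)" using d_pos by simp
    then have "q = - (((r \<bullet> origin - \<beta>') / d) *\<^sub>R r)" unfolding \<open>d *\<^sub>R q = _\<close> by simp
    then show ?thesis by (simp only: minus_divide_left[symmetric] scaleR_minus_left)
  qed
  then have "- (r \<bullet> origin - \<beta>') / d \<in> \<int>" using q(1) mult by simp
  then obtain N :: int where N: "- (r \<bullet> origin - \<beta>') / d = of_int N" by (auto elim: Ints_cases)
  \<comment> \<open>Subtracting \<open>N\<close> times the marks keeps the gradient and lowers the
    function by the constant \<open>N * d\<close>; the integer \<open>N\<close> is read off from the
    image of the vertex \<open>origin\<close>.\<close>
  define y where "y i = z i - N * int (m i)" for i
  have vy: "vec y = r"
  proof -
    have "vec y = vec z - real_of_int N *\<^sub>R (\<Sum>i\<in>I. real (m i) *\<^sub>R \<alpha> i)"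
      by (simp add: vec_def y_def scaleR_diff_left sum_subtractf scaleR_sum_right)
    then show ?thesis using marks_sum_vec z by simp
  qed
  have "off y = \<beta>'"
  proof -
    have "val y origin = (\<Sum>i\<in>I. real_of_int (z i) * (\<alpha> i \<bullet> origin - b i)) - of_int N * d"
    proof -
      have "val y origin = (\<Sum>i\<in>I. real_of_int (z i) * (\<alpha> i \<bullet> origin - b i))
          - of_int N * (\<Sum>i\<in>I. real (m i) * (\<alpha> i \<bullet> origin - b i))"
        unfolding val_def y_def sum_distrib_left sum_subtractf[symmetric]
        by (rule sum.cong) (simp_all add: left_diff_distrib)
      then show ?thesis unfolding marks_sum .
    qed
    also have "(\<Sum>i\<in>I. real_of_int (z i) * (\<alpha> i \<bullet> origin - b i)) = 0"
    proof (rule sum.neutral, rule ballI)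
      fix i assume "i \<in> I"
      then show "real_of_int (z i) * (\<alpha> i \<bullet> origin - b i) = 0" using z(2) origin(2)[of i] by (cases "i = p") auto
    qed
    finally have "r \<bullet> origin - off y = - (of_int N * d)" by (simp add: val_eq vy)
    moreover have "of_int N * d = - (r \<bullet> origin - \<beta>')" using N d_pos by (simp add: field_simps)
    ultimately show ?thesis by simp
  qed
  then have "a = (1 / k') *\<^sub>R vec y" "\<beta> = (1 / k') * off y" using k'0 vy by (simp_all add: k' \<beta>'_def)
  then show ?thesis using that[of "1 / k'" y] k'0 vy r2 by simp
qed

lemma vec_upd:
  assumes i: "i \<in> I"
  shows "vec (z(i := z i - k)) = vec z - of_int k *\<^sub>R \<alpha> i" "off (z(i := z i - k)) = off z - of_int k * b i"
proof -
  have "vec (z(i := z i - k)) = of_int (z i - k) *\<^sub>R \<alpha> i + (\<Sum>j\<in>I - {i}. of_int (z j) *\<^sub>R \<alpha> j)"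
    unfolding vec_def by (subst sum.remove[OF finite_I i]) (auto intro!: sum.cong)
  moreover have "vec z = of_int (z i) *\<^sub>R \<alpha> i + (\<Sum>j\<in>I - {i}. of_int (z j) *\<^sub>R \<alpha> j)"
    unfolding vec_def by (rule sum.remove[OF finite_I i])
  ultimately show "vec (z(i := z i - k)) = vec z - of_int k *\<^sub>R \<alpha> i" by (simp add: algebra_simps)
  have "off (z(i := z i - k)) = of_int (z i - k) * b i + (\<Sum>j\<in>I - {i}. of_int (z j) * b j)"
    unfolding off_def by (subst sum.remove[OF finite_I i]) (auto intro!: sum.cong)
  moreover have "off z = of_int (z i) * b i + (\<Sum>j\<in>I - {i}. of_int (z j) * b j)"
    unfolding off_def by (rule sum.remove[OF finite_I i])
  ultimately show "off (z(i := z i - k)) = off z - of_int k * b i" by (simp add: algebra_simps)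
qed

text \<open>Induction on the height. As the squared norm is positive, some \<open>\<alpha> i\<close>
  with \<open>z i > 0\<close> has positive product with the root, and the simple reflection
  subtracts a positive multiple of \<open>\<alpha> i\<close>. The result is sign coherent: if its
  coefficients are non-negative, induction and conjugation apply; if they are non-positive, the root
  was supported at \<open>i\<close> and equals \<open>\<alpha> i\<close>.\<close>

lemma positive_root_in_G:
  "(\<forall>i\<in>I. z i \<ge> 0) \<Longrightarrow> vec z \<bullet> vec z = 2 \<Longrightarrow> \<rho> (vec z) (off z) \<in> G"
proof (induction "nat (\<Sum>i\<in>I. z i)" arbitrary: z rule: less_induct)
  case less
  have "(\<Sum>i\<in>I. of_int (z i) * (\<alpha> i \<bullet> vec z)) = 2"
    using less.prems(2) by (subst (asm) vec_def) (simp add: inner_sum_left)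
  then obtain i where i: "i \<in> I" "of_int (z i) * (\<alpha> i \<bullet> vec z) > 0"
    by (metis (no_types, lifting) less_numeral_extra(1) not_le sum_nonpos zero_less_numeral)
  then have zi: "z i > 0" and pos: "\<alpha> i \<bullet> vec z > 0"
    using less.prems(1) by (auto simp: zero_less_mult_iff)
  have "vec z \<in> coroot_lattice" using lattice_eq by auto
  then have "\<alpha> i \<bullet> vec z \<in> \<int>" by (rule inner_coroot_lattice[OF i(1)])
  then obtain k :: int where k: "\<alpha> i \<bullet> vec z = of_int k" by (auto elim: Ints_cases)
  then have k0: "k > 0" using pos by simp
  define y where "y = z(i := z i - k)"
  have vy: "vec y = vec z - of_int k *\<^sub>R \<alpha> i" and oy: "off y = off z - of_int k * b i"
    unfolding y_def by (rule vec_upd[OF i(1)])+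
  have "vec y \<bullet> vec y = 2"
    unfolding vy using less.prems(2) norm2[OF i(1)] k
    by (simp add: inner_diff_left inner_diff_right inner_commute)
  then consider "\<forall>j\<in>I. y j \<ge> 0" | "\<forall>j\<in>I. y j \<le> 0" using sign_coherent_affine by blast
  then show ?case
  proof cases
    case 1
    have "(\<Sum>j\<in>I. y j) = (\<Sum>j\<in>I. z j) - k"
      using sum.remove[OF finite_I i(1), of y] sum.remove[OF finite_I i(1), of z]
      by (simp add: y_def)
    moreover have "(\<Sum>j\<in>I. y j) \<ge> 0" using 1 by (intro sum_nonneg) auto
    ultimately have "nat (\<Sum>j\<in>I. y j) < nat (\<Sum>j\<in>I. z j)" using k0 by linarith
    then have yG: "\<rho> (vec y) (off y) \<in> G"
      using less.hyps 1 \<open>vec y \<bullet> vec y = 2\<close> by blast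
    let ?s = "\<rho> (\<alpha> i) (b i)"
    have "vec y \<noteq> 0" using \<open>vec y \<bullet> vec y = 2\<close> by auto
    then have "\<rho> (linear_part ?s (vec y)) (off y + linear_part ?s (vec y) \<bullet> ?s 0) \<in> G"
      by (intro G_conjugate G_generator yG i(1))
    moreover have ls: "linear_part ?s (vec y) = vec z"
      unfolding generator_linear_part coroot_eq[OF i(1)] vy using k norm2[OF i(1)]
      by (simp add: inner_diff_right algebra_simps)
    moreover have "off y + vec z \<bullet> ?s 0 = off z"
      unfolding generator_eq coroot_eq[OF i(1)] oy using k by (simp add: inner_commute)
    ultimately show ?thesis by simp
  next
    case 2
    have zj: "z j = 0" if "j \<in> I - {i}" for j
    proof -
      have "y j = z j" using that by (simp add: y_def)
      then show ?thesis using less.prems(1) 2 that by force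
    qed
    have vz: "vec z = of_int (z i) *\<^sub>R \<alpha> i"
      unfolding vec_def by (subst sum.remove[OF finite_I i(1)]) (simp add: zj)
    have oz: "off z = of_int (z i) * b i"
      unfolding off_def by (subst sum.remove[OF finite_I i(1)]) (simp add: zj)
    have "of_int (z i * z i) = (1::real)" using less.prems(2) norm2[OF i(1)] unfolding vz by simp
    then have "z i * z i = 1" by (simp only: of_int_eq_1_iff)
    then have "z i = 1" using zi by (simp add: zmult_eq_1_iff)
    then show ?thesis using G_generator[OF i(1)] vz oz by simp
  qed
qed

lemma root_in_G:
  assumes "vec z \<bullet> vec z = 2" shows "\<rho> (vec z) (off z) \<in> G"
  using sign_coherent_affine[OF assms]
proof
  assume "\<forall>i\<in>I. z i \<ge> 0"
  then show ?thesis using assms by (rule positive_root_in_G)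
next
  assume z: "\<forall>i\<in>I. z i \<le> 0"
  define y where "y i = - z i" for i
  have vy: "vec y = (- 1) *\<^sub>R vec z" and oy: "off y = (- 1) * off z"
    by (simp_all add: vec_def off_def y_def sum_negf)
  have "\<rho> (vec y) (off y) \<in> G"
    by (rule positive_root_in_G) (use z assms in \<open>auto simp: y_def vy\<close>)
  moreover have "vec z \<noteq> 0" using assms by auto
  ultimately show ?thesis unfolding vy oy by (subst (asm) hyperplane_reflection_cong) auto
qed

text \<open>Moving the simplex by an element of \<open>G\<close> changes neither the group nor the
  Gram matrix nor the marks. This permits the passage to a simplex for which \<nu> is
  dominant.\<close>

lemma conjugate_system:
  assumes g: "g \<in> G"
  defines "\<alpha>' \<equiv> \<lambda>i. linear_part g (\<alpha> i)"
  defines "b' \<equiv> \<lambda>i. b i + linear_part g (\<alpha> i) \<bullet> g 0"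
  shows "affine_simply_laced I \<alpha>' b' c m d p"
    and "cartan_simplex.G I \<alpha>' b' = G"
    and "\<alpha>' i \<bullet> \<alpha>' j = \<alpha> i \<bullet> \<alpha> j"
    and "\<alpha>' i \<bullet> g x - b' i = \<alpha> i \<bullet> x - b i"
proof -
  have o: "orthogonal_transformation (linear_part g)" by (rule linear_part_orthogonal[OF G_isometry[OF g]])
  have ip: "linear_part g v \<bullet> linear_part g w = v \<bullet> w" for v w
    using o by (simp add: orthogonal_transformation_def)
  have bij: "bij g" by (rule G_bij[OF g])
  show val': "\<alpha>' i \<bullet> g x - b' i = \<alpha> i \<bullet> x - b i" for i x
  proof -
    have "g x = linear_part g x + g 0" by (simp add: linear_part_def)
    then show ?thesis by (simp add: \<alpha>'_def b'_def inner_add_right ip)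
  qed
  show ip': "\<alpha>' i \<bullet> \<alpha>' j = \<alpha> i \<bullet> \<alpha> j" for i j by (simp add: \<alpha>'_def ip)
  have nz: "\<alpha>' i \<noteq> 0" if "i \<in> I" for i
    using linear_part_nonzero[OF G_isometry[OF g] nonzero[OF that]] by (simp add: \<alpha>'_def)
  show loc: "affine_simply_laced I \<alpha>' b' c m d p"
  proof
    show "(\<Sum>i\<in>I. c i * (\<alpha>' i \<bullet> x - b' i)) = 1" for x
    proof -
      obtain y where "x = g y" using bij by (metis bij_pointE)
      then show ?thesis using barycentric_sum[of y] by (simp add: val')
    qed
    show "\<exists>x. \<forall>i\<in>I. \<alpha>' i \<bullet> x - b' i = y i" if "(\<Sum>i\<in>I. c i * y i) = 1" for y
    proof -
      from barycentric_point[OF that] obtain x where "\<forall>i\<in>I. \<alpha> i \<bullet> x - b i = y i" by blast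
      then show ?thesis by (intro exI[of _ "g x"]) (simp add: val')
    qed
    show "v = 0" if "\<And>i. i \<in> I \<Longrightarrow> \<alpha>' i \<bullet> v = 0" for v
    proof -
      have "surj (linear_part g)" using o by (rule orthogonal_transformation_surj)
      then obtain u where u: "v = linear_part g u" by (metis surjD)
      have "u = 0" by (rule spanning) (use that in \<open>simp add: u \<alpha>'_def ip\<close>)
      then show ?thesis using u by (simp add: linear_part_def)
    qed
  qed (use finite_I nz weight_pos norm2 gram d_pos weight_eq p_in mark_p neighbour in \<open>auto simp: ip'\<close>)
  interpret A: affine_simply_laced I \<alpha>' b' c m d p by (rule loc)
  have conj: "\<rho> (\<alpha>' i) (b' i) \<circ> g = g \<circ> \<rho> (\<alpha> i) (b i)" if "i \<in> I" for i
    unfolding \<alpha>'_def b'_def by (rule conjugate_reflection[OF G_isometry[OF g] nonzero[OF that], symmetric])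
  show "A.G = G"
  proof
    show "A.G \<subseteq> G"
    proof -
      have "\<rho> (\<alpha>' i) (b' i) \<in> G" if "i \<in> I" for i
        unfolding \<alpha>'_def b'_def by (rule G_conjugate[OF g G_generator[OF that] nonzero[OF that]])
      then have "(\<lambda>i. \<rho> (\<alpha>' i) (b' i)) ` I \<subseteq> G" by blast
      then show ?thesis
        using generate_subset_generate[OF A.R0 R0] unfolding A.G_def G_def by blast
    qed
    have "gen ((\<lambda>i. \<rho> (\<alpha> i) (b i)) ` I)
        \<subseteq> {h. \<exists>h'\<in>A.G. h' \<circ> g = g \<circ> h}"
    proof (rule generate_reflections_subset[OF R0])
      show "(\<lambda>i. \<rho> (\<alpha> i) (b i)) ` I \<subseteq> {h. \<exists>h'\<in>A.G. h' \<circ> g = g \<circ> h}"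
        using conj A.G_generator by blast
      show "id \<in> {h. \<exists>h'\<in>A.G. h' \<circ> g = g \<circ> h}" using A.G_id by (auto intro!: bexI[of _ id])
      show "f \<circ> h \<in> {h. \<exists>h'\<in>A.G. h' \<circ> g = g \<circ> h}"
        if "f \<in> {h. \<exists>h'\<in>A.G. h' \<circ> g = g \<circ> h}" "h \<in> {h. \<exists>h'\<in>A.G. h' \<circ> g = g \<circ> h}" for f h
      proof -
        from that obtain f' h' where f: "f' \<in> A.G" "f' \<circ> g = g \<circ> f" and h: "h' \<in> A.G" "h' \<circ> g = g \<circ> h"
          by blast
        have "(f' \<circ> h') \<circ> g = g \<circ> (f \<circ> h)" using f(2) h(2) by (metis comp_assoc)
        then show ?thesis using A.G_comp[OF f(1) h(1)] by blast
      qed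
    qed
    then have key: "\<exists>h'\<in>A.G. h' \<circ> g = g \<circ> h" if "h \<in> G" for h using that unfolding G_def by blast
    show "G \<subseteq> A.G"
    proof
      fix h assume h: "h \<in> G"
      have "inv_into UNIV g \<circ> h \<circ> g \<in> G" by (intro G_comp G_inv g h)
      then obtain h' where h': "h' \<in> A.G" "h' \<circ> g = g \<circ> (inv_into UNIV g \<circ> h \<circ> g)" using key by blast
      have "h' x = h x" for x
      proof -
        obtain y where y: "x = g y" using bij by (metis bij_pointE)
        have "h' (g y) = g (inv_into UNIV g (h (g y)))" using fun_cong[OF h'(2), of y] by simp
        then show ?thesis using bij by (simp add: y bij_is_surj surj_f_inv_f)
      qed
      then have "h' = h" by blast
      then show "h \<in> A.G" using h'(1) by simp
    qed
  qed
qed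

text \<open>\<tau> has product 1 with every simple root other than \<open>\<alpha> p\<close>. Among
  the finitely many linear parts \<open>l\<close> one maximises
  \<open>\<nu> \<bullet> l \<tau>\<close>; composing it with a simple reflection lowers this value
  by \<open>\<nu> \<bullet> l (\<alpha> i)\<close>, which is therefore non-negative.\<close>

lemma dominant_conjugate:
  "\<exists>g\<in>G. \<forall>i\<in>I - {p}. \<nu> \<bullet> linear_part g (\<alpha> i) \<ge> 0"
proof -
  define \<tau> where "\<tau> = (\<Sum>k\<in>I - {p}. coweight k)"
  have \<tau>: "\<alpha> i \<bullet> \<tau> = 1" if "i \<in> I - {p}" for i
  proof -
    have "\<alpha> i \<bullet> \<tau> = (\<Sum>k\<in>I - {p}. if i = k then 1 else 0)"
      unfolding \<tau>_def inner_sum_right by (rule sum.cong) (use coweight that in auto)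
    then show ?thesis using finite_I that by simp
  qed
  let ?f = "\<lambda>l. \<nu> \<bullet> l \<tau>"
  have "linear_part ` G \<noteq> {}" using G_id by blast
  then obtain l where l: "l \<in> linear_part ` G" "\<And>l'. l' \<in> linear_part ` G \<Longrightarrow> - ?f l \<le> - ?f l'"
    using ex_is_arg_min_if_finite[OF finite_linear_part, of "\<lambda>l. - ?f l"] by (auto simp: is_arg_min_linorder)
  then obtain g where g: "g \<in> G" "l = linear_part g" by blast
  have "\<nu> \<bullet> linear_part g (\<alpha> i) \<ge> 0" if i: "i \<in> I - {p}" for i
  proof -
    let ?s = "\<rho> (\<alpha> i) (b i)"
    have lin: "linear (linear_part g)"
      by (rule orthogonal_transformation_linear[OF linear_part_orthogonal[OF G_isometry[OF g(1)]]])
    have "g \<circ> ?s \<in> G" using g(1) G_generator i by (intro G_comp) auto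
    then have "?f (linear_part (g \<circ> ?s)) \<le> ?f l" using l(2)[of "linear_part (g \<circ> ?s)"] by simp
    moreover have "linear_part (g \<circ> ?s) \<tau> = linear_part g \<tau> - linear_part g (\<alpha> i)"
      using i \<tau>[OF i] coroot_eq[of i] linear_part_comp[OF G_isometry[OF g(1)]]
      by (simp add: generator_linear_part linear_diff[OF lin])
    ultimately show ?thesis by (simp add: g(2) inner_diff_right)
  qed
  then show ?thesis using g(1) by blast
qed

text \<open>A root has coefficients of one sign, so under dominance orthogonality to \<nu> means
  that coefficients vanish. Absorption is then applied to two monoids: the stabiliser of the
  coweight of \<open>q\<close> makes \<nu> orthogonal to the simple roots other than
  \<open>\<alpha> p\<close> and \<open>\<alpha> q\<close>, and a congruence for \<nu>-values on the
  lattice yields mark 1.\<close>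

lemma dominant_maximal:
  assumes abs: "absorbing_normal {a. a \<noteq> 0 \<and> (\<exists>c. \<rho> a c \<in> G)}
      {k *\<^sub>R \<alpha> i | k i. k \<noteq> 0 \<and> i \<in> I} \<nu>"
    and dom: "\<And>i. i \<in> I - {p} \<Longrightarrow> \<nu> \<bullet> \<alpha> i \<ge> 0"
  obtains q where "q \<in> I - {p}" "m q = 1" "\<And>i. i \<in> I - {p, q} \<Longrightarrow> \<alpha> i \<bullet> \<nu> = 0" "\<alpha> q \<bullet> \<nu> > 0"
proof -
  let ?D = "{a. a \<noteq> 0 \<and> (\<exists>c. \<rho> a c \<in> G)}"
  let ?S = "{k *\<^sub>R \<alpha> i | k i. k \<noteq> 0 \<and> i \<in> I}"
  interpret N: absorbing_normal ?D ?S \<nu> by (rule abs)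
  have alphaS: "\<alpha> i \<in> ?S" if "i \<in> I" for i
    using that by (intro CollectI exI[of _ 1] exI[of _ i]) simp
  have alphaD: "\<alpha> i \<in> ?D" if "i \<in> I" for i using alphaS[OF that] N.S_subset by blast
  have "\<exists>q\<in>I - {p}. \<nu> \<bullet> \<alpha> q \<noteq> 0"
  proof (rule ccontr)
    assume "\<not> ?thesis"
    then have z: "\<forall>i\<in>I - {p}. \<alpha> i \<bullet> \<nu> = 0" by (simp add: inner_commute)
    then have "\<alpha> p \<bullet> \<nu> = 0" unfolding inner_alpha_p by simp
    then have "\<nu> = 0" using z by (intro spanning) auto
    then show False using N.normal_nonzero by simp
  qed
  then obtain q where q: "q \<in> I - {p}" "\<nu> \<bullet> \<alpha> q > 0" using dom by force
  \<comment> \<open>A root orthogonal to \<nu> has \<open>\<alpha> q\<close>-coefficient 0, so its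
    reflection fixes \<open>coweight q\<close>. So does the reflection along
    \<open>\<alpha> j\<close>, whereas the one along \<open>\<alpha> q\<close> moves it.\<close>
  have other: "\<alpha> j \<bullet> \<nu> = 0" if j: "j \<in> I - {p, q}" for j
  proof (rule N.absorbs[of "{f. f (coweight q) = coweight q}" "\<alpha> q"])
    show "reflect a \<in> {f. f (coweight q) = coweight q}" if a: "a \<in> ?D" "a \<bullet> \<nu> = 0" for a
    proof -
      from a(1) obtain \<beta> where \<beta>: "a \<noteq> 0" "\<rho> a \<beta> \<in> G" by blast
      obtain z k where z: "k \<noteq> 0" "vec z \<bullet> vec z = 2" "a = k *\<^sub>R vec z" "\<beta> = k * off z"
        by (rule reflection_root[OF \<beta>])
      have "vec z \<in> coroot_lattice" using lattice_eq by auto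
      then obtain y where y: "vec z = vec y" "y p = 0" "\<And>k. k \<in> I - {p} \<Longrightarrow> of_int (y k) = vec z \<bullet> coweight k"
        using lattice_vec by metis
      have vy: "vec y = (\<Sum>i\<in>I - {p}. of_int (y i) *\<^sub>R \<alpha> i)"
        unfolding vec_def sum_split_p using y(2) by simp
      have "vec y \<bullet> \<nu> = 0" using a(2) z y(1) by simp
      then have s0: "(\<Sum>i\<in>I - {p}. of_int (y i) * (\<alpha> i \<bullet> \<nu>)) = 0" unfolding vy by (simp add: inner_sum_left)
      have "vec y \<bullet> vec y = 2" using z(2) y(1) by simp
      then have "(\<forall>i\<in>I. y i \<ge> 0) \<or> (\<forall>i\<in>I. y i \<le> 0)" using y(2) by (rule sign_coherent_finite)
      then have "of_int (y q) * (\<alpha> q \<bullet> \<nu>) = 0"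
      proof
        assume "\<forall>i\<in>I. y i \<ge> 0"
        then have "of_int (y i) * (\<alpha> i \<bullet> \<nu>) \<ge> 0" if "i \<in> I - {p}" for i
          using dom[OF that] that by (simp add: inner_commute)
        then show ?thesis using s0 sum_nonneg_eq_0_iff[of "I - {p}"] finite_I q(1) by (metis (no_types, lifting) finite_Diff)
      next
        assume "\<forall>i\<in>I. y i \<le> 0"
        then have "- (of_int (y i) * (\<alpha> i \<bullet> \<nu>)) \<ge> 0" if "i \<in> I - {p}" for i
          using dom[OF that] that by (simp add: inner_commute mult_nonpos_nonneg)
        moreover have "(\<Sum>i\<in>I - {p}. - (of_int (y i) * (\<alpha> i \<bullet> \<nu>))) = 0" using s0 by (simp add: sum_negf)
        ultimately have "- (of_int (y q) * (\<alpha> q \<bullet> \<nu>)) = 0"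
          using sum_nonneg_eq_0_iff[of "I - {p}" "\<lambda>i. - (of_int (y i) * (\<alpha> i \<bullet> \<nu>))"] finite_I q(1)
          by (metis (no_types, lifting) finite_Diff)
        then show ?thesis by simp
      qed
      then have "y q = 0" using q(2) by (simp add: inner_commute)
      then have "vec z \<bullet> coweight q = 0" using y(3)[OF q(1)] by simp
      then show ?thesis using z by (simp add: reflect_fixes)
    qed
    have qq: "\<alpha> q \<bullet> coweight q = 1" using coweight[OF q(1)] by simp
    then show "reflect (\<alpha> q) \<notin> {f. f (coweight q) = coweight q}"
      using norm2[of q] nonzero[of q] q(1) by (simp add: reflect_def)
    have "\<alpha> j \<bullet> coweight q = 0" using coweight[of j q] j by simp
    then show "reflect (\<alpha> j) \<in> {f. f (coweight q) = coweight q}" by (simp add: reflect_fixes)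
    show "\<alpha> j \<in> ?D" "\<alpha> q \<in> ?S" using j q alphaD alphaS by auto
  qed auto
  have fp: "\<alpha> p \<bullet> \<nu> = - (real (m q) * (\<alpha> q \<bullet> \<nu>))"
  proof -
    have "(\<Sum>i\<in>I - {p}. real (m i) * (\<alpha> i \<bullet> \<nu>)) = (\<Sum>i\<in>I - {p}. if i = q then real (m q) * (\<alpha> q \<bullet> \<nu>) else 0)"
      by (rule sum.cong) (use other in auto)
    then show ?thesis unfolding inner_alpha_p using finite_I q(1) by simp
  qed
  have qpos: "\<alpha> q \<bullet> \<nu> > 0" using q(2) by (simp add: inner_commute)
  have mq: "m q = 1"
  proof (rule ccontr)
    assume "m q \<noteq> 1"
    then have m2: "m q \<ge> 2" using mark_pos[of q] q by auto
    then obtain j where j: "j \<in> I" "\<alpha> j \<bullet> \<alpha> q = - 1" using neighbour q by blast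
    \<comment> \<open>\<open>\<alpha> p \<bullet> \<nu>\<close> is \<open>- u\<close>. On the
      lattice, reflections along vectors orthogonal to \<nu> keep \<nu>-values, the one along
      \<open>\<alpha> p\<close> changes them by multiples of \<open>u\<close>, and the one along
      \<open>\<alpha> q\<close> changes that of the neighbour \<open>\<alpha> j\<close> by
      \<open>\<alpha> q \<bullet> \<nu>\<close>, not a multiple of \<open>u\<close> when the mark is
      at least 2.\<close>
    define u where "u = real (m q) * (\<alpha> q \<bullet> \<nu>)"
    let ?K = "{f. \<forall>v\<in>coroot_lattice. f v \<in> coroot_lattice \<and> (\<exists>n::int. (f v - v) \<bullet> \<nu> = of_int n * u)}"
    have "\<alpha> p \<bullet> \<nu> = 0"
    proof (rule N.absorbs[of ?K "\<alpha> q"])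
      show "id \<in> ?K" by (auto intro: exI[of _ 0])
      show "f \<circ> g \<in> ?K" if f: "f \<in> ?K" and g: "g \<in> ?K" for f g
      proof -
        have "(f \<circ> g) v \<in> coroot_lattice \<and> (\<exists>n::int. ((f \<circ> g) v - v) \<bullet> \<nu> = of_int n * u)"
          if v: "v \<in> coroot_lattice" for v
        proof -
          have gv: "g v \<in> coroot_lattice" using g v by blast
          obtain n n' :: int where "(g v - v) \<bullet> \<nu> = of_int n * u" "(f (g v) - g v) \<bullet> \<nu> = of_int n' * u"
            using f g v gv by blast
          then have "((f \<circ> g) v - v) \<bullet> \<nu> = of_int (n + n') * u" by (simp add: inner_diff_left algebra_simps)
          then show ?thesis using f gv by (auto simp del: of_int_add)
        qed
        then show ?thesis by blast
      qed
      have latD: "reflect a v \<in> coroot_lattice" if "a \<in> ?D" "v \<in> coroot_lattice" for a v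
      proof -
        from that(1) obtain \<beta> where "\<rho> a \<beta> \<in> G" by blast
        then show ?thesis using linear_part_coroot_lattice[OF _ that(2)] by (metis linear_part_reflect)
      qed
      show "reflect a \<in> ?K" if "a \<in> ?D" "a \<bullet> \<nu> = 0" for a
      proof -
        have "(reflect a v - v) \<bullet> \<nu> = of_int 0 * u" for v using that by (simp add: reflect_def)
        then show ?thesis using latD[OF that(1)] by blast
      qed
      show "\<alpha> q \<in> ?S" "\<alpha> p \<in> ?D" using alphaS alphaD q p_in by auto
      show "reflect (\<alpha> q) \<notin> ?K"
      proof
        assume "reflect (\<alpha> q) \<in> ?K"
        moreover have "\<alpha> j \<in> coroot_lattice" using coroot_in_lattice[OF j(1)] coroot_eq[OF j(1)] by simp
        ultimately obtain n :: int where n: "(reflect (\<alpha> q) (\<alpha> j) - \<alpha> j) \<bullet> \<nu> = of_int n * u" by blast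
        have "(reflect (\<alpha> q) (\<alpha> j) - \<alpha> j) \<bullet> \<nu> = \<alpha> q \<bullet> \<nu>"
          using j(2) norm2[of q] q(1) by (simp add: reflect_def inner_commute)
        then have "of_int n * real (m q) = 1" using n qpos by (simp add: u_def)
        then have "n * int (m q) = 1" by (metis of_int_eq_1_iff of_int_mult of_int_of_nat_eq)
        then show False using m2 by (simp add: zmult_eq_1_iff)
      qed
      have "(reflect (\<alpha> p) v - v) \<bullet> \<nu> = of_int n * u" if "\<alpha> p \<bullet> v = of_int n" for v and n :: int
        using that norm2[OF p_in] fp by (simp add: reflect_def u_def)
      moreover have "\<exists>n::int. \<alpha> p \<bullet> v = of_int n" if "v \<in> coroot_lattice" for v
        using inner_coroot_lattice[OF p_in that] by (auto elim: Ints_cases)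
      ultimately show "reflect (\<alpha> p) \<in> ?K" using latD[OF alphaD[OF p_in]] by blast
    qed
    then show False using fp qpos m2 by simp
  qed
  show ?thesis using that[OF q(1) mq other qpos] .
qed

end

section \<open>Chambers of a subgroup of corank one\<close>

lemma diagram_iso_cong:
  assumes "D \<simeq>\<^sub>D Diagram J f" "\<And>x y. x \<in> J \<Longrightarrow> y \<in> J \<Longrightarrow> x \<noteq> y \<Longrightarrow> f x y = g x y"
  shows "D \<simeq>\<^sub>D Diagram J g"
proof (rule diagram_iso_trans[OF assms(1)])
  show "Diagram J f \<simeq>\<^sub>D Diagram J g"
    unfolding diagram_iso_def using assms(2) by (intro exI[of _ id]) auto
qed

locale corank_one_subgroup = affine_simply_laced I \<alpha> b c m d p
  for I :: "'i set" and \<alpha> :: "'i \<Rightarrow> 'a::euclidean_space" and b c m d p +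
  fixes W :: "('a \<Rightarrow> 'a) set" and \<nu> :: 'a and q :: 'i
  assumes W_subset: "W \<subseteq> G" and W_generated: "W = gen (W \<inter> reflections)"
    and W_iff: "a \<noteq> 0 \<Longrightarrow> \<rho> a \<beta> \<in> W \<longleftrightarrow> \<rho> a \<beta> \<in> G \<and> a \<bullet> \<nu> = 0"
    and q_in: "q \<in> I - {p}" and mark_q: "m q = 1"
    and orthogonal: "i \<in> I - {p, q} \<Longrightarrow> \<alpha> i \<bullet> \<nu> = 0" and q_pos: "\<alpha> q \<bullet> \<nu> > 0"
begin

text \<open>As \<open>p\<close> and \<open>q\<close> both have mark 1, \<open>\<alpha> p\<close> and
  \<open>\<alpha> q\<close> have opposite products with \<nu>. The roots of \<open>W\<close> are
  thus recognised by \<open>z p = z q\<close>.\<close>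

lemma vec_normal: "vec z \<bullet> \<nu> = of_int (z q - z p) * (\<alpha> q \<bullet> \<nu>)"
proof -
  have only_q: "(\<Sum>i\<in>I - {p}. t i * (\<alpha> i \<bullet> \<nu>)) = t q * (\<alpha> q \<bullet> \<nu>)" for t :: "'i \<Rightarrow> real"
  proof -
    have "(\<Sum>i\<in>I - {p}. t i * (\<alpha> i \<bullet> \<nu>)) = (\<Sum>i\<in>I - {p}. if i = q then t q * (\<alpha> q \<bullet> \<nu>) else 0)"
      by (rule sum.cong) (use orthogonal in auto)
    then show ?thesis using finite_I q_in by simp
  qed
  have "\<alpha> p \<bullet> \<nu> = - (\<alpha> q \<bullet> \<nu>)"
    unfolding inner_alpha_p only_q using mark_q by simp
  then show ?thesis
    unfolding vec_def sum_split_p inner_add_left inner_sum_left inner_scaleR_left only_q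
    by (simp add: algebra_simps)
qed

lemma W_root:
  assumes "a \<noteq> 0" "\<rho> a \<beta> \<in> W"
  obtains z k where "k \<noteq> 0" "vec z \<bullet> vec z = 2" "z p = z q" "a = k *\<^sub>R vec z" "\<beta> = k * off z"
proof -
  have aG: "\<rho> a \<beta> \<in> G" "a \<bullet> \<nu> = 0" using W_iff assms by auto
  obtain z k where z: "k \<noteq> 0" "vec z \<bullet> vec z = 2" "a = k *\<^sub>R vec z" "\<beta> = k * off z"
    by (rule reflection_root[OF assms(1) aG(1)])
  then have "vec z \<bullet> \<nu> = 0" using aG(2) by simp
  then have "z p = z q" using vec_normal q_pos by simp
  then show ?thesis using that z by blast
qed

lemma root_in_W:
  assumes "vec z \<bullet> vec z = 2" "z p = z q" shows "\<rho> (vec z) (off z) \<in> W"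
proof -
  have "vec z \<noteq> 0" using assms(1) by auto
  then show ?thesis using W_iff root_in_G[OF assms(1)] vec_normal assms(2) by simp
qed

lemma W_reflections: "W \<inter> reflections \<subseteq> reflections" by blast

lemma W_comp: "f \<in> W \<Longrightarrow> g \<in> W \<Longrightarrow> f \<circ> g \<in> W"
  using generate_comp[OF W_reflections] W_generated by metis

lemma W_inv: "f \<in> W \<Longrightarrow> inv_into UNIV f \<in> W"
  using generate_inv[OF W_reflections] W_generated by metis

lemma W_id: "id \<in> W" using generate_id W_generated by metis

lemma W_conjugate:
  "g \<in> W \<Longrightarrow> \<rho> a \<beta> \<in> W \<Longrightarrow> a \<noteq> 0 \<Longrightarrow>
     \<rho> (linear_part g a) (\<beta> + linear_part g a \<bullet> g 0) \<in> W"
  using conjugate_reflection_mem[OF W_reflections] W_generated by metis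

lemma mirror_image:
  assumes g: "g \<in> W" and H: "\<rho> a \<beta> \<in> W" "a \<noteq> 0" and x: "a \<bullet> g x = \<beta>"
  shows "x \<in> \<Union> (mirrors W)"
proof -
  define h where "h = inv_into UNIV g"
  have h: "h \<in> W" unfolding h_def by (rule W_inv[OF g])
  have iso: "affine_isometry h" using h W_subset G_isometry by blast
  have hg: "h (g x) = x" unfolding h_def using G_bij g W_subset by (meson bij_is_inj inv_f_f subsetD)
  have "linear_part h a \<bullet> x = \<beta> + linear_part h a \<bullet> h 0"
  proof -
    have "x = linear_part h (g x) + h 0" using hg by (simp add: linear_part_def)
    moreover have "linear_part h a \<bullet> linear_part h (g x) = a \<bullet> g x"
      using linear_part_orthogonal[OF iso] by (simp add: orthogonal_transformation_def)
    ultimately show ?thesis using x by (metis inner_add_right)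
  qed
  moreover have "\<rho> (linear_part h a) (\<beta> + linear_part h a \<bullet> h 0) \<in> W"
    using h H by (rule W_conjugate)
  moreover have "linear_part h a \<noteq> 0" using linear_part_nonzero[OF iso H(2)] .
  ultimately show ?thesis unfolding mirrors_def by blast
qed

text \<open>By discreteness only finitely many elements keep \<open>x\<close> within its original
  distance of \<open>y\<close>.\<close>

lemma nearest_in_orbit: "\<exists>w\<in>W. \<forall>w'\<in>W. dist (w x) y \<le> dist (w' x) y"
proof -
  let ?B = "{w \<in> W. dist (w x) y \<le> dist x y}"
  define r where "r = dist x y + dist y origin + dist origin x"
  have "?B \<subseteq> {g \<in> G. norm (g origin - origin) \<le> r}"
  proof
    fix w assume w: "w \<in> ?B"
    then have iso: "affine_isometry w" using W_subset G_isometry by blast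
    have "norm (w origin - w x) = norm (origin - x)"
      using affine_isometry_diff[OF iso, of origin x] linear_part_orthogonal[OF iso]
      by (metis orthogonal_transformation_norm)
    then have "dist (w origin) (w x) = dist origin x" by (simp add: dist_norm)
    moreover have "dist (w origin) origin \<le> dist (w origin) (w x) + (dist (w x) y + dist y origin)"
      using dist_triangle[of "w origin" origin "w x"] dist_triangle[of "w x" origin y] by linarith
    ultimately show "w \<in> {g \<in> G. norm (g origin - origin) \<le> r}"
      using w W_subset by (auto simp: r_def dist_norm)
  qed
  then have fin: "finite ?B" using finite_bounded finite_subset by blast
  have ne: "?B \<noteq> {}" using W_id by force
  obtain w where w: "w \<in> ?B" "\<And>w'. w' \<in> ?B \<Longrightarrow> dist (w x) y \<le> dist (w' x) y"
    using ex_is_arg_min_if_finite[OF fin ne, of "\<lambda>w. dist (w x) y"] by (auto simp: is_arg_min_linorder)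
  have "dist (w x) y \<le> dist (w' x) y" if w': "w' \<in> W" for w'
  proof (cases "dist (w' x) y \<le> dist x y")
    case True
    then show ?thesis using w(2) w' by simp
  next
    case False
    then show ?thesis using w(1) by simp
  qed
  then show ?thesis using w(1) by blast
qed

text \<open>\<open>J\<close> indexes candidate walls, and by \<open>sep\<close> no mirror of
  \<open>W\<close> meets the open region they bound. Every chamber is conjugate to that region: let
  \<open>w\<close> in \<open>W\<close> bring a point \<open>x\<close> of \<open>C\<close> as close
  as possible to an interior point \<open>y\<close>; if \<open>w x\<close> were beyond a wall,
  reflecting in that wall would bring it closer. Hence \<open>C\<close> is the region pulled back
  along \<open>w\<close>, with the same Gram matrix.\<close>

lemma chamber_diagram:
  fixes J :: "'j set" and \<zeta> :: "'j \<Rightarrow> 'i \<Rightarrow> int"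
  assumes fin: "finite J"
    and root: "\<And>j. j \<in> J \<Longrightarrow> vec (\<zeta> j) \<bullet> vec (\<zeta> j) = 2" "\<And>j. j \<in> J \<Longrightarrow> \<zeta> j p = \<zeta> j q"
    and gr: "\<And>j k. j \<in> J \<Longrightarrow> k \<in> J \<Longrightarrow> j \<noteq> k \<Longrightarrow> vec (\<zeta> j) \<bullet> vec (\<zeta> k) \<in> {0, - 1, - 2}"
    and sep: "\<And>z x. z p = z q \<Longrightarrow> vec z \<bullet> vec z = 2 \<Longrightarrow> (\<And>j. j \<in> J \<Longrightarrow> val (\<zeta> j) x > 0) \<Longrightarrow> val z x \<noteq> 0"
    and int: "\<exists>x. \<forall>j\<in>J. val (\<zeta> j) x > 0"
    and irr: "\<And>j. j \<in> J \<Longrightarrow> \<exists>x. val (\<zeta> j) x < 0 \<and> (\<forall>k\<in>J - {j}. val (\<zeta> k) x > 0)"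
    and C: "fundamental_chamber W C"
  shows "coxeter_diagram (closure C) \<simeq>\<^sub>D Diagram J
     (\<lambda>j k. if vec (\<zeta> j) \<bullet> vec (\<zeta> k) = 0 then 0 else if vec (\<zeta> j) \<bullet> vec (\<zeta> k) = - 1 then 1 else \<infinity>)"
proof -
  have Cc: "C \<in> components (UNIV - \<Union> (mirrors W))" using C by (simp add: fundamental_chamber_def)
  obtain x where x: "x \<in> C" using in_components_nonempty[OF Cc] by blast
  have C_sub: "C \<subseteq> UNIV - \<Union> (mirrors W)" using in_components_subset[OF Cc] .
  obtain y where y: "\<forall>j\<in>J. val (\<zeta> j) y > 0" using int by blast
  obtain w where w: "w \<in> W" "\<And>w'. w' \<in> W \<Longrightarrow> dist (w x) y \<le> dist (w' x) y"
    using nearest_in_orbit by blast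
  have isow: "affine_isometry w" using w W_subset G_isometry by blast
  have bijw: "bij w" using w W_subset G_bij by blast
  have nz: "vec (\<zeta> j) \<noteq> 0" if "j \<in> J" for j using root(1)[OF that] by auto
  have refl: "\<rho> (vec (\<zeta> j)) (off (\<zeta> j)) \<in> W" if "j \<in> J" for j
    using root that by (intro root_in_W) auto
  have off_mirror: "val (\<zeta> j) (w u) \<noteq> 0" if "u \<in> C" "j \<in> J" for u j
  proof
    assume "val (\<zeta> j) (w u) = 0"
    then have "u \<in> \<Union> (mirrors W)"
      using mirror_image[OF w(1) refl[OF that(2)] nz[OF that(2)]] by (simp add: val_eq)
    then show False using C_sub that by blast
  qed
  have pos: "val (\<zeta> j) (w x) > 0" if j: "j \<in> J" for j
  proof (rule ccontr)
    assume "\<not> val (\<zeta> j) (w x) > 0"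
    then have neg: "val (\<zeta> j) (w x) < 0" using off_mirror[OF x j] by linarith
    let ?r = "vec (\<zeta> j)" and ?u = "w x"
    define v where "v = val (\<zeta> j) ?u"
    have "(\<rho> ?r (off (\<zeta> j)) \<circ> w) \<in> W" using W_comp[OF refl[OF j] w(1)] .
    then have le: "dist ?u y \<le> dist (\<rho> ?r (off (\<zeta> j)) ?u) y"
      using w(2)[of "\<rho> ?r (off (\<zeta> j)) \<circ> w"] by simp
    have "\<rho> ?r (off (\<zeta> j)) ?u = ?u - v *\<^sub>R ?r"
      unfolding hyperplane_reflection_def root(1)[OF j] v_def val_eq
      by (simp only: nonzero_mult_div_cancel_left zero_neq_numeral not_False_eq_True)
    then have "\<rho> ?r (off (\<zeta> j)) ?u - y = (?u - y) - v *\<^sub>R ?r" by simp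
    then have "(dist (\<rho> ?r (off (\<zeta> j)) ?u) y)\<^sup>2 = ((?u - y) - v *\<^sub>R ?r) \<bullet> ((?u - y) - v *\<^sub>R ?r)"
      by (simp only: dist_norm power2_norm_eq_inner)
    also have "\<dots> = (?u - y) \<bullet> (?u - y) - 2 * v * (?r \<bullet> (?u - y)) + 2 * v * v"
      using root(1)[OF j] by (simp add: inner_diff_left inner_diff_right inner_commute algebra_simps)
    also have "?r \<bullet> (?u - y) = v - val (\<zeta> j) y" by (simp add: v_def val_eq inner_diff_right)
    also have "(?u - y) \<bullet> (?u - y) - 2 * v * (v - val (\<zeta> j) y) + 2 * v * v
        = (dist ?u y)\<^sup>2 + 2 * v * val (\<zeta> j) y"
      by (simp add: dist_norm power2_norm_eq_inner algebra_simps)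
    \<comment> \<open>The squared distance changes by \<open>2 * v * val (\<zeta> j) y\<close>,
      which is negative because \<open>w x\<close> and \<open>y\<close> lie on different sides of
      the wall.\<close>
    finally have "(dist (\<rho> ?r (off (\<zeta> j)) ?u) y)\<^sup>2 < (dist ?u y)\<^sup>2"
      using neg y j by (simp add: v_def mult_neg_pos)
    then show False using le by (simp add: power_mono leD)
  qed
  define D where "D = {u. \<forall>j\<in>J. val (\<zeta> j) (w u) > 0}"
  define \<gamma> where "\<gamma> j = linear_part (inv_into UNIV w) (vec (\<zeta> j))" for j
  define \<beta> where "\<beta> j = off (\<zeta> j) + \<gamma> j \<bullet> inv_into UNIV w 0" for j
  define h where "h = inv_into UNIV w"
  have isoh: "affine_isometry h" using W_inv[OF w(1)] W_subset G_isometry unfolding h_def by blast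
  have hw: "h (w u) = u" and wh: "w (h u) = u" for u
    unfolding h_def using bijw by (simp_all add: bij_is_inj bij_is_surj surj_f_inv_f)
  have oh: "orthogonal_transformation (linear_part h)" by (rule linear_part_orthogonal[OF isoh])
  have iph: "linear_part h u \<bullet> linear_part h v = u \<bullet> v" for u v
    using oh by (simp add: orthogonal_transformation_def)
  have val_w: "val (\<zeta> j) (w u) = \<gamma> j \<bullet> u - \<beta> j" for j u
  proof -
    have "u = linear_part h (w u) + h 0" using hw[of u] by (simp add: linear_part_def)
    then have "\<gamma> j \<bullet> u = vec (\<zeta> j) \<bullet> w u + \<gamma> j \<bullet> h 0"
      by (metis inner_add_right \<gamma>_def h_def iph)
    then show ?thesis by (simp add: val_eq \<beta>_def h_def)
  qed
  have D_eq: "D = (\<Inter>j\<in>J. {u. \<gamma> j \<bullet> u > \<beta> j})" unfolding D_def val_w by auto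
  have D_convex: "convex D" unfolding D_eq by (intro convex_INT convex_halfspace_gt)
  have CD: "C = D"
  proof
    show "C \<subseteq> D"
    proof
      fix u assume u: "u \<in> C"
      have conn: "connected C" using in_components_connected[OF Cc] .
      have "val (\<zeta> j) (w u) > 0" if j: "j \<in> J" for j
      proof (rule ccontr)
        assume "\<not> val (\<zeta> j) (w u) > 0"
        then have "val (\<zeta> j) (w u) < 0" using off_mirror[OF u j] by linarith
        then have "\<gamma> j \<bullet> u \<le> \<beta> j" "\<beta> j \<le> \<gamma> j \<bullet> x" using pos[OF j] unfolding val_w by auto
        then obtain v where "v \<in> C" "\<gamma> j \<bullet> v = \<beta> j"
          using connected_ivt_hyperplane[OF conn u x] by blast
        then show False using off_mirror[OF _ j, of v] unfolding val_w by simp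
      qed
      then show "u \<in> D" by (simp add: D_def)
    qed
    show "D \<subseteq> C"
    proof (rule components_maximal[OF Cc])
      show "connected D" using D_convex by (rule convex_connected)
      show "C \<inter> D \<noteq> {}" using x pos by (auto simp: D_def)
      show "D \<subseteq> UNIV - \<Union> (mirrors W)"
      proof
        fix u assume u: "u \<in> D"
        have "u \<notin> \<Union> (mirrors W)"
        proof
          assume "u \<in> \<Union> (mirrors W)"
          then obtain a \<theta> where a: "a \<noteq> 0" "\<rho> a \<theta> \<in> W" "a \<bullet> u = \<theta>"
            by (auto simp: mirrors_def)
          have aw: "\<rho> (linear_part w a) (\<theta> + linear_part w a \<bullet> w 0) \<in> W"
            using w(1) a(2,1) by (rule W_conjugate)
          have "linear_part w a \<noteq> 0" using linear_part_nonzero[OF isow a(1)] .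
          then obtain z k where z: "k \<noteq> 0" "vec z \<bullet> vec z = 2" "z p = z q" "linear_part w a = k *\<^sub>R vec z"
            "\<theta> + linear_part w a \<bullet> w 0 = k * off z" using W_root aw by metis
          have "linear_part w a \<bullet> w u = \<theta> + linear_part w a \<bullet> w 0"
          proof -
            have "w u = linear_part w u + w 0" by (simp add: linear_part_def)
            moreover have "linear_part w a \<bullet> linear_part w u = a \<bullet> u"
              using linear_part_orthogonal[OF isow] by (simp add: orthogonal_transformation_def)
            ultimately show ?thesis using a(3) by (simp add: inner_add_right)
          qed
          then have "k * val z (w u) = 0" using z(4,5) by (simp add: val_eq right_diff_distrib)
          then have "val z (w u) = 0" using z(1) by simp
          moreover have "val z (w u) \<noteq> 0" by (rule sep[OF z(3,2)]) (use u in \<open>auto simp: D_def\<close>)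
          ultimately show False by simp
        qed
        then show "u \<in> UNIV - \<Union> (mirrors W)" by simp
      qed
    qed
  qed
  have cl: "closure C = {u. \<forall>j\<in>J. \<gamma> j \<bullet> u \<ge> \<beta> j}"
  proof
    show "closure C \<subseteq> {u. \<forall>j\<in>J. \<gamma> j \<bullet> u \<ge> \<beta> j}"
    proof (rule closure_minimal)
      show "C \<subseteq> {u. \<forall>j\<in>J. \<gamma> j \<bullet> u \<ge> \<beta> j}" unfolding CD D_eq by (auto simp: less_imp_le)
      have "{u. \<forall>j\<in>J. \<gamma> j \<bullet> u \<ge> \<beta> j} = (\<Inter>j\<in>J. {u. \<gamma> j \<bullet> u \<ge> \<beta> j})" by auto
      then show "closed {u. \<forall>j\<in>J. \<gamma> j \<bullet> u \<ge> \<beta> j}" by (simp add: closed_INT closed_halfspace_ge)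
    qed
    show "{u. \<forall>j\<in>J. \<gamma> j \<bullet> u \<ge> \<beta> j} \<subseteq> closure C"
    proof
      fix u assume u: "u \<in> {u. \<forall>j\<in>J. \<gamma> j \<bullet> u \<ge> \<beta> j}"
      define f where "f n = u + (1 / real (Suc n)) *\<^sub>R (x - u)" for n :: nat
      have "f n \<in> C" for n
      proof -
        define t where "t = 1 / real (Suc n)"
        have t: "0 < t" "t \<le> 1" by (simp_all add: t_def)
        have "\<gamma> j \<bullet> f n > \<beta> j" if j: "j \<in> J" for j
        proof -
          have "\<gamma> j \<bullet> f n - \<beta> j = (1 - t) * (\<gamma> j \<bullet> u - \<beta> j) + t * (\<gamma> j \<bullet> x - \<beta> j)"
            unfolding f_def t_def[symmetric] by (simp add: inner_add_right inner_diff_right algebra_simps)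
          moreover have "(1 - t) * (\<gamma> j \<bullet> u - \<beta> j) \<ge> 0" using t u j by simp
          moreover have "t * (\<gamma> j \<bullet> x - \<beta> j) > 0" using t pos[OF j] unfolding val_w by simp
          ultimately show ?thesis by linarith
        qed
        then show ?thesis unfolding CD D_eq by simp
      qed
      moreover have "f \<longlonglongrightarrow> u + 0 *\<^sub>R (x - u)"
        unfolding f_def by (intro tendsto_intros LIMSEQ_Suc[OF lim_1_over_n])
      ultimately show "u \<in> closure C" unfolding closure_sequential by (intro exI[of _ f]) auto
    qed
  qed
  have "simply_laced_polyhedron J \<gamma> \<beta> (closure C)"
  proof
    show "finite J" by (rule fin)
    show "closure C = {u. \<forall>j\<in>J. \<gamma> j \<bullet> u \<ge> \<beta> j}" by (rule cl)
    show "\<gamma> j \<bullet> \<gamma> j = 2" if "j \<in> J" for j using root(1)[OF that] iph by (simp add: \<gamma>_def h_def)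
    show "\<gamma> j \<bullet> \<gamma> k \<in> {0, - 1, - 2}" if "j \<in> J" "k \<in> J" "j \<noteq> k" for j k
      using gr[OF that] iph by (simp add: \<gamma>_def h_def)
    show "\<exists>u. \<forall>j\<in>J. \<gamma> j \<bullet> u > \<beta> j" using pos unfolding val_w by (intro exI[of _ x]) auto
    show "\<exists>u. \<gamma> j \<bullet> u < \<beta> j \<and> (\<forall>k\<in>J - {j}. \<gamma> k \<bullet> u > \<beta> k)" if j: "j \<in> J" for j
    proof -
      obtain u where u: "val (\<zeta> j) u < 0" "\<forall>k\<in>J - {j}. val (\<zeta> k) u > 0" using irr[OF j] by blast
      have "val (\<zeta> k) u = \<gamma> k \<bullet> h u - \<beta> k" for k using val_w[of k "h u"] wh by simp
      then show ?thesis using u by (intro exI[of _ "h u"]) auto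
    qed
  qed
  then have "coxeter_diagram (closure C) \<simeq>\<^sub>D Diagram J
      (\<lambda>i j. if \<gamma> i \<bullet> \<gamma> j = 0 then 0 else if \<gamma> i \<bullet> \<gamma> j = - 1 then 1 else \<infinity>)"
    by (rule simply_laced_polyhedron.coxeter_diagram_iso)
  moreover have "\<gamma> i \<bullet> \<gamma> j = vec (\<zeta> i) \<bullet> vec (\<zeta> j)" for i j using iph by (simp add: \<gamma>_def h_def)
  ultimately show ?thesis by (simp cong: if_cong)
qed

text \<open>Removing the nodes \<open>p\<close> and \<open>q\<close> from the affine diagram leaves the components \<open>K k\<close>; the
  chamber has as walls the remaining nodes and, for each component, the lowest root of the
  component, which is written as a sum of simple roots over \<open>P k\<close>.\<close>

lemma component_diagram:
  fixes \<kappa> :: "'i \<Rightarrow> 'k" and P :: "'k \<Rightarrow> 'i set"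
  defines "K k \<equiv> {j \<in> I - {p, q}. \<kappa> j = k}"
  defines "N \<equiv> \<kappa> ` (I - {p, q})"
  defines "\<delta> x y \<equiv> (case (x, y) of (Inl i, Inl j) \<Rightarrow> \<alpha> i \<bullet> \<alpha> j
      | (Inl j, Inr k) \<Rightarrow> if \<kappa> j = k then (\<Sum>i\<in>P k. \<alpha> i) \<bullet> \<alpha> j else 0
      | (Inr k, Inl j) \<Rightarrow> if \<kappa> j = k then (\<Sum>i\<in>P k. \<alpha> i) \<bullet> \<alpha> j else 0
      | (Inr k, Inr l) \<Rightarrow> 0)"
  assumes orth: "\<And>i j. i \<in> I - {p, q} \<Longrightarrow> j \<in> I - {p, q} \<Longrightarrow> \<kappa> i \<noteq> \<kappa> j \<Longrightarrow> \<alpha> i \<bullet> \<alpha> j = 0"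
    and P: "\<And>k. k \<in> N \<Longrightarrow> P k \<subseteq> I"
      "\<And>k j. k \<in> N \<Longrightarrow> j \<in> I - K k \<Longrightarrow> j \<in> P k \<and> m j = 1"
      "\<And>k j. k \<in> N \<Longrightarrow> j \<in> K k \<inter> P k \<Longrightarrow> m j \<ge> 2"
    and lowest: "\<And>k. k \<in> N \<Longrightarrow> (\<Sum>i\<in>P k. \<alpha> i) \<bullet> (\<Sum>i\<in>P k. \<alpha> i) = 2"
      "\<And>k j. k \<in> N \<Longrightarrow> j \<in> K k \<Longrightarrow> (\<Sum>i\<in>P k. \<alpha> i) \<bullet> \<alpha> j \<in> {0, - 1, - 2}"
    and C: "fundamental_chamber W C"
  shows "coxeter_diagram (closure C) \<simeq>\<^sub>D Diagram ((I - {p, q}) <+> N)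
     (\<lambda>x y. if \<delta> x y = 0 then 0 else if \<delta> x y = - 1 then 1 else \<infinity>)"
proof -
  define \<gamma> where "\<gamma> x = (case x of Inl j \<Rightarrow> \<alpha> j | Inr k \<Rightarrow> (\<Sum>i\<in>P k. \<alpha> i))" for x
  define ind where "ind k i = (if i \<in> P k then 1 else 0 :: int)" for k i
  define \<zeta> where "\<zeta> x = (case x of Inl j \<Rightarrow> (\<lambda>i. if i = j then 1 else 0) | Inr k \<Rightarrow> ind k)" for x :: "'i + 'k"
  \<comment> \<open>The coefficients of the highest root of the component \<open>k\<close>, the
    negative of the lowest root: the assumptions on \<open>P\<close> make them vanish off
    \<open>K k\<close> and positive on it.\<close>
  define m' where "m' k j = int (m j) - ind k j" for k j
  have K_sub: "K k \<subseteq> I - {p}" "K k \<subseteq> I" "finite (K k)" "p \<notin> K k" "q \<notin> K k" for k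
    using finite_I by (auto simp: K_def)
  have pP: "ind k p = 1" "ind k q = 1" if "k \<in> N" for k
    using P(2)[OF that, of p] P(2)[OF that, of q] p_in q_in K_sub by (auto simp: ind_def)
  have m'1: "m' k j \<ge> 1" if "k \<in> N" "j \<in> K k" for k j
    using P(3)[OF that(1), of j] mark_pos[of j] K_sub(2)[of k] that(2) by (force simp: m'_def ind_def)
  have m'0: "m' k j = 0" if "k \<in> N" "j \<in> I - K k" for k j
    using P(2)[OF that] by (simp add: m'_def ind_def)
  have m'm: "m' k j \<le> int (m j)" for k j by (simp add: m'_def ind_def)
  have sumK: "(\<Sum>i\<in>I. if i \<in> K k then f i else 0) = sum f (K k)" for k and f :: "'i \<Rightarrow> 'z::comm_monoid_add"
    using finite_I K_sub(2)[of k] by (simp add: sum.inter_restrict[symmetric] inf.absorb2)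
  have vec_ind: "vec (ind k) = (\<Sum>i\<in>P k. \<alpha> i)" if "k \<in> N" for k
  proof -
    have "vec (ind k) = (\<Sum>i\<in>I. if i \<in> P k then \<alpha> i else 0)"
      unfolding vec_def ind_def by (rule sum.cong) auto
    then show ?thesis using finite_I P(1)[OF that] by (simp add: sum.inter_restrict[symmetric] inf.absorb2)
  qed
  have vec_unit: "vec (\<lambda>i. if i = j then 1 else 0) = \<alpha> j" if "j \<in> I" for j
  proof -
    have "vec (\<lambda>i. if i = j then 1 else 0) = (\<Sum>i\<in>I. if i = j then \<alpha> j else 0)"
      unfolding vec_def by (rule sum.cong) auto
    then show ?thesis using finite_I that by simp
  qed
  have val_unit: "val (\<lambda>i. if i = j then 1 else 0) x = \<alpha> j \<bullet> x - b j" if "j \<in> I" for j x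
  proof -
    have "val (\<lambda>i. if i = j then 1 else 0) x = (\<Sum>i\<in>I. if i = j then \<alpha> j \<bullet> x - b j else 0)"
      unfolding val_def by (rule sum.cong) auto
    then show ?thesis using finite_I that by simp
  qed
  have val_ind: "val (ind k) x = d - (\<Sum>j\<in>K k. m' k j * (\<alpha> j \<bullet> x - b j))" if k: "k \<in> N" for k x
  proof -
    have "d - val (ind k) x = (\<Sum>i\<in>I. m' k i * (\<alpha> i \<bullet> x - b i))"
      unfolding marks_sum[of x, symmetric] val_def sum_subtractf[symmetric]
      by (rule sum.cong) (auto simp: m'_def left_diff_distrib)
    also have "\<dots> = (\<Sum>i\<in>I. if i \<in> K k then m' k i * (\<alpha> i \<bullet> x - b i) else 0)"
      by (rule sum.cong) (use m'0[OF k] in auto)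
    finally show ?thesis unfolding sumK by simp
  qed
  have vec_ind': "vec (ind k) = - (\<Sum>j\<in>K k. m' k j *\<^sub>R \<alpha> j)" if k: "k \<in> N" for k
  proof -
    have "- vec (ind k) = (\<Sum>i\<in>I. real (m i) *\<^sub>R \<alpha> i) - vec (ind k)" using marks_sum_vec by simp
    also have "\<dots> = (\<Sum>i\<in>I. m' k i *\<^sub>R \<alpha> i)"
      unfolding vec_def sum_subtractf[symmetric] by (rule sum.cong) (auto simp: m'_def scaleR_diff_left)
    also have "\<dots> = (\<Sum>i\<in>I. if i \<in> K k then m' k i *\<^sub>R \<alpha> i else 0)"
      by (rule sum.cong) (use m'0[OF k] in auto)
    finally show ?thesis unfolding sumK by (metis minus_minus)
  qed
  have orthK: "\<alpha> i \<bullet> \<alpha> j = 0" if "i \<in> K k" "j \<in> K l" "k \<noteq> l" for i j k l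
    using orth[of i j] that by (auto simp: K_def)
  have ind_unit: "vec (ind k) \<bullet> \<alpha> j = 0" if "k \<in> N" "j \<in> K l" "k \<noteq> l" for k l j
    unfolding vec_ind'[OF that(1)] using orthK[OF _ that(2,3)] by (simp add: inner_sum_left)
  have ind_ind: "vec (ind k) \<bullet> vec (ind l) = 0" if "k \<in> N" "l \<in> N" "k \<noteq> l" for k l
    unfolding vec_ind'[OF that(2)] using ind_unit[OF that(1) _ that(3)] by (simp add: inner_sum_right)
  have ind_K: "vec (ind k) \<bullet> \<alpha> j \<in> {0, - 1, - 2}" if "k \<in> N" "j \<in> I - {p, q}" for k j
  proof (cases "j \<in> K k")
    case True
    then show ?thesis using lowest(2)[OF that(1) True] vec_ind[OF that(1)] by simp
  next
    case False
    then have "k \<noteq> \<kappa> j" "j \<in> K (\<kappa> j)" using that(2) by (auto simp: K_def)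
    then show ?thesis using ind_unit[OF that(1)] by simp
  qed
  let ?J = "(I - {p, q}) <+> N"
  have \<gamma>: "vec (\<zeta> x) = \<gamma> x" if "x \<in> ?J" for x
    using that vec_ind vec_unit by (auto simp: \<zeta>_def \<gamma>_def)
  have N_ex: "\<kappa> j \<in> N" "j \<in> K (\<kappa> j)" if "j \<in> I - {p, q}" for j using that by (auto simp: N_def K_def)
  have K_ne: "K k \<noteq> {}" if "k \<in> N" for k using that by (auto simp: N_def K_def)
  \<comment> \<open>The values on \<open>I - {p, q}\<close> can be prescribed freely, since the wall
    \<open>q\<close> of mark 1 compensates; the value of the lowest root of a component depends on
    that component only.\<close>
  have pick: "\<exists>x. (\<forall>j\<in>I - {p, q}. \<alpha> j \<bullet> x - b j = y j) \<and>
      (\<forall>k\<in>N. val (ind k) x = d - (\<Sum>j\<in>K k. m' k j * y j))" for y :: "'i \<Rightarrow> real"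
  proof -
    have q: "q \<in> I" using q_in by blast
    obtain x where x: "\<forall>i\<in>I - {q}. \<alpha> i \<bullet> x - b i = y i"
      using values_exist_except[OF q mark_q] by blast
    have "val (ind k) x = d - (\<Sum>j\<in>K k. m' k j * y j)" if "k \<in> N" for k
      unfolding val_ind[OF that] using x K_sub(2,5)[of k] by (auto intro!: sum.cong)
    then show ?thesis using x by auto
  qed
  define M where "M = (\<Sum>i\<in>I. real (m i))"
  \<comment> \<open>So small that values up to \<epsilon> on a component keep its lowest root
    positive.\<close>
  define \<epsilon> where "\<epsilon> = d / (1 + M)"
  have M0: "M \<ge> 0" by (simp add: M_def sum_nonneg)
  then have \<epsilon>: "\<epsilon> > 0" "\<epsilon> * M < d"
    using d_pos by (simp_all add: \<epsilon>_def pos_divide_less_eq)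
  have small: "d - (\<Sum>j\<in>K k. m' k j * y j) > 0" if k: "k \<in> N" and y: "\<And>j. j \<in> K k \<Longrightarrow> y j \<le> \<epsilon>"
    for k and y :: "'i \<Rightarrow> real"
  proof -
    have "(\<Sum>j\<in>K k. m' k j * y j) \<le> (\<Sum>j\<in>K k. real (m j) * \<epsilon>)"
    proof (rule sum_mono)
      fix j assume j: "j \<in> K k"
      have "m' k j * y j \<le> m' k j * \<epsilon>" using m'1[OF k j] y[OF j] by (intro mult_left_mono) auto
      also have "\<dots> \<le> real (m j) * \<epsilon>"
      proof (rule mult_right_mono)
        have "real_of_int (m' k j) \<le> real_of_int (int (m j))" using m'm[of k j] by (simp only: of_int_le_iff)
        then show "real_of_int (m' k j) \<le> real (m j)" by simp
      qed (use \<epsilon>(1) in simp)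
      finally show "m' k j * y j \<le> real (m j) * \<epsilon>" .
    qed
    also have "\<dots> \<le> M * \<epsilon>" unfolding M_def sum_distrib_right
      by (rule sum_mono2) (use finite_I K_sub \<epsilon>(1) in auto)
    also have "\<dots> < d" using \<epsilon>(2) by (simp add: mult.commute)
    finally show ?thesis by simp
  qed
  have \<delta>: "vec (\<zeta> x) \<bullet> vec (\<zeta> y) = \<delta> x y" if x: "x \<in> ?J" and y: "y \<in> ?J" and xy: "x \<noteq> y" for x y
  proof (cases x; cases y)
    fix i j assume e: "x = Inl i" "y = Inl j"
    then show ?thesis using x y vec_unit[of i] vec_unit[of j] by (auto simp: \<zeta>_def \<delta>_def)
  next
    fix i k assume e: "x = Inl i" "y = Inr k"
    then have i: "i \<in> I - {p, q}" and k: "k \<in> N" using x y by blast+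
    then show ?thesis using e ind_unit[OF k N_ex(2)[OF i]] vec_ind[OF k] vec_unit[of i]
      by (auto simp: \<zeta>_def \<delta>_def inner_commute)
  next
    fix i k assume e: "x = Inr k" "y = Inl i"
    then have i: "i \<in> I - {p, q}" and k: "k \<in> N" using x y by blast+
    then show ?thesis using e ind_unit[OF k N_ex(2)[OF i]] vec_ind[OF k] vec_unit[of i]
      by (auto simp: \<zeta>_def \<delta>_def)
  next
    fix k l assume e: "x = Inr k" "y = Inr l"
    then show ?thesis using ind_ind[of k l] x y xy by (auto simp: \<zeta>_def \<delta>_def)
  qed
  have iso: "coxeter_diagram (closure C) \<simeq>\<^sub>D Diagram ?J
     (\<lambda>j k. if vec (\<zeta> j) \<bullet> vec (\<zeta> k) = 0 then 0 else if vec (\<zeta> j) \<bullet> vec (\<zeta> k) = - 1 then 1 else \<infinity>)"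
  proof (rule chamber_diagram[OF _ _ _ _ _ _ _ C])
    show "finite ?J" using finite_I by (simp add: N_def)
    show "vec (\<zeta> x) \<bullet> vec (\<zeta> x) = 2" if "x \<in> ?J" for x
      unfolding \<gamma>[OF that] using that lowest(1) norm2 by (auto simp: \<gamma>_def)
    show "\<zeta> x p = \<zeta> x q" if "x \<in> ?J" for x
      using that pP by (auto simp: \<zeta>_def split: if_splits)
    show "vec (\<zeta> x) \<bullet> vec (\<zeta> y) \<in> {0, - 1, - 2}" if x: "x \<in> ?J" and y: "y \<in> ?J" and xy: "x \<noteq> y" for x y
      unfolding \<delta>[OF that] using x y xy gram lowest(2)
      by (cases x; cases y) (auto simp: \<delta>_def K_def)
    show "\<exists>x. \<forall>j\<in>?J. val (\<zeta> j) x > 0"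
    proof -
      obtain x where x: "\<forall>j\<in>I - {p, q}. \<alpha> j \<bullet> x - b j = \<epsilon>"
        "\<forall>k\<in>N. val (ind k) x = d - (\<Sum>j\<in>K k. m' k j * \<epsilon>)" using pick[of "\<lambda>_. \<epsilon>"] by blast
      have "val (\<zeta> j) x > 0" if "j \<in> ?J" for j
      proof (cases j)
        case (Inl i)
        then have i: "i \<in> I - {p, q}" using that by blast
        then have "val (\<zeta> j) x = \<epsilon>" using Inl bspec[OF x(1) i] by (simp add: \<zeta>_def val_unit)
        then show ?thesis using \<epsilon>(1) by simp
      next
        case (Inr k)
        then have "k \<in> N" using that by blast
        then show ?thesis using Inr x(2) small[of k "\<lambda>_. \<epsilon>"] by (simp add: \<zeta>_def)
      qed
      then show ?thesis by blast
    qed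
    show "\<exists>x. val (\<zeta> j) x < 0 \<and> (\<forall>k\<in>?J - {j}. val (\<zeta> k) x > 0)" if j: "j \<in> ?J" for j
    proof (cases j)
      case (Inl i)
      then have i: "i \<in> I - {p, q}" using j by auto
      define y where "y l = (if l = i then - \<epsilon> else \<epsilon>)" for l
      obtain x where x: "\<forall>j\<in>I - {p, q}. \<alpha> j \<bullet> x - b j = y j"
        "\<forall>k\<in>N. val (ind k) x = d - (\<Sum>j\<in>K k. m' k j * y j)" using pick[of y] by blast
      have "val (\<zeta> j) x < 0" using Inl i bspec[OF x(1) i] \<epsilon>(1) by (simp add: \<zeta>_def val_unit y_def)
      moreover have "val (\<zeta> k) x > 0" if "k \<in> ?J - {j}" for k
      proof (cases k)
        case (Inl l)
        then have l: "l \<in> I - {p, q}" "l \<noteq> i" using that \<open>j = Inl i\<close> by auto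
        then have "val (\<zeta> k) x = \<epsilon>" using Inl bspec[OF x(1) l(1)] by (simp add: \<zeta>_def val_unit y_def)
        then show ?thesis using \<epsilon>(1) by simp
      next
        case (Inr l)
        then have "l \<in> N" using that by blast
        moreover have "y j \<le> \<epsilon>" for j using \<epsilon>(1) by (simp add: y_def)
        ultimately show ?thesis using Inr x(2) small[of l y] by (simp add: \<zeta>_def)
      qed
      ultimately show ?thesis by blast
    next
      case (Inr k)
      then have k: "k \<in> N" using j by auto
      \<comment> \<open>A large value on the component \<open>k\<close> makes its lowest root
        negative and leaves all other walls positive.\<close>
      define y where "y l = (if l \<in> K k then 2 * d else \<epsilon>)" for l
      obtain x where x: "\<forall>j\<in>I - {p, q}. \<alpha> j \<bullet> x - b j = y j"
        "\<forall>k\<in>N. val (ind k) x = d - (\<Sum>j\<in>K k. m' k j * y j)" using pick[of y] by blast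
      obtain l where l: "l \<in> K k" using K_ne[OF k] by blast
      have "2 * d \<le> m' k l * y l" using l m'1[OF k l] d_pos by (simp add: y_def)
      also have "\<dots> \<le> (\<Sum>j\<in>K k. m' k j * y j)"
      proof (rule member_le_sum[OF l _ K_sub(3)])
        show "0 \<le> m' k j * y j" if "j \<in> K k - {l}" for j
          using m'1[OF k, of j] that d_pos by (simp add: y_def)
      qed
      finally have "val (\<zeta> j) x < 0" using x(2) k d_pos Inr by (simp add: \<zeta>_def)
      moreover have "val (\<zeta> i) x > 0" if i: "i \<in> ?J - {j}" for i
      proof (cases i)
        case (Inl l)
        then have "l \<in> I - {p, q}" using i by auto
        then show ?thesis using Inl x(1) \<epsilon>(1) d_pos by (auto simp: \<zeta>_def val_unit y_def)
      next
        case (Inr l)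
        then have l: "l \<in> N" "l \<noteq> k" using i \<open>j = Inr k\<close> by auto
        have "y i \<le> \<epsilon>" if "i \<in> K l" for i using that l by (auto simp: y_def K_def)
        then show ?thesis using small[OF l(1), of y] x(2) l(1) Inr by (simp add: \<zeta>_def)
      qed
      ultimately show ?thesis by blast
    qed
    show "val z x \<noteq> 0" if zpq: "z p = z q" and z2: "vec z \<bullet> vec z = 2" and pos: "\<And>j. j \<in> ?J \<Longrightarrow> val (\<zeta> j) x > 0" for z x
    proof -
      \<comment> \<open>Subtracting a multiple of the marks keeps the gradient and makes the
        coefficients vanish at \<open>p\<close> and \<open>q\<close>, both of mark 1; the gradient
        then splits into orthogonal parts \<open>w k\<close> along the components.\<close>
      define u where "u i = z i - z p * int (m i)" for i
      define w where "w k = (\<Sum>i\<in>K k. of_int (u i) *\<^sub>R \<alpha> i)" for k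
      have u0: "u p = 0" "u q = 0" using mark_p mark_q zpq by (simp_all add: u_def)
      have vu: "vec z = (\<Sum>i\<in>I. of_int (u i) *\<^sub>R \<alpha> i)"
      proof -
        have "(\<Sum>i\<in>I. of_int (u i) *\<^sub>R \<alpha> i) = vec z - of_int (z p) *\<^sub>R (\<Sum>i\<in>I. real (m i) *\<^sub>R \<alpha> i)"
          by (simp add: vec_def u_def scaleR_diff_left sum_subtractf scaleR_sum_right)
        then show ?thesis using marks_sum_vec by simp
      qed
      also have "\<dots> = (\<Sum>i\<in>I - {p, q}. of_int (u i) *\<^sub>R \<alpha> i)"
        by (rule sum.mono_neutral_right) (use finite_I u0 in auto)
      also have "\<dots> = (\<Sum>k\<in>N. w k)"
        unfolding w_def K_def N_def by (rule sum.group[symmetric]) (use finite_I in auto)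
      finally have vw: "vec z = (\<Sum>k\<in>N. w k)" .
      have finN: "finite N" using finite_I by (simp add: N_def)
      have ww: "w k \<bullet> w l = 0" if "k \<noteq> l" for k l
        unfolding w_def using orthK that by (simp add: inner_sum_left inner_sum_right)
      have norm_sum: "(\<Sum>k\<in>N. w k \<bullet> w k) = 2"
      proof -
        have "vec z \<bullet> vec z = (\<Sum>k\<in>N. \<Sum>l\<in>N. w k \<bullet> w l)"
          unfolding vw by (simp add: inner_sum_left inner_sum_right) (rule sum.swap)
        also have "\<dots> = (\<Sum>k\<in>N. \<Sum>l\<in>N. if l = k then w k \<bullet> w k else 0)"
          by (intro sum.cong refl) (use ww in auto)
        finally show ?thesis using z2 finN by simp
      qed
      then obtain k where k: "k \<in> N" "w k \<noteq> 0"
        by (metis (no_types, lifting) inner_zero_left sum.neutral zero_neq_numeral)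
      have wk_vec: "w k = vec (\<lambda>i. if i \<in> K k then u i else 0)"
        unfolding w_def vec_def sumK[symmetric] by (rule sum.cong) auto
      \<comment> \<open>Every part has an even squared norm and these add up to 2, so the root lives
        on a single component.\<close>
      obtain n :: int where n: "w k \<bullet> w k = 2 * of_int n" using even_norm unfolding wk_vec by blast
      have "w k \<bullet> w k > 0" using k(2) by simp
      then have "n \<ge> 1" using n by simp
      then have wk2: "w k \<bullet> w k \<ge> 2" using n by simp
      have w0: "w l = 0" if l: "l \<in> N" "l \<noteq> k" for l
      proof -
        have "(\<Sum>k\<in>N. w k \<bullet> w k) = w k \<bullet> w k + (\<Sum>l\<in>N - {k}. w l \<bullet> w l)"
          using finN k(1) by (rule sum.remove)
        then have "(\<Sum>l\<in>N - {k}. w l \<bullet> w l) \<le> 0" using norm_sum wk2 by linarith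
        moreover have "w l \<bullet> w l \<le> (\<Sum>l\<in>N - {k}. w l \<bullet> w l)"
          by (rule member_le_sum) (use l finN in auto)
        ultimately have "w l \<bullet> w l \<le> 0" by linarith
        then show ?thesis by (metis inner_gt_zero_iff not_le)
      qed
      have uout: "u j = 0" if j: "j \<in> I - K k" for j
      proof (cases "j \<in> {p, q}")
        case False
        then have jK: "j \<in> I - {p, q}" using j by blast
        then have "\<kappa> j \<noteq> k" using j by (auto simp: K_def)
        then have w: "w (\<kappa> j) = 0" using w0 N_ex(1)[OF jK] by blast
        have "w (\<kappa> j) = (\<Sum>i\<in>I - {p}. (if i \<in> K (\<kappa> j) then of_int (u i) else 0) *\<^sub>R \<alpha> i)"
          unfolding w_def by (rule sum.mono_neutral_cong_left) (use finite_I K_sub in auto)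
        moreover have "j \<in> I - {p}" using jK by blast
        ultimately have "w (\<kappa> j) \<bullet> coweight j = (if j \<in> K (\<kappa> j) then of_int (u j) else 0)"
          using coweight_sum by simp
        then show ?thesis using w N_ex(2)[OF jK] by simp
      qed (use u0 in auto)
      \<comment> \<open>The root over the affine simple system of the component \<open>k\<close>:
        coefficients on \<open>K k\<close>, and in the place of \<open>p\<close> the coefficient of
        the lowest root \<open>vec (ind k)\<close>. All walls of this system are positive at
        \<open>x\<close>, so sign coherence keeps the value of the root away from 0.\<close>
      define y where "y = (\<lambda>i. z i - z p * ind k i)(p := z p)"
      define \<delta> where "\<delta> i = (if i = p then vec (ind k) else \<alpha> i)" for i
      let ?L = "insert p (K k)"
      have regroup: "(\<Sum>i\<in>?L. of_int (y i) *\<^sub>R \<delta> i)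
          = vec (\<lambda>i. (if i \<in> K k then y i else 0) + y p * ind k i)" for y :: "'i \<Rightarrow> int"
      proof -
        have "(\<Sum>i\<in>?L. of_int (y i) *\<^sub>R \<delta> i) = of_int (y p) *\<^sub>R vec (ind k) + (\<Sum>i\<in>K k. of_int (y i) *\<^sub>R \<alpha> i)"
          using K_sub(3,4)[of k] by (simp add: \<delta>_def) (rule sum.cong, auto)
        also have "(\<Sum>i\<in>K k. of_int (y i) *\<^sub>R \<alpha> i) = vec (\<lambda>i. if i \<in> K k then y i else 0)"
          unfolding vec_def sumK[symmetric] by (rule sum.cong) auto
        finally show ?thesis
          by (simp add: vec_def scaleR_add_left sum.distrib scaleR_sum_right add.commute)
      qed
      have zy: "z i = (if i \<in> K k then y i else 0) + y p * ind k i" if i: "i \<in> I" for i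
      proof (cases "i \<in> K k")
        case True
        then show ?thesis using K_sub(4)[of k] by (auto simp: y_def)
      next
        case False
        then have "u i = 0" using uout i by blast
        moreover have "ind k i = 1" "m i = 1" using P(2)[OF k(1), of i] False i by (auto simp: ind_def)
        ultimately show ?thesis using False by (simp add: u_def y_def)
      qed
      have zL: "(\<Sum>i\<in>?L. of_int (y i) *\<^sub>R \<delta> i) = vec z"
        unfolding regroup vec_def using zy by (intro sum.cong) auto
      have sgn: "(\<forall>i\<in>?L. y i \<ge> 0) \<or> (\<forall>i\<in>?L. y i \<le> 0)"
      proof (rule sign_coherent[of _ \<delta>])
        show "finite ?L" using K_sub by simp
        show "(\<Sum>i\<in>?L. of_int (y i) *\<^sub>R \<delta> i) \<bullet> (\<Sum>i\<in>?L. of_int (y i) *\<^sub>R \<delta> i) = 2"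
          unfolding zL by (rule z2)
        show "\<exists>n::int. (\<Sum>i\<in>?L. of_int (y i) *\<^sub>R \<delta> i) \<bullet> (\<Sum>i\<in>?L. of_int (y i) *\<^sub>R \<delta> i) = 2 * of_int n"
          for y :: "'i \<Rightarrow> int" unfolding regroup by (rule even_norm)
        show "\<delta> i \<bullet> \<delta> j \<le> 0" if ij: "i \<in> ?L" "j \<in> ?L" "i \<noteq> j" for i j
        proof -
          have L: "l \<in> I - {p, q}" if "l \<in> K k" for l using that by (auto simp: K_def)
          consider "i \<in> K k" "j \<in> K k" | "i = p" "j \<in> K k" | "j = p" "i \<in> K k" using ij by blast
          then show ?thesis
          proof cases
            case 1
            then have "i \<in> I" "j \<in> I" "i \<noteq> p" "j \<noteq> p" using K_sub(2,4)[of k] by auto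
            then show ?thesis using gram[of i j] ij(3) by (auto simp: \<delta>_def)
          next
            case 2
            then show ?thesis using ind_K[OF k(1) L[of j]] K_sub(4)[of k] by (auto simp: \<delta>_def)
          next
            case 3
            then show ?thesis using ind_K[OF k(1) L[of i]] K_sub(4)[of k] by (auto simp: \<delta>_def inner_commute)
          qed
        qed
        show "(\<forall>j\<in>?L. y j = 0) \<or> (\<forall>j\<in>?L. y j > 0)"
          if y: "\<And>j. j \<in> ?L \<Longrightarrow> y j \<ge> 0" "(\<Sum>i\<in>?L. of_int (y i) *\<^sub>R \<delta> i) = 0" for y :: "'i \<Rightarrow> int"
        proof -
          define v where "v i = (if i \<in> K k then y i else 0) + y p * ind k i" for i
          have "vec v = 0" using y(2) unfolding regroup v_def .
          then have "(\<Sum>i\<in>I. real_of_int (v i) *\<^sub>R \<alpha> i) = 0" by (simp add: vec_def)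
          then have "real_of_int (v i) = real_of_int (v p) * real (m i)" if "i \<in> I" for i
            using that by (rule relation_marks)
          moreover have "v p = y p" using K_sub(4)[of k] pP[OF k(1)] by (simp add: v_def)
          ultimately have vi: "v i = y p * int (m i)" if "i \<in> I" for i
            using that by (metis of_int_eq_iff of_int_mult of_int_of_nat_eq)
          have yi: "y i = y p * m' k i" if i: "i \<in> K k" for i
            using vi[of i] i K_sub(2)[of k] by (auto simp: v_def m'_def algebra_simps)
          show ?thesis
          proof (cases "y p = 0")
            case True
            then show ?thesis using yi by auto
          next
            case False
            then have "y p > 0" using y(1)[of p] by simp
            moreover have "y i > 0" if "i \<in> K k" for i
              using yi[OF that] m'1[OF k(1) that] \<open>y p > 0\<close> by simp
            ultimately show ?thesis by auto
          qed
        qed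
      qed
      define v where "v i = (if i = p then val (ind k) x else \<alpha> i \<bullet> x - b i)" for i
      have vpos: "v i > 0" if "i \<in> ?L" for i
      proof (cases "i = p")
        case True
        have "Inr k \<in> ?J" using k(1) by blast
        then have "val (\<zeta> (Inr k)) x > 0" by (rule pos)
        then show ?thesis using True by (simp add: v_def \<zeta>_def)
      next
        case False
        then have i: "i \<in> I - {p, q}" using that by (auto simp: K_def)
        then have "Inl i \<in> ?J" by blast
        then have "val (\<zeta> (Inl i)) x > 0" by (rule pos)
        then show ?thesis using False i by (simp add: v_def \<zeta>_def val_unit)
      qed
      have val_y: "val z x = (\<Sum>i\<in>?L. of_int (y i) * v i)"
      proof -
        have "val z x = (\<Sum>i\<in>I. of_int ((if i \<in> K k then y i else 0) + y p * ind k i) * (\<alpha> i \<bullet> x - b i))"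
          unfolding val_def by (rule sum.cong) (use zy in auto)
        also have "\<dots> = (\<Sum>i\<in>I. (if i \<in> K k then of_int (y i) * (\<alpha> i \<bullet> x - b i) else 0))
            + of_int (y p) * val (ind k) x"
          unfolding val_def sum_distrib_left sum.distrib[symmetric]
          by (rule sum.cong) (auto simp: algebra_simps)
        also have "\<dots> = (\<Sum>i\<in>K k. of_int (y i) * v i) + of_int (y p) * v p"
          unfolding sumK using K_sub(4)[of k] by (auto simp: v_def intro!: sum.cong)
        finally show ?thesis using K_sub(3,4)[of k] by simp
      qed
      show "val z x \<noteq> 0"
      proof
        assume "val z x = 0"
        then have s0: "(\<Sum>i\<in>?L. of_int (y i) * v i) = 0" using val_y by simp
        have finL: "finite ?L" using K_sub by simp
        from sgn have "\<forall>i\<in>?L. of_int (y i) * v i = 0"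
        proof
          assume "\<forall>i\<in>?L. y i \<ge> 0"
          then have "of_int (y i) * v i \<ge> 0" if "i \<in> ?L" for i
            using vpos[OF that] that by (intro mult_nonneg_nonneg) (auto simp: less_imp_le)
          then show ?thesis using s0 sum_nonneg_eq_0_iff[OF finL, of "\<lambda>i. of_int (y i) * v i"] by blast
        next
          assume "\<forall>i\<in>?L. y i \<le> 0"
          then have "of_int (y i) * v i \<le> 0" if "i \<in> ?L" for i
            using vpos[OF that] that by (intro mult_nonpos_nonneg) (auto simp: less_imp_le)
          then have "\<And>i. i \<in> ?L \<Longrightarrow> - (of_int (y i) * v i) \<ge> 0" by simp
          moreover have "(\<Sum>i\<in>?L. - (of_int (y i) * v i)) = 0" using s0 by (simp only: sum_negf)
          ultimately have "\<forall>i\<in>?L. - (of_int (y i) * v i) = 0"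
            using sum_nonneg_eq_0_iff[OF finL, of "\<lambda>i. - (of_int (y i) * v i)"] by blast
          then show ?thesis by simp
        qed
        then have "\<forall>i\<in>?L. y i = 0" using vpos by (metis less_irrefl mult_eq_0_iff of_int_eq_0_iff)
        then have "(\<Sum>i\<in>?L. of_int (y i) *\<^sub>R \<delta> i) = 0" by (intro sum.neutral) simp
        then show False using zL z2 by simp
      qed
    qed
  qed
  show ?thesis by (intro diagram_iso_cong[OF iso]) (simp add: \<delta>)
qed

end

section \<open>The four families\<close>

lemma (in affine_simply_laced) corank_one_exists:
  assumes max: "maximal_reflection_subgroup W G" and inf: "infinite_index W G"
  obtains \<alpha>' b' \<nu> q where "corank_one_subgroup I \<alpha>' b' c m d p W \<nu> q"
    "\<And>i j. \<alpha>' i \<bullet> \<alpha>' j = \<alpha> i \<bullet> \<alpha> j"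
proof -
  obtain \<nu> where \<nu>: "\<nu> \<noteq> 0" "\<And>a c. a \<noteq> 0 \<Longrightarrow> \<rho> a c \<in> W \<Longrightarrow> a \<bullet> \<nu> = 0"
    using maximal_normal_exists[OF max inf] by blast
  obtain g where g: "g \<in> G" "\<forall>i\<in>I - {p}. \<nu> \<bullet> linear_part g (\<alpha> i) \<ge> 0"
    using dominant_conjugate by blast
  define \<alpha>' b' where "\<alpha>' = (\<lambda>i. linear_part g (\<alpha> i))" and "b' = (\<lambda>i. b i + linear_part g (\<alpha> i) \<bullet> g 0)"
  note conj = conjugate_system[OF g(1), folded \<alpha>'_def b'_def]
  interpret A: affine_simply_laced I \<alpha>' b' c m d p by (rule conj(1))
  have max': "maximal_reflection_subgroup W A.G" using max conj(2) by simp
  have abs: "absorbing_normal {a. a \<noteq> 0 \<and> (\<exists>c. \<rho> a c \<in> A.G)}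
      {k *\<^sub>R \<alpha>' i | k i. k \<noteq> 0 \<and> i \<in> I} \<nu>"
    "a \<noteq> 0 \<Longrightarrow> \<rho> a \<beta> \<in> W \<longleftrightarrow> \<rho> a \<beta> \<in> A.G \<and> a \<bullet> \<nu> = 0" for a \<beta>
    by (rule A.maximal_absorbing_normal[OF max']; use \<nu> in blast)+
  obtain q where q: "q \<in> I - {p}" "m q = 1" "\<And>i. i \<in> I - {p, q} \<Longrightarrow> \<alpha>' i \<bullet> \<nu> = 0" "\<alpha>' q \<bullet> \<nu> > 0"
    by (rule A.dominant_maximal[OF abs(1)]) (use g(2) in \<open>auto simp: \<alpha>'_def\<close>)
  have "corank_one_subgroup I \<alpha>' b' c m d p W \<nu> q"
  proof
    show "W \<subseteq> A.G" using maximal_reflection_subgroupD(1)[OF max'] .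
    show "W = gen (W \<inter> reflections)"
      using maximal_reflection_subgroupD(3)[OF max'] .
  qed (use abs(2) q in auto)
  then show ?thesis by (rule that) (simp add: \<alpha>'_def conj(3))
qed

section \<open>Diagrams with numbered nodes; types E_6, E_7 and E_8\<close>

definition gadj :: "nat set set \<Rightarrow> nat \<Rightarrow> nat \<Rightarrow> real" where
  "gadj E i j = (if i = j then 2 else if {i, j} \<in> E then - 1 else 0)"

lemma sum_gadj:
  assumes "finite P"
  shows "(\<Sum>i\<in>P. gadj E i j) = (if j \<in> P then 2 else 0) - real (card {i \<in> P. i \<noteq> j \<and> {i, j} \<in> E})"
proof -
  have "(\<Sum>i\<in>P. gadj E i j)
      = (\<Sum>i\<in>P. (if i = j then 2 else 0) - (if i \<noteq> j \<and> {i, j} \<in> E then 1 else 0))"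
    by (rule sum.cong) (auto simp: gadj_def)
  also have "\<dots> = (\<Sum>i\<in>P. if i = j then 2 else 0) - (\<Sum>i\<in>P. if i \<noteq> j \<and> {i, j} \<in> E then 1 else 0)"
    by (simp add: sum_subtractf)
  also have "(\<Sum>i\<in>P. if i \<noteq> j \<and> {i, j} \<in> E then 1 else 0 :: real) = card {i \<in> P. i \<noteq> j \<and> {i, j} \<in> E}"
    using assms by (simp add: sum.inter_filter[symmetric])
  finally show ?thesis using assms by simp
qed

lemma bij_betw_case_sum:
  assumes f: "bij_betw f S (V - {z})" "z \<in> V"
  shows "bij_betw (case_sum f (\<lambda>_. z)) (S <+> {()}) V"
  unfolding bij_betw_def
proof
  show "inj_on (case_sum f (\<lambda>_. z)) (S <+> {()})"
    using f bij_betwE[OF f(1)] by (intro inj_onI) (auto simp: bij_betw_def inj_on_def)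
  show "case_sum f (\<lambda>_. z) ` (S <+> {()}) = V"
    using f by (auto simp: bij_betw_def image_Un Plus_def image_image)
qed

locale labelled_subgroup = corank_one_subgroup "{0..n}" \<alpha> b c m d p W \<nu> q
  for n :: nat and \<alpha> :: "nat \<Rightarrow> 'a::euclidean_space" and b c m d p W \<nu> q +
  fixes E :: "nat set set" and C :: "'a set"
  assumes gadj: "i \<in> {0..n} \<Longrightarrow> j \<in> {0..n} \<Longrightarrow> \<alpha> i \<bullet> \<alpha> j = gadj E i j" and C: "fundamental_chamber W C"
begin

lemma sum_inner:
  assumes "P \<subseteq> {0..n}"
  shows "j \<in> {0..n} \<Longrightarrow> (\<Sum>i\<in>P. \<alpha> i) \<bullet> \<alpha> j = (\<Sum>i\<in>P. gadj E i j)"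
    and "(\<Sum>i\<in>P. \<alpha> i) \<bullet> (\<Sum>i\<in>P. \<alpha> i) = (\<Sum>j\<in>P. \<Sum>i\<in>P. gadj E i j)"
  using assms gadj by (auto simp: inner_sum_left inner_sum_right subset_iff intro!: sum.cong)

text \<open>The case of a single component after deleting \<open>p\<close> and \<open>q\<close>. Its
  lowest root is the sum of the simple roots over \<open>P\<close>; \<open>f\<close> renumbers the
  remaining nodes, and \<open>z\<close> is the number given to the lowest root in the target
  diagram.\<close>

lemma connected_diagram:
  assumes P: "{p, q} \<subseteq> P" "P \<subseteq> {0..n}" "\<forall>j\<in>P - {p, q}. m j \<ge> 2"
    and P_root: "(\<Sum>j\<in>P. \<Sum>i\<in>P. gadj E i j) = 2"
    and P_adj: "\<forall>j\<in>{0..n} - {p, q}. (\<Sum>i\<in>P. gadj E i j) = (if {f j, z} \<in> E' then - 1 else 0)"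
    and f: "bij_betw f ({0..n} - {p, q}) (V - {z})" "z \<in> V" and ne: "{0..n} - {p, q} \<noteq> {}"
    and adj: "\<forall>i\<in>{0..n} - {p, q}. \<forall>j\<in>{0..n} - {p, q}. i \<noteq> j \<longrightarrow> {f i, f j} \<in> E' \<longleftrightarrow> {i, j} \<in> E"
  shows "coxeter_diagram (closure C) \<simeq>\<^sub>D simple_diagram V E'"
proof -
  let ?L = "{0..n} - {p, q}"
  have N: "(\<lambda>_. ()) ` ?L = {()}" using ne by auto
  let ?f = "case_sum f (\<lambda>_. z)"
  have "bij_betw ?f (?L <+> {()}) V" using f by (rule bij_betw_case_sum)
  then have iso2: "Diagram (?L <+> {()}) D \<simeq>\<^sub>D simple_diagram V E'"
    if "\<And>x y. x \<in> ?L <+> {()} \<Longrightarrow> y \<in> ?L <+> {()} \<Longrightarrow> x \<noteq> y \<Longrightarrow>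
      D x y = (if {?f x, ?f y} \<in> E' then 1 else 0)" for D
    using that unfolding diagram_iso_def simple_diagram_def by (intro exI[of _ ?f]) auto
  show ?thesis
  proof (rule diagram_iso_trans[OF component_diagram[where \<kappa> = "\<lambda>_. ()" and P = "\<lambda>_. P", OF _ _ _ _ _ _ C, unfolded N] iso2])
    show "j \<in> P \<and> m j = 1" if "j \<in> {0..n} - {j \<in> ?L. () = k}" for j k
      using that P mark_p mark_q by auto
    have s: "(\<Sum>i\<in>P. \<alpha> i) \<bullet> \<alpha> j = (if {f j, z} \<in> E' then - 1 else 0)" if "j \<in> ?L" for j
      using sum_inner(1)[OF P(2), of j] P_adj that by auto
    show "(\<Sum>i\<in>P. \<alpha> i) \<bullet> \<alpha> j \<in> {0, - 1, - 2}" if "j \<in> {j \<in> ?L. () = k}" for j k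
      using s[of j] that by simp
    show "(\<Sum>i\<in>P. \<alpha> i) \<bullet> (\<Sum>i\<in>P. \<alpha> i) = 2" unfolding sum_inner(2)[OF P(2)] by (rule P_root)
    have g: "\<alpha> i \<bullet> \<alpha> j = (if {f i, f j} \<in> E' then - 1 else 0)" if "i \<in> ?L" "j \<in> ?L" "i \<noteq> j" for i j
      using adj that gadj[of i j] by (simp add: gadj_def)
    let ?t = "\<lambda>x y. case (x, y) of (Inl i, Inl j) \<Rightarrow> \<alpha> i \<bullet> \<alpha> j
      | (Inl j, Inr k) \<Rightarrow> if () = k then (\<Sum>i\<in>P. \<alpha> i) \<bullet> \<alpha> j else 0
      | (Inr k, Inl j) \<Rightarrow> if () = k then (\<Sum>i\<in>P. \<alpha> i) \<bullet> \<alpha> j else 0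
      | (Inr k, Inr l) \<Rightarrow> 0"
    show "(if ?t x y = 0 then 0 else if ?t x y = - 1 then 1 else \<infinity>) = (if {?f x, ?f y} \<in> E' then 1 else (0 :: enat))"
      if xy: "x \<in> ?L <+> {()}" "y \<in> ?L <+> {()}" "x \<noteq> y" for x y
    proof -
      have "?t x y = (if {?f x, ?f y} \<in> E' then - 1 else 0)"
      proof (cases x; cases y)
        fix i j assume "x = Inl i" "y = Inl j"
        moreover from this have "i \<in> ?L" "j \<in> ?L" "i \<noteq> j" using xy by blast+
        ultimately show ?thesis using g by simp
      next
        fix i k assume "x = Inl i" "y = Inr k"
        moreover from this have "i \<in> ?L" using xy by blast
        ultimately show ?thesis using s by simp
      next
        fix i k assume "x = Inr k" "y = Inl i"
        moreover from this have "i \<in> ?L" using xy by blast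
        ultimately show ?thesis using s by (simp add: insert_commute)
      qed (use xy(3) in simp)
      then show ?thesis by simp
    qed
  qed (use P in auto)
qed

end

definition E6_edges :: "nat set set" where
  "E6_edges = {{0, 1}, {1, 2}, {0, 3}, {3, 4}, {0, 5}, {5, 6}}"

definition E7_edges :: "nat set set" where
  "E7_edges = {{0, 1}, {1, 2}, {2, 3}, {0, 4}, {4, 5}, {5, 6}, {0, 7}}"

context labelled_subgroup
begin

text \<open>The two possible \<open>q\<close> are exchanged by a symmetry of the diagram.
  \<open>P\<close> is the path from \<open>p\<close> to \<open>q\<close>, and the simple roots along
  a path add up to a root. In the list for \<open>f\<close> the entries at \<open>p\<close> and
  \<open>q\<close> are fillers.\<close>

lemma E6_chamber:
  assumes n: "n = 6" "E = E6_edges" and m: "m = (!) [3, 2, 1, 2, 1, 2, 1]" and p: "p = 2"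
  shows "coxeter_diagram (closure C) \<simeq>\<^sub>D affine_D 5"
proof -
  have L: "{0..6::nat} = {0, 1, 2, 3, 4, 5, 6}" by auto
  have target: "affine_D 5 = simple_diagram {0, 1, 2, 3, 4, 5} {{1, 2}, {2, 3}, {3, 4}, {0, 2}, {3, 5}}"
  proof -
    have "{0..5::nat} = {0, 1, 2, 3, 4, 5}" by auto
    moreover have "{{i, Suc i} | i::nat. 1 \<le> i \<and> Suc i \<le> 5 - 1} = {{1, 2}, {2, 3}, {3, 4}}"
      by (auto simp: le_Suc_eq numeral_eq_Suc)
    ultimately show ?thesis by (simp add: affine_D_def insert_commute)
  qed
  have "q \<noteq> 2" "[3, 2, 1, 2, 1, 2, 1 :: nat] ! q = 1" using q_in p m mark_q by auto
  then consider "q = 4" | "q = 6" using q_in unfolding n(1) L by auto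
  then show ?thesis
  proof cases
    case 1
    show ?thesis unfolding target
      by (rule connected_diagram[where P = "{0, 1, 2, 3, 4}" and z = 0 and f = "(!) [3, 4, 0, 5, 0, 2, 1]"])
        (simp_all add: n(1) L 1 p m n(2) insert_Diff_if gadj_def E6_edges_def doubleton_eq_iff bij_betw_def insert_commute)
  next
    case 2
    show ?thesis unfolding target
      by (rule connected_diagram[where P = "{2, 1, 0, 5, 6}" and z = 0 and f = "(!) [3, 4, 0, 2, 1, 5, 0]"])
        (simp_all add: n(1) L 2 p m n(2) insert_Diff_if gadj_def E6_edges_def doubleton_eq_iff bij_betw_def insert_commute)
  qed
qed

text \<open>The only other node of mark 1 is the end of the second long arm. The lowest root, again
  the sum along the path from \<open>p\<close> to \<open>q\<close>, is joined only to the node 7 of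
  the short arm.\<close>

lemma E7_chamber:
  assumes n: "n = 7" "E = E7_edges" and m: "m = (!) [4, 3, 2, 1, 3, 2, 1, 2]" and p: "p = 3"
  shows "coxeter_diagram (closure C) \<simeq>\<^sub>D affine_E6"
proof -
  have L: "{0..7::nat} = {0, 1, 2, 3, 4, 5, 6, 7}" and L6: "{0..6::nat} = {0, 1, 2, 3, 4, 5, 6}" by auto
  have "q \<noteq> 3" "[4, 3, 2, 1, 3, 2, 1, 2 :: nat] ! q = 1" using q_in p m mark_q by auto
  then have q6: "q = 6" using q_in unfolding n(1) L by auto
  show ?thesis unfolding affine_E6_def
    by (rule connected_diagram[where P = "{0..6}" and z = 6 and f = "(!) [0, 1, 2, 0, 3, 4, 0, 5]"])
      (simp_all add: n(1) L L6 q6 p m n(2) insert_Diff_if gadj_def E7_edges_def doubleton_eq_iff bij_betw_def insert_commute)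
qed

text \<open>The affine node is the only one of mark 1, so nothing is left for
  \<open>q\<close>.\<close>

lemma E8_no_chamber:
  assumes "n = 8" and m: "m = (!) [6, 5, 4, 3, 2, 1, 4, 2, 3]" and p: "p = 5"
  shows False
proof -
  have L: "{0..n} = {0, 1, 2, 3, 4, 5, 6, 7, 8}" using assms(1) by auto
  have "q \<noteq> 5" "[6, 5, 4, 3, 2, 1, 4, 2, 3 :: nat] ! q = 1" using q_in p m mark_q by auto
  then show False using q_in unfolding L by auto
qed

end

section \<open>Type D: \<open>q\<close> at the same fork as \<open>p\<close> or at the opposite
  one\<close>

definition D_edges :: "nat \<Rightarrow> nat set set" where
  "D_edges n = {{i, Suc i} | i. 1 \<le> i \<and> Suc i \<le> n - 1} \<union> {{0, 2}, {n - 2, n}}"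

definition D_marks :: "nat \<Rightarrow> nat \<Rightarrow> nat" where
  "D_marks n i = (if i \<in> {0, 1, n - 1, n} then 1 else 2)"

lemma mem_D_edges:
  "{i, j} \<in> D_edges n \<longleftrightarrow> (j = Suc i \<and> 1 \<le> i \<and> j \<le> n - 1) \<or> (i = Suc j \<and> 1 \<le> j \<and> i \<le> n - 1)
    \<or> {i, j} = {0, 2} \<or> {i, j} = {n - 2, n}"
  unfolding D_edges_def by (auto simp: doubleton_eq_iff)

context labelled_subgroup
begin

text \<open>\<open>q\<close> is the companion of \<open>p\<close> at the same fork. The lowest root,
  the sum along the path 0, 2, 1, is joined to the node 3, and for \<open>n = 4\<close> to both 3
  and 4. In that case the result is a square, numbered as the cycle \<open>affine_D 3\<close>, and
  is treated separately.\<close>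

lemma D_chamber_end:
  assumes n: "n \<ge> 4" and E: "E = D_edges n" and m: "m = D_marks n" and p: "p = 0" and q: "q = 1"
  shows "coxeter_diagram (closure C) \<simeq>\<^sub>D affine_D (n - 1)"
proof -
  have s: "(\<Sum>i\<in>{0, 1, 2}. gadj (D_edges n) i j) = (if n = 4 \<and> j \<in> {3, 4} \<or> n > 4 \<and> j = 3 then - 1 else 0)"
    if "j \<in> {2..n}" for j
    using that n by (auto simp: gadj_def mem_D_edges doubleton_eq_iff)
  have S: "(\<Sum>j\<in>{0, 1, 2}. \<Sum>i\<in>{0, 1, 2}. gadj (D_edges n) i j) = 2"
    using n by (auto simp: gadj_def mem_D_edges doubleton_eq_iff)
  have K: "{0..n} - {0, 1} = {2..n}" by auto
  have conn: "coxeter_diagram (closure C) \<simeq>\<^sub>D simple_diagram {0..n - 1} E'"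
    if f: "bij_betw f {2..n} {1..n - 1}" and new: "\<forall>j\<in>{2..n}. {f j, 0} \<in> E' \<longleftrightarrow> n = 4 \<and> j \<in> {3, 4} \<or> n > 4 \<and> j = 3"
      and adj: "\<forall>i\<in>{2..n}. \<forall>j\<in>{2..n}. i \<noteq> j \<longrightarrow> {f i, f j} \<in> E' \<longleftrightarrow> {i, j} \<in> D_edges n" for f E'
  proof (rule connected_diagram[where P = "{0, 1, 2}" and z = 0 and f = f, unfolded p q E K])
    have "{0..n - 1} - {0} = {1..n - 1}" by auto
    then show "bij_betw f {2..n} ({0..n - 1} - {0})" using f by simp
  qed (use n s S adj new m in \<open>auto simp: D_marks_def\<close>)
  show ?thesis
  proof (cases "n = 4")
    case True
    have iv: "{2..n} = {2, 3, 4}" "{1..n - 1} = {1, 2, 3}" using True by auto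
    have "affine_D 3 = simple_diagram {0..3} {{0, 1}, {1, 2}, {2, 3}, {0, 3}}"
    proof -
      have "{{i, Suc i} | i::nat. i < 3} = {{0, 1}, {1, 2}, {2, 3}}"
        by (auto simp: less_Suc_eq numeral_eq_Suc)
      then show ?thesis by (simp add: affine_D_def affine_A_def insert_commute)
    qed
    moreover have "coxeter_diagram (closure C) \<simeq>\<^sub>D simple_diagram {0..n - 1} {{0, 1}, {1, 2}, {2, 3}, {0, 3}}"
    proof (rule conn[where f = "(!) [0, 0, 2, 1, 3]"])
      show "bij_betw ((!) [0, 0, 2, 1, 3]) {2..n} {1..n - 1 :: nat}"
        unfolding iv using True by (simp add: bij_betw_def insert_commute)
    qed (unfold iv, simp_all add: mem_D_edges doubleton_eq_iff True)
    ultimately show ?thesis using True by simp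
  next
    case False
    have "coxeter_diagram (closure C) \<simeq>\<^sub>D simple_diagram {0..n - 1} (D_edges (n - 1))"
    proof (rule conn[where f = "\<lambda>j. j - 1"])
      have n5: "5 \<le> n" using False n by simp
      show "bij_betw (\<lambda>j. j - 1) {2..n} {1..n - 1}"
        by (rule bij_betw_byWitness[of _ Suc]) auto
      show "\<forall>j\<in>{2..n}. {j - 1, 0} \<in> D_edges (n - 1) \<longleftrightarrow> n = 4 \<and> j \<in> {3, 4} \<or> n > 4 \<and> j = 3"
        using False n unfolding mem_D_edges doubleton_eq_iff by auto
      have "{i - 1, j - 1} \<in> D_edges (n - 1) \<longleftrightarrow> {i, j} \<in> D_edges n" if ij: "2 \<le> i" "2 \<le> j" for i j
      proof -
        obtain i' j' n' where *: "i = 2 + i'" "j = 2 + j'" "n = 5 + n'"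
          using ij n5 unfolding le_iff_add by blast
        show ?thesis unfolding * by (auto simp: mem_D_edges doubleton_eq_iff)
      qed
      then show "\<forall>i\<in>{2..n}. \<forall>j\<in>{2..n}. i \<noteq> j \<longrightarrow> {i - 1, j - 1} \<in> D_edges (n - 1) \<longleftrightarrow> {i, j} \<in> D_edges n"
        by simp
    qed
    moreover have "n - 1 \<noteq> 3" using False by simp
    ultimately show ?thesis by (simp add: affine_D_def D_edges_def)
  qed
qed

text \<open>\<open>q\<close> is an end node at the opposite fork and \<open>r\<close> its companion.
  The lowest root, the sum along the path from 0 to \<open>q\<close>, is joined to the ends 1 and
  \<open>r\<close> of the remaining path and closes it to a cycle of \<open>n\<close> nodes, in
  which it gets the number 0 and \<open>r\<close> the number \<open>n - 1\<close>.\<close>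

lemma D_chamber_across:
  assumes n: "n \<ge> 4" and E: "E = D_edges n" and m: "m = D_marks n" and p: "p = 0" and q: "q = n \<or> q = n - 1"
  shows "coxeter_diagram (closure C) \<simeq>\<^sub>D affine_A (n - 1)"
proof -
  obtain k where k: "n = 4 + k" using n unfolding le_iff_add by blast
  let ?P = "insert 0 (insert q {2..n - 2})"
  let ?E' = "{{i, Suc i} | i. i < n - 1} \<union> {{0, n - 1}}"
  define r where "r = 2 * n - 1 - q"
  have qr: "q = n \<and> r = n - 1 \<or> q = n - 1 \<and> r = n" using q n by (auto simp: r_def)
  have nbr: "{i \<in> ?P. i \<noteq> j \<and> {i, j} \<in> D_edges n} = (if j \<le> 1 then {2} else if j \<ge> n - 1 then {n - 2}
      else {if j = 2 then 0 else j - 1, if j = n - 2 then q else Suc j})" if "j \<in> {0..n}" for j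
    using qr
  proof (elim disjE conjE)
    assume "q = n" "r = n - 1"
    then show ?thesis using that unfolding k by (auto simp: mem_D_edges doubleton_eq_iff)
  next
    assume "q = n - 1" "r = n"
    then show ?thesis using that unfolding k by (auto simp: mem_D_edges doubleton_eq_iff)
  qed
  have s: "(\<Sum>i\<in>?P. gadj (D_edges n) i j) = (if j \<in> {0, q} then 1 else if j \<in> {1, r} then - 1 else 0)"
    if "j \<in> {0..n}" for j
  proof -
    have "finite ?P" by simp
    show ?thesis unfolding sum_gadj[OF \<open>finite ?P\<close>] nbr[OF that] using that n qr by (elim disjE conjE) auto
  qed
  have "(\<Sum>j\<in>?P. \<Sum>i\<in>?P. gadj (D_edges n) i j) = (\<Sum>j\<in>?P. if j \<in> {0, q} then 1 else 0)"
    by (rule sum.cong) (use s n qr in auto)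
  also have "\<dots> = (\<Sum>j\<in>{0, q}. 1)"
    by (rule sum.mono_neutral_cong_right) (use n qr in auto)
  also have "\<dots> = 2" using n qr by auto
  finally have S: "(\<Sum>j\<in>?P. \<Sum>i\<in>?P. gadj (D_edges n) i j) = 2" .
  let ?f = "\<lambda>j. if j = r then n - 1 else j"
  have "coxeter_diagram (closure C) \<simeq>\<^sub>D simple_diagram {0..n - 1} ?E'"
  proof (rule connected_diagram[where P = ?P and z = 0 and f = ?f, unfolded p E])
    show "bij_betw ?f ({0..n} - {0, q}) ({0..n - 1} - {0})"
      by (rule bij_betw_byWitness[of _ "\<lambda>j. if j = n - 1 then r else j"]) (use n qr in auto)
    show "\<forall>j\<in>{0..n} - {0, q}. (\<Sum>i\<in>?P. gadj (D_edges n) i j) = (if {?f j, 0} \<in> ?E' then - 1 else 0)"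
    proof
      fix j assume j: "j \<in> {0..n} - {0, q}"
      have "{i, 0} \<in> ?E' \<longleftrightarrow> i = 1 \<or> i = n - 1" if "i > 0" for i using that n by (auto simp: doubleton_eq_iff)
      moreover have "?f j > 0" "?f j = 1 \<or> ?f j = n - 1 \<longleftrightarrow> j \<in> {1, r}" using j n qr by auto
      moreover have "(\<Sum>i\<in>?P. gadj (D_edges n) i j) = (if j \<in> {1, r} then - 1 else 0)" using s[of j] j by simp
      ultimately show "(\<Sum>i\<in>?P. gadj (D_edges n) i j) = (if {?f j, 0} \<in> ?E' then - 1 else 0)" by presburger
    qed
    show "\<forall>i\<in>{0..n} - {0, q}. \<forall>j\<in>{0..n} - {0, q}. i \<noteq> j \<longrightarrow> {?f i, ?f j} \<in> ?E' \<longleftrightarrow> {i, j} \<in> D_edges n"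
      using qr
    proof (elim disjE conjE)
      assume "q = n" "r = n - 1"
      then show ?thesis unfolding k by (auto simp: doubleton_eq_iff mem_D_edges)
    next
      assume "q = n - 1" "r = n"
      then show ?thesis unfolding k by (auto simp: doubleton_eq_iff mem_D_edges)
    qed
    have "1 \<in> {0..n} - {0, q}" using n qr by auto
    then show "{0..n} - {0, q} \<noteq> {}" by blast
  qed (use n S m qr in \<open>auto simp: D_marks_def simp del: sum.insert\<close>)
  then show ?thesis using n by (auto simp: affine_A_def)
qed

lemma D_chamber:
  assumes n: "n \<ge> 4" and E: "E = D_edges n" and m: "m = D_marks n" and p: "p = 0"
  shows "coxeter_diagram (closure C) \<simeq>\<^sub>D affine_D (n - 1) \<or> coxeter_diagram (closure C) \<simeq>\<^sub>D affine_A (n - 1)"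
proof -
  have "q \<noteq> 0" "D_marks n q = 1" using q_in p m mark_q by auto
  then have "q = 1 \<or> q = n \<or> q = n - 1" unfolding D_marks_def by (metis insertE emptyE numeral_eq_one_iff semiring_norm(85))
  then show ?thesis using D_chamber_end[OF n E m p] D_chamber_across[OF n E m p] by blast
qed

end

section \<open>Type A: a cycle with two nodes removed\<close>

definition cycle_edges :: "nat \<Rightarrow> nat set set" where
  "cycle_edges n = {{i, Suc i} | i. i < n} \<union> {{0, n}}"

lemma mem_cycle_edges:
  "{i, j} \<in> cycle_edges n \<longleftrightarrow> (j = Suc i \<and> i < n) \<or> (i = Suc j \<and> j < n) \<or> i = 0 \<and> j = n \<or> i = n \<and> j = 0"
  unfolding cycle_edges_def by (auto simp: doubleton_eq_iff)

lemma affine_A_eq: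
  "affine_A n = Diagram (if n = 0 then {} else {0..n})
     (\<lambda>i j. if n = 0 then 0 else if n = 1 then \<infinity> else if {i, j} \<in> cycle_edges n then 1 else 0)"
  by (auto simp: affine_A_def simple_diagram_def cycle_edges_def)

lemma sum_gadj_cycle:
  assumes "finite P" "n \<ge> 2" "j \<in> {0..n}"
  shows "(\<Sum>i\<in>P. gadj (cycle_edges n) i j) = (if j \<in> P then 2 else 0)
    - (if (if j = n then 0 else Suc j) \<in> P then 1 else 0) - (if (if j = 0 then n else j - 1) \<in> P then 1 else 0)"
proof -
  have "(\<Sum>i\<in>P. gadj (cycle_edges n) i j) = (\<Sum>i\<in>P. (if i = j then 2 else 0)
      - (if i = (if j = n then 0 else Suc j) then 1 else 0) - (if i = (if j = 0 then n else j - 1) then 1 else 0))"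
    by (rule sum.cong) (use assms in \<open>auto simp: gadj_def mem_cycle_edges\<close>)
  also have "\<dots> = (\<Sum>i\<in>P. if i = j then 2 else 0)
      - (\<Sum>i\<in>P. if i = (if j = n then 0 else Suc j) then 1 else 0)
      - (\<Sum>i\<in>P. if i = (if j = 0 then n else j - 1) then 1 else 0)"
    by (simp only: sum_subtractf)
  finally show ?thesis using assms(1) by simp
qed

context labelled_subgroup
begin

text \<open>Without 0 and \<open>q\<close> two arcs remain, told apart by the truth value of
  \<open>j < q\<close>; the lowest root of an arc is the sum over its complement \<open>P k\<close>.
  An arc is empty when \<open>q\<close> is 1 or \<open>n\<close>; \<open>?N\<close> keeps the
  non-empty ones, and an empty one accounts for a summand \<open>affine_A 0\<close>. A one-node arc
  is joined to its lowest root by a bold edge, as in \<open>affine_A 1\<close>.\<close>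

lemma A_chamber:
  assumes n: "n \<ge> 2" and E: "E = cycle_edges n" and m: "m = (\<lambda>_. 1)" and p: "p = 0"
  shows "coxeter_diagram (closure C) \<simeq>\<^sub>D affine_A (q - 1) +\<^sub>D affine_A (n - q)"
proof -
  have q: "q \<in> {1..n}" "q \<in> {0..n}" using q_in p by auto
  let ?E = "cycle_edges n"
  define P where "P k = (if k then insert 0 {q..n} else {0..q})" for k
  have finP: "finite (P k)" for k by (simp add: P_def)
  have sT: "(\<Sum>i\<in>P True. gadj ?E i j) = (if j = 0 \<or> j = q then 1 else if j > q then 0
      else - ((if j = 1 then 1 else 0) + (if j = q - 1 then 1 else 0)))" if "j \<in> {0..n}" "q \<ge> 2" for j
    unfolding sum_gadj_cycle[OF finP n that(1)] using that q by (auto simp: P_def)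
  have sF: "(\<Sum>i\<in>P False. gadj ?E i j) = (if j = 0 \<or> j = q then 1 else if j < q then 0
      else - ((if j = n then 1 else 0) + (if j = Suc q then 1 else 0)))" if "j \<in> {0..n}" "q < n" for j
    unfolding sum_gadj_cycle[OF finP n that(1)] using that q n by (auto simp: P_def)
  let ?N = "(\<lambda>j. j < q) ` ({0..n} - {0, q})"
  have N: "?N = {k. if k then q \<ge> 2 else q < n}"
  proof -
    have "k \<in> ?N \<longleftrightarrow> (if k then q \<ge> 2 else q < n)" for k
    proof
      show "(if k then q \<ge> 2 else q < n)" if "k \<in> ?N" using that by auto
      assume "if k then q \<ge> 2 else q < n"
      then show "k \<in> ?N" using q(1) by (intro image_eqI[of _ _ "if k then 1 else n"]) (auto split: if_splits)
    qed
    then show ?thesis by blast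
  qed
  have S: "(\<Sum>j\<in>P k. \<Sum>i\<in>P k. gadj ?E i j) = 2" if "k \<in> ?N" for k
  proof -
    have "(\<Sum>j\<in>P k. \<Sum>i\<in>P k. gadj ?E i j) = (\<Sum>j\<in>P k. if j \<in> {0, q} then 1 else 0)"
      by (rule sum.cong, simp, cases k) (use that sT sF q in \<open>auto simp: P_def N\<close>)
    also have "\<dots> = (\<Sum>j\<in>{0, q}. 1)"
      by (rule sum.mono_neutral_cong_right) (use q finP in \<open>auto simp: P_def\<close>)
    finally show ?thesis using q by simp
  qed
  let ?f = "case_sum (\<lambda>j. if j < q then Inl j else Inr (j - q)) (\<lambda>k. if k then Inl 0 else Inr 0) :: nat + bool \<Rightarrow> nat + nat"
  let ?h = "case_sum (\<lambda>j. if j = 0 then Inr True else Inl j) (\<lambda>j. if j = 0 then Inr False else Inl (j + q)) :: nat + nat \<Rightarrow> nat + bool"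
  have f: "bij_betw ?f (({0..n} - {0, q}) <+> ?N) (nodes (affine_A (q - 1) +\<^sub>D affine_A (n - q)))"
    unfolding N by (rule bij_betw_byWitness[of _ ?h]) (use q in \<open>auto simp: affine_A_eq diagram_sum_def split: if_splits\<close>)
  show ?thesis (is "_ \<simeq>\<^sub>D ?T")
  proof (rule diagram_iso_trans[OF component_diagram[where \<kappa> = "\<lambda>j. j < q" and P = P, OF _ _ _ _ _ _ C, unfolded p]])
    have PL: "P k \<subseteq> {0..n}" for k using q by (auto simp: P_def)
    note ip = sum_inner(1)[OF PL] gadj
    let ?t = "\<lambda>x y. case (x, y) of (Inl i, Inl j) \<Rightarrow> \<alpha> i \<bullet> \<alpha> j
      | (Inl j, Inr k) \<Rightarrow> if (j < q) = k then (\<Sum>i\<in>P k. \<alpha> i) \<bullet> \<alpha> j else 0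
      | (Inr k, Inl j) \<Rightarrow> if (j < q) = k then (\<Sum>i\<in>P k. \<alpha> i) \<bullet> \<alpha> j else 0
      | (Inr k, Inr l) \<Rightarrow> 0"
    let ?d = "\<lambda>x y. if ?t x y = 0 then 0 else if ?t x y = - 1 then 1 else (\<infinity> :: enat)"
    have lowest_edge: "edge_mult ?T (?f (Inr k)) (?f (Inl j)) = ?d (Inr k) (Inl j)" "edge_mult ?T (?f (Inl j)) (?f (Inr k)) = ?d (Inl j) (Inr k)"
      if "j \<in> {0..n} - {0, q}" "k \<in> ?N" for j k
    proof -
      have j: "j \<in> {0..n}" "j \<noteq> 0" "j \<noteq> q" using that by auto
      show "edge_mult ?T (?f (Inr k)) (?f (Inl j)) = ?d (Inr k) (Inl j)" "edge_mult ?T (?f (Inl j)) (?f (Inr k)) = ?d (Inl j) (Inr k)"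
        using that(2) j sT[of j] sF[of j] unfolding N
        by (cases k; auto simp: ip E diagram_sum_def affine_A_eq mem_cycle_edges)+
    qed
    have node_edge: "edge_mult ?T (?f (Inl i)) (?f (Inl j)) = ?d (Inl i) (Inl j)"
      if ij: "i \<in> {0..n} - {0, q}" "j \<in> {0..n} - {0, q}" "i \<noteq> j" for i j
    proof -
      have pos: "i > 0" "j > 0" "i \<noteq> q" "j \<noteq> q" "i \<le> n" "j \<le> n" using ij by auto
      have "?d (Inl i) (Inl j) = (if j = Suc i \<or> i = Suc j then 1 else 0)"
        using pos ij(3) by (auto simp: ip E gadj_def mem_cycle_edges)
      moreover have "edge_mult ?T (?f (Inl i)) (?f (Inl j)) = (if j = Suc i \<or> i = Suc j then 1 else 0)"
      proof (cases "i < q"; cases "j < q")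
        assume "i < q" "j < q"
        moreover from this have "q - 1 \<noteq> 0" "q - 1 \<noteq> 1" "i \<noteq> 0" "j \<noteq> 0" using pos ij(3) by auto
        ultimately show ?thesis unfolding affine_A_eq by (auto simp: diagram_sum_def mem_cycle_edges)
      next
        assume "\<not> i < q" "\<not> j < q"
        then obtain i' j' where "i = Suc i' + q" "j = Suc j' + q" using pos
          by (metis add.commute le_neq_implies_less less_imp_Suc_add not_le add_Suc_shift add_Suc_right)
        moreover from this have "n - q \<noteq> 0" "n - q \<noteq> 1" using pos ij(3) by auto
        ultimately show ?thesis using pos unfolding affine_A_eq by (auto simp: diagram_sum_def mem_cycle_edges)
      qed (use pos in \<open>simp_all add: diagram_sum_def\<close>)
      ultimately show ?thesis by simp
    qed
    have "edge_mult ?T (?f x) (?f y) = ?d x y"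
      if xy: "x \<in> ({0..n} - {0, q}) <+> ?N" "y \<in> ({0..n} - {0, q}) <+> ?N" "x \<noteq> y" for x y
    proof (cases x; cases y)
      fix i j assume "x = Inl i" "y = Inl j"
      then show ?thesis using node_edge[of i j] xy by blast
    next
      fix i k assume "x = Inl i" "y = Inr k"
      then show ?thesis using lowest_edge(2)[of i k] xy by blast
    next
      fix i k assume "x = Inr k" "y = Inl i"
      then show ?thesis using lowest_edge(1)[of i k] xy by blast
    next
      fix k k' assume "x = Inr k" "y = Inr k'"
      then show ?thesis using xy(3) by (auto simp: diagram_sum_def)
    qed
    then show "Diagram (({0..n} - {0, q}) <+> ?N) ?d \<simeq>\<^sub>D ?T"
      using f unfolding diagram_iso_def diagram.sel by blast
    show "\<alpha> i \<bullet> \<alpha> j = 0" if "i \<in> {0..n} - {0, q}" "j \<in> {0..n} - {0, q}" "(i < q) \<noteq> (j < q)" for i j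
      using that by (auto simp: ip E gadj_def mem_cycle_edges)
    show "P k \<subseteq> {0..n}" for k by (rule PL)
    show "j \<in> P k \<and> m j = 1" if "j \<in> {0..n} - {j \<in> {0..n} - {0, q}. (j < q) = k}" for j k
      using that m by (auto simp: P_def split: if_splits)
    show "2 \<le> m j" if "j \<in> {j \<in> {0..n} - {0, q}. (j < q) = k} \<inter> P k" for j k
      using that by (auto simp: P_def split: if_splits)
    show "(\<Sum>i\<in>P k. \<alpha> i) \<bullet> (\<Sum>i\<in>P k. \<alpha> i) = 2" if "k \<in> ?N" for k
      using S[OF that] sum_inner(2)[OF PL] E by simp
    show "(\<Sum>i\<in>P k. \<alpha> i) \<bullet> \<alpha> j \<in> {0, - 1, - 2}" if "k \<in> ?N" "j \<in> {j \<in> {0..n} - {0, q}. (j < q) = k}" for j k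
      using that sT sF unfolding N by (cases k) (auto simp: ip E)
  qed
qed

end

text \<open>No nodes remain besides \<open>p\<close> and \<open>q\<close>, so there are no walls,
  and both summands are empty.\<close>

lemma (in corank_one_subgroup) A1_chamber:
  assumes "I = {p, q}" and C: "fundamental_chamber W C"
  shows "coxeter_diagram (closure C) \<simeq>\<^sub>D affine_A 0 +\<^sub>D affine_A 0"
proof -
  have I: "I - {p, q} = {}" using assms(1) by blast
  note iso = component_diagram[where \<kappa> = "\<lambda>_. ()" and P = "\<lambda>_. {}", OF _ _ _ _ _ _ C, unfolded I image_empty]
  show ?thesis
    by (rule diagram_iso_trans[OF iso]) (auto simp: diagram_iso_def affine_A_eq diagram_sum_def bij_betw_def Plus_def)
qed

section \<open>Weights of the nodes of a Coxeter simplex\<close>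

text \<open>\<open>t\<close> is the golden ratio: for x = \<pi>/5 one has cos 3x = - cos 2x, and
  removing the factor cos x + 1 leaves its quadratic equation. The bounds 3/2 and 5/3 are those that
  the exclusion of pentagonal edges uses.\<close>

lemma two_cos_pi_div_5:
  fixes t :: real
  assumes t: "t = 2 * cos (pi / 5)"
  shows "t\<^sup>2 = t + 1" "t > 3 / 2" "t < 5 / 3"
proof -
  have pos: "cos (pi / 5) > 0" by (rule cos_gt_zero) auto
  have "cos (3 * (pi / 5)) = - cos (2 * (pi / 5))"
    using cos_pi_minus[of "2 * (pi / 5)"] by (simp add: field_simps)
  then have "4 * cos (pi / 5) ^ 3 - 3 * cos (pi / 5) = - (2 * (cos (pi / 5))\<^sup>2 - 1)"
    by (simp only: cos_treble_cos cos_double_cos)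
  then have "(cos (pi / 5) + 1) * (4 * (cos (pi / 5))\<^sup>2 - 2 * cos (pi / 5) - 1) = 0"
    by (simp add: algebra_simps power2_eq_square power3_eq_cube)
  then have "4 * (cos (pi / 5))\<^sup>2 - 2 * cos (pi / 5) - 1 = 0" using pos by simp
  then show sq: "t\<^sup>2 = t + 1" by (simp add: t power_mult_distrib)
  have t0: "t > 0" using pos t by simp
  have "(t - 3 / 2) * (t + 1 / 2) = 1 / 4" "(5 / 3 - t) * (t + 2 / 3) = 1 / 9"
    using sq by (simp_all add: power2_eq_square algebra_simps)
  then have "(t - 3 / 2) * (t + 1 / 2) > 0" "(5 / 3 - t) * (t + 2 / 3) > 0" by simp_all
  then show "t > 3 / 2" "t < 5 / 3" using t0 by (simp_all add: zero_less_mult_iff)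
qed

lemma two_cos_pi_div_cases:
  fixes m :: nat
  assumes "m \<ge> 2"
  shows "2 * cos (pi / m) \<in> {0, 1, sqrt 2, 2 * cos (pi / 5)} \<or> 2 * cos (pi / m) \<ge> sqrt 3"
proof -
  consider "m = 2" | "m = 3" | "m = 4" | "m = 5" | "m \<ge> 6" using assms by linarith
  then show ?thesis
  proof cases
    case 5
    then have "cos (pi / m) \<ge> cos (pi / 6)"
      by (intro cos_monotone_0_pi_le) (auto intro!: divide_left_mono simp: field_simps)
    then show ?thesis by (simp add: cos_30)
  qed (simp_all add: cos_60 cos_45)
qed

locale coxeter_weights = simplex_data I \<alpha> b c
  for I :: "'i set" and \<alpha> :: "'i \<Rightarrow> 'a::euclidean_space" and b c +
  assumes norm2: "i \<in> I \<Longrightarrow> \<alpha> i \<bullet> \<alpha> i = 2"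
    and angle: "i \<in> I \<Longrightarrow> j \<in> I \<Longrightarrow> i \<noteq> j \<Longrightarrow> \<exists>m::nat\<ge>2. \<alpha> i \<bullet> \<alpha> j = - 2 * cos (pi / m)"
    and card_I: "card I \<ge> 3"
begin

definition \<kappa> :: "'i \<Rightarrow> 'i \<Rightarrow> real" where
  "\<kappa> i j = - (\<alpha> i \<bullet> \<alpha> j)"

text \<open>The defining relation \<open>2 * c i = (\<Sum>j\<in>I - {i}. \<kappa> i j * c j)\<close> of the weights is used by
  splitting off neighbours one at a time: \<open>rest i X\<close> is what the nodes outside \<open>X\<close> contribute.\<close>

definition rest :: "'i \<Rightarrow> 'i set \<Rightarrow> real" where
  "rest i X = (\<Sum>j\<in>I - insert i X. \<kappa> i j * c j)"

lemma \<kappa>_commute: "\<kappa> i j = \<kappa> j i"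
  by (simp add: \<kappa>_def inner_commute)

lemma \<kappa>_cases:
  assumes "i \<in> I" "j \<in> I" "i \<noteq> j"
  shows "\<kappa> i j \<in> {0, 1, sqrt 2, 2 * cos (pi / 5)} \<or> \<kappa> i j \<ge> sqrt 3"
proof -
  obtain m :: nat where m: "m \<ge> 2" "\<kappa> i j = 2 * cos (pi / m)" using angle[OF assms] by (auto simp: \<kappa>_def)
  then show ?thesis using two_cos_pi_div_cases by simp
qed

lemma \<kappa>_zero_or_ge_1:
  assumes "i \<in> I" "j \<in> I" "i \<noteq> j" shows "\<kappa> i j = 0 \<or> \<kappa> i j \<ge> 1"
  using \<kappa>_cases[OF assms] two_cos_pi_div_5(2)[OF refl] by (auto intro: order_trans[of _ "sqrt 3"])

lemma rest_empty:
  assumes i: "i \<in> I" shows "rest i {} = 2 * c i"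
proof -
  have "0 = (\<Sum>j\<in>I. c j *\<^sub>R \<alpha> j) \<bullet> \<alpha> i" using weighted_sum_zero by simp
  also have "\<dots> = (\<Sum>j\<in>I. c j * (\<alpha> j \<bullet> \<alpha> i))" by (simp add: inner_sum_left)
  also have "\<dots> = c i * (\<alpha> i \<bullet> \<alpha> i) + (\<Sum>j\<in>I - {i}. c j * (\<alpha> j \<bullet> \<alpha> i))"
    using finite_I i by (rule sum.remove)
  also have "(\<Sum>j\<in>I - {i}. c j * (\<alpha> j \<bullet> \<alpha> i)) = - rest i {}"
    by (simp add: rest_def \<kappa>_def sum_negf inner_commute mult.commute)
  finally show ?thesis using norm2[OF i] by simp
qed

lemma rest_split:
  assumes "j \<in> I" "j \<noteq> i" "j \<notin> X"
  shows "rest i X = \<kappa> i j * c j + rest i (insert j X)"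
proof -
  have "I - insert i (insert j X) = (I - insert i X) - {j}" by blast
  then show ?thesis unfolding rest_def
    using assms finite_I sum.remove[of "I - insert i X" j "\<lambda>j. \<kappa> i j * c j"] by simp
qed

lemma contribution_nonneg:
  assumes "i \<in> I" "j \<in> I" "i \<noteq> j" shows "\<kappa> i j * c j \<ge> 0"
  using \<kappa>_zero_or_ge_1[OF assms] weight_pos[OF assms(2)] by auto

lemma rest_nonneg: "i \<in> I \<Longrightarrow> rest i X \<ge> 0"
  unfolding rest_def using contribution_nonneg by (intro sum_nonneg) auto

lemma rest_zeroD:
  assumes "rest i X = 0" "i \<in> I" "j \<in> I" "j \<noteq> i" "j \<notin> X" shows "\<kappa> i j = 0"
proof -
  have "\<kappa> i j * c j = 0"
    using assms(1) rest_split[OF assms(3-5)] contribution_nonneg[OF assms(2,3) assms(4)[symmetric]]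
      rest_nonneg[OF assms(2), of "insert j X"] by linarith
  then show ?thesis using weight_pos[OF assms(3)] by simp
qed

lemma rest_posE:
  assumes "rest i X \<noteq> 0" "i \<in> I"
  obtains j where "j \<in> I" "j \<noteq> i" "j \<notin> X" "\<kappa> i j \<ge> 1"
proof -
  obtain j where "j \<in> I - insert i X" "\<kappa> i j * c j \<noteq> 0"
    using assms(1) unfolding rest_def by (rule sum.not_neutral_contains_not_neutral)
  then show ?thesis using that[of j] \<kappa>_zero_or_ge_1[of i j] assms(2) by auto
qed

text \<open>The weight relation at \<open>j\<close> gives
  \<open>\<kappa> j i * c i \<le> 2 * c j\<close>. So of the total \<open>2 * c i\<close> available
  at \<open>i\<close>, an edge claims at least a quarter if its label \<open>\<kappa> i j\<close> is
  1, half if it is sqrt 2, three quarters if it is sqrt 3.\<close>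

lemma contribution_ge:
  assumes "i \<in> I" "j \<in> I" "i \<noteq> j"
  shows "(\<kappa> i j)\<^sup>2 * c i / 2 \<le> \<kappa> i j * c j"
proof -
  have "2 * c j \<ge> \<kappa> j i * c i"
    using rest_empty[OF assms(2)] rest_split[of i j "{}"] rest_nonneg[of j "{i}"] assms by simp
  then have "\<kappa> i j * (\<kappa> i j * c i) \<le> \<kappa> i j * (2 * c j)"
    using \<kappa>_zero_or_ge_1[OF assms] by (intro mult_left_mono) (auto simp: \<kappa>_commute)
  then show ?thesis by (simp add: power2_eq_square)
qed

lemma contribution_ge_half:
  assumes "i \<in> I" "j \<in> I" "i \<noteq> j" "\<kappa> i j \<ge> 1"
  shows "c i / 2 \<le> \<kappa> i j * c j"
proof -
  have "1 * c i \<le> (\<kappa> i j)\<^sup>2 * c i"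
    using assms weight_pos[OF assms(1)] by (intro mult_right_mono) auto
  then show ?thesis using contribution_ge[OF assms(1-3)] by simp
qed

lemma rest_ge_half:
  assumes "i \<in> I" "rest i X \<noteq> 0" shows "c i / 2 \<le> rest i X"
proof -
  obtain k where k: "k \<in> I" "k \<noteq> i" "k \<notin> X" "\<kappa> i k \<ge> 1" by (rule rest_posE[OF assms(2,1)]) blast
  then show ?thesis
    using rest_split[of k i X] contribution_ge_half[of i k] rest_nonneg[of i "insert k X"] assms by auto
qed

lemma closed_eq_I:
  assumes "J \<subseteq> I" "J \<noteq> {}" "\<And>i j. i \<in> J \<Longrightarrow> j \<in> I \<Longrightarrow> j \<notin> J \<Longrightarrow> \<kappa> i j = 0"
  shows "J = I"
  using irreducible[OF assms(1)] assms(2,3) by (auto simp: \<kappa>_def)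

lemma no_isolated_edge:
  assumes "i \<in> I" "j \<in> I" "i \<noteq> j" and r: "rest i {j} = 0" "rest j {i} = 0"
  shows False
proof -
  have "{i, j} = I"
    by (rule closed_eq_I) (use assms rest_zeroD[OF r(1)] rest_zeroD[OF r(2)] in auto)
  then have "card I = 2" using assms(3) by (metis card_2_iff)
  then show False using card_I by simp
qed

text \<open>An edge of label at least sqrt 3 claims three quarters of the total at \<open>i\<close>,
  a further neighbour the last quarter; so all estimates are equalities, and the diagram is that of
  affine type G_2. Fact \<open>1\<close> assumes a further neighbour at \<open>i\<close>; one of the
  two ends must have one.\<close>

lemma \<kappa>_large:
  assumes ij: "i \<in> I" "j \<in> I" "i \<noteq> j" "\<kappa> i j \<ge> sqrt 3"
  obtains i' j' k where "I = {i', j', k}" "distinct [i', j', k]" "\<kappa> i' j' = sqrt 3" "\<kappa> i' k = 1" "\<kappa> j' k = 0"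
proof -
  note result = that
  have 1: thesis if ij: "i \<in> I" "j \<in> I" "i \<noteq> j" "\<kappa> i j \<ge> sqrt 3" and A: "rest i {j} \<noteq> 0" for i j
  proof -
    obtain k where k: "k \<in> I" "k \<noteq> i" "k \<noteq> j" "\<kappa> i k \<ge> 1" by (rule rest_posE[OF A ij(1)]) blast
    have ci: "2 * c i = \<kappa> i j * c j + \<kappa> i k * c k + rest i {k, j}"
      using rest_empty[OF ij(1)] rest_split[of j i "{}"] rest_split[of k i "{j}"] ij k by simp
    have ge: "(\<kappa> i j)\<^sup>2 * c i / 2 \<le> \<kappa> i j * c j" "c i / 2 \<le> \<kappa> i k * c k" "rest i {k, j} \<ge> 0"
      using contribution_ge[OF ij(1-3)] contribution_ge_half[of i k] rest_nonneg[of i] ij k by auto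
    have sq: "(\<kappa> i j)\<^sup>2 \<ge> 3" using power_mono[OF ij(4), of 2] by simp
    then have "3 * c i \<le> (\<kappa> i j)\<^sup>2 * c i" using weight_pos[OF ij(1)] by (intro mult_right_mono) auto
    then have eqs: "(\<kappa> i j)\<^sup>2 * c i = 3 * c i" "\<kappa> i j * c j = 3 / 2 * c i" "\<kappa> i k * c k = c i / 2" "rest i {k, j} = 0"
      using ci ge by linarith+
    have kij: "\<kappa> i j = sqrt 3"
      using eqs(1) weight_pos[OF ij(1)] ij(4) by (intro real_sqrt_unique[symmetric]) (auto intro: order_trans[of _ "sqrt 3"])
    have cj: "2 * c j = sqrt 3 * c i"
    proof -
      have "sqrt 3 * (2 * c j) = sqrt 3 * (sqrt 3 * c i)" using eqs(2) kij by (simp flip: mult.assoc)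
      then show ?thesis by simp
    qed
    have jrest: "rest j {i} = 0"
      using rest_empty[OF ij(2)] rest_split[of i j "{}"] ij cj kij by (simp add: \<kappa>_commute)
    have ksq: "(\<kappa> i k)\<^sup>2 \<le> 1" using contribution_ge[of i k] ij k eqs(3) weight_pos[OF ij(1)] by simp
    then have kik: "\<kappa> i k = 1" using k(4) power2_le_imp_le[of "\<kappa> i k" 1] by simp
    have krest: "rest k {i} = 0"
      using rest_empty[OF k(1)] rest_split[of i k "{}"] ij k kik eqs(3) by (simp add: \<kappa>_commute)
    have "{i, j, k} = I"
    proof (rule closed_eq_I)
      show "\<kappa> x y = 0" if "x \<in> {i, j, k}" "y \<in> I" "y \<notin> {i, j, k}" for x y
        using that ij k rest_zeroD[OF eqs(4), of y] rest_zeroD[OF jrest, of y] rest_zeroD[OF krest, of y] by auto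
    qed (use ij k in auto)
    moreover have "\<kappa> j k = 0" using rest_zeroD[OF jrest, of k] ij k by auto
    ultimately show thesis using result[of i j k] ij k kij kik by auto
  qed
  have "rest i {j} \<noteq> 0 \<or> rest j {i} \<noteq> 0" using no_isolated_edge[OF ij(1-3)] by blast
  then show thesis using 1[of i j] 1[of j i] ij by (auto simp: \<kappa>_commute)
qed

end
text \<open>Rescaling the normals by \<open>t\<close> keeps the reflections and turns the weights
  into \<open>c i / t i\<close>, but changes the Cartan matrix. A \<open>t\<close> that makes it
  integral gives access to the discreteness results of \<open>cartan_simplex\<close>.\<close>

lemma (in simplex_data) scaled_absorbing_normal:
  fixes t :: "'i \<Rightarrow> real"
  defines "\<Gamma> \<equiv> gen ((\<lambda>i. \<rho> (\<alpha> i) (b i)) ` I)"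
  assumes t: "\<And>i. i \<in> I \<Longrightarrow> t i > 0"
    and int: "\<And>i j. i \<in> I \<Longrightarrow> j \<in> I \<Longrightarrow> 2 * (t i * (\<alpha> i \<bullet> \<alpha> j)) / (t j * (\<alpha> j \<bullet> \<alpha> j)) \<in> \<int>"
    and max: "maximal_reflection_subgroup W \<Gamma>" and inf: "infinite_index W \<Gamma>"
  obtains D \<nu> where "absorbing_normal D {k *\<^sub>R \<alpha> i | k i. k \<noteq> 0 \<and> i \<in> I} \<nu>"
proof -
  interpret T: cartan_simplex I "\<lambda>i. t i *\<^sub>R \<alpha> i" "\<lambda>i. t i * b i" "\<lambda>i. c i / t i"
  proof
    show "finite I" by (rule finite_I)
    show "t i *\<^sub>R \<alpha> i \<noteq> 0" "c i / t i > 0" if "i \<in> I" for i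
      using nonzero[OF that] weight_pos[OF that] t[OF that] by auto
    have "(\<Sum>i\<in>I. c i / t i * ((t i *\<^sub>R \<alpha> i) \<bullet> x - t i * b i)) = (\<Sum>i\<in>I. c i * (\<alpha> i \<bullet> x - b i))" for x
      by (rule sum.cong) (use t in \<open>auto simp: right_diff_distrib[symmetric] dest: less_imp_neq[symmetric]\<close>)
    then show "(\<Sum>i\<in>I. c i / t i * ((t i *\<^sub>R \<alpha> i) \<bullet> x - t i * b i)) = 1" for x
      using barycentric_sum by simp
    show "\<exists>x. \<forall>i\<in>I. (t i *\<^sub>R \<alpha> i) \<bullet> x - t i * b i = y i" if y: "(\<Sum>i\<in>I. c i / t i * y i) = 1" for y
    proof -
      obtain x where x: "\<forall>i\<in>I. \<alpha> i \<bullet> x - b i = y i / t i"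
        using barycentric_point[of "\<lambda>i. y i / t i"] y by auto
      have "(t i *\<^sub>R \<alpha> i) \<bullet> x - t i * b i = y i" if i: "i \<in> I" for i
        using bspec[OF x i] t[OF i] by (simp add: field_simps)
      then show ?thesis by blast
    qed
    show "v = 0" if "\<And>i. i \<in> I \<Longrightarrow> (t i *\<^sub>R \<alpha> i) \<bullet> v = 0" for v
      by (rule spanning) (use that t in force)
    show "2 * ((t i *\<^sub>R \<alpha> i) \<bullet> (t j *\<^sub>R \<alpha> j)) / ((t j *\<^sub>R \<alpha> j) \<bullet> (t j *\<^sub>R \<alpha> j)) \<in> \<int>" if "i \<in> I" "j \<in> I" for i j
      using int[OF that] t[OF that(2)] by simp
  qed
  have "(\<lambda>i. \<rho> (t i *\<^sub>R \<alpha> i) (t i * b i)) ` I = (\<lambda>i. \<rho> (\<alpha> i) (b i)) ` I"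
  proof (rule image_cong[OF refl])
    show "\<rho> (t i *\<^sub>R \<alpha> i) (t i * b i) = \<rho> (\<alpha> i) (b i)" if "i \<in> I" for i
      using hyperplane_reflection_cong[OF nonzero[OF that]] t[OF that] by simp
  qed
  then have G: "T.G = \<Gamma>" by (simp add: T.G_def \<Gamma>_def)
  obtain \<nu> where \<nu>: "\<nu> \<noteq> 0" "\<And>a c. a \<noteq> 0 \<Longrightarrow> \<rho> a c \<in> W \<Longrightarrow> a \<bullet> \<nu> = 0"
    using T.maximal_normal_exists[unfolded G, OF max inf] by blast
  have S: "{k *\<^sub>R (t i *\<^sub>R \<alpha> i) | k i. k \<noteq> 0 \<and> i \<in> I} = {k *\<^sub>R \<alpha> i | k i. k \<noteq> 0 \<and> i \<in> I}"
  proof (intro subset_antisym subsetI)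
    fix x assume "x \<in> {k *\<^sub>R (t i *\<^sub>R \<alpha> i) | k i. k \<noteq> 0 \<and> i \<in> I}"
    then obtain k i where x: "x = k *\<^sub>R (t i *\<^sub>R \<alpha> i)" "k \<noteq> 0" "i \<in> I" by blast
    then have "x = (k * t i) *\<^sub>R \<alpha> i" "k * t i \<noteq> 0" using t[of i] by auto
    then show "x \<in> {k *\<^sub>R \<alpha> i | k i. k \<noteq> 0 \<and> i \<in> I}" using x(3) by blast
  next
    fix x assume "x \<in> {k *\<^sub>R \<alpha> i | k i. k \<noteq> 0 \<and> i \<in> I}"
    then obtain k i where x: "x = k *\<^sub>R \<alpha> i" "k \<noteq> 0" "i \<in> I" by blast
    then have "x = (k / t i) *\<^sub>R (t i *\<^sub>R \<alpha> i)" "k / t i \<noteq> 0" using t[of i] by auto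
    then show "x \<in> {k *\<^sub>R (t i *\<^sub>R \<alpha> i) | k i. k \<noteq> 0 \<and> i \<in> I}" using x(3) by blast
  qed
  show ?thesis
    by (rule that, unfold S[symmetric], rule T.maximal_absorbing_normal(1)[unfolded G, OF max]) (use \<nu> in blast)+
qed

context coxeter_weights
begin

text \<open>Two further neighbours would claim at least \<open>c i\<close>, and so would a single
  edge of label sqrt 2 or more, the golden ratio included. Hence exactly one simple edge is
  left.\<close>

lemma small_rest:
  assumes i: "i \<in> I" and r: "rest i X \<noteq> 0" "rest i X < c i"
  obtains k where "k \<in> I" "k \<noteq> i" "k \<notin> X" "\<kappa> i k = 1" "c k = rest i X" "rest i (insert k X) = 0" "c i / 2 \<le> c k"
proof -
  obtain k where k: "k \<in> I" "k \<noteq> i" "k \<notin> X" "\<kappa> i k \<ge> 1" by (rule rest_posE[OF r(1) i]) blast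
  have s: "rest i X = \<kappa> i k * c k + rest i (insert k X)" by (rule rest_split) (use k in auto)
  have h: "c i / 2 \<le> \<kappa> i k * c k" "(\<kappa> i k)\<^sup>2 * c i / 2 \<le> \<kappa> i k * c k"
    using contribution_ge_half[of i k] contribution_ge[of i k] i k by auto
  have zero: "rest i (insert k X) = 0"
  proof (rule ccontr)
    assume "rest i (insert k X) \<noteq> 0"
    then obtain l where l: "l \<in> I" "l \<noteq> i" "l \<notin> insert k X" "\<kappa> i l \<ge> 1" by (rule rest_posE[OF _ i]) blast
    have "rest i (insert k X) = \<kappa> i l * c l + rest i (insert l (insert k X))" by (rule rest_split) (use l in auto)
    then show False
      using s h(1) contribution_ge_half[of i l] rest_nonneg[OF i, of "insert l (insert k X)"] i l r(2) by auto
  qed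
  have "(\<kappa> i k)\<^sup>2 < 2"
  proof (rule ccontr)
    assume "\<not> (\<kappa> i k)\<^sup>2 < 2"
    then have "2 * c i \<le> (\<kappa> i k)\<^sup>2 * c i" using weight_pos[OF i] by (intro mult_right_mono) auto
    then show False using h(2) s zero r(2) by linarith
  qed
  then have "\<kappa> i k = 1"
  proof -
    have "\<kappa> i k \<noteq> sqrt 2" "\<not> \<kappa> i k \<ge> sqrt 3" using \<open>(\<kappa> i k)\<^sup>2 < 2\<close> power_mono[of "sqrt 3" "\<kappa> i k" 2] by auto
    moreover have "\<kappa> i k \<noteq> 2 * cos (pi / 5)"
      using \<open>(\<kappa> i k)\<^sup>2 < 2\<close> two_cos_pi_div_5[OF refl] by auto
    ultimately show ?thesis using \<kappa>_cases[of i k] i k by auto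
  qed
  then show thesis using that[of k] k s zero h(1) by simp
qed

text \<open>Suppose \<open>i\<close> has a neighbour besides \<open>j\<close>. The bounds on the
  golden ratio \<open>t\<close> then make \<open>j\<close> a leaf and force a path \<open>k\<close>,
  \<open>l\<close> beyond \<open>i\<close> whose weights are combinations of \<open>c i\<close> and
  \<open>t * c i\<close>. At \<open>l\<close> the remainder is non-zero, as t < 5/3, but less than
  half of \<open>c l\<close>, as t > 3/2.\<close>

lemma \<kappa>_not_pentagonal:
  assumes ij: "i \<in> I" "j \<in> I" "i \<noteq> j" shows "\<kappa> i j \<noteq> 2 * cos (pi / 5)"
proof
  define t :: real where "t = 2 * cos (pi / 5)"
  note t = two_cos_pi_div_5[OF t_def]
  assume "\<kappa> i j = 2 * cos (pi / 5)"
  then have kt: "\<kappa> i j = t" by (simp add: t_def)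
  have 1: False if ij: "i \<in> I" "j \<in> I" "i \<noteq> j" "\<kappa> i j = t" and A: "rest i {j} \<noteq> 0" for i j
  proof -
    have ci: "2 * c i = t * c j + rest i {j}" and cj: "2 * c j = t * c i + rest j {i}"
      using rest_empty ij rest_split[of j i "{}"] rest_split[of i j "{}"] by (auto simp: \<kappa>_commute)
    have pos: "c i > 0" "c j > 0" using weight_pos ij by auto
    have tt: "t * (t * u) = t * u + u" for u
      using t(1) by (simp add: power2_eq_square distrib_right flip: mult.assoc)
    have "2 * (2 * c i) = t * (t * c i + rest j {i}) + 2 * rest i {j}"
      using ci cj by (simp add: algebra_simps)
    then have eA: "3 * c i - t * c i = t * rest j {i} + 2 * rest i {j}"
      by (simp add: distrib_left tt)
    have "2 * (2 * c j) = t * (t * c j + rest i {j}) + 2 * rest j {i}"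
      using ci cj by (simp add: algebra_simps)
    then have eB: "3 * c j - t * c j = t * rest i {j} + 2 * rest j {i}"
      by (simp add: distrib_left tt)
    have tc: "3 / 2 * u \<le> t * u" if "u \<ge> 0" for u
      using t that by (intro mult_right_mono) auto
    define u where "u = t * c i"
    have tci: "3 / 2 * c i < u" "u < 5 / 3 * c i"
      unfolding u_def using t pos by (auto intro: mult_strict_right_mono simp del: times_divide_eq_left)
    have B: "rest j {i} = 0"
    proof (rule ccontr)
      assume "rest j {i} \<noteq> 0"
      then have "rest j {i} \<ge> c j / 2" "rest i {j} \<ge> c i / 2" using rest_ge_half ij A by auto
      moreover obtain v w w' where vw: "v = t * c j" "w = t * rest i {j}" "w' = t * rest j {i}" by blast
      moreover have "3 / 2 * c j \<le> v" "3 / 2 * rest i {j} \<le> w" "3 / 2 * rest j {i} \<le> w'"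
        unfolding vw using pos rest_nonneg[OF ij(1), of "{j}"] rest_nonneg[OF ij(2), of "{i}"] by (intro tc; simp)+
      ultimately show False using eA eB tci pos unfolding u_def[symmetric] vw[symmetric] by linarith
    qed
    have A': "rest i {j} = (3 * c i - u) / 2" using eA B by (simp add: u_def)
    have "rest i {j} < c i" using A' tci pos by (simp add: field_simps)
    then obtain k where k: "k \<in> I" "k \<noteq> i" "\<kappa> i k = 1" "c k = (3 * c i - u) / 2"
      using small_rest[OF ij(1) A] A' by metis
    have rk: "rest k {i} = 2 * c i - u"
      using rest_empty[OF k(1)] rest_split[of i k "{}"] k ij by (simp add: \<kappa>_commute field_simps)
    have "rest k {i} \<noteq> 0" "rest k {i} < c k" using rk k(4) tci pos by (simp_all add: field_simps)
    then obtain l where l: "l \<in> I" "l \<noteq> k" "\<kappa> k l = 1" "c l = 2 * c i - u"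
      using small_rest[OF k(1)] rk by metis
    have rl: "rest l {k} = (5 * c i - 3 * (u)) / 2"
      using rest_empty[OF l(1)] rest_split[of k l "{}"] k l by (simp add: \<kappa>_commute field_simps)
    then have "rest l {k} \<noteq> 0" using tci by simp
    then have "c l / 2 \<le> rest l {k}" by (rule rest_ge_half[OF l(1)])
    then show False using rl l(4) tci pos by (simp add: field_simps)
  qed
  show False using no_isolated_edge[OF ij] 1[of i j] 1[of j i] ij kt by (auto simp: \<kappa>_commute)
qed

end

subsection \<open>Exclusion of multiple edges\<close>

context coxeter_weights
begin

definition \<Gamma> :: "('a \<Rightarrow> 'a) set" where
  "\<Gamma> = gen ((\<lambda>i. \<rho> (\<alpha> i) (b i)) ` I)"

lemma scaled_normal:
  assumes max: "maximal_reflection_subgroup W \<Gamma>" and inf: "infinite_index W \<Gamma>"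
    and t: "\<And>i. i \<in> I \<Longrightarrow> t i > 0"
    and int: "\<And>i j. i \<in> I \<Longrightarrow> j \<in> I \<Longrightarrow> i \<noteq> j \<Longrightarrow> t i * \<kappa> i j / t j \<in> \<int>"
  obtains D \<nu> where "absorbing_normal D {k *\<^sub>R \<alpha> i | k i. k \<noteq> 0 \<and> i \<in> I} \<nu>"
proof (rule scaled_absorbing_normal[OF t _ max[unfolded \<Gamma>_def] inf[unfolded \<Gamma>_def]])
  show "2 * (t i * (\<alpha> i \<bullet> \<alpha> j)) / (t j * (\<alpha> j \<bullet> \<alpha> j)) \<in> \<int>" if "i \<in> I" "j \<in> I" for i j
  proof (cases "i = j")
    case True
    then show ?thesis using norm2[OF that(2)] t[OF that(2)] by simp
  next
    case False
    have "2 * (t i * (\<alpha> i \<bullet> \<alpha> j)) / (t j * (\<alpha> j \<bullet> \<alpha> j)) = - (t i * \<kappa> i j / t j)"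
      using norm2[OF that(2)] by (simp add: \<kappa>_def)
    then show ?thesis using int[OF that False] by (simp only: Ints_minus)
  qed
qed (use that in blast)+

lemma no_large_\<kappa>:
  assumes max: "maximal_reflection_subgroup W \<Gamma>" and inf: "infinite_index W \<Gamma>"
    and ij: "i \<in> I" "j \<in> I" "i \<noteq> j"
  shows "\<kappa> i j < sqrt 3"
proof (rule ccontr)
  assume "\<not> \<kappa> i j < sqrt 3"
  then obtain i j k where ijk: "I = {i, j, k}" "distinct [i, j, k]" "\<kappa> i j = sqrt 3" "\<kappa> i k = 1" "\<kappa> j k = 0"
    using \<kappa>_large[OF ij] by (metis not_less)
  define t where "t x = (if x = j then sqrt 3 else 1)" for x
  obtain D \<nu> where abs: "absorbing_normal D {k *\<^sub>R \<alpha> i | k i. k \<noteq> 0 \<and> i \<in> I} \<nu>"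
  proof (rule scaled_normal[OF max inf, of t])
    show "t x * \<kappa> x y / t y \<in> \<int>" if "x \<in> I" "y \<in> I" "x \<noteq> y" for x y
      using that ijk by (auto simp: t_def \<kappa>_commute)
  qed (auto simp: t_def)
  have n: "\<alpha> i \<bullet> \<alpha> i = 2" "\<alpha> j \<bullet> \<alpha> j = 2" "\<alpha> k \<bullet> \<alpha> k = 2" using norm2 ijk(1) by auto
  have g: "\<alpha> i \<bullet> \<alpha> j = - sqrt 3" "\<alpha> i \<bullet> \<alpha> k = - 1" "\<alpha> j \<bullet> \<alpha> k = 0" using ijk(3-5) by (auto simp: \<kappa>_def)
  have sq: "1 / sqrt 2 * (1 / sqrt 2) = (1 / 2 :: real)" by simp
  define g' k' where "g' = (1 / sqrt 2) *\<^sub>R \<alpha> j" and "k' = (1 / sqrt 2) *\<^sub>R \<alpha> k"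
  \<comment> \<open>The two outer normals are orthogonal and determine the middle one; the relation
    is verified by computing that the difference has norm 0.\<close>
  have rel: "\<alpha> i = (- 1 / 2) *\<^sub>R \<alpha> k - (sqrt 3 / 2) *\<^sub>R \<alpha> j"
  proof -
    define z where "z = \<alpha> i - ((- 1 / 2) *\<^sub>R \<alpha> k - (sqrt 3 / 2) *\<^sub>R \<alpha> j)"
    have "z \<bullet> z = 0"
      using n g by (simp add: z_def inner_diff_left inner_diff_right inner_commute)
    then have "z = 0" by simp
    then show ?thesis by (simp only: z_def right_minus_eq)
  qed
  have x: "(- 1 / 2) *\<^sub>R k' - (sqrt 3 / 2) *\<^sub>R g' = (1 / sqrt 2) *\<^sub>R \<alpha> i"
    unfolding rel g'_def k'_def by (simp add: scaleR_diff_right mult.commute)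
  show False
  proof (rule absorbing_normal.no_hexagonal[OF abs, of g' k'], unfold x)
    show "v = 0" if "g' \<bullet> v = 0" "k' \<bullet> v = 0" for v
    proof (rule spanning)
      show "\<alpha> l \<bullet> v = 0" if "l \<in> I" for l
        using that \<open>g' \<bullet> v = 0\<close> \<open>k' \<bullet> v = 0\<close> rel unfolding ijk(1) by (auto simp: g'_def k'_def inner_diff_left)
    qed
    show "g' \<in> {k *\<^sub>R \<alpha> i | k i. k \<noteq> 0 \<and> i \<in> I}" "k' \<in> {k *\<^sub>R \<alpha> i | k i. k \<noteq> 0 \<and> i \<in> I}"
      "(1 / sqrt 2) *\<^sub>R \<alpha> i \<in> {k *\<^sub>R \<alpha> i | k i. k \<noteq> 0 \<and> i \<in> I}"
      unfolding g'_def k'_def using ijk(1) by (auto intro!: exI[of _ "1 / sqrt 2"])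
    show "\<exists>r y. r \<noteq> 0 \<and> s = r *\<^sub>R y \<and> y \<in> {g', k', (1 / sqrt 2) *\<^sub>R \<alpha> i}"
      if "s \<in> {k *\<^sub>R \<alpha> i | k i. k \<noteq> 0 \<and> i \<in> I}" for s
    proof -
      from that obtain r l where s: "s = r *\<^sub>R \<alpha> l" "r \<noteq> 0" "l \<in> I" by blast
      then show ?thesis unfolding g'_def k'_def using ijk(1)
        by (intro exI[of _ "r * sqrt 2"] exI[of _ "(1 / sqrt 2) *\<^sub>R \<alpha> l"]) auto
    qed
  qed (use n g sq in \<open>simp_all add: g'_def k'_def\<close>)
qed

text \<open>If both ends of an edge of label sqrt 2 have further neighbours, each has exactly one,
  \<open>k\<close> and \<open>l\<close>, with weight determined by \<open>c i\<close> and
  \<open>c j\<close>. The remainders beyond \<open>k\<close> and \<open>l\<close> cannot both be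
  non-zero; by symmetry let the one at \<open>k\<close> vanish. This fixes the ratio of
  \<open>c i\<close> and \<open>c j\<close>, and beyond \<open>l\<close> exactly one more node
  \<open>r\<close> follows: affine type F_4.\<close>

lemma F4_shape:
  assumes ij: "i \<in> I" "j \<in> I" "i \<noteq> j" "\<kappa> i j = sqrt 2" and r: "rest i {j} \<noteq> 0" "rest j {i} \<noteq> 0"
  obtains i j k l r where "I = {i, j, k, l, r}" "distinct [i, j, k, l, r]"
    "\<kappa> i j = sqrt 2" "\<kappa> i k = 1" "\<kappa> j l = 1" "\<kappa> l r = 1"
    "\<kappa> i l = 0" "\<kappa> i r = 0" "\<kappa> j k = 0" "\<kappa> j r = 0" "\<kappa> k l = 0" "\<kappa> k r = 0"
proof -
  note result = that
  define s :: real where "s = sqrt 2"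
  have s: "s * s = 2" "s * (s * u) = 2 * u" for u by (simp_all add: s_def flip: mult.assoc)
  have s': "s * (2 * (s * u)) = 4 * u" "s * (3 * (s * u)) = 6 * u" "s * (3 * u) = 3 * (s * u)" "s * (4 * u) = 4 * (s * u)" for u
  proof -
    have "s * (2 * (s * u)) = (s * s) * (2 * u)" "s * (3 * (s * u)) = (s * s) * (3 * u)" by (simp_all only: mult_ac)
    then show "s * (2 * (s * u)) = 4 * u" "s * (3 * (s * u)) = 6 * u" by (simp_all only: s(1))
  qed simp_all
  have side: "\<exists>k. k \<in> I \<and> k \<noteq> i \<and> k \<noteq> j \<and> \<kappa> i k = 1 \<and> c k = 2 * c i - s * c j \<and> rest i {k, j} = 0
      \<and> rest k {i} = 3 * c i - 2 * (s * c j)"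
    and bound: "2 * (s * c i) \<le> 3 * c j" "2 * (s * c j) \<le> 3 * c i"
    if ij: "i \<in> I" "j \<in> I" "i \<noteq> j" "\<kappa> i j = s" and r: "rest i {j} \<noteq> 0" "rest j {i} \<noteq> 0" for i j
  proof -
    have A: "rest i {j} = 2 * c i - s * c j" and B: "rest j {i} = 2 * c j - s * c i"
      using rest_empty ij rest_split[of j i "{}"] rest_split[of i j "{}"] by (auto simp: \<kappa>_commute)
    have h: "c i / 2 \<le> rest i {j}" "c j / 2 \<le> rest j {i}" using rest_ge_half ij r by auto
    then show b: "2 * (s * c i) \<le> 3 * c j" "2 * (s * c j) \<le> 3 * c i" using A B by auto
    have "s * (2 * (s * c i)) \<le> s * (3 * c j)" using b(1) by (intro mult_left_mono) (auto simp: s_def)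
    then have "4 * c i \<le> 3 * (s * c j)" by (simp only: s')
    then have "rest i {j} < c i" using A weight_pos[OF ij(1)] by (simp add: field_simps)
    then obtain k where k: "k \<in> I" "k \<noteq> i" "k \<notin> {j}" "\<kappa> i k = 1" "c k = rest i {j}" "rest i {k, j} = 0"
      using small_rest[OF ij(1) r(1)] by metis
    moreover have "rest k {i} = 3 * c i - 2 * (s * c j)"
      using rest_empty[OF k(1)] rest_split[of i k "{}"] k ij A by (simp add: \<kappa>_commute)
    ultimately show "\<exists>k. k \<in> I \<and> k \<noteq> i \<and> k \<noteq> j \<and> \<kappa> i k = 1 \<and> c k = 2 * c i - s * c j \<and> rest i {k, j} = 0
      \<and> rest k {i} = 3 * c i - 2 * (s * c j)" using A by auto
  qed
  have 1: thesis
    if ij: "i \<in> I" "j \<in> I" "i \<noteq> j" "\<kappa> i j = s"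
      and k: "k \<in> I" "k \<noteq> i" "k \<noteq> j" "\<kappa> i k = 1" "rest i {k, j} = 0"
      and l: "l \<in> I" "l \<noteq> j" "l \<noteq> i" "\<kappa> j l = 1" "c l = 2 * c j - s * c i" "rest j {l, i} = 0"
        "rest l {j} = 3 * c j - 2 * (s * c i)"
      and k0: "rest k {i} = 0" "rest k {i} = 3 * c i - 2 * (s * c j)" for i j k l
  proof -
    have e: "3 * c i = 2 * (s * c j)" using k0 by simp
    have "s * (2 * (s * c j)) = s * (3 * c i)" using e by simp
    then have e': "4 * c j = 3 * (s * c i)" by (simp only: s')
    have cl: "3 * c l = 2 * c j" and rl: "3 * rest l {j} = c j" using l(5,7) e' by (simp_all add: field_simps)
    have pos: "c j > 0" using weight_pos[OF ij(2)] .
    have "rest l {j} \<noteq> 0" "rest l {j} < c l" using cl rl pos by auto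
    then obtain r where r: "r \<in> I" "r \<noteq> l" "r \<notin> {j}" "\<kappa> l r = 1" "c r = rest l {j}" "rest l {r, j} = 0"
      using small_rest[OF l(1)] by metis
    have rr: "rest r {l} = 0"
      using rest_empty[OF r(1)] rest_split[of l r "{}"] r l cl rl by (simp add: \<kappa>_commute)
    have zk: "\<kappa> k x = 0" if "x \<in> I" "x \<noteq> k" "x \<noteq> i" for x using rest_zeroD[OF k0(1)] k that by auto
    have zi: "\<kappa> i x = 0" if "x \<in> I" "x \<noteq> i" "x \<noteq> j" "x \<noteq> k" for x using rest_zeroD[OF k(5)] ij that by auto
    have zj: "\<kappa> j x = 0" if "x \<in> I" "x \<noteq> i" "x \<noteq> j" "x \<noteq> l" for x using rest_zeroD[OF l(6)] ij that by auto
    have zl: "\<kappa> l x = 0" if "x \<in> I" "x \<noteq> l" "x \<noteq> j" "x \<noteq> r" for x using rest_zeroD[OF r(6)] l that by auto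
    have zr: "\<kappa> r x = 0" if "x \<in> I" "x \<noteq> r" "x \<noteq> l" for x using rest_zeroD[OF rr] r that by auto
    have lk: "l \<noteq> k" using zk[of j] l(4) ij k \<kappa>_commute[of k j] by auto
    have ri: "r \<noteq> i" using zi[of l] r(4) l lk \<kappa>_commute[of i l] by auto
    have rk: "r \<noteq> k" using zk[of l] r(4) l lk \<kappa>_commute[of k l] by auto
    have zero: "\<kappa> x y = 0" if "x \<in> {i, j, k, l, r}" "y \<in> I" "y \<notin> {i, j, k, l, r}" for x y
    proof -
      have y: "y \<noteq> i" "y \<noteq> j" "y \<noteq> k" "y \<noteq> l" "y \<noteq> r" using that(3) by auto
      from that(1) consider "x = i" | "x = j" | "x = k" | "x = l" | "x = r" by blast
      then show ?thesis
        by cases (simp_all only: zi[OF that(2) y(1-3)] zj[OF that(2) y(1,2,4)] zk[OF that(2) y(3,1)]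
          zl[OF that(2) y(4,2,5)] zr[OF that(2) y(5,4)])
    qed
    have "{i, j, k, l, r} \<subseteq> I" "{i, j, k, l, r} \<noteq> {}" using ij k l r by auto
    then have "{i, j, k, l, r} = I" using zero by (rule closed_eq_I)
    moreover have "distinct [i, j, k, l, r]" using ij k l r lk ri rk by auto
    moreover have "\<kappa> i l = 0" "\<kappa> i r = 0" "\<kappa> j k = 0" "\<kappa> j r = 0" "\<kappa> k l = 0" "\<kappa> k r = 0"
      using zi[of l] zi[of r] zj[of k] zj[of r] zk[of l] zk[of r] ij k l r lk ri rk by simp_all
    ultimately show thesis using result[of i j k l r] ij(4) k(4) l(4) r(4) by (simp only: s_def)
  qed
  have ij': "\<kappa> i j = s" "\<kappa> j i = s" using ij(4) by (auto simp: s_def \<kappa>_commute)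
  obtain k where k: "k \<in> I" "k \<noteq> i" "k \<noteq> j" "\<kappa> i k = 1" "c k = 2 * c i - s * c j" "rest i {k, j} = 0"
      "rest k {i} = 3 * c i - 2 * (s * c j)"
    using side[OF ij(1-3) ij'(1) r] by blast
  obtain l where l: "l \<in> I" "l \<noteq> j" "l \<noteq> i" "\<kappa> j l = 1" "c l = 2 * c j - s * c i" "rest j {l, i} = 0"
      "rest l {j} = 3 * c j - 2 * (s * c i)"
    using side[OF ij(2,1) ij(3)[symmetric] ij'(2) r(2,1)] by blast
  have "rest k {i} = 0 \<or> rest l {j} = 0"
  proof (rule ccontr)
    assume "\<not> (rest k {i} = 0 \<or> rest l {j} = 0)"
    then have "c k / 2 \<le> rest k {i}" "c l / 2 \<le> rest l {j}"
      using rest_ge_half[OF k(1)] rest_ge_half[OF l(1)] by blast+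
    then have h: "3 * (s * c j) \<le> 4 * c i" "3 * (s * c i) \<le> 4 * c j"
      using k(5,7) l(5,7) by (auto simp: field_simps)
    have "s * (3 * (s * c i)) \<le> s * (4 * c j)" using h(2) by (intro mult_left_mono) (auto simp: s_def)
    then have "3 * c i \<le> 2 * (s * c j)" using s(2)[of "c i"] unfolding s'(3,4) by linarith
    then show False using h(1) weight_pos[OF ij(1)] by linarith
  qed
  then show thesis
    using 1[OF ij(1-3) ij'(1) k(1-4,6) l _ k(7)] 1[OF ij(2,1) ij(3)[symmetric] ij'(2) l(1-4,6) k _ l(7)] by blast
qed

text \<open>By \<open>F4_shape\<close> the diagram would be of affine type F_4, which
  \<open>no_type_F4\<close> excludes. The factor sqrt 2 at \<open>i\<close> and \<open>k\<close>,
  the nodes on one side of the double edge, makes the Cartan matrix integral.\<close>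

lemma sqrt2_edge_leaf:
  assumes max: "maximal_reflection_subgroup W \<Gamma>" and inf: "infinite_index W \<Gamma>"
    and ij: "i \<in> I" "j \<in> I" "i \<noteq> j" "\<kappa> i j = sqrt 2"
  shows "rest i {j} = 0 \<or> rest j {i} = 0"
proof (rule ccontr)
  assume "\<not> (rest i {j} = 0 \<or> rest j {i} = 0)"
  then obtain i j k l r where sh: "I = {i, j, k, l, r}" "distinct [i, j, k, l, r]"
    "\<kappa> i j = sqrt 2" "\<kappa> i k = 1" "\<kappa> j l = 1" "\<kappa> l r = 1"
    "\<kappa> i l = 0" "\<kappa> i r = 0" "\<kappa> j k = 0" "\<kappa> j r = 0" "\<kappa> k l = 0" "\<kappa> k r = 0"
    using F4_shape[OF ij] by blast
  define t where "t x = (if x \<in> {i, k} then sqrt 2 else 1)" for x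
  have sd: "1 / sqrt 2 * sqrt 2 = 1" "sqrt 2 / sqrt 2 = 1" by simp_all
  obtain D \<nu> where abs: "absorbing_normal D {k *\<^sub>R \<alpha> i | k i. k \<noteq> 0 \<and> i \<in> I} \<nu>" (is "absorbing_normal _ ?S _")
  proof (rule scaled_normal[OF max inf, of t])
    have tv: "t i = sqrt 2" "t k = sqrt 2" "t j = 1" "t l = 1" "t r = 1" using sh(2) by (auto simp: t_def)
    note rev = sh(3-)[unfolded \<kappa>_commute[of i] \<kappa>_commute[of j l] \<kappa>_commute[of j r] \<kappa>_commute[of j k]
      \<kappa>_commute[of k l] \<kappa>_commute[of k r] \<kappa>_commute[of l r]]
    show "t x * \<kappa> x y / t y \<in> \<int>" if xy: "x \<in> I" "y \<in> I" "x \<noteq> y" for x y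
    proof -
      have "x = i \<or> x = j \<or> x = k \<or> x = l \<or> x = r" "y = i \<or> y = j \<or> y = k \<or> y = l \<or> y = r"
        using xy sh(1) by blast+
      with xy(3) show ?thesis
        by (elim disjE) (simp_all only: tv sh(3-) rev, simp_all)
    qed
  qed (auto simp: t_def)
  have n: "\<alpha> i \<bullet> \<alpha> i = 2" "\<alpha> j \<bullet> \<alpha> j = 2" "\<alpha> k \<bullet> \<alpha> k = 2" "\<alpha> l \<bullet> \<alpha> l = 2" "\<alpha> r \<bullet> \<alpha> r = 2"
    using norm2 sh(1) by auto
  have g: "\<alpha> i \<bullet> \<alpha> j = - sqrt 2" "\<alpha> i \<bullet> \<alpha> k = - 1" "\<alpha> j \<bullet> \<alpha> l = - 1" "\<alpha> l \<bullet> \<alpha> r = - 1"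
    "\<alpha> i \<bullet> \<alpha> l = 0" "\<alpha> i \<bullet> \<alpha> r = 0" "\<alpha> j \<bullet> \<alpha> k = 0" "\<alpha> j \<bullet> \<alpha> r = 0" "\<alpha> k \<bullet> \<alpha> l = 0" "\<alpha> k \<bullet> \<alpha> r = 0"
    using sh(3-) by (auto simp: \<kappa>_def)
  \<comment> \<open>The usual coordinates of F_4, solved for the orthonormal basis from the double
    edge outwards. A vanishing norm then shows that the remaining root \<open>\<alpha> r\<close> is
    \<open>- (e1 + e2)\<close>.\<close>
  define e4 where "e4 = (1 / sqrt 2) *\<^sub>R \<alpha> i"
  define e3 where "e3 = \<alpha> j + e4"
  define e2 where "e2 = \<alpha> l + e3"
  define e1 where "e1 = sqrt 2 *\<^sub>R \<alpha> k + e2 + e3 + e4"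
  have a: "\<alpha> j \<bullet> e4 = - 1" "\<alpha> l \<bullet> e4 = 0" "\<alpha> r \<bullet> e4 = 0" "\<alpha> k \<bullet> e4 = - (1 / sqrt 2)" "e4 \<bullet> e4 = 1"
    using n g by (simp_all add: e4_def inner_commute)
  have b: "\<alpha> l \<bullet> e3 = - 1" "\<alpha> r \<bullet> e3 = 0" "\<alpha> k \<bullet> e3 = - (1 / sqrt 2)" "e3 \<bullet> e3 = 1" "e3 \<bullet> e4 = 0"
    using n g a by (simp_all add: e3_def inner_add_left inner_add_right inner_commute)
  have c: "\<alpha> r \<bullet> e2 = - 1" "\<alpha> k \<bullet> e2 = - (1 / sqrt 2)" "e2 \<bullet> e2 = 1" "e2 \<bullet> e3 = 0" "e2 \<bullet> e4 = 0"
    using n g a b by (simp_all add: e2_def inner_add_left inner_add_right inner_commute)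
  have d: "\<alpha> r \<bullet> e1 = - 1" "e1 \<bullet> e1 = 1" "e1 \<bullet> e2 = 0" "e1 \<bullet> e3 = 0" "e1 \<bullet> e4 = 0"
    using n g a b c by (simp_all add: e1_def inner_add_left inner_add_right inner_commute)
  define z where "z = \<alpha> r + (e1 + e2)"
  have "z \<bullet> z = 0" using n c d by (simp add: z_def inner_add_left inner_add_right inner_commute)
  then have "z = 0" by simp
  then have ar: "\<alpha> r = - (e1 + e2)" by (simp only: z_def eq_neg_iff_add_eq_0)
  have ai: "\<alpha> i = sqrt 2 *\<^sub>R e4" and aj: "\<alpha> j = e3 - e4" and al: "\<alpha> l = e2 - e3"
    and ak: "\<alpha> k = sqrt 2 *\<^sub>R ((1 / 2) *\<^sub>R (e1 - e2 - e3 - e4))"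
    using sd by (simp_all add: e4_def e3_def e2_def e1_def)
  have inS: "q *\<^sub>R \<alpha> x \<in> ?S" if "x \<in> I" "q \<noteq> 0" for x q using that by blast
  show False
  proof (rule absorbing_normal.no_type_F4[OF abs, of e1 e2 e3 e4])
    show "v = 0" if "e1 \<bullet> v = 0" "e2 \<bullet> v = 0" "e3 \<bullet> v = 0" "e4 \<bullet> v = 0" for v
    proof (rule spanning)
      show "\<alpha> x \<bullet> v = 0" if "x \<in> I" for x
        using that \<open>e1 \<bullet> v = 0\<close> \<open>e2 \<bullet> v = 0\<close> \<open>e3 \<bullet> v = 0\<close> \<open>e4 \<bullet> v = 0\<close> unfolding sh(1)
        by (auto simp: ai aj ak al ar inner_diff_left inner_add_left)
    qed
    have "e1 + e2 = (- 1) *\<^sub>R \<alpha> r" by (simp add: ar)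
    then show "e1 + e2 \<in> ?S" using inS[of r "- 1"] sh(1) by force
    show "e2 - e3 \<in> ?S" using inS[of l 1] sh(1) by (simp add: al)
    show "e3 - e4 \<in> ?S" using inS[of j 1] sh(1) by (simp add: aj)
    show "e4 \<in> ?S" using inS[of i "1 / sqrt 2"] sh(1) by (simp add: e4_def)
    show "(1 / 2) *\<^sub>R (e1 - e2 - e3 - e4) \<in> ?S" using inS[of k "1 / sqrt 2"] sh(1) by (simp add: ak)
    show "\<exists>q y. q \<noteq> 0 \<and> s = q *\<^sub>R y \<and> y \<in> {e1 + e2, e2 - e3, e3 - e4, e4, (1 / 2) *\<^sub>R (e1 - e2 - e3 - e4)}"
      if "s \<in> ?S" for s
    proof -
      from that obtain q x where s: "s = q *\<^sub>R \<alpha> x" "q \<noteq> 0" "x \<in> I" by blast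
      then consider "x = i" | "x = j" | "x = k" | "x = l" | "x = r" unfolding sh(1) by blast
      then show ?thesis
      proof cases
        case 1 then show ?thesis using s by (intro exI[of _ "q * sqrt 2"] exI[of _ e4]) (simp add: ai)
      next
        case 2 then show ?thesis using s by (intro exI[of _ q] exI[of _ "e3 - e4"]) (simp add: aj)
      next
        case 3 then show ?thesis using s
          by (intro exI[of _ "q * sqrt 2"] exI[of _ "(1 / 2) *\<^sub>R (e1 - e2 - e3 - e4)"]) (simp add: ak)
      next
        case 4 then show ?thesis using s by (intro exI[of _ q] exI[of _ "e2 - e3"]) (simp add: al)
      next
        case 5 then show ?thesis using s by (intro exI[of _ "- q"] exI[of _ "e1 + e2"]) (simp add: ar algebra_simps)
      qed
    qed
  qed (use a b c d in simp_all)
qed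

section \<open>Chains that start with a double edge\<close>

definition spine :: "(nat \<Rightarrow> 'i) \<Rightarrow> nat \<Rightarrow> bool" where
  "spine f k \<longleftrightarrow> (\<forall>u\<le>k. f u \<in> I) \<and> (\<forall>u<k. \<kappa> (f u) (f (Suc u)) = (if u = 0 then sqrt 2 else 1))
     \<and> (\<forall>u v. Suc u < v \<and> v \<le> k \<longrightarrow> \<kappa> (f u) (f v) = 0)"

text \<open>On a spine these vectors are the orthonormal basis for which the simple roots take the
  usual form of type B: \<open>\<alpha> (f 0)\<close> is sqrt 2 times the vector 0, and
  \<open>\<alpha> (f u)\<close> is the difference of the vectors \<open>u\<close> and
  \<open>u - 1\<close>.\<close>

definition spine_vector :: "(nat \<Rightarrow> 'i) \<Rightarrow> nat \<Rightarrow> 'a" where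
  "spine_vector f u = (1 / sqrt 2) *\<^sub>R \<alpha> (f 0) + (\<Sum>v\<in>{1..u}. \<alpha> (f v))"

lemma spine_inj:
  assumes "spine f k" shows "inj_on f {..k}"
proof -
  have "f u \<noteq> f v" if "u < v" "v \<le> k" for u v
  proof
    assume "f u = f v"
    then have "\<kappa> (f u) (f v) = - 2" using assms that norm2[of "f v"] by (simp add: \<kappa>_def spine_def)
    moreover have "\<kappa> (f u) (f v) \<ge> 0"
      using assms that by (cases "Suc u = v") (auto simp: spine_def)
    ultimately show False by simp
  qed
  then show ?thesis by (intro linorder_inj_onI) auto
qed

lemma spine_bound:
  assumes "spine f k" shows "k < card I"
proof -
  have "f ` {..k} \<subseteq> I" using assms by (auto simp: spine_def)
  then have "card {..k} \<le> card I" using card_inj_on_le[OF spine_inj[OF assms]] finite_I by blast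
  then show ?thesis by simp
qed

lemma spine_vector_simps:
  "spine_vector f 0 = (1 / sqrt 2) *\<^sub>R \<alpha> (f 0)"
  "spine_vector f (Suc u) = \<alpha> (f (Suc u)) + spine_vector f u"
  by (simp_all add: spine_vector_def add.commute add.left_commute)

lemma spine_vector_orthonormal:
  assumes f: "spine f k" and "u \<le> k"
  shows "(\<forall>v\<le>u. spine_vector f v \<bullet> spine_vector f u = (if v = u then 1 else 0))
    \<and> (\<forall>v\<le>k. v > u \<longrightarrow> \<alpha> (f v) \<bullet> spine_vector f u = (if v = Suc u then - 1 else 0))"
  using \<open>u \<le> k\<close>
proof (induction u)
  case 0
  have "\<alpha> (f v) \<bullet> \<alpha> (f 0) = (if v = 1 then - sqrt 2 else 0)" if "v \<le> k" "v > 0" for v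
    using f that unfolding spine_def \<kappa>_def by (cases "v = 1") (auto simp: inner_commute)
  moreover have "\<alpha> (f 0) \<bullet> \<alpha> (f 0) = 2" using f norm2 by (auto simp: spine_def)
  ultimately show ?case by (auto simp: spine_vector_simps)
next
  case (Suc u)
  let ?e = "spine_vector f" and ?a = "\<alpha> (f (Suc u))"
  have IH: "\<And>v. v \<le> u \<Longrightarrow> ?e v \<bullet> ?e u = (if v = u then 1 else 0)"
    "\<And>v. v \<le> k \<Longrightarrow> v > u \<Longrightarrow> \<alpha> (f v) \<bullet> ?e u = (if v = Suc u then - 1 else 0)"
    using Suc by auto
  have n: "?a \<bullet> ?a = 2" using f Suc.prems norm2 by (auto simp: spine_def)
  have low: "?a \<bullet> ?e v = (if v = u then - 1 else 0)" if "v \<le> u" for v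
    using that
  proof (induction v)
    case 0
    have "\<kappa> (f 0) (f (Suc u)) = (if u = 0 then sqrt 2 else 0)" using f Suc.prems by (auto simp: spine_def)
    then have "?a \<bullet> \<alpha> (f 0) = - (if u = 0 then sqrt 2 else 0)" by (simp add: \<kappa>_def inner_commute minus_equation_iff)
    then show ?case by (auto simp: spine_vector_simps)
  next
    case (Suc v)
    have "\<kappa> (f (Suc v)) (f (Suc u)) = (if u = Suc v then 1 else 0)"
      using f \<open>Suc u \<le> k\<close> Suc.prems by (auto simp: spine_def)
    then show ?case using Suc by (auto simp: spine_vector_simps \<kappa>_def inner_commute inner_add_right)
  qed
  have "?e v \<bullet> ?e (Suc u) = (if v = Suc u then 1 else 0)" if "v \<le> Suc u" for v
  proof (cases "v = Suc u")
    case True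
    then show ?thesis using n low[of u] IH(1)[of u]
      by (simp add: spine_vector_simps(2) inner_add_left inner_add_right inner_commute)
  next
    case False
    then show ?thesis using that low[of v] IH(1)[of v]
      by (auto simp: spine_vector_simps(2) inner_add_left inner_add_right inner_commute)
  qed
  moreover have "\<alpha> (f v) \<bullet> ?e (Suc u) = (if v = Suc (Suc u) then - 1 else 0)" if v: "v \<le> k" "v > Suc u" for v
  proof -
    have "\<kappa> (f (Suc u)) (f v) = (if v = Suc (Suc u) then 1 else 0)"
      using f v by (auto simp: spine_def)
    then show ?thesis using IH(2)[of v] v by (auto simp: spine_vector_simps(2) inner_add_right \<kappa>_def inner_commute)
  qed
  ultimately show ?case by blast
qed

end

lemma reflect_signed_permutation:
  fixes e :: "nat \<Rightarrow> 'a::euclidean_space"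
  assumes orth: "\<And>i j. i < n \<Longrightarrow> j < n \<Longrightarrow> e i \<bullet> e j = (if i = j then 1 else 0)"
    and ab: "a < n" "b < n" "a \<noteq> b" and i: "i < n" and r: "r \<noteq> 0"
    and x: "x \<in> {e a - e b, e a + e b, e a}"
  shows "\<exists>j<n. reflect (r *\<^sub>R x) (e i) = e j \<or> reflect (r *\<^sub>R x) (e i) = - e j"
proof -
  have o: "e a \<bullet> e a = 1" "e b \<bullet> e b = 1" "e a \<bullet> e b = 0" "e b \<bullet> e a = 0"
    "e a \<bullet> e i = (if a = i then 1 else 0)" "e b \<bullet> e i = (if b = i then 1 else 0)"
    using orth ab i by auto
  have "reflect (e a - e b) (e i) = (if i = a then e b else if i = b then e a else e i)"
    "reflect (e a + e b) (e i) = (if i = a then - e b else if i = b then - e a else e i)"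
    "reflect (e a) (e i) = (if i = a then - e a else e i)"
    using o ab(3) by (auto simp: reflect_def inner_diff_left inner_diff_right inner_add_left inner_add_right scaleR_2)
  then show ?thesis unfolding reflect_scale[OF r] using x ab i by (auto split: if_splits)
qed

context coxeter_weights
begin

text \<open>The two forms of \<open>\<alpha> w\<close> are the two ways in which a spine can close
  up: a second double edge, or a fork with one prong \<open>f k\<close> and the other
  \<open>w\<close>. In both cases every simple root is a multiple of a basis vector or of a sum or
  difference of two, so the generators act by signed permutations.\<close>

lemma no_closed_spine:
  assumes abs: "absorbing_normal D {k *\<^sub>R \<alpha> i | k i. k \<noteq> 0 \<and> i \<in> I} \<nu>" (is "absorbing_normal _ ?S _")
    and f: "spine f k" "k \<ge> 1" and I: "I = insert w (f ` {..k})"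
    and w: "\<alpha> w = - sqrt 2 *\<^sub>R spine_vector f k \<or> \<alpha> w = - (spine_vector f (k - 1) + spine_vector f k)"
  shows False
proof -
  let ?e = "spine_vector f"
  have orth: "?e u \<bullet> ?e v = (if u = v then 1 else 0)" if "u < Suc k" "v < Suc k" for u v
    using spine_vector_orthonormal[OF f(1), of u] spine_vector_orthonormal[OF f(1), of v] that
    by (cases "v \<le> u") (auto simp: inner_commute)
  have f0: "\<alpha> (f 0) = sqrt 2 *\<^sub>R ?e 0" by (simp add: spine_vector_simps)
  have fS: "\<alpha> (f u) = ?e u - ?e (u - 1)" if "u > 0" for u
    using that spine_vector_simps(2)[of f "u - 1"] by simp
  show False
  proof (rule absorbing_normal.no_signed_permutations[OF abs, of "Suc k" ?e])
    show "Suc k \<ge> 2" using f(2) by simp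
    show "?e u \<bullet> ?e v = (if u = v then 1 else 0)" if "u < Suc k" "v < Suc k" for u v using orth that .
    show "v = 0" if v: "\<And>u. u < Suc k \<Longrightarrow> ?e u \<bullet> v = 0" for v
    proof (rule spanning)
      have "\<alpha> (f u) \<bullet> v = 0" if "u \<le> k" for u
        using v[of u] v[of "u - 1"] that f0 fS[of u] by (cases "u = 0") (auto simp: inner_diff_left)
      moreover have "\<alpha> w \<bullet> v = 0" using w v[of k] v[of "k - 1"] by (auto simp: inner_diff_left)
      ultimately show "\<alpha> i \<bullet> v = 0" if "i \<in> I" for i using that I by auto
    qed
    have fI: "f u \<in> I" if "u \<le> k" for u using f(1) that by (auto simp: spine_def)
    have "?e 0 = (1 / sqrt 2) *\<^sub>R \<alpha> (f 0)" by (rule spine_vector_simps)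
    then show "?e 0 \<in> ?S" using fI[of 0] by force
    show "?e u - ?e (u - 1) \<in> ?S" if "0 < u" "u < Suc k" for u
    proof -
      have "?e u - ?e (u - 1) = 1 *\<^sub>R \<alpha> (f u)" using fS[OF that(1)] by simp
      then show ?thesis using fI[of u] that by force
    qed
    show "\<exists>v<Suc k. reflect s (?e u) = ?e v \<or> reflect s (?e u) = - ?e v" if s: "s \<in> ?S" and u: "u < Suc k" for s u
    proof -
      from s obtain r i where s: "s = r *\<^sub>R \<alpha> i" "r \<noteq> 0" "i \<in> I" by blast
      have "\<exists>a b q x. a < Suc k \<and> b < Suc k \<and> a \<noteq> b \<and> q \<noteq> 0 \<and> \<alpha> i = q *\<^sub>R x \<and> x \<in> {?e a - ?e b, ?e a + ?e b, ?e a}"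
      proof (cases "i = w")
        case True
        show ?thesis using w
        proof
          assume "\<alpha> w = - sqrt 2 *\<^sub>R ?e k"
          then show ?thesis using True f(2)
            by (intro exI[of _ k] exI[of _ "k - 1"] exI[of _ "- sqrt 2"] exI[of _ "?e k"]) auto
        next
          assume "\<alpha> w = - (?e (k - 1) + ?e k)"
          then show ?thesis using True f(2)
            by (intro exI[of _ "k - 1"] exI[of _ k] exI[of _ "- 1"] exI[of _ "?e (k - 1) + ?e k"]) auto
        qed
      next
        case False
        then obtain v where v: "v \<le> k" "i = f v" using s(3) I by auto
        show ?thesis
        proof (cases "v = 0")
          case True
          then show ?thesis using v f0 f(2)
            by (intro exI[of _ 0] exI[of _ 1] exI[of _ "sqrt 2"] exI[of _ "?e 0"]) auto
        next
          case False
          then show ?thesis using v fS[of v]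
            by (intro exI[of _ v] exI[of _ "v - 1"] exI[of _ 1] exI[of _ "?e v - ?e (v - 1)"]) auto
        qed
      qed
      then obtain a b q x where abx: "a < Suc k" "b < Suc k" "a \<noteq> b" "q \<noteq> 0" "\<alpha> i = q *\<^sub>R x"
        "x \<in> {?e a - ?e b, ?e a + ?e b, ?e a}" by blast
      have "s = (r * q) *\<^sub>R x" "r * q \<noteq> 0" using s abx by auto
      then show ?thesis using reflect_signed_permutation[OF orth abx(1-3) u _ abx(6)] by metis
    qed
  qed
qed

lemma \<kappa>_cases':
  assumes max: "maximal_reflection_subgroup W \<Gamma>" and inf: "infinite_index W \<Gamma>"
    and "i \<in> I" "j \<in> I" "i \<noteq> j"
  shows "\<kappa> i j = 0 \<or> \<kappa> i j = 1 \<or> \<kappa> i j = sqrt 2"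
  using \<kappa>_cases[OF assms(3-5)] no_large_\<kappa>[OF assms] \<kappa>_not_pentagonal[OF assms(3-5)] by auto

text \<open>By \<open>sqrt2_edge_leaf\<close> and \<open>no_isolated_edge\<close> every double edge
  has exactly one end that is a leaf; halving the squared norm of these leaf roots makes the Cartan
  matrix integral.\<close>

lemma leaf_scaled_normal:
  assumes max: "maximal_reflection_subgroup W \<Gamma>" and inf: "infinite_index W \<Gamma>"
  obtains D \<nu> where "absorbing_normal D {k *\<^sub>R \<alpha> i | k i. k \<noteq> 0 \<and> i \<in> I} \<nu>"
proof -
  define L where "L x \<longleftrightarrow> (\<exists>y\<in>I. y \<noteq> x \<and> \<kappa> x y = sqrt 2 \<and> rest x {y} = 0)" for x
  have unique: "y = z" if "x \<in> I" "y \<in> I" "z \<in> I" "y \<noteq> x" "z \<noteq> x" "\<kappa> x z \<noteq> 0" "rest x {y} = 0" for x y z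
    using rest_zeroD[OF that(7) that(1) that(3) that(5)] that(6) by auto
  show thesis
  proof (rule scaled_normal[OF max inf, of "\<lambda>x. if L x then 1 / sqrt 2 else 1"])
    show "(if L x then 1 / sqrt 2 else 1) * \<kappa> x y / (if L y then 1 / sqrt 2 else 1) \<in> \<int>"
      if xy: "x \<in> I" "y \<in> I" "x \<noteq> y" for x y
    proof -
      have yx: "\<kappa> y x = \<kappa> x y" by (rule \<kappa>_commute)
      consider "\<kappa> x y = 0" | "\<kappa> x y = 1" | "\<kappa> x y = sqrt 2" using \<kappa>_cases'[OF max inf xy] by blast
      then show ?thesis
      proof cases
        case 2
        then have "\<not> L x" "\<not> L y"
          using unique[of x _ y] unique[of y _ x] xy yx unfolding L_def by (metis real_sqrt_eq_1_iff zero_neq_one numeral_eq_one_iff semiring_norm(85))+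
        then show ?thesis using 2 by simp
      next
        case 3
        then have "L x \<longleftrightarrow> rest x {y} = 0" "L y \<longleftrightarrow> rest y {x} = 0"
          using unique[of x _ y] unique[of y _ x] xy yx unfolding L_def by (metis real_sqrt_eq_zero_cancel_iff zero_neq_numeral)+
        then have "L x \<longleftrightarrow> \<not> L y"
          using sqrt2_edge_leaf[OF max inf xy 3] no_isolated_edge[OF xy] by blast
        then show ?thesis using 3 by auto
      qed simp
    qed
  qed (use that in auto)
qed

text \<open>After the leaf \<open>j\<close> of a double edge the weights along the spine are
  constant, equal to \<open>x\<close>, and so is the remainder at its end. A longest such spine
  cannot be continued by one simple edge alone, so the remainder is used up by a second double edge
  or by two simple edges to leaves; \<open>no_closed_spine\<close> excludes both.\<close>

lemma no_sqrt2_edge: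
  assumes max: "maximal_reflection_subgroup W \<Gamma>" and inf: "infinite_index W \<Gamma>"
    and ij: "i \<in> I" "j \<in> I" "i \<noteq> j"
  shows "\<kappa> i j \<noteq> sqrt 2"
proof
  assume "\<kappa> i j = sqrt 2"
  then obtain i j where ij: "i \<in> I" "j \<in> I" "i \<noteq> j" "\<kappa> i j = sqrt 2" "\<kappa> j i = sqrt 2" "rest j {i} = 0"
    using sqrt2_edge_leaf[OF max inf ij] ij \<kappa>_commute by metis
  obtain D \<nu> where abs: "absorbing_normal D {k *\<^sub>R \<alpha> i | k i. k \<noteq> 0 \<and> i \<in> I} \<nu>"
    by (rule leaf_scaled_normal[OF max inf])
  define x where "x = c i"
  have x: "x > 0" using weight_pos[OF ij(1)] by (simp add: x_def)
  define s :: real where "s = sqrt 2"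
  have s: "s * s = 2" "s * (s * u) = 2 * u" for u by (simp_all add: s_def flip: mult.assoc)
  have cj: "2 * c j = s * x"
    using rest_empty[OF ij(2)] rest_split[of i j "{}"] ij by (simp add: s_def x_def)
  have ri: "rest i {j} = x"
  proof -
    have "2 * x = s * c j + rest i {j}"
      using rest_empty[OF ij(1)] rest_split[of j i "{}"] ij by (simp add: s_def x_def)
    moreover have "2 * (s * c j) = 2 * x"
      unfolding mult.left_commute[of 2] cj s(2) ..
    ultimately show ?thesis by simp
  qed
  define nbrs :: "(nat \<Rightarrow> 'i) \<Rightarrow> nat \<Rightarrow> 'i set"
    where "nbrs f u = insert (f (Suc u)) (if u = 0 then {} else {f (u - 1)})" for f u
  define R where "R f k \<longleftrightarrow> spine f k \<and> k \<ge> 1 \<and> f 0 = j \<and> f 1 = i \<and> c (f k) = x \<and> rest (f k) {f (k - 1)} = x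
    \<and> (\<forall>u<k. rest (f u) (nbrs f u) = 0)" for f k
  define f1 where "f1 u = (if u = 0 then j else i)" for u :: nat
  have R1: "R f1 1"
    using ij ri by (auto simp: R_def spine_def f1_def nbrs_def x_def)
  obtain k where k: "\<exists>f. R f k" "\<And>f k'. R f k' \<Longrightarrow> k' \<le> k"
  proof -
    have "\<exists>k. (\<exists>f. R f k) \<and> (\<forall>k'. (\<exists>f. R f k') \<longrightarrow> k' \<le> k)"
      by (rule Nat.ex_has_greatest_nat[of _ 1 "card I"]) (use R1 spine_bound in \<open>force simp: R_def\<close>)+
    then show thesis using that by blast
  qed
  then obtain f where f: "R f k" by blast
  let ?v = "f k" and ?p = "f (k - 1)"
  have sp: "spine f k" and k1: "k \<ge> 1" and f01: "f 0 = j" "f 1 = i" and cv: "c ?v = x" and rv: "rest ?v {?p} = x"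
    and zero: "\<And>u. u < k \<Longrightarrow> rest (f u) (nbrs f u) = 0"
    using f by (auto simp: R_def)
  have fI: "f u \<in> I" if "u \<le> k" for u using sp that by (auto simp: spine_def)
  have ends: "?v \<in> f ` {..k}" "?p \<in> f ` {..k}" by auto
  have far: "\<kappa> (f u) (f v) = 0" if "Suc u < v" "v \<le> k" for u v using sp that by (auto simp: spine_def)
  have inj: "f u \<noteq> f v" if "u \<noteq> v" "u \<le> k" "v \<le> k" for u v
    using spine_inj[OF sp] that by (auto simp: inj_on_def)
  have fresh: "w \<notin> f ` {..k}" "\<And>u. u < k \<Longrightarrow> \<kappa> (f u) w = 0"
    if w: "w \<in> I" "w \<noteq> ?v" "w \<notin> {?p}" "\<kappa> ?v w \<noteq> 0" for w
  proof -
    have ne: "w \<noteq> f u" if "u \<le> k" for u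
    proof
      assume wu: "w = f u"
      then have "u \<noteq> k" "u \<noteq> k - 1" using w by auto
      then have "\<kappa> (f u) ?v = 0" using far[of u k] that by simp
      then show False using wu w(4) \<kappa>_commute by metis
    qed
    then show "w \<notin> f ` {..k}" by blast
    show "\<kappa> (f u) w = 0" if u: "u < k" for u
      by (rule rest_zeroD[OF zero[OF u]]) (use u fI ne w in \<open>auto simp: nbrs_def\<close>)
  qed
  obtain w where w: "w \<in> I" "w \<noteq> ?v" "w \<notin> {?p}" "\<kappa> ?v w \<ge> 1"
    using rest_posE[of ?v "{?p}"] rv x fI[of k] by auto
  have w0: "\<kappa> ?v w \<noteq> 0" using w(4) by auto
  have rw: "x = \<kappa> ?v w * c w + rest ?v {w, ?p}" using rest_split[of w ?v "{?p}"] w rv by auto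
  have rwv: "rest w {?v} = 2 * c w - \<kappa> ?v w * x"
    using rest_empty[OF w(1)] rest_split[of ?v w "{}"] w fI[of k] cv \<kappa>_commute[of w ?v] by simp
  have fw: "w \<notin> f ` {..k}" "\<And>u. u < k \<Longrightarrow> \<kappa> (f u) w = 0" using fresh[OF w(1-3) w0] by auto
  let ?g = "f(Suc k := w)"
  have g: "spine ?g (Suc k)" if "\<kappa> ?v w = 1"
    using sp that fw(2) w(1) k1 unfolding spine_def by (auto simp: le_Suc_eq less_Suc_eq)
  have covers: "insert w (f ` {..k}) \<union> X = I"
    if X: "X \<subseteq> I" "\<And>y. y \<in> I \<Longrightarrow> y \<notin> insert w (f ` {..k}) \<union> X \<Longrightarrow> \<kappa> ?v y = 0"
      "\<And>z y. z \<in> insert w X \<Longrightarrow> y \<in> I \<Longrightarrow> y \<notin> insert w (f ` {..k}) \<union> X \<Longrightarrow> \<kappa> z y = 0" for X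
  proof (rule closed_eq_I)
    show "\<kappa> z y = 0" if z: "z \<in> insert w (f ` {..k}) \<union> X" and y: "y \<in> I" "y \<notin> insert w (f ` {..k}) \<union> X" for z y
    proof (cases "z \<in> insert w X")
      case False
      then obtain u where u: "u \<le> k" "z = f u" using z by blast
      show ?thesis
      proof (cases "u = k")
        case False
        then have uk: "u < k" using u(1) by simp
        show ?thesis unfolding u(2)
          by (rule rest_zeroD[OF zero[OF uk]]) (use uk fI y in \<open>auto simp: nbrs_def\<close>)
      qed (use X(2) y u in blast)
    qed (use X(3) y in blast)
  qed (use X(1) w(1) fI in auto)
  have orthw: "spine_vector f u \<bullet> \<alpha> w = 0" if "u < k" for u
    using that
  proof (induction u)
    case (Suc u)
    then show ?case using fw(2)[of "Suc u"] by (simp add: spine_vector_simps inner_add_left \<kappa>_def)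
  qed (use fw(2)[of 0] k1 in \<open>simp add: spine_vector_simps \<kappa>_def\<close>)
  have vk: "spine_vector f k = \<alpha> ?v + spine_vector f (k - 1)"
    using spine_vector_simps(2)[of f "k - 1"] k1 by simp
  have kw: "spine_vector f k \<bullet> \<alpha> w = - \<kappa> ?v w"
    using orthw[of "k - 1"] k1 unfolding vk by (simp add: inner_add_left \<kappa>_def)
  have kk: "spine_vector f k \<bullet> spine_vector f k = 1" using spine_vector_orthonormal[OF sp, of k] by simp
  have "\<kappa> ?v w = 1 \<or> \<kappa> ?v w = s"
    using \<kappa>_cases'[OF max inf fI[of k] w(1)] w w0 by (auto simp: s_def)
  then show False
  proof
    assume ks: "\<kappa> ?v w = s"
    then have "x \<le> \<kappa> ?v w * c w" using contribution_ge[of ?v w] fI[of k] w cv s(1) by (simp add: power2_eq_square)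
    then have z: "rest ?v {w, ?p} = 0" and sc: "s * c w = x"
      using rw rest_nonneg[OF fI[of k], of "{w, ?p}"] ks by auto
    have "s * (s * c w) = s * x" using sc by simp
    then have rw0: "rest w {?v} = 0" using rwv ks s(2) by simp
    have "insert w (f ` {..k}) \<union> {} = I"
    proof (rule covers)
      show "\<kappa> ?v y = 0" if "y \<in> I" "y \<notin> insert w (f ` {..k}) \<union> {}" for y
        using rest_zeroD[OF z fI[of k] that(1)] that(2) ends by blast
      show "\<kappa> z y = 0" if "z \<in> insert w {}" "y \<in> I" "y \<notin> insert w (f ` {..k}) \<union> {}" for z y
        using rest_zeroD[OF rw0 w(1) that(2)] that(1,3) by auto
    qed simp
    moreover have "\<alpha> w = - sqrt 2 *\<^sub>R spine_vector f k"
    proof -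
      define z where "z = \<alpha> w - (- sqrt 2 *\<^sub>R spine_vector f k)"
      have "z \<bullet> z = 0" using kw kk ks norm2[OF w(1)]
        by (simp add: z_def s_def inner_add_left inner_add_right inner_commute)
      then have "z = 0" by simp
      then show ?thesis by (simp only: z_def right_minus_eq)
    qed
    ultimately show False using no_closed_spine[OF abs sp k1, of w] by auto
  next
    assume k1w: "\<kappa> ?v w = 1"
    show False
    proof (cases "rest ?v {w, ?p} = 0")
      case True
      have cw: "c w = x" using rw k1w True by simp
      have "R ?g (Suc k)" unfolding R_def
      proof (intro conjI allI impI)
        show "rest (?g u) (nbrs ?g u) = 0" if "u < Suc k" for u
          using that zero[of u] True k1 by (cases "u = k") (auto simp: nbrs_def)
      qed (use g[OF k1w] k1 f01 cw rwv k1w in auto)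
      then show False using k(2) by force
    next
      case False
      then obtain w' where w': "w' \<in> I" "w' \<noteq> ?v" "w' \<notin> {w, ?p}" "\<kappa> ?v w' \<ge> 1"
        by (rule rest_posE[OF _ fI[of k]]) auto
      have rw': "rest ?v {w, ?p} = \<kappa> ?v w' * c w' + rest ?v {w', w, ?p}" by (rule rest_split) (use w' in auto)
      have "x / 2 \<le> \<kappa> ?v w * c w" "x / 2 \<le> \<kappa> ?v w' * c w'"
        using contribution_ge_half[of ?v w] contribution_ge_half[of ?v w'] w w' fI[of k] cv by auto
      then have eqs: "c w = x / 2" "\<kappa> ?v w' * c w' = x / 2" "rest ?v {w', w, ?p} = 0"
        using rw rw' rest_nonneg[OF fI[of k], of "{w', w, ?p}"] unfolding k1w by linarith+
      have "\<kappa> ?v w' \<noteq> sqrt 2"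
      proof
        assume "\<kappa> ?v w' = sqrt 2"
        then show False using contribution_ge[of ?v w'] w' fI[of k] cv eqs(2) x by simp
      qed
      then have k1w': "\<kappa> ?v w' = 1" using \<kappa>_cases'[OF max inf fI[of k] w'(1)] w' by auto
      have rw0: "rest w {?v} = 0" using rwv eqs(1) k1w by simp
      have rw0': "rest w' {?v} = 0"
        using rest_empty[OF w'(1)] rest_split[of ?v w' "{}"] w' fI[of k] cv k1w' eqs(2) \<kappa>_commute[of w' ?v] by simp
      have fw': "w' \<notin> f ` {..k}" "\<And>u. u < k \<Longrightarrow> \<kappa> (f u) w' = 0"
        using fresh[of w'] w' k1w' by auto
      have ww': "\<kappa> w w' = 0" using rest_zeroD[OF rw0 w(1) w'(1)] w' by auto
      have "insert w (f ` {..k}) \<union> {w'} = I"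
      proof (rule covers)
        show "\<kappa> ?v y = 0" if "y \<in> I" "y \<notin> insert w (f ` {..k}) \<union> {w'}" for y
          using rest_zeroD[OF eqs(3) fI[of k] that(1)] that(2) ends by blast
        show "\<kappa> z y = 0" if "z \<in> insert w {w'}" "y \<in> I" "y \<notin> insert w (f ` {..k}) \<union> {w'}" for z y
          using rest_zeroD[OF rw0 w(1) that(2)] rest_zeroD[OF rw0' w'(1) that(2)] that(1,3) by auto
      qed (use w' in auto)
      moreover have "?g ` {..Suc k} = insert w (f ` {..k})" by (auto simp: atMost_Suc)
      ultimately have I: "I = insert w' (?g ` {..Suc k})" by blast
      have gf: "spine_vector ?g u = spine_vector f u" if "u \<le> k" for u
        unfolding spine_vector_def using that by (auto intro: sum.cong)
      have orthw': "spine_vector f u \<bullet> \<alpha> w' = 0" if "u < k" for u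
        using that
      proof (induction u)
        case (Suc u)
        then show ?case using fw'(2)[of "Suc u"] by (simp add: spine_vector_simps inner_add_left \<kappa>_def)
      qed (use fw'(2)[of 0] k1 in \<open>simp add: spine_vector_simps \<kappa>_def\<close>)
      have kw': "spine_vector f k \<bullet> \<alpha> w' = - 1"
        using orthw'[of "k - 1"] k1 k1w' unfolding vk by (simp add: inner_add_left \<kappa>_def)
      have "\<alpha> w' = - (spine_vector ?g (Suc k - 1) + spine_vector ?g (Suc k))"
      proof -
        define e where "e = spine_vector f k"
        have e: "e \<bullet> e = 1" "e \<bullet> \<alpha> w = - 1" "e \<bullet> \<alpha> w' = - 1" using kk kw kw' k1w by (auto simp: e_def)
        define z where "z = \<alpha> w' - - (e + (\<alpha> w + e))"
        have "z \<bullet> z = 0" using e ww' norm2[OF w(1)] norm2[OF w'(1)]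
          by (simp add: z_def \<kappa>_def inner_diff_left inner_diff_right inner_add_left inner_add_right inner_commute
              del: inner_eq_zero_iff diff_minus_eq_add)
        then have "z = 0" by simp
        then have "\<alpha> w' = - (e + (\<alpha> w + e))" by (simp only: z_def right_minus_eq)
        then show ?thesis using gf[of k] by (simp add: spine_vector_simps(2) e_def)
      qed
      then show False using no_closed_spine[OF abs g[OF k1w] _ I] by simp
    qed
  qed
qed

lemma simply_laced:
  assumes "maximal_reflection_subgroup W \<Gamma>" "infinite_index W \<Gamma>" "i \<in> I" "j \<in> I" "i \<noteq> j"
  shows "\<kappa> i j = 0 \<or> \<kappa> i j = 1"
  using \<kappa>_cases'[OF assms] no_sqrt2_edge[OF assms] by blast

end

section \<open>Graphs with a harmonic weight\<close>

text \<open>The weights are those of the simplex divided by their minimum, attained at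
  \<open>p\<close>. They are real numbers; with harmonicity, the lower bound 1 drives all case
  distinctions, and integrality is an outcome.\<close>

locale harmonic_graph =
  fixes I :: "'i set" and A :: "'i \<Rightarrow> 'i \<Rightarrow> bool" and \<omega> :: "'i \<Rightarrow> real" and p :: 'i
  assumes fin: "finite I" and A_commute: "A i j \<longleftrightarrow> A j i" and A_irrefl: "\<not> A i i"
    and connected: "J \<subseteq> I \<Longrightarrow> J \<noteq> {} \<Longrightarrow> (\<And>i j. i \<in> J \<Longrightarrow> j \<in> I \<Longrightarrow> j \<notin> J \<Longrightarrow> \<not> A i j) \<Longrightarrow> J = I"
    and weight_ge_1: "i \<in> I \<Longrightarrow> \<omega> i \<ge> 1" and p: "p \<in> I" "\<omega> p = 1"
    and harmonic: "i \<in> I \<Longrightarrow> (\<Sum>j | j \<in> I \<and> A i j. \<omega> j) = 2 * \<omega> i"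
begin

definition N :: "'i \<Rightarrow> 'i set" where
  "N i = {j \<in> I. A i j}"

definition rem :: "'i \<Rightarrow> 'i set \<Rightarrow> real" where
  "rem i X = (\<Sum>j\<in>N i - X. \<omega> j)"

definition labelled :: "(nat \<Rightarrow> 'i) \<Rightarrow> nat \<Rightarrow> nat set set \<Rightarrow> bool" where
  "labelled e n E \<longleftrightarrow> bij_betw e {0..n} I \<and>
     (\<forall>i\<in>{0..n}. \<forall>j\<in>{0..n}. i \<noteq> j \<longrightarrow> A (e i) (e j) = ({i, j} \<in> E))"

lemma N_commute: "i \<in> I \<Longrightarrow> j \<in> N i \<Longrightarrow> i \<in> N j"
  using A_commute by (auto simp: N_def)

lemma N_in_I: "j \<in> N i \<Longrightarrow> j \<in> I"
  by (simp add: N_def)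

lemma N_irrefl: "i \<notin> N i"
  using A_irrefl by (simp add: N_def)

lemma finite_N: "finite (N i)"
  using fin by (simp add: N_def)

lemma rem_empty: "i \<in> I \<Longrightarrow> rem i {} = 2 * \<omega> i"
  using harmonic by (simp add: rem_def N_def)

lemma rem_split:
  assumes "j \<in> N i" "j \<notin> X" shows "rem i X = \<omega> j + rem i (insert j X)"
proof -
  have "N i - insert j X = (N i - X) - {j}" by blast
  then show ?thesis
    unfolding rem_def using assms finite_N[of i] sum.remove[of "N i - X" j \<omega>] by simp
qed

lemma rem_cases:
  obtains "rem i X = 0" "N i \<subseteq> X" | j where "j \<in> N i" "j \<notin> X" "rem i X \<ge> \<omega> j" "\<omega> j \<ge> 1" "rem i X = \<omega> j + rem i (insert j X)"
proof (cases "N i \<subseteq> X")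
  case True
  then have "N i - X = {}" by blast
  then show thesis using that(1) True unfolding rem_def by (simp only: sum.empty)
next
  case False
  then obtain j where j: "j \<in> N i" "j \<notin> X" by blast
  have "rem i (insert j X) \<ge> 0"
    unfolding rem_def using weight_ge_1 N_in_I by (intro sum_nonneg) (metis DiffD1 order_trans zero_le_one)
  then show thesis using that(2)[of j] j rem_split[OF j] weight_ge_1[OF N_in_I[OF j(1)]] by simp
qed

text \<open>Every neighbour contributes at least 1, so a remainder below 1 means that no neighbour
  is left.\<close>

lemma rem_dichotomy: "rem i X = 0 \<and> N i \<subseteq> X \<or> rem i X \<ge> 1"
  by (rule rem_cases[of i X]) auto

lemma N_of_leaf:
  assumes "j \<in> N i" "N j = {k}" "i \<in> I" shows "k = i"
  using N_commute[OF assms(3,1)] assms(2) by simp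

text \<open>The total 2 is shared among neighbours of weight at least 1.\<close>

lemma unit_neighbours:
  assumes i: "i \<in> I" "\<omega> i = 1"
  shows "(\<exists>u. N i = {u} \<and> \<omega> u = 2) \<or> (\<exists>u v. u \<noteq> v \<and> N i = {u, v} \<and> \<omega> u = 1 \<and> \<omega> v = 1)"
proof -
  have two: "rem i {} = 2" using rem_empty[OF i(1)] i(2) by simp
  then obtain u where u: "u \<in> N i" "\<omega> u \<ge> 1" "rem i {} = \<omega> u + rem i {u}" by (rule_tac rem_cases[of i "{}"]) auto
  show ?thesis
  proof (rule rem_cases[of i "{u}"])
    assume "rem i {u} = 0" "N i \<subseteq> {u}"
    then have "N i = {u}" "\<omega> u = 2" using u two by auto
    then show ?thesis by blast
  next
    fix v assume v: "v \<in> N i" "v \<notin> {u}" "\<omega> v \<ge> 1" "rem i {u} = \<omega> v + rem i {v, u}"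
    then have "rem i {v, u} < 1" "\<omega> u + \<omega> v + rem i {v, u} = 2" using u two by auto
    then have "rem i {v, u} = 0" "N i \<subseteq> {v, u}" "\<omega> u = 1" "\<omega> v = 1"
      using rem_dichotomy[of i "{v, u}"] u v by auto
    then have "N i = {u, v}" "u \<noteq> v" using u v by auto
    then show ?thesis using \<open>\<omega> u = 1\<close> \<open>\<omega> v = 1\<close> by blast
  qed
qed

lemma closed_labelling:
  assumes "e ` L \<subseteq> I" "L \<noteq> {}" "\<And>i. i \<in> L \<Longrightarrow> N (e i) \<subseteq> e ` L"
  shows "e ` L = I"
  by (rule connected) (use assms in \<open>force simp: N_def\<close>)+

lemma labelledI:
  assumes inj: "inj_on e {0..n}" and I: "\<And>i. i \<le> n \<Longrightarrow> e i \<in> I"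
    and N: "\<And>i. i \<le> n \<Longrightarrow> N (e i) = e ` {j \<in> {0..n}. j \<noteq> i \<and> {i, j} \<in> E}"
  shows "labelled e n E"
proof -
  have "e ` {0..n} = I" by (rule closed_labelling) (use I N in auto)
  moreover have "A (e i) (e j) \<longleftrightarrow> {i, j} \<in> E" if "i \<le> n" "j \<le> n" "i \<noteq> j" for i j
  proof -
    have "A (e i) (e j) \<longleftrightarrow> e j \<in> N (e i)" using I that by (simp add: N_def)
    also have "\<dots> \<longleftrightarrow> {i, j} \<in> E"
      unfolding N[OF that(1)] using that by (subst inj_on_image_mem_iff[OF inj]) auto
    finally show ?thesis .
  qed
  ultimately show ?thesis using inj by (auto simp: labelled_def bij_betw_def)
qed

text \<open>Two unit neighbours at \<open>p\<close> propagate by connectedness: every node has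
  weight 1 and exactly two neighbours. A longest injective walk from \<open>p\<close> must then
  return to itself, and only its start has a neighbour to spare.\<close>

lemma cycle_labelling:
  assumes uv: "N p = {u, v}" "u \<noteq> v" "\<omega> u = 1" "\<omega> v = 1"
  obtains e n where "n \<ge> 2" "e 0 = p" "labelled e n (cycle_edges n)" "\<And>i. i \<in> I \<Longrightarrow> \<omega> i = 1"
proof -
  have all: "{i \<in> I. \<omega> i = 1 \<and> card (N i) = 2} = I"
  proof (rule connected)
    show "{i \<in> I. \<omega> i = 1 \<and> card (N i) = 2} \<noteq> {}" using p uv by auto
    show "\<not> A i j" if i: "i \<in> {i \<in> I. \<omega> i = 1 \<and> card (N i) = 2}" and j: "j \<in> I" "j \<notin> {i \<in> I. \<omega> i = 1 \<and> card (N i) = 2}" for i j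
    proof
      assume "A i j"
      then have ji: "j \<in> N i" "i \<in> N j" using i j A_commute by (auto simp: N_def)
      have "\<omega> j = 1" using unit_neighbours[of i] i ji(1) by (auto split: if_splits)
      then have "card (N j) = 2" using unit_neighbours[of j] j(1) ji(2) i by auto
      then show False using j \<open>\<omega> j = 1\<close> by simp
    qed
  qed blast
  then have one: "\<omega> i = 1" and two: "card (N i) = 2" if "i \<in> I" for i using that by blast+
  have N2: "N i = {x, y}" if "i \<in> I" "x \<in> N i" "y \<in> N i" "x \<noteq> y" for i x y
    using two[OF that(1)] that(2-4) card_subset_eq[OF finite_N, of "{x, y}" i] by auto
  define R where "R f k \<longleftrightarrow> inj_on f {..k} \<and> (\<forall>u\<le>k. f u \<in> I) \<and> (\<forall>u<k. f (Suc u) \<in> N (f u)) \<and> f 0 = p" for f :: "nat \<Rightarrow> 'i" and k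
  have bound: "k \<le> card I" if "R f k" for f k
  proof -
    have "card {..k} \<le> card I" by (rule card_inj_on_le[of f]) (use that fin in \<open>auto simp: R_def\<close>)
    then show ?thesis by simp
  qed
  have R1: "R (\<lambda>t. if t = 0 then p else u) 1"
    using uv p N_irrefl[of p] N_in_I[of u p] by (auto simp: R_def inj_on_def)
  have "\<exists>k. (\<exists>f. R f k) \<and> (\<forall>k'. (\<exists>f. R f k') \<longrightarrow> k' \<le> k)"
    by (rule Nat.ex_has_greatest_nat[of _ 1 "card I"]) (use R1 bound in blast)+
  then obtain k f where f: "R f k" and max: "\<And>f k'. R f k' \<Longrightarrow> k' \<le> k" by blast
  have k1: "k \<ge> 1" using max R1 by blast
  have inj: "inj_on f {..k}" and fI: "\<And>t. t \<le> k \<Longrightarrow> f t \<in> I" and step: "\<And>t. t < k \<Longrightarrow> f (Suc t) \<in> N (f t)" and f0: "f 0 = p"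
    using f by (auto simp: R_def)
  have ne: "f s \<noteq> f t" if "s \<le> k" "t \<le> k" "s \<noteq> t" for s t using inj that by (auto simp: inj_on_def)
  have prev: "f (t - 1) \<in> N (f t)" if "0 < t" "t \<le> k" for t
    using step[of "t - 1"] N_commute[of "f (t - 1)" "f t"] fI[of "t - 1"] that by simp
  have mid: "N (f t) = {f (t - 1), f (Suc t)}" if "0 < t" "t < k" for t
    by (rule N2) (use that fI prev step ne in auto)
  obtain z where z: "z \<in> N (f k)" "z \<noteq> f (k - 1)"
  proof -
    obtain x y where "N (f k) = {x, y}" "x \<noteq> y" using two[OF fI[of k]] by (auto simp: card_2_iff)
    then show thesis using that by (metis insertI1 insertI2)
  qed
  have "z \<in> f ` {..k}"
  proof (rule ccontr)
    assume zn: "z \<notin> f ` {..k}"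
    have "R (f(Suc k := z)) (Suc k)"
      using f zn z(1) N_in_I[OF z(1)] unfolding R_def by (auto simp: inj_on_def le_Suc_eq less_Suc_eq)
    then show False using max by force
  qed
  then obtain t where t: "t \<le> k" "z = f t" by blast
  have t0: "t = 0"
  proof (rule ccontr)
    assume "t \<noteq> 0"
    moreover have "t \<noteq> k" using z(1) t(2) N_irrefl by auto
    ultimately have "f k \<in> {f (t - 1), f (Suc t)}" using mid[of t] N_commute[OF fI[of k] z(1)] t by auto
    then have "k = t - 1 \<or> k = Suc t" using ne[of k "t - 1"] ne[of k "Suc t"] t \<open>t \<noteq> k\<close> by fastforce
    then show False using t z(2) \<open>t \<noteq> k\<close> by auto
  qed
  have k2: "k \<ge> 2" using z(2) t t0 k1 by (cases "k = 1") auto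
  have Nk: "N (f k) = {f (k - 1), f 0}" by (rule N2) (use fI prev z t t0 k1 in auto)
  have N0: "N (f 0) = {f 1, f k}"
    by (rule N2) (use fI step[of 0] N_commute[OF fI[of k] z(1)] t t0 k2 ne[of 1 k] in auto)
  have nb: "{j \<in> {0..k}. j \<noteq> i \<and> {i, j} \<in> cycle_edges k} = (if i = 0 then {1, k} else if i = k then {k - 1, 0} else {i - 1, Suc i})"
    if "i \<le> k" for i
    using that k2 by (auto simp: mem_cycle_edges)
  have "labelled f k (cycle_edges k)"
    by (rule labelledI) (use inj fI nb N0 Nk mid k2 in \<open>auto simp: atLeast0AtMost\<close>)
  then show thesis using that[of k f] k2 f0 one by blast
qed

end

text \<open>What remains when the graph has no cycle.\<close>

locale harmonic_tree = harmonic_graph +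
  assumes unit_leaf: "i \<in> I \<Longrightarrow> \<omega> i = 1 \<Longrightarrow> \<exists>u. N i = {u} \<and> \<omega> u = 2"
begin

lemma unit_leaf':
  assumes "i \<in> I" "j \<in> N i" "\<omega> j = 1" shows "N j = {i}" "\<omega> i = 2"
proof -
  obtain u where u: "N j = {u}" "\<omega> u = 2" using unit_leaf[OF N_in_I[OF assms(2)] assms(3)] by blast
  then have "u = i" using N_of_leaf[OF assms(2) u(1) assms(1)] by simp
  then show "N j = {i}" "\<omega> i = 2" using u by auto
qed

text \<open>\<open>v\<close> has the unit leaves \<open>p\<close> and \<open>y\<close> and a
  remainder of 2. This is either one node of weight 2, at which a remainder of 2 appears again, or a
  pair of unit leaves; a longest chain of weight 2 therefore ends in the second fork.\<close>

lemma D_labelling: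
  assumes v: "v \<in> I" "\<omega> v = 2" and y: "y \<in> N v" "\<omega> y = 1" "y \<noteq> p" and pv: "p \<in> N v"
  obtains e n where "n \<ge> 4" "e 0 = p" "labelled e n (D_edges n)" "\<And>i. i \<le> n \<Longrightarrow> \<omega> (e i) = D_marks n i"
proof -
  \<comment> \<open>The neighbours already accounted for. The chain proper begins at 2, with both
    end nodes 0 and 1 behind it, in accordance with \<open>D_edges\<close>.\<close>
  define prev where "prev f k = (if k = 2 then {p, y} else {f (k - 1)})" for f :: "nat \<Rightarrow> 'a" and k :: nat
  define R where "R f k \<longleftrightarrow> k \<ge> 2 \<and> inj_on f {..k} \<and> f 0 = p \<and> f 1 = y \<and> f 2 = v \<and> (\<forall>u\<le>k. f u \<in> I)
    \<and> (\<forall>u. 2 \<le> u \<and> u \<le> k \<longrightarrow> \<omega> (f u) = 2) \<and> (\<forall>u. 2 \<le> u \<and> u < k \<longrightarrow> N (f u) = insert (f (Suc u)) (prev f u))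
    \<and> prev f k \<subseteq> N (f k) \<and> rem (f k) (prev f k) = 2" for f :: "nat \<Rightarrow> 'a" and k
  have yI: "y \<in> I" using N_in_I y by blast
  have Np: "N p = {v}" and Ny: "N y = {v}" using unit_leaf'[OF v(1)] pv y p by auto
  have vpy: "v \<noteq> p" "v \<noteq> y" using v y p by auto
  have rv: "rem v {p, y} = 2"
    using rem_empty[OF v(1)] rem_split[of y v "{}"] rem_split[of p v "{y}"] y pv p v by simp
  define f2 where "f2 t = (if t = 0 then p else if t = 1 then y else v)" for t :: nat
  have R2: "R f2 2"
    using rv vpy yI p v y pv by (auto simp: R_def prev_def f2_def inj_on_def)
  have bound: "k \<le> card I" if "R f k" for f k
  proof -
    have "card {..k} \<le> card I" by (rule card_inj_on_le[of f]) (use that fin in \<open>auto simp: R_def\<close>)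
    then show ?thesis by simp
  qed
  have "\<exists>k. (\<exists>f. R f k) \<and> (\<forall>k'. (\<exists>f. R f k') \<longrightarrow> k' \<le> k)"
    by (rule Nat.ex_has_greatest_nat[of _ 2 "card I"]) (use R2 bound in blast)+
  then obtain k f where f: "R f k" and max: "\<And>f k'. R f k' \<Longrightarrow> k' \<le> k" by blast
  have k2: "k \<ge> 2" and inj: "inj_on f {..k}" and f012: "f 0 = p" "f 1 = y" "f 2 = v" and fI: "\<And>u. u \<le> k \<Longrightarrow> f u \<in> I"
    and fw: "\<And>u. 2 \<le> u \<Longrightarrow> u \<le> k \<Longrightarrow> \<omega> (f u) = 2"
    and fN: "\<And>u. 2 \<le> u \<Longrightarrow> u < k \<Longrightarrow> N (f u) = insert (f (Suc u)) (prev f u)"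
    and fprev: "prev f k \<subseteq> N (f k)" and frem: "rem (f k) (prev f k) = 2"
    using f by (auto simp: R_def)
  have ne: "f s \<noteq> f t" if "s \<le> k" "t \<le> k" "s \<noteq> t" for s t using inj that by (auto simp: inj_on_def)
  have fresh: "w \<notin> f ` {..k}" if w: "w \<in> N (f k)" "w \<notin> prev f k" for w
  proof
    assume "w \<in> f ` {..k}"
    then obtain t where t: "t \<le> k" "w = f t" by blast
    have kt: "f k \<in> N (f t)" using N_commute[OF fI[of k] w(1)] t by simp
    consider "t < 2" | "2 \<le> t" "t < k" | "t = k" using t by linarith
    then show False
    proof cases
      case 1
      then have "t = 0 \<or> t = 1" by auto
      then have w: "w \<in> {p, y}" and "f k = f 2" using t kt f012 Np Ny by auto
      then have "k = 2" using ne[of k 2] k2 by auto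
      then show False using w \<open>w \<notin> prev f k\<close> by (simp add: prev_def)
    next
      case 2
      have "f (Suc t) = f k \<or> f k \<in> prev f t" using fN[OF 2] kt by auto
      moreover have "f k \<notin> prev f t"
        using 2 f012 ne[of k 0] ne[of k 1] ne[of k "t - 1"] by (auto simp: prev_def)
      ultimately have "Suc t = k" using ne[of "Suc t" k] 2 by auto
      then show False using w(2) t 2 by (auto simp: prev_def)
    qed (use kt N_irrefl in auto)
  qed
  obtain u where u: "u \<in> N (f k)" "u \<notin> prev f k" "\<omega> u \<ge> 1" "2 = \<omega> u + rem (f k) (insert u (prev f k))"
    using frem by (rule_tac rem_cases[of "f k" "prev f k"]) auto
  obtain u' where u': "u' \<in> N (f k)" "u' \<notin> insert u (prev f k)" "\<omega> u' \<ge> 1"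
    "rem (f k) (insert u (prev f k)) = \<omega> u' + rem (f k) (insert u' (insert u (prev f k)))"
  proof (rule rem_cases[of "f k" "insert u (prev f k)"])
    assume z: "rem (f k) (insert u (prev f k)) = 0" "N (f k) \<subseteq> insert u (prev f k)"
    let ?g = "f(Suc k := u)"
    have wu: "\<omega> u = 2" using u z by simp
    have fk: "f k \<in> N u" using N_commute[OF fI[of k] u(1)] by simp
    have uI: "u \<in> I" using N_in_I[OF u(1)] .
    have pg: "prev ?g t = prev f t" if "t \<le> k" for t using that k2 by (auto simp: prev_def)
    have "rem u {f k} = 2" using rem_empty[OF uI] rem_split[OF fk, of "{}"] wu fw[of k] k2 by simp
    then have "R ?g (Suc k)" unfolding R_def
    proof (intro conjI allI impI)
      show "inj_on ?g {..Suc k}" using inj fresh[OF u(1,2)] by (auto simp: inj_on_def le_Suc_eq)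
      show "N (?g t) = insert (?g (Suc t)) (prev ?g t)" if t: "2 \<le> t \<and> t < Suc k" for t
        using fN[of t] z(2) u(1) fprev pg[of t] t by (cases "t = k") auto
      show "prev ?g (Suc k) \<subseteq> N (?g (Suc k))" using fk k2 by (simp add: prev_def)
      show "rem (?g (Suc k)) (prev ?g (Suc k)) = 2" using \<open>rem u {f k} = 2\<close> k2 by (simp add: prev_def)
    qed (use k2 f012 fI fw wu uI in \<open>auto simp: le_Suc_eq\<close>)
    then show thesis using max by force
  qed (use that in auto)
  have "rem (f k) (insert u' (insert u (prev f k))) < 1" "\<omega> u + \<omega> u' + rem (f k) (insert u' (insert u (prev f k))) = 2"
    using u(3,4) u'(3,4) by auto
  then have uu': "N (f k) \<subseteq> insert u' (insert u (prev f k))" "\<omega> u = 1" "\<omega> u' = 1"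
    using rem_dichotomy[of "f k" "insert u' (insert u (prev f k))"] u(3) u'(3) by auto
  have Nk: "N (f k) = insert u' (insert u (prev f k))" using uu'(1) u(1) u'(1) fprev by auto
  have Nu: "N u = {f k}" "N u' = {f k}"
    using unit_leaf'(1)[OF fI[OF order_refl] u(1) uu'(2)] unit_leaf'(1)[OF fI[OF order_refl] u'(1) uu'(3)] by blast+
  define n where "n = k + 2"
  define e where "e = f(k + 1 := u, k + 2 := u')"
  have n4: "n \<ge> 4" and e: "\<And>t. t \<le> k \<Longrightarrow> e t = f t" "e (k + 1) = u" "e (k + 2) = u'"
    using k2 by (auto simp: n_def e_def)
  have u'f: "u' \<notin> f ` {..k}" and uf: "u \<notin> f ` {..k}" and uu: "u' \<noteq> u" using fresh u u' by auto
  have iv: "{0..n} = insert (k + 2) (insert (k + 1) {..k})" by (auto simp: n_def)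
  have "inj_on e {..k}" using inj e(1) by (auto simp: inj_on_def)
  moreover have "e ` {..k} = f ` {..k}" using e(1) by auto
  ultimately have "inj_on e (insert (k + 1) {..k})" "e ` insert (k + 1) {..k} = insert u (f ` {..k})"
    using e(2) uf by auto
  then have einj: "inj_on e {0..n}" unfolding iv using e(3) u'f uu by auto
  have nb: "{j \<in> {0..n}. j \<noteq> i \<and> {i, j} \<in> D_edges n} = (if i < 2 then {2} else if i > k then {k}
     else insert (Suc i) (if i = k then {k + 2} else {}) \<union> (if i = 2 then {0, 1} else {i - 1}))" if "i \<le> n" for i
  proof -
    have E: "{i, j} \<in> D_edges n \<longleftrightarrow> (j = Suc i \<and> 1 \<le> i \<and> j \<le> Suc k) \<or> (i = Suc j \<and> 1 \<le> j \<and> i \<le> Suc k)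
      \<or> i = 0 \<and> j = 2 \<or> i = 2 \<and> j = 0 \<or> i = k \<and> j = k + 2 \<or> i = k + 2 \<and> j = k" for j
      unfolding mem_D_edges n_def doubleton_eq_iff by auto
    have "i = 0 \<or> i = 1 \<or> i = 2 \<and> i = k \<or> i = 2 \<and> i < k \<or> 2 < i \<and> i < k \<or> 2 < i \<and> i = k \<or> i = k + 1 \<or> i = k + 2"
      using that unfolding n_def by linarith
    then show ?thesis unfolding E unfolding n_def by (elim disjE) (use k2 in auto)
  qed
  have "labelled e n (D_edges n)"
  proof (rule labelledI[OF einj])
    show "e i \<in> I" if "i \<le> n" for i
      using that e fI N_in_I[OF u(1)] N_in_I[OF u'(1)] by (auto simp: n_def le_Suc_eq)
    show "N (e i) = e ` {j \<in> {0..n}. j \<noteq> i \<and> {i, j} \<in> D_edges n}" if i: "i \<le> n" for i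
    proof -
      consider "i < 2" | "i > k" | "2 \<le> i" "i < k" | "i = k" by linarith
      then show ?thesis
      proof cases
        case 1
        then have "i = 0 \<or> i = 1" by auto
        then show ?thesis unfolding nb[OF i] using 1 e(1) f012 Np Ny k2 by auto
      next
        case 2
        then have "i = k + 1 \<or> i = k + 2" using i by (auto simp: n_def)
        then show ?thesis unfolding nb[OF i] using 2 e Nu k2 by auto
      next
        case 3
        then show ?thesis unfolding nb[OF i] using fN[of i] e(1) f012 by (auto simp: prev_def)
      next
        case 4
        then show ?thesis unfolding nb[OF i] using Nk e f012 k2 by (auto simp: prev_def)
      qed
    qed
  qed
  moreover have "\<omega> (e i) = D_marks n i" if "i \<le> n" for i
  proof -
    have "i = 0 \<or> i = 1 \<or> 2 \<le> i \<and> i \<le> k \<or> i = k + 1 \<or> i = k + 2" using that unfolding n_def by linarith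
    then consider "i = 0" | "i = 1" | "2 \<le> i" "i \<le> k" | "i = k + 1" | "i = k + 2" by blast
    then show ?thesis
      using e f012 fw[of i] p y uu' k2 by cases (auto simp: D_marks_def n_def)
  qed
  ultimately show thesis using that[of n e] n4 e(1) f012 k2 by auto
qed

lemma labelled_list:
  assumes "distinct xs" "length xs = Suc n" "set xs \<subseteq> I" "\<forall>x\<in>set xs. N x \<subseteq> set xs"
    and "\<forall>i\<in>{0..n}. \<forall>j\<in>{0..n}. i \<noteq> j \<longrightarrow> (xs ! j \<in> N (xs ! i) \<longleftrightarrow> {i, j} \<in> E)"
  shows "labelled ((!) xs) n E"
proof -
  have b: "bij_betw ((!) xs) {0..n} (set xs)"
    using bij_betw_nth[OF assms(1)] assms(2) by (simp add: atLeast0AtMost lessThan_Suc_atMost)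
  have "set xs \<noteq> {}" using assms(2) by auto
  then have "set xs = I"
    by (intro connected[OF assms(3)]) (use assms(3,4) in \<open>auto simp: N_def\<close>)
  moreover have "xs ! i \<in> I" if "i \<le> n" for i using assms(2,3) that by auto
  ultimately show ?thesis using b assms(5) by (auto simp: labelled_def N_def)
qed

text \<open>The weights along an arm from \<open>p\<close> are 1, 2, 3 and so on. At the end of a
  longest such arm a node of weight \<open>k + 1\<close> has the remainder \<open>k + 2\<close>,
  shared by at least two further neighbours of weight at least \<open>(k + 1) / 2\<close>. Three of
  them force \<open>k = 1\<close> and type D. With two, the remainders beyond them add up to 2. If
  both are 1, the type is E_6. If they are 0 and 2, then \<open>fork\<close> gives type D for
  \<open>k = 1\<close> and otherwise follows the long arm to a remainder \<open>(5 - k) / 2\<close>,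
  which leaves E_7 for \<open>k = 3\<close> and E_8 for \<open>k = 5\<close>.\<close>

lemma E_or_D_labelling:
  obtains (D) e n where "n \<ge> 4" "e 0 = p" "labelled e n (D_edges n)" "\<And>i. i \<le> n \<Longrightarrow> \<omega> (e i) = D_marks n i"
  | (E6) e where "e 2 = p" "labelled e 6 E6_edges" "\<forall>i\<in>{0..6}. \<omega> (e i) = real ([3, 2, 1, 2, 1, 2, 1] ! i)"
  | (E7) e where "e 3 = p" "labelled e 7 E7_edges" "\<forall>i\<in>{0..7}. \<omega> (e i) = real ([4, 3, 2, 1, 3, 2, 1, 2] ! i)"
  | (E8) e where "e 5 = p" "labelled e 8 {{0, 1}, {1, 2}, {2, 3}, {3, 4}, {4, 5}, {0, 6}, {6, 7}, {0, 8}}" "\<forall>i\<in>{0..8}. \<omega> (e i) = real ([6, 5, 4, 3, 2, 1, 4, 2, 3] ! i)"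
proof -
  define R where "R f k \<longleftrightarrow> k \<ge> 1 \<and> f 0 = p \<and> (\<forall>u\<le>k. f u \<in> I \<and> \<omega> (f u) = real (Suc u))
    \<and> (\<forall>u<k. N (f u) = insert (f (Suc u)) (if u = 0 then {} else {f (u - 1)}))" for f :: "nat \<Rightarrow> 'a" and k
  have bound: "k \<le> card I" if R: "R f k" for f k
  proof -
    have "inj_on f {..k}"
    proof (rule inj_onI)
      fix x y assume "x \<in> {..k}" "y \<in> {..k}" "f x = f y"
      then have "real (Suc x) = real (Suc y)" using R unfolding R_def by (metis atMost_iff)
      then show "x = y" by simp
    qed
    then have "card {..k} \<le> card I" by (rule card_inj_on_le) (use R fin in \<open>auto simp: R_def\<close>)
    then show ?thesis by simp
  qed
  obtain p' where p': "N p = {p'}" "\<omega> p' = 2" using unit_leaf p by blast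
  have "R (\<lambda>t. if t = 0 then p else p') 1"
    using p p' N_in_I[of p' p] by (auto simp: R_def le_Suc_eq)
  then have "\<exists>k. (\<exists>f. R f k) \<and> (\<forall>k'. (\<exists>f. R f k') \<longrightarrow> k' \<le> k)"
    by (intro Nat.ex_has_greatest_nat[of _ 1 "card I"]) (use bound in blast)+
  then obtain k f where f: "R f k" and max: "\<And>f k'. R f k' \<Longrightarrow> k' \<le> k" by blast
  have k1: "k \<ge> 1" and f0: "f 0 = p" and fI: "\<And>u. u \<le> k \<Longrightarrow> f u \<in> I" and fw: "\<And>u. u \<le> k \<Longrightarrow> \<omega> (f u) = real (Suc u)"
    and fN: "\<And>u. u < k \<Longrightarrow> N (f u) = insert (f (Suc u)) (if u = 0 then {} else {f (u - 1)})"
    using f by (auto simp: R_def)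
  let ?v = "f k" and ?q = "f (k - 1)"
  have vI: "?v \<in> I" and wv: "\<omega> ?v = real k + 1" using fI[of k] fw[of k] by auto
  have qv: "?q \<in> N ?v" using fN[of "k - 1"] N_commute[OF fI[of "k - 1"], of ?v] k1 by simp
  have half: "\<omega> r \<ge> \<omega> i / 2" "rem r {i} = 2 * \<omega> r - \<omega> i" if "i \<in> I" "r \<in> N i" for i r
    using rem_empty[OF N_in_I[OF that(2)]] rem_split[OF N_commute[OF that], of "{}"] rem_dichotomy[of r "{i}"] by auto
  have rv: "rem ?v {?q} = real k + 2"
    using rem_empty[OF vI] rem_split[OF qv, of "{}"] wv fw[of "k - 1"] k1 by simp
  then obtain r where r: "r \<in> N ?v" "r \<noteq> ?q" "rem ?v {?q} = \<omega> r + rem ?v {r, ?q}"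
    by (rule_tac rem_cases[of ?v "{?q}"]) auto
  obtain r' where r': "r' \<in> N ?v" "r' \<notin> {r, ?q}" "rem ?v {r, ?q} = \<omega> r' + rem ?v {r', r, ?q}"
  proof (rule rem_cases[of ?v "{r, ?q}"])
    assume z: "rem ?v {r, ?q} = 0" "N ?v \<subseteq> {r, ?q}"
    have "R (f(Suc k := r)) (Suc k)" unfolding R_def
    proof (intro conjI allI impI)
      fix u assume u: "u < Suc k"
      have "N ?v = {r, ?q}" using z(2) r(1) qv by blast
      then show "N ((f(Suc k := r)) u) = insert ((f(Suc k := r)) (Suc u)) (if u = 0 then {} else {(f(Suc k := r)) (u - 1)})"
        using fN[of u] u k1 by (cases "u = k") auto
    qed (use f0 fI fw r rv z N_in_I[OF r(1)] in \<open>auto simp: le_Suc_eq\<close>)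
    then show thesis using max by force
  qed (use that in auto)
  have hr: "\<omega> r \<ge> (real k + 1) / 2" "\<omega> r' \<ge> (real k + 1) / 2"
    using half(1)[OF vI r(1)] half(1)[OF vI r'(1)] wv by auto
  have sum: "\<omega> r + \<omega> r' + rem ?v {r', r, ?q} = real k + 2" using rv r(3) r'(3) by simp
  note result = that
  show thesis
  proof (cases "rem ?v {r', r, ?q} = 0 \<and> N ?v \<subseteq> {r', r, ?q}")
    case False
    then obtain r'' where r'': "r'' \<in> N ?v" "r'' \<notin> {r', r, ?q}" "rem ?v {r', r, ?q} \<ge> \<omega> r''"
      by (rule_tac rem_cases[of ?v "{r', r, ?q}"]) auto
    have "\<omega> r'' \<ge> (real k + 1) / 2" using half(1)[OF vI r''(1)] wv by simp
    then have "real k \<le> 1" using sum hr r''(3) by (simp add: field_simps)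
    then have k: "k = 1" using k1 by simp
    have "\<omega> r = 1" using sum hr r''(3) \<open>\<omega> r'' \<ge> (real k + 1) / 2\<close> k by simp
    moreover have "\<omega> ?v = 2" "r \<noteq> p" "p \<in> N ?v" using wv k r(2) f0 qv by auto
    ultimately show thesis using vI r(1) by (rule_tac D_labelling[of ?v r]) (assumption+, rule D)
  next
    case True
    then have Nv: "N ?v = {r', r, ?q}" and sum0: "\<omega> r + \<omega> r' = real k + 2" using r(1) r'(1) qv sum by auto
    have fork: thesis
      if y: "y \<in> N ?v" "y \<noteq> ?q" "\<omega> y = (real k + 1) / 2" "N y \<subseteq> {?v}" and z: "z \<in> N ?v" "z \<noteq> ?q" "z \<noteq> y" "\<omega> z = (real k + 3) / 2"
      and Nv: "N ?v = {y, z, ?q}" for y z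
    proof (cases "k = 1")
      case True
      then have "\<omega> ?v = 2" "\<omega> y = 1" "y \<noteq> p" "p \<in> N ?v" using wv y f0 qv by auto
      then show thesis using vI y(1) by (rule_tac D_labelling[of ?v y]) (assumption+, rule D)
    next
      case False
      have "rem z {?v} = 2" using half(2)[OF vI z(1)] wv z(4) by (simp add: field_simps)
      then obtain u where u: "u \<in> N z" "u \<noteq> ?v" "\<omega> u \<ge> 1" "2 = \<omega> u + rem z {u, ?v}"
        by (rule_tac rem_cases[of z "{?v}"]) auto
      have zI: "z \<in> I" using N_in_I z(1) .
      \<comment> \<open>The neighbour of a unit leaf has weight 2, but \<open>z\<close> has weight
        \<open>(k + 3) / 2\<close> and \<open>k\<close> is not 1.\<close>
      have "\<not> \<omega> u \<le> 1"
        using unit_leaf'(2)[OF zI u(1)] u(3) z(4) False by auto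
      then have "rem z {u, ?v} = 0" "N z \<subseteq> {u, ?v}" using rem_dichotomy[of z "{u, ?v}"] u(4) by auto
      then have wu: "\<omega> u = 2" and Nz: "N z = {u, ?v}" using u(1,4) N_commute[OF vI z(1)] by auto
      have uI: "u \<in> I" using N_in_I u(1) .
      have ru: "rem u {z} = (5 - real k) / 2" using half(2)[OF zI u(1)] wu z(4) by (simp add: field_simps)
      have uy: "u \<noteq> y" using u(1) y(4) N_commute[OF zI u(1)] z(1) N_irrefl[of ?v] by auto
      have Ny: "N y = {?v}" using y(4) N_commute[OF vI y(1)] by blast
      consider "rem u {z} = 0" "N u \<subseteq> {z}" | "rem u {z} \<ge> 1" using rem_dichotomy by blast
      then show thesis
      proof cases
        case 1
        then have k: "k = 5" using ru by simp
        have Nu: "N u = {z}" using 1 N_commute[OF zI u(1)] by blast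
        let ?xs = "[f 5, f 4, f 3, f 2, f 1, f 0, z, u, y]"
        have w: "\<omega> (f 0) = 1" "\<omega> (f 1) = 2" "\<omega> (f 2) = 3" "\<omega> (f 3) = 4" "\<omega> (f 4) = 5" "\<omega> (f 5) = 6"
          "\<omega> y = 3" "\<omega> z = 4" using fw k y(3) z(4) by auto
        have L: "{0..8::nat} = {0, 1, 2, 3, 4, 5, 6, 7, 8}" by auto
        show thesis
        proof (rule E8[of "(!) ?xs"])
          show "labelled ((!) ?xs) 8 {{0, 1}, {1, 2}, {2, 3}, {3, 4}, {4, 5}, {0, 6}, {6, 7}, {0, 8}}"
          proof (rule labelled_list)
            have "f 4 \<in> N (f 3)" "f 0 \<in> N (f 1)" "f 3 \<in> N (f 2)"
              using fN[of 1] fN[of 2] fN[of 3] k by (simp_all add: eval_nat_numeral)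
            then have "z \<noteq> f 3" "u \<noteq> f 1" "y \<noteq> f 2" using Nz Nu Ny k w wu by auto
            then show dist: "distinct ?xs" using w wu by auto
            then have dist': "distinct (rev ?xs)" by (simp only: distinct_rev)
            have Nf: "N (f 0) = {f 1}" "N (f 1) = {f 2, f 0}" "N (f 2) = {f 3, f 1}" "N (f 3) = {f 4, f 2}"
              "N (f 4) = {f 5, f 3}" "N (f 5) = {y, z, f 4}"
              using fN[of 0] fN[of 1] fN[of 2] fN[of 3] fN[of 4] Nv k by (auto simp: eval_nat_numeral)
            show "set ?xs \<subseteq> I" using fI k zI uI N_in_I[OF y(1)] by auto
            show "\<forall>x\<in>set ?xs. N x \<subseteq> set ?xs" using Nf Nz Nu Ny k by auto
            show "\<forall>i\<in>{0..8}. \<forall>j\<in>{0..8}. i \<noteq> j \<longrightarrow> (?xs ! j \<in> N (?xs ! i) \<longleftrightarrow> {i, j} \<in> {{0, 1}, {1, 2}, {2, 3}, {3, 4}, {4, 5}, {0, 6}, {6, 7}, {0, 8}})"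
              unfolding L using dist dist' by (simp add: Nf[unfolded One_nat_def] Nz[unfolded k] Nu Ny[unfolded k] doubleton_eq_iff)
          qed simp
          show "\<forall>i\<in>{0..8}. \<omega> (?xs ! i) = real ([6, 5, 4, 3, 2, 1, 4, 2, 3] ! i)" unfolding L using w wu by simp
        qed (simp add: f0)
      next
        case 2
        then have "k = 2 \<or> k = 3" using ru k1 False by auto
        then show thesis
        proof
          assume k: "k = 3"
          obtain t where t: "t \<in> N u" "t \<noteq> z" "\<omega> t \<ge> 1" "rem u {z} = \<omega> t + rem u {t, z}"
            using 2 by (rule_tac rem_cases[of u "{z}"]) auto
          then have t1: "\<omega> t = 1" "N u \<subseteq> {t, z}" using ru k rem_dichotomy[of u "{t, z}"] by auto
          have Nu: "N u = {t, z}" and Nt: "N t = {u}"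
            using t1 t(1) N_commute[OF zI u(1)] unit_leaf'(1)[OF uI t(1) t1(1)] by auto
          let ?xs = "[f 3, f 2, f 1, f 0, z, u, t, y]"
          have w: "\<omega> (f 0) = 1" "\<omega> (f 1) = 2" "\<omega> (f 2) = 3" "\<omega> (f 3) = 4"
            "\<omega> y = 2" "\<omega> z = 3" using fw k y(3) z(4) by auto
          have Nf: "N (f 0) = {f 1}" "N (f 1) = {f 2, f 0}" "N (f 2) = {f 3, f 1}" "N (f 3) = {y, z, f 2}"
            using fN[of 0] fN[of 1] fN[of 2] Nv k by (auto simp: eval_nat_numeral)
          have L: "{0..7::nat} = {0, 1, 2, 3, 4, 5, 6, 7}" by auto
          have "z \<noteq> f 2" using z(2) k by simp
          moreover have "z \<in> N u" "f 0 \<in> N (f 1)" using Nu Nf by auto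
          ultimately have ne: "z \<noteq> f 2" "u \<noteq> f 1" "y \<noteq> f 1" using Nf Ny w by auto
          moreover have "t \<noteq> f 0" using Nt Nf(1) ne by auto
          ultimately have ne: "z \<noteq> f 2" "u \<noteq> f 1" "y \<noteq> f 1" "t \<noteq> f 0" "u \<noteq> y" using uy by auto
          have dist: "distinct ?xs" using ne w wu t1 by auto
          then have dist': "distinct (rev ?xs)" by (simp only: distinct_rev)
          show thesis
          proof (rule E7[of "(!) ?xs"])
            show "labelled ((!) ?xs) 7 E7_edges"
            proof (rule labelled_list[OF dist])
              show "set ?xs \<subseteq> I" using fI k zI uI N_in_I[OF y(1)] N_in_I[OF t(1)] by auto
              show "\<forall>x\<in>set ?xs. N x \<subseteq> set ?xs" using Nf Nz Nu Ny Nt k by auto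
              show "\<forall>i\<in>{0..7}. \<forall>j\<in>{0..7}. i \<noteq> j \<longrightarrow> (?xs ! j \<in> N (?xs ! i) \<longleftrightarrow> {i, j} \<in> E7_edges)"
                unfolding L using dist dist' by (simp add: Nf[unfolded One_nat_def] Nz[unfolded k] Nu Ny[unfolded k] Nt E7_edges_def doubleton_eq_iff)
            qed simp
            show "\<forall>i\<in>{0..7}. \<omega> (?xs ! i) = real ([4, 3, 2, 1, 3, 2, 1, 2] ! i)" unfolding L using w wu t1 by simp
          qed (simp add: f0)
        next
          assume k: "k = 2"
          \<comment> \<open>For \<open>k = 2\<close> a node of weight 3/2 appears with a remainder
            of 1, hence with a unit leaf; but the neighbour of a unit leaf has weight 2.\<close>
          obtain t where t: "t \<in> N u" "t \<noteq> z" "\<omega> t \<ge> 1" "rem u {z} = \<omega> t + rem u {t, z}"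
            using 2 by (rule_tac rem_cases[of u "{z}"]) auto
          then have wt: "\<omega> t = 3 / 2" using ru k rem_dichotomy[of u "{t, z}"] by auto
          have tI: "t \<in> I" using N_in_I t(1) .
          have "rem t {u} = 1" using half(2)[OF uI t(1)] wt wu by simp
          then obtain s where "s \<in> N t" "\<omega> s = 1" by (rule_tac rem_cases[of t "{u}"]) auto
          then show thesis using unit_leaf'(2)[OF tI] wt by auto
        qed
      qed
    qed
    have rr: "rem r {?v} + rem r' {?v} = 2" using half(2)[OF vI r(1)] half(2)[OF vI r'(1)] sum0 wv by simp
    consider "rem r {?v} = 0" "N r \<subseteq> {?v}" | "rem r' {?v} = 0" "N r' \<subseteq> {?v}" | "rem r {?v} = 1" "rem r' {?v} = 1"
      using rem_dichotomy[of r "{?v}"] rem_dichotomy[of r' "{?v}"] rr by fastforce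
    then show thesis
    proof cases
      case 1
      show thesis by (rule fork[of r r']) (use 1 rr half(2)[OF vI r(1)] half(2)[OF vI r'(1)] wv r r' Nv in auto)
    next
      case 2
      show thesis by (rule fork[of r' r]) (use 2 rr half(2)[OF vI r(1)] half(2)[OF vI r'(1)] wv r r' Nv in auto)
    next
      case 3
      have branch: "\<exists>t. N r = {t, ?v} \<and> t \<noteq> ?v \<and> \<omega> t = 1 \<and> N t = {r} \<and> \<omega> r = 2 \<and> k = 2"
        if r: "r \<in> N ?v" "rem r {?v} = 1" for r
      proof -
        obtain t where t: "t \<in> N r" "t \<noteq> ?v" "\<omega> t \<ge> 1" "rem r {?v} = \<omega> t + rem r {t, ?v}"
          using r(2) by (rule_tac rem_cases[of r "{?v}"]) auto
        then have t1: "\<omega> t = 1" "N r \<subseteq> {t, ?v}" using r(2) rem_dichotomy[of r "{t, ?v}"] by auto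
        have "N t = {r}" "\<omega> r = 2" using unit_leaf'[OF N_in_I[OF r(1)] t(1) t1(1)] by auto
        moreover have "k = 2" using half(2)[OF vI r(1)] r(2) wv \<open>\<omega> r = 2\<close> by simp
        ultimately show ?thesis using t t1 N_commute[OF vI r(1)] by auto
      qed
      obtain t where t: "N r = {t, ?v}" "t \<noteq> ?v" "\<omega> t = 1" "N t = {r}" "\<omega> r = 2" "k = 2"
        using branch[OF r(1) 3(1)] by blast
      obtain t' where t': "N r' = {t', ?v}" "t' \<noteq> ?v" "\<omega> t' = 1" "N t' = {r'}" "\<omega> r' = 2"
        using branch[OF r'(1) 3(2)] by blast
      let ?xs = "[f 2, f 1, f 0, r, t, r', t']"
      have w: "\<omega> (f 0) = 1" "\<omega> (f 1) = 2" "\<omega> (f 2) = 3" using fw \<open>k = 2\<close> by auto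
      have Nf: "N (f 0) = {f 1}" "N (f 1) = {f 2, f 0}" "N (f 2) = {r', r, f 1}"
        using fN[of 0] fN[of 1] Nv \<open>k = 2\<close> by (auto simp: eval_nat_numeral)
      have Nr: "N r = {t, f 2}" "N r' = {t', f 2}" using t(1) t'(1) \<open>k = 2\<close> by auto
      have L: "{0..6::nat} = {0, 1, 2, 3, 4, 5, 6}" by auto
      have ne: "r \<noteq> f 1" "r' \<noteq> f 1" "r \<noteq> r'" using r(2) r'(2) \<open>k = 2\<close> by auto
      then have "t \<noteq> f 0" "t' \<noteq> f 0" "t \<noteq> t'" using t(4) t'(4) Nf(1) by auto
      then have dist: "distinct ?xs" using ne w t(3,5) t'(3,5) by auto
      then have dist': "distinct (rev ?xs)" by (simp only: distinct_rev)
      show thesis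
      proof (rule E6[of "(!) ?xs"])
        show "labelled ((!) ?xs) 6 E6_edges"
        proof (rule labelled_list[OF dist])
          show "set ?xs \<subseteq> I" using fI \<open>k = 2\<close> N_in_I[OF r(1)] N_in_I[OF r'(1)] N_in_I[of t r] N_in_I[of t' r'] Nr by auto
          show "\<forall>x\<in>set ?xs. N x \<subseteq> set ?xs" using Nf Nr t(4) t'(4) by auto
          show "\<forall>i\<in>{0..6}. \<forall>j\<in>{0..6}. i \<noteq> j \<longrightarrow> (?xs ! j \<in> N (?xs ! i) \<longleftrightarrow> {i, j} \<in> E6_edges)"
            unfolding L using dist dist' by (simp add: Nf[unfolded One_nat_def] Nr t(4) t'(4) E6_edges_def doubleton_eq_iff)
        qed simp
        show "\<forall>i\<in>{0..6}. \<omega> (?xs ! i) = real ([3, 2, 1, 2, 1, 2, 1] ! i)" unfolding L using w t(3,5) t'(3,5) by simp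
      qed (simp add: f0)
    qed
  qed
qed

end

section \<open>Classification\<close>

locale maximal_coxeter = coxeter_weights I \<alpha> b c
  for I :: "'i set" and \<alpha> :: "'i \<Rightarrow> 'a::euclidean_space" and b c +
  fixes W :: "('a \<Rightarrow> 'a) set" and C :: "'a set" and p :: 'i
  assumes max: "maximal_reflection_subgroup W \<Gamma>" and inf: "infinite_index W \<Gamma>"
    and C: "fundamental_chamber W C"
    and p: "p \<in> I" and p_min: "i \<in> I \<Longrightarrow> c p \<le> c i"
begin

definition A :: "'i \<Rightarrow> 'i \<Rightarrow> bool" where
  "A i j \<longleftrightarrow> i \<noteq> j \<and> \<kappa> i j = 1"

definition \<omega> :: "'i \<Rightarrow> real" where
  "\<omega> i = c i / c p"

sublocale harmonic_graph I A \<omega> p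
proof
  have cp: "c p > 0" using weight_pos p by blast
  show "finite I" "p \<in> I" "\<omega> p = 1" using finite_I p cp by (auto simp: \<omega>_def)
  show "A i j \<longleftrightarrow> A j i" "\<not> A i i" for i j by (auto simp: A_def \<kappa>_commute)
  show "\<omega> i \<ge> 1" if "i \<in> I" for i using p_min[OF that] cp by (simp add: \<omega>_def)
  show "J = I" if J: "J \<subseteq> I" "J \<noteq> {}" "\<And>i j. i \<in> J \<Longrightarrow> j \<in> I \<Longrightarrow> j \<notin> J \<Longrightarrow> \<not> A i j" for J
  proof (rule closed_eq_I[OF J(1,2)])
    show "\<kappa> i j = 0" if "i \<in> J" "j \<in> I" "j \<notin> J" for i j
      using simply_laced[OF max inf, of i j] J(3)[OF that] J(1) that by (auto simp: A_def)
  qed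
  show "(\<Sum>j | j \<in> I \<and> A i j. \<omega> j) = 2 * \<omega> i" if i: "i \<in> I" for i
  proof -
    have "(\<Sum>j\<in>I - {i}. \<kappa> i j * \<omega> j) = (\<Sum>j | j \<in> I \<and> A i j. \<omega> j)"
      by (rule sum.mono_neutral_cong_right) (use finite_I simply_laced[OF max inf i] in \<open>auto simp: A_def\<close>)
    moreover have "(\<Sum>j\<in>I - {i}. \<kappa> i j * \<omega> j) = rest i {} / c p"
      by (simp add: rest_def \<omega>_def sum_divide_distrib)
    ultimately show ?thesis using rest_empty[OF i] by (simp add: \<omega>_def)
  qed
qed

lemma gram_labelled:
  assumes "labelled e n E" "i \<in> {0..n}" "j \<in> {0..n}"
  shows "\<alpha> (e i) \<bullet> \<alpha> (e j) = gadj E i j"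
proof (cases "i = j")
  case True
  then show ?thesis using assms norm2 by (auto simp: labelled_def gadj_def bij_betw_def)
next
  case False
  have I: "e i \<in> I" "e j \<in> I" "e i \<noteq> e j" using assms False by (auto simp: labelled_def bij_betw_def inj_on_def)
  then have "\<alpha> (e i) \<bullet> \<alpha> (e j) = (if A (e i) (e j) then - 1 else 0)"
    using simply_laced[OF max inf I] by (auto simp: A_def \<kappa>_def)
  then show ?thesis using assms False by (simp add: labelled_def gadj_def)
qed

text \<open>Integral weights \<open>M\<close> become the marks, with \<open>1 / c p\<close> as the
  constant \<open>d\<close>. The conjugate simplex supplied by \<open>corank_one_exists\<close> has
  the same Gram matrix and so inherits the labelling.\<close>

lemma labelled_subgroup_exists:
  assumes e: "labelled e n E" and M: "\<forall>i\<in>{0..n}. \<omega> (e i) = real (M i)" and l: "e l = p" "l \<in> {0..n}"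
  obtains \<alpha>' b' c' d \<nu> q where "labelled_subgroup n \<alpha>' b' c' M d l W \<nu> q E C"
proof -
  have bij: "bij_betw e {0..n} I" using e by (simp add: labelled_def)
  have eI: "e i \<in> I" if "i \<in> {0..n}" for i using bij_betwE[OF bij] that by blast
  have img: "e ` {0..n} = I" using bij by (simp add: bij_betw_def)
  have cp: "c p > 0" using weight_pos p by blast
  interpret S: affine_simply_laced "{0..n}" "\<lambda>i. \<alpha> (e i)" "\<lambda>i. b (e i)" "\<lambda>i. c (e i)" M "1 / c p" l
  proof
    show "\<alpha> (e i) \<noteq> 0" "c (e i) > 0" "\<alpha> (e i) \<bullet> \<alpha> (e i) = 2" if "i \<in> {0..n}" for i
      using nonzero weight_pos norm2 eI[OF that] by auto
    show "(\<Sum>i\<in>{0..n}. c (e i) * (\<alpha> (e i) \<bullet> x - b (e i))) = 1" for x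
      using sum.reindex_bij_betw[OF bij, of "\<lambda>i. c i * (\<alpha> i \<bullet> x - b i)"] barycentric_sum by simp
    show "\<exists>x. \<forall>i\<in>{0..n}. \<alpha> (e i) \<bullet> x - b (e i) = y i" if y: "(\<Sum>i\<in>{0..n}. c (e i) * y i) = 1" for y
    proof -
      have inv: "inv_into {0..n} e (e i) = i" if "i \<in> {0..n}" for i using bij that by (simp add: bij_betw_def)
      have "(\<Sum>i\<in>I. c i * y (inv_into {0..n} e i)) = (\<Sum>i\<in>{0..n}. c (e i) * y (inv_into {0..n} e (e i)))"
        by (rule sum.reindex_bij_betw[OF bij, symmetric])
      also have "\<dots> = 1" using y inv by simp
      finally obtain x where x: "\<forall>i\<in>I. \<alpha> i \<bullet> x - b i = y (inv_into {0..n} e i)"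
        using barycentric_point[of "\<lambda>i. y (inv_into {0..n} e i)"] by blast
      have "\<alpha> (e i) \<bullet> x - b (e i) = y i" if "i \<in> {0..n}" for i using bspec[OF x eI[OF that]] inv[OF that] by simp
      then show ?thesis by blast
    qed
    show "v = 0" if "\<And>i. i \<in> {0..n} \<Longrightarrow> \<alpha> (e i) \<bullet> v = 0" for v
      by (rule spanning) (use that img in auto)
    show "\<alpha> (e i) \<bullet> \<alpha> (e j) \<in> {0, - 1, - 2}" if "i \<in> {0..n}" "j \<in> {0..n}" "i \<noteq> j" for i j
      using gram_labelled[OF e that(1,2)] that(3) by (simp add: gadj_def)
    show "1 / c p > 0" "l \<in> {0..n}" using cp l by auto
    show "c (e i) = real (M i) / (1 / c p)" if "i \<in> {0..n}" for i
      using bspec[OF M that] cp by (simp add: \<omega>_def field_simps)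
    show "M l = 1" using bspec[OF M l(2)] l(1) cp by (simp add: \<omega>_def)
    show "\<exists>j\<in>{0..n}. \<alpha> (e j) \<bullet> \<alpha> (e i) = - 1" if i: "i \<in> {0..n}" for i
    proof -
      have "rem (e i) {} \<noteq> 0" using rem_empty[OF eI[OF i]] weight_ge_1[OF eI[OF i]] by simp
      then obtain j where "j \<in> N (e i)" by (rule_tac rem_cases[of "e i" "{}"]) auto
      moreover from this obtain k where "k \<in> {0..n}" "j = e k" using img N_in_I by blast
      ultimately show ?thesis by (intro bexI[of _ k]) (auto simp: N_def A_def \<kappa>_def inner_commute)
    qed
  qed simp
  have "(\<lambda>i. \<rho> (\<alpha> (e i)) (b (e i))) ` {0..n} = (\<lambda>i. \<rho> (\<alpha> i) (b i)) ` I"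
    unfolding img[symmetric] image_image ..
  then have G: "S.G = \<Gamma>" by (simp add: S.G_def \<Gamma>_def)
  obtain \<alpha>' b' \<nu> q where sub: "corank_one_subgroup {0..n} \<alpha>' b' (\<lambda>i. c (e i)) M (1 / c p) l W \<nu> q"
    "\<And>i j. \<alpha>' i \<bullet> \<alpha>' j = \<alpha> (e i) \<bullet> \<alpha> (e j)"
    by (rule S.corank_one_exists[unfolded G, OF max inf]) (rule that)
  interpret T: corank_one_subgroup "{0..n}" \<alpha>' b' "\<lambda>i. c (e i)" M "1 / c p" l W \<nu> q by (rule sub(1))
  have "labelled_subgroup n \<alpha>' b' (\<lambda>i. c (e i)) M (1 / c p) l W \<nu> q E C"
    by unfold_locales (use gram_labelled[OF e] sub(2) C in auto)
  then show thesis by (rule that)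
qed

lemma simplex_diagram_labelled:
  assumes "labelled e n E"
  shows "coxeter_diagram {x. \<forall>i\<in>I. \<alpha> i \<bullet> x \<ge> b i} \<simeq>\<^sub>D simple_diagram {0..n} E"
proof -
  interpret P: irredundant_polyhedron I \<alpha> b "{x. \<forall>i\<in>I. \<alpha> i \<bullet> x \<ge> b i}"
    by (rule irredundant_polyhedron) (use norm2 card_I in auto)
  interpret P: simply_laced_polyhedron I \<alpha> b "{x. \<forall>i\<in>I. \<alpha> i \<bullet> x \<ge> b i}"
    by unfold_locales (use simply_laced[OF max inf] in \<open>force simp: \<kappa>_def\<close>)
  have e: "bij_betw e {0..n} I" using assms by (simp add: labelled_def)
  let ?f = "inv_into {0..n} e"
  have ef: "e (?f i) = i" "?f i \<in> {0..n}" if "i \<in> I" for i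
    using e that by (auto simp: bij_betw_def f_inv_into_f inv_into_into)
  have ne: "?f i \<noteq> ?f j" if "i \<in> I" "j \<in> I" "i \<noteq> j" for i j using ef that by metis
  show ?thesis
  proof (rule diagram_iso_trans[OF P.coxeter_diagram_iso])
    show "Diagram I (\<lambda>i j. if \<alpha> i \<bullet> \<alpha> j = 0 then 0 else if \<alpha> i \<bullet> \<alpha> j = - 1 then 1 else \<infinity>) \<simeq>\<^sub>D simple_diagram {0..n} E"
      unfolding diagram_iso_def simple_diagram_def diagram.sel
    proof (intro exI[of _ ?f] conjI ballI impI)
      show "bij_betw ?f I {0..n}" using e by (rule bij_betw_inv_into)
      show "(if {?f i, ?f j} \<in> E then 1 else 0) = (if \<alpha> i \<bullet> \<alpha> j = 0 then 0 else if \<alpha> i \<bullet> \<alpha> j = - 1 then 1 else (\<infinity> :: enat))"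
        if "i \<in> I" "j \<in> I" "i \<noteq> j" for i j
        using gram_labelled[OF assms ef(2)[OF that(1)] ef(2)[OF that(2)]] ef(1)[OF that(1)] ef(1)[OF that(2)] ne[OF that]
        by (simp add: gadj_def)
    qed
  qed
qed

lemma classification:
  defines "\<Sigma>\<^sub>F \<equiv> coxeter_diagram {x. \<forall>i\<in>I. \<alpha> i \<bullet> x \<ge> b i}" and "\<Sigma> \<equiv> coxeter_diagram (closure C)"
  shows "(\<exists>n k. n \<ge> 1 \<and> k \<le> n - 1 \<and>
            \<Sigma>\<^sub>F \<simeq>\<^sub>D affine_A n \<and> \<Sigma> \<simeq>\<^sub>D affine_A k +\<^sub>D affine_A (n - 1 - k)) \<or>
         (\<exists>n\<ge>4. \<Sigma>\<^sub>F \<simeq>\<^sub>D affine_D n \<and> \<Sigma> \<simeq>\<^sub>D affine_D (n - 1)) \<or>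
         (\<exists>n\<ge>4. \<Sigma>\<^sub>F \<simeq>\<^sub>D affine_D n \<and> \<Sigma> \<simeq>\<^sub>D affine_A (n - 1)) \<or>
         (\<Sigma>\<^sub>F \<simeq>\<^sub>D affine_E6 \<and> \<Sigma> \<simeq>\<^sub>D affine_D 5) \<or>
         (\<Sigma>\<^sub>F \<simeq>\<^sub>D affine_E7 \<and> \<Sigma> \<simeq>\<^sub>D affine_E6)"
proof (cases "\<exists>u v. N p = {u, v} \<and> u \<noteq> v \<and> \<omega> u = 1 \<and> \<omega> v = 1")
  case True
  then obtain u v where uv: "N p = {u, v}" "u \<noteq> v" "\<omega> u = 1" "\<omega> v = 1" by blast
  obtain e n where en: "n \<ge> 2" "e 0 = p" "labelled e n (cycle_edges n)" "\<And>i. i \<in> I \<Longrightarrow> \<omega> i = 1"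
    by (rule cycle_labelling[OF uv]) blast
  have M: "\<forall>i\<in>{0..n}. \<omega> (e i) = real 1" using en(3,4) by (auto simp: labelled_def bij_betw_def)
  obtain \<alpha>' b' c' d \<nu> q where "labelled_subgroup n \<alpha>' b' c' (\<lambda>_. 1) d 0 W \<nu> q (cycle_edges n) C"
    by (rule labelled_subgroup_exists[OF en(3) M en(2)]) (simp, rule that)
  then interpret S: labelled_subgroup n \<alpha>' b' c' "\<lambda>_. 1" d 0 W \<nu> q "cycle_edges n" C .
  have q1: "q \<in> {1..n}" using S.q_in by auto
  have "\<Sigma> \<simeq>\<^sub>D affine_A (q - 1) +\<^sub>D affine_A (n - q)" unfolding \<Sigma>_def using S.A_chamber[OF en(1)] by simp
  moreover have "\<Sigma>\<^sub>F \<simeq>\<^sub>D affine_A n"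
    using simplex_diagram_labelled[OF en(3)] en(1) by (simp add: \<Sigma>\<^sub>F_def affine_A_def cycle_edges_def)
  moreover have "n - 1 - (q - 1) = n - q" using q1 by auto
  ultimately show ?thesis using q1 en(1) by (intro disjI1 exI[of _ n] exI[of _ "q - 1"]) auto
next
  case False
  interpret T: harmonic_tree I A \<omega> p
  proof
    \<comment> \<open>A unit node with two unit neighbours would, by \<open>cycle_labelling\<close>
      started at that node, make all weights 1; then \<open>p\<close> would have two unit neighbours
      as well.\<close>
    show "\<exists>u. N i = {u} \<and> \<omega> u = 2" if i: "i \<in> I" "\<omega> i = 1" for i
    proof (rule ccontr)
      assume "\<not> (\<exists>u. N i = {u} \<and> \<omega> u = 2)"
      then obtain u v where uv: "N i = {u, v}" "u \<noteq> v" "\<omega> u = 1" "\<omega> v = 1" using unit_neighbours[OF i] by blast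
      interpret H: harmonic_graph I A \<omega> i
        by unfold_locales (use fin A_commute A_irrefl connected weight_ge_1 harmonic i in blast)+
      have one: "\<omega> j = 1" if "j \<in> I" for j by (rule H.cycle_labelling[OF uv]) (use that in blast)
      then have "\<omega> u \<noteq> 2" if "u \<in> N p" for u using N_in_I[OF that] by simp
      then show False using unit_neighbours[OF p(1) one[OF p(1)]] False by blast
    qed
  qed
  show ?thesis
  proof (rule T.E_or_D_labelling)
    fix e n assume en: "n \<ge> 4" "e 0 = p" "labelled e n (D_edges n)" "\<And>i. i \<le> n \<Longrightarrow> \<omega> (e i) = D_marks n i"
    have M: "\<forall>i\<in>{0..n}. \<omega> (e i) = real (D_marks n i)" using en(4) by simp
    obtain \<alpha>' b' c' d \<nu> q where "labelled_subgroup n \<alpha>' b' c' (D_marks n) d 0 W \<nu> q (D_edges n) C"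
      by (rule labelled_subgroup_exists[OF en(3) M en(2)]) (simp, rule that)
    then interpret S: labelled_subgroup n \<alpha>' b' c' "D_marks n" d 0 W \<nu> q "D_edges n" C .
    have "\<Sigma> \<simeq>\<^sub>D affine_D (n - 1) \<or> \<Sigma> \<simeq>\<^sub>D affine_A (n - 1)" unfolding \<Sigma>_def using S.D_chamber[OF en(1)] by simp
    moreover have "\<Sigma>\<^sub>F \<simeq>\<^sub>D affine_D n"
      using simplex_diagram_labelled[OF en(3)] en(1) by (simp add: \<Sigma>\<^sub>F_def affine_D_def D_edges_def)
    ultimately show ?thesis using en(1) by blast
  next
    fix e assume en: "e 2 = p" "labelled e 6 E6_edges" "\<forall>i\<in>{0..6}. \<omega> (e i) = real ([3, 2, 1, 2, 1, 2, 1] ! i)"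
    obtain \<alpha>' b' c' d \<nu> q where "labelled_subgroup 6 \<alpha>' b' c' ((!) [3, 2, 1, 2, 1, 2, 1]) d 2 W \<nu> q E6_edges C"
      by (rule labelled_subgroup_exists[OF en(2,3,1)]) (simp, rule that)
    then interpret S: labelled_subgroup 6 \<alpha>' b' c' "(!) [3, 2, 1, 2, 1, 2, 1]" d 2 W \<nu> q "E6_edges" C .
    have "\<Sigma> \<simeq>\<^sub>D affine_D 5" unfolding \<Sigma>_def by (rule S.E6_chamber) simp_all
    moreover have "\<Sigma>\<^sub>F \<simeq>\<^sub>D affine_E6"
      using simplex_diagram_labelled[OF en(2)] by (simp add: \<Sigma>\<^sub>F_def affine_E6_def E6_edges_def)
    ultimately show ?thesis by blast
  next
    fix e assume en: "e 3 = p" "labelled e 7 E7_edges" "\<forall>i\<in>{0..7}. \<omega> (e i) = real ([4, 3, 2, 1, 3, 2, 1, 2] ! i)"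
    obtain \<alpha>' b' c' d \<nu> q where "labelled_subgroup 7 \<alpha>' b' c' ((!) [4, 3, 2, 1, 3, 2, 1, 2]) d 3 W \<nu> q E7_edges C"
      by (rule labelled_subgroup_exists[OF en(2,3,1)]) (simp, rule that)
    then interpret S: labelled_subgroup 7 \<alpha>' b' c' "(!) [4, 3, 2, 1, 3, 2, 1, 2]" d 3 W \<nu> q "E7_edges" C .
    have "\<Sigma> \<simeq>\<^sub>D affine_E6" unfolding \<Sigma>_def by (rule S.E7_chamber) simp_all
    moreover have "\<Sigma>\<^sub>F \<simeq>\<^sub>D affine_E7"
      using simplex_diagram_labelled[OF en(2)] by (simp add: \<Sigma>\<^sub>F_def affine_E7_def E7_edges_def)
    ultimately show ?thesis by blast
  next
    fix e assume en: "e 5 = p" "labelled e 8 {{0, 1}, {1, 2}, {2, 3}, {3, 4}, {4, 5}, {0, 6}, {6, 7}, {0, 8}}" "\<forall>i\<in>{0..8}. \<omega> (e i) = real ([6, 5, 4, 3, 2, 1, 4, 2, 3] ! i)"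
    obtain \<alpha>' b' c' d \<nu> q where "labelled_subgroup 8 \<alpha>' b' c' ((!) [6, 5, 4, 3, 2, 1, 4, 2, 3]) d 5 W \<nu> q {{0, 1}, {1, 2}, {2, 3}, {3, 4}, {4, 5}, {0, 6}, {6, 7}, {0, 8}} C"
      by (rule labelled_subgroup_exists[OF en(2,3,1)]) (simp, rule that)
    then interpret S: labelled_subgroup 8 \<alpha>' b' c' "(!) [6, 5, 4, 3, 2, 1, 4, 2, 3]" d 5 W \<nu> q "{{0, 1}, {1, 2}, {2, 3}, {3, 4}, {4, 5}, {0, 6}, {6, 7}, {0, 8}}" C .
    show ?thesis by (rule FalseE, rule S.E8_no_chamber) simp_all
  qed
qed

end

text \<open>The two normals of a segment are opposite and the weights equal, so both nodes have mark
  1 and \<open>q\<close> is the second node.\<close>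

lemma (in simplex_data) segment_classification:
  assumes norm2: "\<And>i. i \<in> I \<Longrightarrow> \<alpha> i \<bullet> \<alpha> i = 2" and I: "I = {p, r}" "p \<noteq> r" and pr: "\<alpha> p \<bullet> \<alpha> r = - 2"
    and max: "maximal_reflection_subgroup W (gen ((\<lambda>i. \<rho> (\<alpha> i) (b i)) ` I))"
    and inf: "infinite_index W (gen ((\<lambda>i. \<rho> (\<alpha> i) (b i)) ` I))"
    and C: "fundamental_chamber W C"
  shows "coxeter_diagram {x. \<forall>i\<in>I. \<alpha> i \<bullet> x \<ge> b i} \<simeq>\<^sub>D affine_A 1"
    and "coxeter_diagram (closure C) \<simeq>\<^sub>D affine_A 0 +\<^sub>D affine_A 0"
proof -
  have n: "\<alpha> p \<bullet> \<alpha> p = 2" "\<alpha> r \<bullet> \<alpha> r = 2" using norm2 I by auto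
  have cp: "c p > 0" using weight_pos I by blast
  have "(\<Sum>i\<in>I. c i *\<^sub>R \<alpha> i) \<bullet> \<alpha> p = 0" using weighted_sum_zero by simp
  then have cr: "c r = c p" using I n pr by (simp add: inner_add_left inner_add_right inner_commute)
  interpret P: irredundant_polyhedron I \<alpha> b "{x. \<forall>i\<in>I. \<alpha> i \<bullet> x \<ge> b i}"
    by (rule irredundant_polyhedron) (use norm2 I in auto)
  have gram: "\<alpha> i \<bullet> \<alpha> j = - 2" if "i \<in> I" "j \<in> I" "i \<noteq> j" for i j
    using that I pr by (auto simp: inner_commute)
  interpret P: simply_laced_polyhedron I \<alpha> b "{x. \<forall>i\<in>I. \<alpha> i \<bullet> x \<ge> b i}"
    by unfold_locales (use gram in simp)
  show "coxeter_diagram {x. \<forall>i\<in>I. \<alpha> i \<bullet> x \<ge> b i} \<simeq>\<^sub>D affine_A 1"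
  proof (rule diagram_iso_trans[OF P.coxeter_diagram_iso])
    let ?f = "\<lambda>i. if i = p then 0 else (1 :: nat)"
    have "bij_betw ?f I {0, 1}" using I by (auto simp: bij_betw_def)
    then show "Diagram I (\<lambda>i j. if \<alpha> i \<bullet> \<alpha> j = 0 then 0 else if \<alpha> i \<bullet> \<alpha> j = - 1 then 1 else \<infinity>) \<simeq>\<^sub>D affine_A 1"
      unfolding diagram_iso_def affine_A_def using gram by (intro exI[of _ ?f]) auto
  qed
  interpret S: affine_simply_laced I \<alpha> b c "\<lambda>_. 1" "1 / c p" p
  proof
    show "1 / c p > 0" "p \<in> I" using cp I by auto
    show "c i = real 1 / (1 / c p)" if "i \<in> I" for i using that I cr by auto
  qed (use norm2 gram in auto)
  have G: "S.G = gen ((\<lambda>i. \<rho> (\<alpha> i) (b i)) ` I)" by (rule S.G_def)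
  obtain \<alpha>' b' \<nu> q where "corank_one_subgroup I \<alpha>' b' c (\<lambda>_. 1) (1 / c p) p W \<nu> q"
    by (rule S.corank_one_exists[unfolded G, OF max inf]) (rule that)
  then interpret T: corank_one_subgroup I \<alpha>' b' c "\<lambda>_. 1" "1 / c p" p W \<nu> q .
  have "I = {p, q}" using I T.q_in by auto
  then show "coxeter_diagram (closure C) \<simeq>\<^sub>D affine_A 0 +\<^sub>D affine_A 0" by (rule T.A1_chamber[OF _ C])
qed

theorem theorem3:
  fixes F C :: "'a::euclidean_space set" and W :: "('a \<Rightarrow> 'a) set"
  assumes "euclidean_coxeter_simplex F"
    and "maximal_reflection_subgroup W (facet_reflection_group F)"
    and "infinite_index W (facet_reflection_group F)"
    and "fundamental_chamber W C"
  defines "\<Sigma>\<^sub>F \<equiv> coxeter_diagram F" and "\<Sigma> \<equiv> coxeter_diagram (closure C)"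
  shows "(\<exists>n k. n \<ge> 1 \<and> k \<le> n - 1 \<and>
            \<Sigma>\<^sub>F \<simeq>\<^sub>D affine_A n \<and> \<Sigma> \<simeq>\<^sub>D affine_A k +\<^sub>D affine_A (n - 1 - k)) \<or>
         (\<exists>n\<ge>4. \<Sigma>\<^sub>F \<simeq>\<^sub>D affine_D n \<and> \<Sigma> \<simeq>\<^sub>D affine_D (n - 1)) \<or>
         (\<exists>n\<ge>4. \<Sigma>\<^sub>F \<simeq>\<^sub>D affine_D n \<and> \<Sigma> \<simeq>\<^sub>D affine_A (n - 1)) \<or>
         (\<Sigma>\<^sub>F \<simeq>\<^sub>D affine_E6 \<and> \<Sigma> \<simeq>\<^sub>D affine_D 5) \<or>
         (\<Sigma>\<^sub>F \<simeq>\<^sub>D affine_E7 \<and> \<Sigma> \<simeq>\<^sub>D affine_E6)"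
proof -
  have simplex: "int DIM('a) simplex F" using assms(1) by (simp add: euclidean_coxeter_simplex_def)
  obtain I :: "'a set" and \<alpha> b c where data: "simplex_data I \<alpha> b c" and norm2: "\<And>v. v \<in> I \<Longrightarrow> \<alpha> v \<bullet> \<alpha> v = 2"
    and F: "F = {x. \<forall>v\<in>I. \<alpha> v \<bullet> x \<ge> b v}" and card: "card I = DIM('a) + 1"
    by (rule simplex_inward_normals[OF simplex]) blast
  interpret simplex_data I \<alpha> b c by (rule data)
  have card2: "card I \<ge> 2" using card DIM_positive[where 'a = 'a] by linarith
  interpret P: irredundant_polyhedron I \<alpha> b F
    unfolding F by (rule irredundant_polyhedron[OF norm2 card2])
  note gram = coxeter_simplex_gram[OF norm2 card assms(1)[unfolded F]]
  note max = assms(2)[unfolded P.facet_reflection_group_eq] and inf = assms(3)[unfolded P.facet_reflection_group_eq]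
  show ?thesis
  \<comment> \<open>In dimension 1 the facets form no angle and their edge is bold; the weight
    arguments, which read edge labels from angles, start with three facets.\<close>
  proof (cases "card I = 2")
    case True
    then obtain p r where I: "I = {p, r}" "p \<noteq> r" by (meson card_2_iff)
    have "\<alpha> p \<bullet> \<alpha> r = - 2" using gram[of p r] I True by simp
    then have "\<Sigma>\<^sub>F \<simeq>\<^sub>D affine_A 1" "\<Sigma> \<simeq>\<^sub>D affine_A 0 +\<^sub>D affine_A 0"
      using segment_classification[OF norm2 I _ max inf assms(4)] unfolding \<Sigma>\<^sub>F_def \<Sigma>_def F by blast+
    then show ?thesis by (intro disjI1 exI[of _ 1] exI[of _ 0]) simp
  next
    case False
    interpret coxeter_weights I \<alpha> b c
      by unfold_locales (use norm2 gram False card2 in auto)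
    have "I \<noteq> {}" using card2 by auto
    then obtain p where p: "p \<in> I" "\<And>i. i \<in> I \<Longrightarrow> c p \<le> c i"
      using ex_is_arg_min_if_finite[OF finite_I, of c] by (auto simp: is_arg_min_linorder)
    interpret maximal_coxeter I \<alpha> b c W C p
      by unfold_locales (use max inf assms(4) p in \<open>auto simp: \<Gamma>_def\<close>)
    show ?thesis using classification unfolding \<Sigma>\<^sub>F_def \<Sigma>_def F .
  qed
qed

end
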